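(* Let $p$ be a prime, let $b>0$ and $D>0$ be real numbers, let $\mathrm{P}$ be the law on $D([0,\infty)\colon\mathbb Z_p)$ of the Brownian motion in $\mathbb Z_p$ with exponent $b$ and diffusion coefficient $D$, and let $(\mathrm P^m)$ be the sequence of laws on $D([0,\infty)\colon\mathbb Z_p)$ of the embedded, time-scaled random walks with time scaling $\lambda_m=\sigma p^{mb}$, $\sigma=D/\beta$. Then the sequence of measures $(\mathrm P^m)$ converges weakly to $\mathrm P$ as $m\to\infty$.
   Context: Basic notation. $|\cdot|$ is the $p$-adic absolute value on $\mathbb Q_p$; every $x\in\mathbb Q_p$ is uniquely $x=\sum_{k\in\mathbb Z}a_x(k)p^k$ with $a_x(k)\in\{0,\dots,p-1\}$; $\{x\}=\sum_{k<0}a_x(k)p^k$ and $\chi(x)=e^{2\pi\sqrt{-1}\{x\}}$. Put $\beta=\frac{p^{b+1}-1}{p^b(p-1)}$. $\mu$ is the Haar measure on $\mathbb Z_p$ of total mass $1$. $D([0,\infty)\colon\mathbb Z_p)$ is the Skorohod space of càdlàg functions $[0,\infty)\to\mathbb Z_p$ with the Skorohod metric, and $Y_t(\omega)=\omega(t)$. Limiting measure $\mathrm P$. For $y\in\mathbb Q_p$ write $\langle y\rangle=y+\mathbb Z_p\in\mathbb Q_p/\mathbb Z_p$, and put $|\langle y\rangle|=|y|$ if $\langle y\rangle\neq\langle 0\rangle$, $|\langle 0\rangle|=0$. The Vladimirov-Kochubei operator $\Delta_{b,0}$ on $L^2(\mathbb Z_p)$ is the self-adjoint closure of the Fourier multiplier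 operator on locally constant functions with symbol $|\langle y\rangle|^b-\beta^{-1}$ for $\langle y\rangle\ne\langle0\rangle$ and $0$ for $\langle y\rangle=\langle 0\rangle$. The fundamental solution $\rho$ of $\frac{\mathrm d}{\mathrm dt}\rho=-D\Delta_{b,0}\rho$ has Fourier transform $\phi(t,\langle y\rangle)=e^{-D(|\langle y\rangle|^b-\beta^{-1})t}$ for $\langle y\rangle\neq\langle 0\rangle$ and $\phi(t,\langle 0\rangle)=1$; that is, $\rho(t,x)=\sum_{\langle y\rangle\in\mathbb Q_p/\mathbb Z_p}\chi(xy)\phi(t,\langle y\rangle)$ for $t>0$, $x\in\mathbb Z_p$. The family $(\rho(t,\cdot))_{t>0}$ is a convolution semigroup of probability densities with respect to $\mu$. $\mathrm P$ is the probability measure on $D([0,\infty)\colon\mathbb Z_p)$ such that $Y_0=0$ almost surely and, for $0=t_0<t_1<\dots<t_k$ and Borel sets $U_1,\dots,U_k\subseteq\mathbb Z_p$, $$\mathrm P(Y_{t_1}\in U_1,\dots,Y_{t_k}\in U_k)=\int_{U_1}\cdots\int_{U_k}\prod_{i=1}^k\rho(t_i-t_{i-1},x_i-x_{i-1})\,\mathrm d\mu(x_k)\cdots\mathrm d\mu(x_1)\quad(x_0=0).$$ Discrete walks. For a natural number $m\ge1$ let $G_m=\mathbb Z_p/p^m\mathbb Z_p$, $[x]=x+p^m\mathbb Z_p$, and $|[x]|=|x|$ if $[x]\ne[0]$, $|[0]|=0$. For $\ell\in\{1,\dots,m\}$ let $\mathbb S_m(\ell)=\{[x]\in G_m\colon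 |[x]|=p^{\ell-m}\}$. Let $X=X^{(m)}$ be the $G_m$-valued random variable whose law is constant on each $\mathbb S_m(\ell)$ and satisfies $\mathrm{Prob}(X\in\mathbb S_m(\ell))=c_m p^{-\ell b}$ for $\ell\in\{1,\dots,m\}$ and $\mathrm{Prob}(X=[0])=0$, where $c_m=\frac{p^{mb}}{p^{mb}-1}(p^b-1)$. Let $S_n=S_0+X_1+\dots+X_n$, $n\in\mathbb N_0$, with $S_0=[0]$ almost surely and $X_1,X_2,\dots$ independent copies of $X^{(m)}$. Embedding. $\Gamma_m\colon G_m\to\mathbb Z_p$ is $\Gamma_m([x])=\sum_{i=0}^{m-1}a_x(i)p^i$. With $\sigma=D/\beta$ and $\lambda_m=\sigma p^{mb}$, consider the continuous-time process $\Gamma_m(S_{\lfloor t\lambda_m\rfloor})$, $t\ge0$. $\mathrm P^m$ is the probability measure on $D([0,\infty)\colon\mathbb Z_p)$ under which $(Y_t)_{t\geq 0}$ has the same finite dimensional distributions as this process. The sequence $(\mathrm P^m)$ is indexed by natural numbers $m\ge N(p,b)$, where $N(p,b)$ is the maximum of $1+\lceil\frac1b\log_p\frac{p^{b+1}-1}{p^b-1}\rceil$ and $\frac1b\log_p(2\sqrt2\,p^b)$. *)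

theory Defs
  imports
    "HOL-Probability.Probability"
    "HOL-Computational_Algebra.Primes"
    "HOL-Library.Set_Algebras"
begin

section \<open>The field of \<open>p\<close>-adic numbers\<close>

text \<open>
  The prime is carried by a type: \<open>p = CARD('p)\<close>. Every prime is the cardinality of some type, so a
  theorem that is polymorphic in \<open>'p::prime_type\<close> speaks about all primes.
\<close>

class prime_type = finite +
  assumes prime_CARD: "prime CARD('a)"

instance bool :: prime_type
  by standard simp

definition rat_padic_abs :: "nat \<Rightarrow> rat \<Rightarrow> real" where
  "rat_padic_abs p r =
     (if r = 0 then 0
      else case quotient_of r of (a, c) \<Rightarrow>
        real p powi (int (multiplicity (int p) c) - int (multiplicity (int p) a)))"

context
  fixes p :: nat
  assumes p: "prime p"
begin

lemma rat_padic_abs_zero [simp]: "rat_padic_abs p 0 = 0"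
  by (simp add: rat_padic_abs_def)

lemma rat_padic_abs_frac:
  assumes "a \<noteq> 0" "c \<noteq> 0"
  shows "rat_padic_abs p (of_int a / of_int c) =
    real p powi (int (multiplicity (int p) c) - int (multiplicity (int p) a))"
proof -
  obtain a' c' where q: "quotient_of (of_int a / of_int c) = (a', c')"
    by (cases "quotient_of (of_int a / of_int c)")
  have c': "c' > 0" using quotient_of_denom_pos[OF q] .
  have eq: "(of_int a / of_int c :: rat) = of_int a' / of_int c'"
    using quotient_of_div[OF q] .
  have a': "a' \<noteq> 0" using eq assms c' by auto
  have "(of_int (a * c') :: rat) = of_int (a' * c)"
    using eq assms c' by (simp add: field_simps)
  then have "a * c' = a' * c" by (simp only: of_int_eq_iff)
  then have "multiplicity (int p) (a * c') = multiplicity (int p) (a' * c)" by simp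
  then have "multiplicity (int p) a + multiplicity (int p) c' =
      multiplicity (int p) a' + multiplicity (int p) c"
    using assms a' c' p by (simp add: prime_elem_multiplicity_mult_distrib)
  then show ?thesis
    using assms q by (simp add: rat_padic_abs_def) (rule arg_cong[where f = "(powi) (real p)"], linarith)
qed

lemma rat_frac_cases:
  fixes r :: rat
  obtains a c where "r = of_int a / of_int c" "c > (0::int)"
  using that quotient_of_div[of r] quotient_of_denom_pos[of r] by (cases "quotient_of r") auto

lemma rat_padic_abs_nonneg [simp]: "0 \<le> rat_padic_abs p r"
  by (auto simp: rat_padic_abs_def split: prod.splits)

lemma rat_padic_abs_eq_0_iff [simp]: "rat_padic_abs p r = 0 \<longleftrightarrow> r = 0"
  using prime_gt_0_nat[OF p] by (auto simp: rat_padic_abs_def split: prod.splits)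

lemma rat_padic_abs_mult: "rat_padic_abs p (r * s) = rat_padic_abs p r * rat_padic_abs p s"
proof (cases "r = 0 \<or> s = 0")
  case False
  obtain a c where r: "r = of_int a / of_int c" "c > (0::int)" by (rule rat_frac_cases)
  obtain a' c' where s: "s = of_int a' / of_int c'" "c' > (0::int)" by (rule rat_frac_cases)
  have nz: "a \<noteq> 0" "a' \<noteq> 0" "c \<noteq> 0" "c' \<noteq> 0" using False r s by auto
  have rs: "r * s = of_int (a * a') / of_int (c * c')" using r s by simp
  show ?thesis
    unfolding rs unfolding r(1) s(1) using nz p prime_gt_0_nat[OF p]
    by (subst (1 2 3) rat_padic_abs_frac)
       (auto simp: prime_elem_multiplicity_mult_distrib power_int_diff power_int_add)
qed auto

lemma rat_padic_abs_one [simp]: "rat_padic_abs p 1 = 1"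
  using rat_padic_abs_frac[of 1 1] by simp

lemma rat_padic_abs_minus [simp]: "rat_padic_abs p (- r) = rat_padic_abs p r"
proof -
  have "rat_padic_abs p (- 1) = 1"
    using rat_padic_abs_frac[of "-1" 1] by (simp add: multiplicity_unit_right[of "-1"])
  then show ?thesis using rat_padic_abs_mult[of "- 1" r] by simp
qed

lemma rat_padic_abs_inverse: "rat_padic_abs p (inverse r) = inverse (rat_padic_abs p r)"
proof (cases "r = 0")
  case False
  then have "rat_padic_abs p (inverse r) * rat_padic_abs p r = 1"
    by (simp flip: rat_padic_abs_mult)
  then show ?thesis by (metis inverse_unique mult.commute)
qed simp

lemma rat_padic_abs_ultrametric:
  "rat_padic_abs p (r + s) \<le> max (rat_padic_abs p r) (rat_padic_abs p s)"
proof (cases "r = 0 \<or> s = 0 \<or> r + s = 0")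
  case True
  then show ?thesis by (auto simp: le_max_iff_disj)
next
  case False
  obtain a c where r: "r = of_int a / of_int c" "c > (0::int)" by (rule rat_frac_cases)
  obtain a' c' where s: "s = of_int a' / of_int c'" "c' > (0::int)" by (rule rat_frac_cases)
  define n where "n = c * c'"
  have n: "n \<noteq> 0" using r s by (auto simp: n_def)
  have r': "r = of_int (a * c') / of_int n" and s': "s = of_int (a' * c) / of_int n"
    using r s by (auto simp: n_def)
  have rs: "r + s = of_int (a * c' + a' * c) / of_int n"
    unfolding r' s' by (simp add: add_divide_distrib)
  let ?m = "multiplicity (int p)"
  have nz: "a * c' \<noteq> 0" "a' * c \<noteq> 0" "a * c' + a' * c \<noteq> 0"
    using False r s rs by (auto simp del: of_int_add of_int_mult)
  have "?m (a * c' + a' * c) \<ge> min (?m (a * c')) (?m (a' * c))"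
  proof (rule multiplicity_geI)
    show "a * c' + a' * c \<noteq> 0" by (rule nz)
    show "\<not> is_unit (int p)" using p by (auto simp: prime_nat_iff)
    show "int p ^ min (?m (a * c')) (?m (a' * c)) dvd a * c' + a' * c"
      by (rule dvd_add) (meson multiplicity_dvd' min.cobounded1 min.cobounded2)+
  qed
  then have "?m (a * c' + a' * c) \<ge> ?m (a * c') \<or> ?m (a * c' + a' * c) \<ge> ?m (a' * c)"
    by auto
  then have "real p powi (int (?m n) - int (?m (a * c' + a' * c))) \<le>
      max (real p powi (int (?m n) - int (?m (a * c'))))
          (real p powi (int (?m n) - int (?m (a' * c))))"
    unfolding le_max_iff_disj using prime_ge_1_nat[OF p]
    by (auto intro!: power_int_increasing)
  then show ?thesis
    unfolding rs unfolding r' s' by (simp only: rat_padic_abs_frac[OF _ n] nz not_False_eq_True)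
qed

lemma rat_padic_abs_triangle:
  "rat_padic_abs p (r + s) \<le> rat_padic_abs p r + rat_padic_abs p s"
  using rat_padic_abs_ultrametric[of r s] rat_padic_abs_nonneg[of r] rat_padic_abs_nonneg[of s]
  by linarith

lemma rat_padic_abs_diff_commute: "rat_padic_abs p (r - s) = rat_padic_abs p (s - r)"
  using rat_padic_abs_minus[of "r - s"] by simp

lemma rat_padic_abs_reverse_triangle:
  "\<bar>rat_padic_abs p r - rat_padic_abs p s\<bar> \<le> rat_padic_abs p (r - s)"
  using rat_padic_abs_triangle[of "r - s" s] rat_padic_abs_triangle[of "s - r" r]
    rat_padic_abs_diff_commute[of r s] by simp

end

definition padic_Cauchy :: "nat \<Rightarrow> (nat \<Rightarrow> rat) \<Rightarrow> bool" where
  "padic_Cauchy p X \<longleftrightarrow>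
     (\<forall>e>0. \<exists>k. \<forall>m\<ge>k. \<forall>n\<ge>k. rat_padic_abs p (X m - X n) < e)"

definition padic_null :: "nat \<Rightarrow> (nat \<Rightarrow> rat) \<Rightarrow> bool" where
  "padic_null p X \<longleftrightarrow> (\<lambda>n. rat_padic_abs p (X n)) \<longlonglongrightarrow> 0"

definition padic_rel :: "nat \<Rightarrow> (nat \<Rightarrow> rat) \<Rightarrow> (nat \<Rightarrow> rat) \<Rightarrow> bool" where
  "padic_rel p X Y \<longleftrightarrow> padic_Cauchy p X \<and> padic_Cauchy p Y \<and> padic_null p (\<lambda>n. X n - Y n)"

context
  fixes p :: nat
  assumes p: "prime p"
begin

lemma padic_CauchyD:
  "padic_Cauchy p X \<Longrightarrow> e > 0 \<Longrightarrow> \<exists>k. \<forall>m\<ge>k. \<forall>n\<ge>k. rat_padic_abs p (X m - X n) < e"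
  by (simp add: padic_Cauchy_def)

lemma padic_Cauchy_const [simp]: "padic_Cauchy p (\<lambda>n. x)"
  by (simp add: padic_Cauchy_def p)

lemma padic_null_zero [simp]: "padic_null p (\<lambda>n. 0)"
  by (simp add: padic_null_def p)

lemma padic_null_minus: "padic_null p X \<Longrightarrow> padic_null p (\<lambda>n. - X n)"
  by (simp add: padic_null_def p)

lemma padic_null_add:
  assumes "padic_null p X" "padic_null p Y"
  shows "padic_null p (\<lambda>n. X n + Y n)"
  unfolding padic_null_def
proof (rule tendsto_sandwich[OF _ _ tendsto_const])
  show "(\<lambda>n. rat_padic_abs p (X n) + rat_padic_abs p (Y n)) \<longlonglongrightarrow> 0"
    using tendsto_add[OF assms[unfolded padic_null_def]] by simp
qed (auto simp: p rat_padic_abs_triangle)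

lemma padic_Cauchy_add:
  assumes X: "padic_Cauchy p X" and Y: "padic_Cauchy p Y"
  shows "padic_Cauchy p (\<lambda>n. X n + Y n)"
  unfolding padic_Cauchy_def
proof (intro allI impI)
  fix e :: real assume e: "e > 0"
  obtain k where k: "\<forall>m\<ge>k. \<forall>n\<ge>k. rat_padic_abs p (X m - X n) < e"
    using X e by (auto simp: padic_Cauchy_def)
  obtain l where l: "\<forall>m\<ge>l. \<forall>n\<ge>l. rat_padic_abs p (Y m - Y n) < e"
    using Y e by (auto simp: padic_Cauchy_def)
  have "rat_padic_abs p (X m + Y m - (X n + Y n)) < e" if "m \<ge> max k l" "n \<ge> max k l" for m n
  proof -
    have "rat_padic_abs p (X m + Y m - (X n + Y n)) \<le>
        max (rat_padic_abs p (X m - X n)) (rat_padic_abs p (Y m - Y n))"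
      using rat_padic_abs_ultrametric[OF p, of "X m - X n" "Y m - Y n"]
      by (simp add: algebra_simps)
    also have "\<dots> < e" using k l that by simp
    finally show ?thesis .
  qed
  then show "\<exists>k. \<forall>m\<ge>k. \<forall>n\<ge>k. rat_padic_abs p (X m + Y m - (X n + Y n)) < e" by blast
qed

lemma padic_Cauchy_minus: "padic_Cauchy p X \<Longrightarrow> padic_Cauchy p (\<lambda>n. - X n)"
proof -
  have "rat_padic_abs p (- X m - - X n) = rat_padic_abs p (X m - X n)" for m n
    using rat_padic_abs_minus[OF p, of "X m - X n"] by simp
  then show "padic_Cauchy p X \<Longrightarrow> padic_Cauchy p (\<lambda>n. - X n)"
    by (simp add: padic_Cauchy_def)
qed

lemma padic_Cauchy_abs_convergent:
  assumes "padic_Cauchy p X"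
  shows "convergent (\<lambda>n. rat_padic_abs p (X n))"
proof (rule Cauchy_convergent, rule metric_CauchyI)
  fix e :: real assume "e > 0"
  then obtain k where "\<forall>m\<ge>k. \<forall>n\<ge>k. rat_padic_abs p (X m - X n) < e"
    using assms by (auto simp: padic_Cauchy_def)
  then show "\<exists>M. \<forall>m\<ge>M. \<forall>n\<ge>M. dist (rat_padic_abs p (X m)) (rat_padic_abs p (X n)) < e"
    using rat_padic_abs_reverse_triangle[OF p] unfolding dist_real_def
    by (meson le_less_trans)
qed

lemma padic_Cauchy_bounded:
  assumes "padic_Cauchy p X"
  obtains B where "B > 0" "\<And>n. rat_padic_abs p (X n) \<le> B"
proof -
  from padic_Cauchy_abs_convergent[OF assms]
  have "Bseq (\<lambda>n. rat_padic_abs p (X n))" by (rule convergent_imp_Bseq)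
  then show ?thesis using that by (auto simp: Bseq_def p)
qed

lemma padic_null_mult:
  assumes "padic_Cauchy p X" "padic_null p Y"
  shows "padic_null p (\<lambda>n. X n * Y n)"
proof -
  obtain B where B: "B > 0" "\<And>n. rat_padic_abs p (X n) \<le> B"
    using padic_Cauchy_bounded[OF assms(1)] by blast
  have "(\<lambda>n. B * rat_padic_abs p (Y n)) \<longlonglongrightarrow> 0"
    using tendsto_mult_right_zero[OF assms(2)[unfolded padic_null_def]] .
  then show ?thesis
    unfolding padic_null_def
    by (rule tendsto_sandwich[OF _ _ tendsto_const, rotated 2])
       (auto simp: p rat_padic_abs_mult intro!: always_eventually mult_right_mono B)
qed

lemma padic_Cauchy_mult:
  assumes X: "padic_Cauchy p X" and Y: "padic_Cauchy p Y"
  shows "padic_Cauchy p (\<lambda>n. X n * Y n)"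
  unfolding padic_Cauchy_def
proof (intro allI impI)
  fix e :: real assume e: "e > 0"
  obtain A where A: "A > 0" "\<And>n. rat_padic_abs p (X n) \<le> A"
    using padic_Cauchy_bounded[OF X] by blast
  obtain B where B: "B > 0" "\<And>n. rat_padic_abs p (Y n) \<le> B"
    using padic_Cauchy_bounded[OF Y] by blast
  obtain k where k: "\<forall>m\<ge>k. \<forall>n\<ge>k. rat_padic_abs p (X m - X n) < e / B"
    using padic_CauchyD[OF X, of "e / B"] e B by auto
  obtain l where l: "\<forall>m\<ge>l. \<forall>n\<ge>l. rat_padic_abs p (Y m - Y n) < e / A"
    using padic_CauchyD[OF Y, of "e / A"] e A by auto
  have "rat_padic_abs p (X m * Y m - X n * Y n) < e" if "m \<ge> max k l" "n \<ge> max k l" for m n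
  proof -
    have "X m * Y m - X n * Y n = X m * (Y m - Y n) + (X m - X n) * Y n"
      by (simp add: algebra_simps)
    then have "rat_padic_abs p (X m * Y m - X n * Y n) \<le>
        max (rat_padic_abs p (X m) * rat_padic_abs p (Y m - Y n))
            (rat_padic_abs p (X m - X n) * rat_padic_abs p (Y n))"
      using rat_padic_abs_ultrametric[OF p] by (simp flip: rat_padic_abs_mult[OF p])
    also have "\<dots> \<le> max (A * rat_padic_abs p (Y m - Y n)) (rat_padic_abs p (X m - X n) * B)"
      by (intro max.mono mult_right_mono mult_left_mono A B) (auto simp: p)
    also have "\<dots> < e" using k l that A B by (simp add: field_simps)
    finally show ?thesis .
  qed
  then show "\<exists>k. \<forall>m\<ge>k. \<forall>n\<ge>k. rat_padic_abs p (X m * Y m - X n * Y n) < e" by blast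
qed

lemma padic_Cauchy_not_null:
  assumes X: "padic_Cauchy p X" and nz: "\<not> padic_null p X"
  obtains B k where "B > 0" "\<And>n. n \<ge> k \<Longrightarrow> B < rat_padic_abs p (X n)"
proof -
  obtain L where L: "(\<lambda>n. rat_padic_abs p (X n)) \<longlonglongrightarrow> L"
    using padic_Cauchy_abs_convergent[OF X] by (auto simp: convergent_def)
  have "L \<ge> 0" using L by (rule LIMSEQ_le_const) (auto simp: p)
  moreover have "L \<noteq> 0" using nz L by (auto simp: padic_null_def)
  ultimately have "L > 0" by simp
  then have "eventually (\<lambda>n. L / 2 < rat_padic_abs p (X n)) sequentially"
    using order_tendstoD(1)[OF L, of "L / 2"] by simp
  then show ?thesis using that[of "L / 2"] \<open>L > 0\<close> by (auto simp: eventually_sequentially)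
qed

lemma padic_null_diff_inverse:
  assumes X: "padic_Cauchy p X" "\<not> padic_null p X"
    and Y: "padic_Cauchy p Y" "\<not> padic_null p Y"
    and XY: "padic_null p (\<lambda>n. X n - Y n)"
  shows "padic_null p (\<lambda>n. inverse (X n) - inverse (Y n))"
proof -
  obtain A k where A: "A > 0" "\<And>n. n \<ge> k \<Longrightarrow> A < rat_padic_abs p (X n)"
    using padic_Cauchy_not_null[OF X] by blast
  obtain B l where B: "B > 0" "\<And>n. n \<ge> l \<Longrightarrow> B < rat_padic_abs p (Y n)"
    using padic_Cauchy_not_null[OF Y] by blast
  have *: "rat_padic_abs p (inverse (X n) - inverse (Y n)) \<le>
      inverse A * rat_padic_abs p (X n - Y n) * inverse B" if "n \<ge> max k l" for n
  proof -
    have gt: "A < rat_padic_abs p (X n)" "B < rat_padic_abs p (Y n)" using A B that by auto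
    then have nz: "X n \<noteq> 0" "Y n \<noteq> 0" using A(1) B(1) p by auto
    then have "inverse (X n) - inverse (Y n) = - (inverse (X n) * (X n - Y n) * inverse (Y n))"
      by (simp add: field_simps)
    then have "rat_padic_abs p (inverse (X n) - inverse (Y n)) =
        inverse (rat_padic_abs p (X n)) * rat_padic_abs p (X n - Y n) *
        inverse (rat_padic_abs p (Y n))"
      by (simp add: p rat_padic_abs_mult rat_padic_abs_inverse)
    also have "\<dots> \<le> inverse A * rat_padic_abs p (X n - Y n) * inverse B"
      using gt A(1) B(1) by (intro mult_mono le_imp_inverse_le) (auto simp: p)
    finally show ?thesis .
  qed
  have "(\<lambda>n. inverse A * rat_padic_abs p (X n - Y n) * inverse B) \<longlonglongrightarrow> 0"
    using tendsto_mult_left_zero[OF tendsto_mult_right_zero[OF XY[unfolded padic_null_def]]] .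
  moreover have "eventually (\<lambda>n. rat_padic_abs p (inverse (X n) - inverse (Y n)) \<le>
      inverse A * rat_padic_abs p (X n - Y n) * inverse B) sequentially"
    using * unfolding eventually_sequentially by blast
  ultimately show ?thesis
    unfolding padic_null_def by (subst Lim_null_comparison) (simp_all add: p)
qed

lemma padic_Cauchy_inverse:
  assumes X: "padic_Cauchy p X" "\<not> padic_null p X"
  shows "padic_Cauchy p (\<lambda>n. inverse (X n))"
  unfolding padic_Cauchy_def
proof (intro allI impI)
  fix e :: real assume e: "e > 0"
  obtain A k where A: "A > 0" "\<And>n. n \<ge> k \<Longrightarrow> A < rat_padic_abs p (X n)"
    using padic_Cauchy_not_null[OF X] by blast
  obtain l where l: "\<forall>m\<ge>l. \<forall>n\<ge>l. rat_padic_abs p (X m - X n) < e * A * A"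
    using padic_CauchyD[OF X(1), of "e * A * A"] e A by auto
  have "rat_padic_abs p (inverse (X m) - inverse (X n)) < e" if "m \<ge> max k l" "n \<ge> max k l" for m n
  proof -
    have gt: "A < rat_padic_abs p (X m)" "A < rat_padic_abs p (X n)" using A that by auto
    then have nz: "X m \<noteq> 0" "X n \<noteq> 0" using A(1) p by auto
    then have "inverse (X m) - inverse (X n) = - (inverse (X m) * (X m - X n) * inverse (X n))"
      by (simp add: field_simps)
    then have "rat_padic_abs p (inverse (X m) - inverse (X n)) =
        inverse (rat_padic_abs p (X m)) * rat_padic_abs p (X m - X n) *
        inverse (rat_padic_abs p (X n))"
      by (simp add: p rat_padic_abs_mult rat_padic_abs_inverse)
    also have "\<dots> \<le> inverse A * rat_padic_abs p (X m - X n) * inverse A"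
      using gt A(1) by (intro mult_mono le_imp_inverse_le) (auto simp: p)
    also have "\<dots> < e" using l that A(1) by (simp add: field_simps)
    finally show ?thesis .
  qed
  then show "\<exists>k. \<forall>m\<ge>k. \<forall>n\<ge>k. rat_padic_abs p (inverse (X m) - inverse (X n)) < e" by blast
qed

lemma padic_rel_refl: "padic_Cauchy p X \<Longrightarrow> padic_rel p X X"
  by (simp add: padic_rel_def)

lemma padic_rel_null_iff:
  assumes "padic_rel p X Y"
  shows "padic_null p X \<longleftrightarrow> padic_null p Y"
proof
  from assms have XY: "padic_null p (\<lambda>n. X n - Y n)" by (simp add: padic_rel_def)
  show "padic_null p Y" if "padic_null p X"
    using padic_null_add[OF that padic_null_minus[OF XY]] by simp
  show "padic_null p X" if "padic_null p Y"
    using padic_null_add[OF that XY] by simp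
qed

lemma part_equivp_padic_rel: "part_equivp (padic_rel p)"
proof (rule part_equivpI)
  show "\<exists>X. padic_rel p X X"
    using padic_rel_refl[OF padic_Cauchy_const] by blast
  show "symp (padic_rel p)"
  proof (rule sympI)
    fix X Y assume *: "padic_rel p X Y"
    then have "padic_null p (\<lambda>n. - (X n - Y n))"
      by (intro padic_null_minus) (simp add: padic_rel_def)
    with * show "padic_rel p Y X" by (simp add: padic_rel_def)
  qed
  show "transp (padic_rel p)"
  proof (rule transpI)
    fix X Y Z assume *: "padic_rel p X Y" "padic_rel p Y Z"
    then have "padic_null p (\<lambda>n. (X n - Y n) + (Y n - Z n))"
      by (intro padic_null_add) (simp_all add: padic_rel_def)
    with * show "padic_rel p X Z" by (simp add: padic_rel_def)
  qed
qed

end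

typedef ('p::prime_type) padic =
  "{C. \<exists>X. padic_rel CARD('p) X X \<and> C = Collect (padic_rel CARD('p) X)}"
  by (intro exI CollectI conjI) (auto intro: padic_rel_refl[OF prime_CARD padic_Cauchy_const[OF prime_CARD]])

definition abs_padic :: "(nat \<Rightarrow> rat) \<Rightarrow> 'p::prime_type padic" where
  "abs_padic X = Abs_padic (Collect (padic_rel CARD('p) X))"

definition rep_padic :: "'p::prime_type padic \<Rightarrow> nat \<Rightarrow> rat" where
  "rep_padic x = (SOME X. X \<in> Rep_padic x)"

definition cr_padic :: "(nat \<Rightarrow> rat) \<Rightarrow> 'p::prime_type padic \<Rightarrow> bool" where
  "cr_padic X x \<longleftrightarrow> padic_rel CARD('p) X X \<and> abs_padic X = x"

lemma Quotient_padic: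
  "Quotient (padic_rel CARD('p)) (abs_padic :: _ \<Rightarrow> 'p::prime_type padic) rep_padic cr_padic"
proof -
  interpret quot_type "padic_rel CARD('p)" "Abs_padic :: _ \<Rightarrow> 'p padic" Rep_padic
  proof
    show "part_equivp (padic_rel CARD('p))" by (rule part_equivp_padic_rel[OF prime_CARD])
    show "\<exists>X. padic_rel CARD('p) X X \<and> Rep_padic y = Collect (padic_rel CARD('p) X)"
      for y :: "'p padic" using Rep_padic[of y] by simp
    show "Abs_padic (Rep_padic x) = x" for x :: "'p padic" by (rule Rep_padic_inverse)
    show "Rep_padic (Abs_padic C :: 'p padic) = C"
      if "\<exists>X. padic_rel CARD('p) X X \<and> C = Collect (padic_rel CARD('p) X)" for C
      using that by (simp add: Abs_padic_inverse)
    show "Rep_padic x = Rep_padic y \<longleftrightarrow> x = y" for x y :: "'p padic" by (rule Rep_padic_inject)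
  qed
  have eq: "(abs_padic :: _ \<Rightarrow> 'p padic) = abs" "(rep_padic :: 'p padic \<Rightarrow> _) = rep"
    by (simp_all add: fun_eq_iff abs_padic_def rep_padic_def abs_def rep_def)
  show ?thesis
    unfolding eq
    by (rule Quotient3_to_Quotient[OF Quotient])
       (rule eq_reflection, simp add: fun_eq_iff cr_padic_def flip: eq)
qed

setup_lifting Quotient_padic

instantiation padic :: (prime_type) field
begin

lift_definition zero_padic :: "'a padic" is "\<lambda>n. 0"
  by (simp add: padic_rel_refl prime_CARD)

lift_definition one_padic :: "'a padic" is "\<lambda>n. 1"
  by (simp add: padic_rel_refl prime_CARD)

lift_definition plus_padic :: "'a padic \<Rightarrow> 'a padic \<Rightarrow> 'a padic" is "\<lambda>X Y n. X n + Y n"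
proof -
  fix X X' Y Y' :: "nat \<Rightarrow> rat"
  assume *: "padic_rel CARD('a) X X'" "padic_rel CARD('a) Y Y'"
  then have "padic_null CARD('a) (\<lambda>n. (X n - X' n) + (Y n - Y' n))"
    by (intro padic_null_add prime_CARD) (auto simp: padic_rel_def)
  with * show "padic_rel CARD('a) (\<lambda>n. X n + Y n) (\<lambda>n. X' n + Y' n)"
    by (simp add: padic_rel_def padic_Cauchy_add prime_CARD algebra_simps)
qed

lift_definition uminus_padic :: "'a padic \<Rightarrow> 'a padic" is "\<lambda>X n. - X n"
proof -
  fix X X' :: "nat \<Rightarrow> rat"
  assume *: "padic_rel CARD('a) X X'"
  then have "padic_null CARD('a) (\<lambda>n. - (X n - X' n))"
    by (intro padic_null_minus prime_CARD) (auto simp: padic_rel_def)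
  with * show "padic_rel CARD('a) (\<lambda>n. - X n) (\<lambda>n. - X' n)"
    by (simp add: padic_rel_def padic_Cauchy_minus prime_CARD)
qed

lift_definition times_padic :: "'a padic \<Rightarrow> 'a padic \<Rightarrow> 'a padic" is "\<lambda>X Y n. X n * Y n"
proof -
  fix X X' Y Y' :: "nat \<Rightarrow> rat"
  assume *: "padic_rel CARD('a) X X'" "padic_rel CARD('a) Y Y'"
  then have "padic_null CARD('a) (\<lambda>n. X n * (Y n - Y' n) + Y' n * (X n - X' n))"
    by (intro padic_null_add padic_null_mult prime_CARD) (auto simp: padic_rel_def)
  with * show "padic_rel CARD('a) (\<lambda>n. X n * Y n) (\<lambda>n. X' n * Y' n)"
    by (simp add: padic_rel_def padic_Cauchy_mult prime_CARD algebra_simps)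
qed

lift_definition inverse_padic :: "'a padic \<Rightarrow> 'a padic"
  is "\<lambda>X. if padic_null CARD('a) X then (\<lambda>n. 0) else (\<lambda>n. inverse (X n))"
proof -
  fix X X' :: "nat \<Rightarrow> rat"
  assume *: "padic_rel CARD('a) X X'"
  then show "padic_rel CARD('a)
      (if padic_null CARD('a) X then (\<lambda>n. 0) else (\<lambda>n. inverse (X n)))
      (if padic_null CARD('a) X' then (\<lambda>n. 0) else (\<lambda>n. inverse (X' n)))"
    using padic_rel_null_iff[OF prime_CARD *]
    by (auto simp: padic_rel_def padic_Cauchy_inverse padic_null_diff_inverse prime_CARD)
qed

definition "x - y = x + - y" for x y :: "'a padic"

definition "x div y = x * inverse y" for x y :: "'a padic"

instance
proof
  fix a b c :: "'a padic"
  note [simp] = padic_rel_def prime_CARD padic_Cauchy_add padic_Cauchy_minus padic_Cauchy_mult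
  show "a + b = b + a" by transfer (simp add: ac_simps)
  show "(a + b) + c = a + (b + c)" by transfer (simp add: ac_simps)
  show "0 + a = a" by transfer simp
  show "- a + a = 0" by transfer simp
  show "a - b = a + - b" by (rule minus_padic_def)
  show "(a * b) * c = a * (b * c)" by transfer (simp add: ac_simps)
  show "a * b = b * a" by transfer (simp add: ac_simps)
  show "1 * a = a" by transfer simp
  show "(a + b) * c = a * c + b * c" by transfer (simp add: distrib_right)
  show "(0::'a padic) \<noteq> 1" by transfer (simp add: padic_null_def LIMSEQ_const_iff)
  have "padic_null CARD('a) (\<lambda>n. inverse (X n) * X n - 1)"
    if X: "padic_Cauchy CARD('a) X" "\<not> padic_null CARD('a) X" for X
  proof -
    obtain A k where A: "A > 0" "\<And>n. n \<ge> k \<Longrightarrow> A < rat_padic_abs CARD('a) (X n)"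
      using padic_Cauchy_not_null[OF prime_CARD X] by blast
    have "X n \<noteq> 0" if "n \<ge> k" for n using A(1) A(2)[OF that] by auto
    then have "eventually (\<lambda>n. rat_padic_abs CARD('a) (inverse (X n) * X n - 1) = 0) sequentially"
      unfolding eventually_sequentially by (intro exI[of _ k]) simp
    then show ?thesis unfolding padic_null_def by (rule tendsto_eventually)
  qed
  then show "a \<noteq> 0 \<Longrightarrow> inverse a * a = 1"
    by transfer (simp add: padic_Cauchy_inverse)
  show "a div b = a * inverse b" by (rule divide_padic_def)
  show "inverse (0::'a padic) = 0" by transfer simp
qed

end

lift_definition padic_abs :: "'a::prime_type padic \<Rightarrow> real" is "\<lambda>X. lim (\<lambda>n. rat_padic_abs CARD('a) (X n))"
proof -
  fix X X' :: "nat \<Rightarrow> rat"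
  assume *: "padic_rel CARD('a) X X'"
  obtain L where L: "(\<lambda>n. rat_padic_abs CARD('a) (X n)) \<longlonglongrightarrow> L"
    using * padic_Cauchy_abs_convergent[OF prime_CARD]
    by (auto simp: padic_rel_def convergent_def)
  have "(\<lambda>n. rat_padic_abs CARD('a) (X n) - rat_padic_abs CARD('a) (X' n)) \<longlonglongrightarrow> 0"
  proof (rule Lim_null_comparison)
    show "(\<lambda>n. rat_padic_abs CARD('a) (X n - X' n)) \<longlonglongrightarrow> 0"
      using * by (simp add: padic_rel_def padic_null_def)
  qed (simp add: rat_padic_abs_reverse_triangle prime_CARD)
  from tendsto_diff[OF L this] have "(\<lambda>n. rat_padic_abs CARD('a) (X' n)) \<longlonglongrightarrow> L" by simp
  with L show "lim (\<lambda>n. rat_padic_abs CARD('a) (X n)) = lim (\<lambda>n. rat_padic_abs CARD('a) (X' n))"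
    by (simp add: limI)
qed

lemma padic_abs_LIMSEQ:
  "padic_Cauchy CARD('a::prime_type) X \<Longrightarrow>
    (\<lambda>n. rat_padic_abs CARD('a) (X n)) \<longlonglongrightarrow> lim (\<lambda>n. rat_padic_abs CARD('a) (X n))"
  using padic_Cauchy_abs_convergent[OF prime_CARD] by (simp add: convergent_LIMSEQ_iff)

lemma padic_abs_eq_0_iff: "padic_abs x = 0 \<longleftrightarrow> x = 0" for x :: "'a::prime_type padic"
proof transfer
  fix X :: "nat \<Rightarrow> rat"
  assume "padic_rel CARD('a) X X"
  then have X: "padic_Cauchy CARD('a) X" by (simp add: padic_rel_def)
  have "lim (\<lambda>n. rat_padic_abs CARD('a) (X n)) = 0 \<longleftrightarrow> padic_null CARD('a) X"
    using padic_abs_LIMSEQ[OF X] unfolding padic_null_def by (metis LIMSEQ_unique)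
  then show "lim (\<lambda>n. rat_padic_abs CARD('a) (X n)) = 0 \<longleftrightarrow> padic_rel CARD('a) X (\<lambda>n. 0)"
    using X by (simp add: padic_rel_def prime_CARD)
qed

lemma padic_abs_minus: "padic_abs (- x) = padic_abs x" for x :: "'a::prime_type padic"
  by transfer (simp add: prime_CARD)

lemma padic_abs_ultrametric: "padic_abs (x + y) \<le> max (padic_abs x) (padic_abs y)" for x y :: "'a::prime_type padic"
proof (transfer, simp only: padic_rel_def)
  fix X Y :: "nat \<Rightarrow> rat"
  let ?N = "rat_padic_abs CARD('a)"
  assume *: "padic_Cauchy CARD('a) X \<and> padic_Cauchy CARD('a) X \<and> padic_null CARD('a) (\<lambda>n. X n - X n)"
    "padic_Cauchy CARD('a) Y \<and> padic_Cauchy CARD('a) Y \<and> padic_null CARD('a) (\<lambda>n. Y n - Y n)"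
  show "lim (\<lambda>n. ?N (X n + Y n)) \<le> max (lim (\<lambda>n. ?N (X n))) (lim (\<lambda>n. ?N (Y n)))"
    by (rule tendsto_le[OF _ tendsto_max[OF padic_abs_LIMSEQ padic_abs_LIMSEQ] padic_abs_LIMSEQ])
       (use * in \<open>auto simp: padic_Cauchy_add prime_CARD rat_padic_abs_ultrametric\<close>)
qed

lemma padic_abs_nonneg: "0 \<le> padic_abs x" for x :: "'a::prime_type padic"
  using padic_abs_ultrametric[of x "- x"] padic_abs_minus[of x] padic_abs_eq_0_iff[of "0 :: 'a padic"]
  by simp

lemma padic_abs_mult: "padic_abs (x * y) = padic_abs x * padic_abs y" for x y :: "'a::prime_type padic"
proof (transfer, simp only: padic_rel_def)
  fix X Y :: "nat \<Rightarrow> rat"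
  let ?N = "rat_padic_abs CARD('a)"
  assume *: "padic_Cauchy CARD('a) X \<and> padic_Cauchy CARD('a) X \<and> padic_null CARD('a) (\<lambda>n. X n - X n)"
    "padic_Cauchy CARD('a) Y \<and> padic_Cauchy CARD('a) Y \<and> padic_null CARD('a) (\<lambda>n. Y n - Y n)"
  then have "(\<lambda>n. ?N (X n) * ?N (Y n)) \<longlonglongrightarrow> lim (\<lambda>n. ?N (X n)) * lim (\<lambda>n. ?N (Y n))"
    by (intro tendsto_mult padic_abs_LIMSEQ) auto
  then show "lim (\<lambda>n. ?N (X n * Y n)) = lim (\<lambda>n. ?N (X n)) * lim (\<lambda>n. ?N (Y n))"
    by (simp add: rat_padic_abs_mult prime_CARD limI)
qed

instantiation padic :: (prime_type) metric_space
begin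

definition "dist x y = padic_abs (x - y)" for x y :: "'a padic"

definition "(uniformity :: ('a padic \<times> 'a padic) filter) =
  (INF e\<in>{0<..}. principal {(x, y). dist x y < e})"

definition "open U \<longleftrightarrow> (\<forall>x\<in>U. eventually (\<lambda>(x', y). x' = x \<longrightarrow> y \<in> U) uniformity)"
  for U :: "'a padic set"

instance
proof
  fix x y z :: "'a padic"
  show "dist x y = 0 \<longleftrightarrow> x = y" by (simp add: dist_padic_def padic_abs_eq_0_iff)
  have "padic_abs (x - y) \<le> max (padic_abs (x - z)) (padic_abs (z - y))"
    using padic_abs_ultrametric[of "x - z" "z - y"] by simp
  moreover have "padic_abs (z - y) = padic_abs (y - z)" using padic_abs_minus[of "z - y"] by simp
  ultimately show "dist x y \<le> dist x z + dist y z"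
    using padic_abs_nonneg[of "x - z"] padic_abs_nonneg[of "y - z"]
    by (simp add: dist_padic_def)
qed (simp_all add: dist_padic_def uniformity_padic_def open_padic_def)

end


section \<open>Digits, additive character and cosets\<close>

text \<open>\<open>digit x k\<close> is \<open>a\<^sub>x(k)\<close> in the unique expansion \<open>x = (\<Sum>k\<in>\<int>. a\<^sub>x(k) p\<^sup>k)\<close>.\<close>

definition digit :: "'p::prime_type padic \<Rightarrow> int \<Rightarrow> nat" where
  "digit x = (THE a. (\<forall>k. a k < CARD('p)) \<and>
                ((\<lambda>k. of_nat (a k) * of_nat CARD('p) powi k) has_sum x) UNIV)"

definition frac_part :: "'p::prime_type padic \<Rightarrow> real" where
  "frac_part x = (\<Sum>\<^sub>\<infinity>k\<in>{..<0}. real (digit x k) * real CARD('p) powi k)"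

definition add_char :: "'p::prime_type padic \<Rightarrow> complex" where
  "add_char x = exp (2 * of_real pi * \<i> * of_real (frac_part x))"

definition Zp :: "'p::prime_type padic set" where
  "Zp = {x. padic_abs x \<le> 1}"

definition pZp :: "nat \<Rightarrow> 'p::prime_type padic set" where
  "pZp m = (\<lambda>x. of_nat CARD('p) ^ m * x) ` Zp"

definition QpZp :: "'p::prime_type padic set set" where
  "QpZp = range (\<lambda>y. y +o Zp)"

definition Gm :: "nat \<Rightarrow> 'p::prime_type padic set set" where
  "Gm m = (\<lambda>x. x +o pZp m) ` Zp"

text \<open>
  No use of the chosen representative depends on the choice: the absolute value is constant on
  cosets other than the subgroup itself, \<open>\<chi>(x y)\<close> with \<open>x \<in> \<int>\<^sub>p\<close> depends only on \<open>y + \<int>\<^sub>p\<close>, and the first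
  \<open>m\<close> digits are constant on cosets of \<open>p\<^sup>m \<int>\<^sub>p\<close>.
\<close>

definition coset_rep :: "'p::prime_type padic set \<Rightarrow> 'p padic" where
  "coset_rep C = (SOME x. x \<in> C)"

text \<open>The absolute value of a coset \<open>C\<close> of the subgroup \<open>H\<close>.\<close>

definition coset_abs :: "'p::prime_type padic set \<Rightarrow> 'p padic set \<Rightarrow> real" where
  "coset_abs H C = (if C = H then 0 else padic_abs (coset_rep C))"

definition Zp_borel :: "'p::prime_type padic measure" where
  "Zp_borel = restrict_space borel Zp"

definition Haar_Zp :: "'p::prime_type padic measure \<Rightarrow> bool" where
  "Haar_Zp \<mu> \<longleftrightarrow> prob_space \<mu> \<and> sets \<mu> = sets Zp_borel \<and>
     (\<forall>a\<in>Zp. distr \<mu> Zp_borel (\<lambda>x. a + x) = \<mu>)"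


section \<open>Skorohod space\<close>

text \<open>
  Paths are functions on \<open>[0, \<infinity>)\<close>, encoded as functions on \<^typ>\<open>real\<close> that are \<^const>\<open>undefined\<close> at
  negative times.
\<close>

definition skorohod_space :: "'a::metric_space set \<Rightarrow> (real \<Rightarrow> 'a) set" where
  "skorohod_space E =
     {\<omega> \<in> {0..} \<rightarrow>\<^sub>E E.
        (\<forall>t\<ge>0. (\<omega> \<longlongrightarrow> \<omega> t) (at_right t)) \<and> (\<forall>t>0. \<exists>l\<in>E. (\<omega> \<longlongrightarrow> l) (at_left t))}"

text \<open>
  The Skorohod metric for an arbitrary metric state space, in the form of Ethier and Kurtz,
  \<^emph>\<open>Markov Processes\<close>, Section 3.5:
  \<open>d(x, y) = inf\<^sub>\<theta> max (\<gamma> \<theta>) (\<integral>\<^sub>0\<^sup>\<infinity> e\<^sup>-\<^sup>u d(x, y, \<theta>, u) du)\<close>, the infimum ranging over the time changes \<open>\<theta>\<close>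
  with \<open>\<gamma> \<theta> < \<infinity>\<close>.
\<close>

definition log_slopes :: "(real \<Rightarrow> real) \<Rightarrow> real set" where
  "log_slopes \<theta> = {\<bar>ln ((\<theta> t - \<theta> s) / (t - s))\<bar> | s t. 0 \<le> s \<and> s < t}"

definition time_changes :: "(real \<Rightarrow> real) set" where
  "time_changes = {\<theta>. strict_mono_on {0..} \<theta> \<and> \<theta> ` {0..} = {0..} \<and> bdd_above (log_slopes \<theta>)}"

definition skorohod_gamma :: "(real \<Rightarrow> real) \<Rightarrow> real" where
  "skorohod_gamma \<theta> = Sup (log_slopes \<theta>)"

definition skorohod_gap ::
    "(real \<Rightarrow> 'a::metric_space) \<Rightarrow> (real \<Rightarrow> 'a) \<Rightarrow> (real \<Rightarrow> real) \<Rightarrow> real \<Rightarrow> real" where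
  "skorohod_gap x y \<theta> u = (SUP t\<in>{0..}. min 1 (dist (x (min t u)) (y (min (\<theta> t) u))))"

definition skorohod_cost ::
    "(real \<Rightarrow> 'a::metric_space) \<Rightarrow> (real \<Rightarrow> 'a) \<Rightarrow> (real \<Rightarrow> real) \<Rightarrow> real" where
  "skorohod_cost x y \<theta> =
     max (skorohod_gamma \<theta>) (LBINT u:{0..}. exp (- u) * skorohod_gap x y \<theta> u)"

definition skorohod_dist :: "(real \<Rightarrow> 'a::metric_space) \<Rightarrow> (real \<Rightarrow> 'a) \<Rightarrow> real" where
  "skorohod_dist x y = (INF \<theta>\<in>time_changes. skorohod_cost x y \<theta>)"

context
begin

private definition "q a b = min 1 (dist a b)"

private lemma q: "0 \<le> q a b" "q a b \<le> 1" "q a b = q b a" "q a c \<le> q a b + q b c" "q a a = 0"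
  using dist_triangle[of a c b] zero_le_dist[of a b] zero_le_dist[of b c]
  by (auto simp: q_def dist_commute min_def simp del: zero_le_dist)

private lemma gap_q: "skorohod_gap x y \<theta> u = (SUP t\<in>{0..}. q (x (min t u)) (y (min (\<theta> t) u)))"
  by (simp add: skorohod_gap_def q_def)

private lemma bdd_q [simp]: "bdd_above ((\<lambda>t. q (f t) (g t)) ` A)"
  by (rule bdd_aboveI[of _ 1]) (auto simp: q)

private lemma gap_upper: "t \<ge> 0 \<Longrightarrow> q (x (min t u)) (y (min (\<theta> t) u)) \<le> skorohod_gap x y \<theta> u"
  unfolding gap_q by (rule cSUP_upper) auto

private lemma gap_least:
  "(\<And>t. t \<ge> 0 \<Longrightarrow> q (x (min t u)) (y (min (\<theta> t) u)) \<le> B) \<Longrightarrow> skorohod_gap x y \<theta> u \<le> B"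
  unfolding gap_q by (rule cSUP_least) auto

lemma skorohod_gap_bounds: "0 \<le> skorohod_gap x y \<theta> u" "skorohod_gap x y \<theta> u \<le> 1"
  using order_trans[OF q(1) gap_upper[of 0 x u y \<theta>]] by (auto intro: gap_least q(2))

private lemma time_changeD:
  assumes "\<theta> \<in> time_changes"
  shows "0 \<le> s \<Longrightarrow> s < t \<Longrightarrow> \<theta> s < \<theta> t" "0 \<le> s \<Longrightarrow> 0 \<le> \<theta> s"
    "0 \<le> s \<Longrightarrow> \<exists>t\<ge>0. \<theta> t = s" "\<theta> 0 = 0"
proof -
  show *: "0 \<le> s \<Longrightarrow> s < t \<Longrightarrow> \<theta> s < \<theta> t" for s t
    using assms by (auto simp: time_changes_def strict_mono_on_def)
  have im: "\<theta> ` {0..} = {0..}" using assms by (simp add: time_changes_def)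
  show "0 \<le> s \<Longrightarrow> 0 \<le> \<theta> s" using im by auto
  show surj: "0 \<le> s \<Longrightarrow> \<exists>t\<ge>0. \<theta> t = s" for s
    using im by (metis atLeast_iff image_iff)
  obtain t where t: "t \<ge> 0" "\<theta> t = 0" using surj[of 0] by auto
  have "\<theta> 0 \<ge> 0" using im by auto
  then show "\<theta> 0 = 0" using *[of 0 t] t by (cases "t = 0") auto
qed

private lemma gamma_upper:
  assumes "\<theta> \<in> time_changes" "0 \<le> s" "s < t"
  shows "\<bar>ln ((\<theta> t - \<theta> s) / (t - s))\<bar> \<le> skorohod_gamma \<theta>"
  unfolding skorohod_gamma_def using assms
  by (intro cSup_upper) (auto simp: log_slopes_def time_changes_def)

private lemma log_slopes_nonempty: "log_slopes \<theta> \<noteq> {}"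
proof -
  have "\<bar>ln ((\<theta> 1 - \<theta> 0) / (1 - 0))\<bar> \<in> log_slopes \<theta>"
    unfolding log_slopes_def by (intro CollectI exI[of _ 0] exI[of _ 1]) simp
  then show ?thesis by blast
qed

private lemma gamma_least:
  "(\<And>s t. 0 \<le> s \<Longrightarrow> s < t \<Longrightarrow> \<bar>ln ((\<theta> t - \<theta> s) / (t - s))\<bar> \<le> B) \<Longrightarrow> skorohod_gamma \<theta> \<le> B"
  unfolding skorohod_gamma_def
  by (intro cSup_least log_slopes_nonempty) (auto simp: log_slopes_def)

private lemma gamma_nonneg: "\<theta> \<in> time_changes \<Longrightarrow> 0 \<le> skorohod_gamma \<theta>"
  using gamma_upper[of \<theta> 0 1] by linarith

private lemma time_changesI:
  assumes "\<And>s t. 0 \<le> s \<Longrightarrow> s < t \<Longrightarrow> \<theta> s < \<theta> t" "\<theta> ` {0..} = {0..}"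
    "\<And>s t. 0 \<le> s \<Longrightarrow> s < t \<Longrightarrow> \<bar>ln ((\<theta> t - \<theta> s) / (t - s))\<bar> \<le> B"
  shows "\<theta> \<in> time_changes"
proof -
  have "bdd_above (log_slopes \<theta>)"
    using assms(3) by (intro bdd_aboveI[of _ B]) (auto simp: log_slopes_def)
  then show ?thesis using assms(1,2) by (auto simp: time_changes_def strict_mono_on_def)
qed

private lemma id_time_change: "(\<lambda>t. t) \<in> time_changes" "skorohod_gamma (\<lambda>t. t) = 0"
proof -
  show *: "(\<lambda>t. t) \<in> time_changes" by (rule time_changesI[of _ 0]) auto
  show "skorohod_gamma (\<lambda>t. t) = 0"
    using gamma_nonneg[OF *] by (intro antisym gamma_least) auto
qed

private lemma comp_time_change:
  assumes \<theta>: "\<theta> \<in> time_changes" and \<eta>: "\<eta> \<in> time_changes"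
  shows "\<eta> \<circ> \<theta> \<in> time_changes"
    "skorohod_gamma (\<eta> \<circ> \<theta>) \<le> skorohod_gamma \<theta> + skorohod_gamma \<eta>"
proof -
  have *: "\<bar>ln (((\<eta> \<circ> \<theta>) t - (\<eta> \<circ> \<theta>) s) / (t - s))\<bar> \<le> skorohod_gamma \<theta> + skorohod_gamma \<eta>"
    if st: "0 \<le> s" "s < t" for s t
  proof -
    have 1: "\<theta> s < \<theta> t" "0 \<le> \<theta> s" using time_changeD[OF \<theta>] st by auto
    have 2: "\<eta> (\<theta> s) < \<eta> (\<theta> t)" using time_changeD(1)[OF \<eta>] 1 by auto
    have "((\<eta> \<circ> \<theta>) t - (\<eta> \<circ> \<theta>) s) / (t - s) =
        ((\<theta> t - \<theta> s) / (t - s)) * ((\<eta> (\<theta> t) - \<eta> (\<theta> s)) / (\<theta> t - \<theta> s))"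
      using 1 by simp
    then have "ln (((\<eta> \<circ> \<theta>) t - (\<eta> \<circ> \<theta>) s) / (t - s)) =
        ln ((\<theta> t - \<theta> s) / (t - s)) + ln ((\<eta> (\<theta> t) - \<eta> (\<theta> s)) / (\<theta> t - \<theta> s))"
      using 1 2 st by (simp only: ln_mult_pos divide_pos_pos diff_gt_0_iff_gt)
    then show ?thesis
      using gamma_upper[OF \<theta> st] gamma_upper[OF \<eta> 1(2) 1(1)] by linarith
  qed
  have "(\<eta> \<circ> \<theta>) ` {0..} = {0..}"
    using \<theta> \<eta> by (simp only: time_changes_def mem_Collect_eq image_comp[symmetric])
  moreover have "(\<eta> \<circ> \<theta>) s < (\<eta> \<circ> \<theta>) t" if "0 \<le> s" "s < t" for s t
    using time_changeD[OF \<theta>] time_changeD[OF \<eta>] that by simp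
  ultimately show "\<eta> \<circ> \<theta> \<in> time_changes" using * by (intro time_changesI)
  show "skorohod_gamma (\<eta> \<circ> \<theta>) \<le> skorohod_gamma \<theta> + skorohod_gamma \<eta>"
    by (rule gamma_least) (rule *)
qed

private lemma inv_time_change:
  assumes \<theta>: "\<theta> \<in> time_changes"
  obtains \<eta> where "\<eta> \<in> time_changes" "skorohod_gamma \<eta> \<le> skorohod_gamma \<theta>"
    "\<And>t. t \<ge> 0 \<Longrightarrow> \<theta> (\<eta> t) = t" "\<And>t. t \<ge> 0 \<Longrightarrow> \<eta> (\<theta> t) = t"
proof -
  define \<eta> where "\<eta> = inv_into {0..} \<theta>"
  have im: "\<theta> ` {0..} = {0..}" using \<theta> by (simp add: time_changes_def)
  have inj: "inj_on \<theta> {0..}"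
    using \<theta> by (auto simp: time_changes_def intro: strict_mono_on_imp_inj_on)
  have \<theta>\<eta>: "\<theta> (\<eta> t) = t" if "t \<ge> 0" for t
    unfolding \<eta>_def using that im by (intro f_inv_into_f) auto
  have \<eta>0: "\<eta> t \<ge> 0" if "t \<ge> 0" for t
    unfolding \<eta>_def using inv_into_into[of t \<theta> "{0..}"] im that by auto
  have mono: "\<eta> s < \<eta> t" if "0 \<le> s" "s < t" for s t
  proof (rule ccontr)
    assume "\<not> \<eta> s < \<eta> t"
    then have "\<theta> (\<eta> t) \<le> \<theta> (\<eta> s)"
      using time_changeD(1)[OF \<theta>, of "\<eta> t" "\<eta> s"] \<eta>0[of t] that by (cases "\<eta> t = \<eta> s") auto
    then show False using \<theta>\<eta> that by simp
  qed
  have *: "\<bar>ln ((\<eta> t - \<eta> s) / (t - s))\<bar> \<le> skorohod_gamma \<theta>" if st: "0 \<le> s" "s < t" for s t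
  proof -
    have "(\<eta> t - \<eta> s) / (t - s) = inverse ((\<theta> (\<eta> t) - \<theta> (\<eta> s)) / (\<eta> t - \<eta> s))"
      using st \<theta>\<eta> by simp
    then have "ln ((\<eta> t - \<eta> s) / (t - s)) = - ln ((\<theta> (\<eta> t) - \<theta> (\<eta> s)) / (\<eta> t - \<eta> s))"
      using st \<theta>\<eta> mono[OF st] by (simp only: ln_inverse divide_pos_pos diff_gt_0_iff_gt)
    then show ?thesis using gamma_upper[OF \<theta> \<eta>0[OF st(1)] mono[OF st]] by simp
  qed
  have "\<eta> ` {0..} = {0..}"
    unfolding \<eta>_def using inv_into_image_cancel[OF inj order_refl] im by simp
  then have "\<eta> \<in> time_changes" using mono * by (intro time_changesI)
  moreover have "\<eta> (\<theta> t) = t" if "t \<ge> 0" for t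
    unfolding \<eta>_def using inv_into_f_f[OF inj] that by simp
  ultimately show thesis using that gamma_least[OF *] \<theta>\<eta> by blast
qed

private lemma right_limit_sequence:
  fixes u :: real
  defines "v \<equiv> \<lambda>n. (of_int \<lfloor>real (Suc n) * u\<rfloor> + 1) / real (Suc n)"
  shows "filterlim v (at_right u) sequentially" "v n \<in> \<rat>" "v n > u"
proof -
  have gt: "u < v n" and le: "v n \<le> u + 1 / real (Suc n)" for n
  proof -
    have "real (Suc n) * u < of_int \<lfloor>real (Suc n) * u\<rfloor> + 1" by linarith
    then show "u < v n" by (simp add: v_def field_simps)
    have "v n \<le> (real (Suc n) * u + 1) / real (Suc n)"
      unfolding v_def by (intro divide_right_mono) linarith+
    then show "v n \<le> u + 1 / real (Suc n)" by (simp add: add_divide_distrib)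
  qed
  have "v \<longlonglongrightarrow> u"
  proof (rule tendsto_sandwich[of "\<lambda>_. u" v _ "\<lambda>n. u + 1 / real (Suc n)"])
    show "(\<lambda>n. u + 1 / real (Suc n)) \<longlonglongrightarrow> u"
      using tendsto_add[OF tendsto_const LIMSEQ_inverse_real_of_nat, of u] by (simp add: inverse_eq_divide)
  qed (auto intro: always_eventually less_imp_le gt le simp del: of_nat_Suc)
  then show "filterlim v (at_right u) sequentially"
    using gt by (auto simp: filterlim_at less_imp_neq[symmetric] intro!: always_eventually)
  show "v n \<in> \<rat>" by (simp add: v_def)
  show "v n > u" by (rule gt)
qed

private lemma measurable_right_continuous:
  fixes g :: "real \<Rightarrow> real"
  assumes "\<And>u. (g \<longlongrightarrow> g u) (at_right u)"
  shows "g \<in> borel_measurable borel"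
proof (rule borel_measurable_LIMSEQ_real)
  fix n :: nat
  show "(\<lambda>u. g ((of_int \<lfloor>real (Suc n) * u\<rfloor> + 1) / real (Suc n))) \<in> borel_measurable borel"
    by (rule measurable_compose[where g = "\<lambda>i. g ((of_int i + 1) / real (Suc n))" and N = "count_space UNIV"])
       auto
qed (rule filterlim_compose[OF assms right_limit_sequence(1)])

private lemma q_tendsto: "(f \<longlongrightarrow> a) F \<Longrightarrow> (g \<longlongrightarrow> b) F \<Longrightarrow> ((\<lambda>t. q (f t) (g t)) \<longlongrightarrow> q a b) F"
  unfolding q_def by (intro tendsto_intros)

private lemma cadlag_clamp:
  assumes x: "x \<in> skorohod_space E" and "(f \<longlongrightarrow> f t) (at_right t)"
    and ge: "\<And>s. s > t \<Longrightarrow> f s \<ge> f t" and f: "f t \<ge> 0"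
  shows "((\<lambda>s. x (f s)) \<longlongrightarrow> x (f t)) (at_right t)"
proof -
  have "(x \<longlongrightarrow> x (f t)) (at (f t) within {f t..})"
  proof -
    have "(x \<longlongrightarrow> x (f t)) (at_right (f t))" using x f by (auto simp: skorohod_space_def)
    then show ?thesis by (simp add: at_within_Ici_at_right)
  qed
  then have "continuous (at (f t) within {f t..}) x" by (simp add: continuous_within)
  then show ?thesis
  proof (rule continuous_within_tendsto_compose)
    show "eventually (\<lambda>s. f s \<in> {f t..}) (at_right t)"
      using ge by (auto simp: eventually_at_filter)
  qed fact
qed

private lemma time_change_bounds:
  assumes \<theta>: "\<theta> \<in> time_changes" and st: "0 \<le> s" "s < t"
  shows "exp (- skorohod_gamma \<theta>) * (t - s) \<le> \<theta> t - \<theta> s"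
    "\<theta> t - \<theta> s \<le> exp (skorohod_gamma \<theta>) * (t - s)"
proof -
  let ?r = "(\<theta> t - \<theta> s) / (t - s)"
  have pos: "?r > 0" using time_changeD(1)[OF \<theta> st] st by simp
  have "\<bar>ln ?r\<bar> \<le> skorohod_gamma \<theta>" by (rule gamma_upper[OF \<theta> st])
  then have "- skorohod_gamma \<theta> \<le> ln ?r" "ln ?r \<le> skorohod_gamma \<theta>" by linarith+
  then have "exp (- skorohod_gamma \<theta>) \<le> ?r" "?r \<le> exp (skorohod_gamma \<theta>)"
    using pos by (metis exp_le_cancel_iff exp_ln)+
  then show "exp (- skorohod_gamma \<theta>) * (t - s) \<le> \<theta> t - \<theta> s"
    "\<theta> t - \<theta> s \<le> exp (skorohod_gamma \<theta>) * (t - s)"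
    using st by (simp_all add: pos_le_divide_eq pos_divide_le_eq)
qed

private lemma time_change_right_continuous:
  assumes \<theta>: "\<theta> \<in> time_changes" and t: "t \<ge> 0"
  shows "(\<theta> \<longlongrightarrow> \<theta> t) (at_right t)"
proof (rule tendsto_sandwich[of "\<lambda>_. \<theta> t" \<theta> _ "\<lambda>s. \<theta> t + exp (skorohod_gamma \<theta>) * (s - t)"])
  show "eventually (\<lambda>s. \<theta> t \<le> \<theta> s) (at_right t)"
    using time_changeD(1)[OF \<theta> t]
    by (auto simp: eventually_at_filter intro: less_imp_le intro!: always_eventually)
  show "eventually (\<lambda>s. \<theta> s \<le> \<theta> t + exp (skorohod_gamma \<theta>) * (s - t)) (at_right t)"
    using time_change_bounds(2)[OF \<theta> t]
    by (auto simp: eventually_at_filter algebra_simps intro!: always_eventually)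
  show "((\<lambda>s. \<theta> t + exp (skorohod_gamma \<theta>) * (s - t)) \<longlongrightarrow> \<theta> t) (at_right t)"
    by (rule tendsto_eq_intros refl | simp)+
qed simp

private lemma gap_measurable:
  assumes x: "x \<in> skorohod_space E" and y: "y \<in> skorohod_space E" and \<theta>: "\<theta> \<in> time_changes"
  shows "(\<lambda>u. skorohod_gap x y \<theta> (max u 0)) \<in> borel_measurable borel"
proof -
  define h where "h t u = q (x (min t (max u 0))) (y (min (\<theta> t) (max u 0)))" for t u
  have gap: "skorohod_gap x y \<theta> (max u 0) = (SUP t\<in>\<rat> \<inter> {0..}. h t u)" for u
  proof (rule antisym)
    show "skorohod_gap x y \<theta> (max u 0) \<le> (SUP t\<in>\<rat> \<inter> {0..}. h t u)"
    proof (rule gap_least)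
      fix t :: real assume t: "t \<ge> 0"
      have "((\<lambda>s. h s u) \<longlongrightarrow> h t u) (at_right t)"
        unfolding h_def
      proof (rule q_tendsto)
        show "((\<lambda>s. x (min s (max u 0))) \<longlongrightarrow> x (min t (max u 0))) (at_right t)"
          using t by (intro cadlag_clamp[OF x] tendsto_intros) auto
        show "((\<lambda>s. y (min (\<theta> s) (max u 0))) \<longlongrightarrow> y (min (\<theta> t) (max u 0))) (at_right t)"
        proof (rule cadlag_clamp[OF y])
          show "((\<lambda>s. min (\<theta> s) (max u 0)) \<longlongrightarrow> min (\<theta> t) (max u 0)) (at_right t)"
            by (intro tendsto_min tendsto_const time_change_right_continuous[OF \<theta> t])
          show "min (\<theta> t) (max u 0) \<le> min (\<theta> s) (max u 0)" if "t < s" for s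
            using time_changeD(1)[OF \<theta> t that] by auto
          show "0 \<le> min (\<theta> t) (max u 0)" using time_changeD(2)[OF \<theta> t] by auto
        qed
      qed
      from filterlim_compose[OF this right_limit_sequence(1)]
      have "h t u \<le> (SUP t\<in>\<rat> \<inter> {0..}. h t u)"
      proof (rule LIMSEQ_le_const2)
        show "\<exists>N. \<forall>n\<ge>N. h ((of_int \<lfloor>real (Suc n) * t\<rfloor> + 1) / real (Suc n)) u \<le>
            (SUP t\<in>\<rat> \<inter> {0..}. h t u)"
        proof (intro exI allI impI cSUP_upper)
          fix n :: nat
          show "(of_int \<lfloor>real (Suc n) * t\<rfloor> + 1) / real (Suc n) \<in> \<rat> \<inter> {0..}"
            using right_limit_sequence(2,3)[where n = n and u = t] t by simp
        qed (simp add: h_def)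
      qed
      then show "q (x (min t (max u 0))) (y (min (\<theta> t) (max u 0))) \<le> (SUP t\<in>\<rat> \<inter> {0..}. h t u)"
        by (simp add: h_def)
    qed
    have "\<rat> \<inter> {0::real..} \<noteq> {}" by (auto intro!: exI[of _ 0])
    then show "(SUP t\<in>\<rat> \<inter> {0..}. h t u) \<le> skorohod_gap x y \<theta> (max u 0)"
      by (rule cSUP_least) (auto simp: h_def intro: gap_upper)
  qed
  show ?thesis
    unfolding gap
  proof (rule borel_measurable_cSUP)
    show "countable (\<rat> \<inter> {0::real..})" by (simp add: countable_rat countable_Int1)
    show "bdd_above ((\<lambda>t. h t u) ` (\<rat> \<inter> {0..}))" for u by (simp add: h_def)
    fix t :: real assume "t \<in> \<rat> \<inter> {0..}"
    then have t: "t \<ge> 0" by simp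
    show "h t \<in> borel_measurable borel"
    proof (rule measurable_right_continuous)
      fix u
      show "(h t \<longlongrightarrow> h t u) (at_right u)"
        unfolding h_def using t time_changeD(2)[OF \<theta> t]
        by (intro q_tendsto cadlag_clamp[OF x] cadlag_clamp[OF y] tendsto_intros) auto
    qed
  qed
qed

private lemma exp_set_integrable: "set_integrable lborel {0..} (\<lambda>u::real. exp (- u))"
proof -
  have "(\<integral>\<^sup>+u. ennreal (indicator {0..} u * exp (- u)) \<partial>lborel) = 1"
    using nn_intergal_power_times_exp_Ici[of 0]
    by (simp add: ennreal_mult' ennreal_indicator mult.commute)
  then show ?thesis
    unfolding set_integrable_def by (intro integrableI_bounded) auto
qed

lemma skorohod_gap_set_integrable:
  assumes "x \<in> skorohod_space E" "y \<in> skorohod_space E" "\<theta> \<in> time_changes"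
  shows "set_integrable lborel {0..} (\<lambda>u. exp (- u) * skorohod_gap x y \<theta> u)"
proof (rule set_integrable_bound[OF exp_set_integrable])
  have "(\<lambda>u. indicator {0..} u *\<^sub>R (exp (- u) * skorohod_gap x y \<theta> (max u 0))) \<in> borel_measurable lborel"
    using gap_measurable[OF assms] by measurable
  also have "(\<lambda>u. indicator {0..} u *\<^sub>R (exp (- u) * skorohod_gap x y \<theta> (max u 0))) =
      (\<lambda>u. indicator {0..} u *\<^sub>R (exp (- u) * skorohod_gap x y \<theta> u))"
    by (auto simp: indicator_def fun_eq_iff)
  finally show "set_borel_measurable lborel {0..} (\<lambda>u. exp (- u) * skorohod_gap x y \<theta> u)"
    unfolding set_borel_measurable_def .
  show "AE u in lborel. u \<in> {0..} \<longrightarrow> norm (exp (- u) * skorohod_gap x y \<theta> u) \<le> norm (exp (- u))"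
    using skorohod_gap_bounds[of x y \<theta>] by (simp add: abs_mult)
qed

private lemma gap_integral_nonneg: "0 \<le> (LBINT u:{0..}. exp (- u) * skorohod_gap x y \<theta> u)"
  unfolding set_lebesgue_integral_def by (rule integral_nonneg_AE) (auto simp: skorohod_gap_bounds)

lemma skorohod_dist_le_cost: "\<theta> \<in> time_changes \<Longrightarrow> skorohod_dist x y \<le> skorohod_cost x y \<theta>"
  unfolding skorohod_dist_def
  by (rule cINF_lower) (auto intro!: bdd_belowI[of _ 0] simp: skorohod_cost_def le_max_iff_disj gap_integral_nonneg)

private lemma dist_nonneg: "0 \<le> skorohod_dist x y"
  unfolding skorohod_dist_def using id_time_change(1)
  by (intro cINF_greatest) (auto simp: skorohod_cost_def le_max_iff_disj gap_integral_nonneg)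

private lemma dist_less_cost:
  assumes "skorohod_dist x y < e"
  obtains \<theta> where "\<theta> \<in> time_changes" "skorohod_cost x y \<theta> < e"
proof -
  have "\<exists>\<theta>\<in>time_changes. skorohod_cost x y \<theta> < e"
    using assms id_time_change(1) unfolding skorohod_dist_def
    by (subst (asm) cINF_less_iff)
       (auto intro!: bdd_belowI[of _ 0] simp: skorohod_cost_def le_max_iff_disj gap_integral_nonneg)
  then show thesis using that by blast
qed

private lemma dist_triangle_skorohod:
  assumes x: "x \<in> skorohod_space E" and y: "y \<in> skorohod_space E" and z: "z \<in> skorohod_space E"
  shows "skorohod_dist x z \<le> skorohod_dist x y + skorohod_dist y z"
proof (rule field_le_epsilon)
  fix e :: real assume "e > 0"
  then obtain \<theta> \<eta> where \<theta>: "\<theta> \<in> time_changes" "skorohod_cost x y \<theta> < skorohod_dist x y + e / 2"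
    and \<eta>: "\<eta> \<in> time_changes" "skorohod_cost y z \<eta> < skorohod_dist y z + e / 2"
    using dist_less_cost[of x y "skorohod_dist x y + e / 2"]
      dist_less_cost[of y z "skorohod_dist y z + e / 2"]
    by (metis add_less_cancel_left add.right_neutral half_gt_zero)
  have gap: "skorohod_gap x z (\<eta> \<circ> \<theta>) u \<le> skorohod_gap x y \<theta> u + skorohod_gap y z \<eta> u" for u
  proof (rule gap_least)
    fix t :: real assume t: "t \<ge> 0"
    then have "q (y (min (\<theta> t) u)) (z (min (\<eta> (\<theta> t)) u)) \<le> skorohod_gap y z \<eta> u"
      by (intro gap_upper time_changeD(2)[OF \<theta>(1)])
    with gap_upper[OF t, of x u y \<theta>] q(4)
    show "q (x (min t u)) (z (min ((\<eta> \<circ> \<theta>) t) u)) \<le> skorohod_gap x y \<theta> u + skorohod_gap y z \<eta> u"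
      by (smt (verit) comp_apply)
  qed
  note comp = comp_time_change[OF \<theta>(1) \<eta>(1)]
  note int1 = skorohod_gap_set_integrable[OF x y \<theta>(1)] and int2 = skorohod_gap_set_integrable[OF y z \<eta>(1)]
  have "(LBINT u:{0..}. exp (- u) * skorohod_gap x z (\<eta> \<circ> \<theta>) u) \<le>
      (LBINT u:{0..}. exp (- u) * skorohod_gap x y \<theta> u + exp (- u) * skorohod_gap y z \<eta> u)"
    using gap by (intro set_integral_mono skorohod_gap_set_integrable[OF x z comp(1)] set_integral_add int1 int2)
      (simp flip: distrib_left)
  also have "\<dots> = (LBINT u:{0..}. exp (- u) * skorohod_gap x y \<theta> u) +
      (LBINT u:{0..}. exp (- u) * skorohod_gap y z \<eta> u)"
    by (rule set_integral_add[OF int1 int2])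
  finally have "skorohod_cost x z (\<eta> \<circ> \<theta>) \<le> skorohod_cost x y \<theta> + skorohod_cost y z \<eta>"
    using comp(2) unfolding skorohod_cost_def by linarith
  with skorohod_dist_le_cost[OF comp(1), of x z] \<theta>(2) \<eta>(2)
  show "skorohod_dist x z \<le> skorohod_dist x y + skorohod_dist y z + e" by linarith
qed

private lemma dist_sym_le: "skorohod_dist y x \<le> skorohod_dist x y"
proof (rule field_le_epsilon)
  fix e :: real assume "e > 0"
  then obtain \<theta> where \<theta>: "\<theta> \<in> time_changes" "skorohod_cost x y \<theta> < skorohod_dist x y + e"
    using dist_less_cost[of x y "skorohod_dist x y + e"] by auto
  obtain \<eta> where \<eta>: "\<eta> \<in> time_changes" "skorohod_gamma \<eta> \<le> skorohod_gamma \<theta>"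
    "\<And>t. t \<ge> 0 \<Longrightarrow> \<theta> (\<eta> t) = t" "\<And>t. t \<ge> 0 \<Longrightarrow> \<eta> (\<theta> t) = t"
    using inv_time_change[OF \<theta>(1)] by blast
  have "skorohod_gap y x \<eta> u = skorohod_gap x y \<theta> u" for u
  proof (intro antisym gap_least)
    fix t :: real assume t: "t \<ge> 0"
    show "q (y (min t u)) (x (min (\<eta> t) u)) \<le> skorohod_gap x y \<theta> u"
      using gap_upper[OF time_changeD(2)[OF \<eta>(1) t], of x u y \<theta>] \<eta>(3)[OF t] q(3) by metis
    show "q (x (min t u)) (y (min (\<theta> t) u)) \<le> skorohod_gap y x \<eta> u"
      using gap_upper[OF time_changeD(2)[OF \<theta>(1) t], of y u x \<eta>] \<eta>(4)[OF t] q(3) by metis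
  qed
  with \<eta>(2) have "skorohod_cost y x \<eta> \<le> skorohod_cost x y \<theta>"
    unfolding skorohod_cost_def by auto
  with skorohod_dist_le_cost[OF \<eta>(1), of y x] \<theta>(2) show "skorohod_dist y x \<le> skorohod_dist x y + e"
    by linarith
qed

private lemma dist_refl: "skorohod_dist x x = 0"
proof -
  have gap: "skorohod_gap x x (\<lambda>t. t) u = 0" for u
    by (intro antisym gap_least skorohod_gap_bounds) (simp add: q(5))
  have "skorohod_cost x x (\<lambda>t. t) = 0"
    unfolding skorohod_cost_def id_time_change(2) gap by simp
  then show ?thesis using skorohod_dist_le_cost[OF id_time_change(1), of x x] dist_nonneg[of x x] by simp
qed

private lemma close_time_change:
  assumes x: "x \<in> skorohod_space E" and y: "y \<in> skorohod_space E"
    and d: "skorohod_dist x y = 0" and s: "s \<ge> 0" and e: "e > 0" "e < 1"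
  obtains r where "r \<ge> 0" "\<bar>r - s\<bar> < e" "dist (x s) (y r) < e"
proof -
  define T where "T = s + 1"
  define c where "c = min (ln (1 + e / T)) (exp (- (T + 1)) * e)"
  have T: "T > 0" using s by (simp add: T_def)
  have "1 + e / T > 1" using e T by simp
  then have "c > 0" using e unfolding c_def by (simp only: min_less_iff_conj ln_gt_zero) simp
  then obtain \<theta> where \<theta>: "\<theta> \<in> time_changes" "skorohod_cost x y \<theta> < c"
    using dist_less_cost[of x y c] d by auto
  have \<gamma>: "skorohod_gamma \<theta> < ln (1 + e / T)"
    and int: "(LBINT u:{0..}. exp (- u) * skorohod_gap x y \<theta> u) < exp (- (T + 1)) * e"
    using \<theta>(2) by (auto simp: skorohod_cost_def c_def)
  define r where "r = \<theta> s"
  have r0: "r \<ge> 0" unfolding r_def by (rule time_changeD(2)[OF \<theta>(1) s])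
  have rs: "\<bar>r - s\<bar> < e"
  proof (cases "s = 0")
    case True
    then show ?thesis using time_changeD(4)[OF \<theta>(1)] e by (simp add: r_def)
  next
    case False
    then have s': "0 < s" using s by simp
    let ?g = "skorohod_gamma \<theta>"
    have lo: "exp (- ?g) * s \<le> r" and hi: "r \<le> exp ?g * s"
      using time_change_bounds[OF \<theta>(1) order_refl s'] time_changeD(4)[OF \<theta>(1)] by (auto simp: r_def)
    have g: "exp ?g < 1 + e / T" using \<gamma> e T by (metis exp_less_mono exp_ln add_pos_pos divide_pos_pos zero_less_one)
    have g0: "?g \<ge> 0" by (rule gamma_nonneg[OF \<theta>(1)])
    have es: "e / T * s < e" using e T s' by (simp add: T_def field_simps)
    have "r - s \<le> (exp ?g - 1) * s" using hi by (simp add: algebra_simps)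
    also have "\<dots> \<le> e / T * s" using g s' by (intro mult_right_mono) auto
    finally have 1: "r - s < e" using es by simp
    have "s - r \<le> (1 - exp (- ?g)) * s" using lo by (simp add: algebra_simps)
    also have "\<dots> \<le> (exp ?g - 1) * s"
    proof (rule mult_right_mono)
      have "exp ?g + exp (- ?g) \<ge> 2"
        using exp_ge_add_one_self[of ?g] exp_ge_add_one_self[of "- ?g"] by linarith
      then show "1 - exp (- ?g) \<le> exp ?g - 1" by linarith
    qed (use s' in simp)
    also have "\<dots> \<le> e / T * s" using g s' by (intro mult_right_mono) auto
    finally have "s - r < e" using es by simp
    with 1 show ?thesis by linarith
  qed
  have "\<exists>u\<in>{T..T + 1}. skorohod_gap x y \<theta> u < e"
  proof (rule ccontr)
    assume "\<not> ?thesis"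
    then have ge: "e \<le> skorohod_gap x y \<theta> u" if "u \<in> {T..T + 1}" for u using that by force
    have "exp (- (T + 1)) * e = (LBINT u:{T..T + 1}. exp (- (T + 1)) * e)"
      by (simp add: set_lebesgue_integral_def)
    also have "\<dots> \<le> (LBINT u:{T..T + 1}. exp (- u) * skorohod_gap x y \<theta> u)"
    proof (rule set_integral_mono)
      show "set_integrable lborel {T..T + 1} (\<lambda>u. exp (- (T + 1)) * e)"
        by (simp add: set_integrable_def)
      show "set_integrable lborel {T..T + 1} (\<lambda>u. exp (- u) * skorohod_gap x y \<theta> u)"
        by (rule set_integrable_subset[OF skorohod_gap_set_integrable[OF x y \<theta>(1)]]) (use T in auto)
      show "exp (- (T + 1)) * e \<le> exp (- u) * skorohod_gap x y \<theta> u" if "u \<in> {T..T + 1}" for u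
        using that e ge by (intro mult_mono) auto
    qed
    also have "\<dots> \<le> (LBINT u:{0..}. exp (- u) * skorohod_gap x y \<theta> u)"
      unfolding set_lebesgue_integral_def
    proof (rule integral_mono)
      show "integrable lborel (\<lambda>u. indicator {T..T + 1} u *\<^sub>R (exp (- u) * skorohod_gap x y \<theta> u))"
        using set_integrable_subset[OF skorohod_gap_set_integrable[OF x y \<theta>(1)], of "{T..T + 1}"] T
        by (auto simp: set_integrable_def)
      show "integrable lborel (\<lambda>u. indicator {0..} u *\<^sub>R (exp (- u) * skorohod_gap x y \<theta> u))"
        using skorohod_gap_set_integrable[OF x y \<theta>(1)] by (simp add: set_integrable_def)
      show "indicator {T..T + 1} u *\<^sub>R (exp (- u) * skorohod_gap x y \<theta> u) \<le>
          indicator {0..} u *\<^sub>R (exp (- u) * skorohod_gap x y \<theta> u)" for u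
        using T by (auto simp: indicator_def skorohod_gap_bounds)
    qed
    finally show False using int by simp
  qed
  then obtain u where u: "T \<le> u" "skorohod_gap x y \<theta> u < e" by auto
  have "min s u = s" "min r u = r" using u rs e by (auto simp: T_def)
  then have "q (x s) (y r) < e"
    using gap_upper[OF s, of x u y \<theta>] u(2) by (simp add: r_def)
  then have "dist (x s) (y r) < e" using e by (simp add: q_def min_def split: if_splits)
  with that r0 rs show thesis by blast
qed

private lemma dist_eq_0:
  assumes x: "x \<in> skorohod_space E" and y: "y \<in> skorohod_space E" and d: "skorohod_dist x y = 0"
  shows "x = y"
proof (rule extensionalityI)
  show "x \<in> extensional {0..}" "y \<in> extensional {0..}"
    using x y by (auto simp: skorohod_space_def PiE_def)
  fix t :: real assume "t \<in> {0..}"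
  then have t: "t \<ge> 0" by simp
  have "dist (x t) (y t) \<le> 0 + e" if e: "e > 0" for e
  proof -
    have "(x \<longlongrightarrow> x t) (at_right t)" "(y \<longlongrightarrow> y t) (at_right t)"
      using x y t by (auto simp: skorohod_space_def)
    then have "eventually (\<lambda>s. dist (x s) (x t) < e / 3) (at_right t)"
      "eventually (\<lambda>s. dist (y s) (y t) < e / 3) (at_right t)"
      using e by (auto intro!: tendstoD simp del: divide_const_simps less_divide_eq_numeral1)
    from eventually_conj[OF this]
    obtain b where b: "b > t" "\<And>s. t < s \<Longrightarrow> s < b \<Longrightarrow> dist (x s) (x t) < e / 3 \<and> dist (y s) (y t) < e / 3"
      unfolding eventually_at_right_field by blast
    define s where "s = (t + b) / 2"
    define \<delta> where "\<delta> = Min {e / 3, (b - t) / 2, 1 / 2}"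
    have "\<delta> > 0" "\<delta> < 1" using e b(1) by (auto simp: \<delta>_def)
    moreover have "\<delta> \<le> e / 3" "\<delta> \<le> (b - t) / 2" by (simp_all only: \<delta>_def) (rule Min_le, simp, simp)+
    moreover have "s \<ge> 0" using t b by (simp add: s_def)
    ultimately obtain r where r: "\<bar>r - s\<bar> < \<delta>" "dist (x s) (y r) < \<delta>"
      using close_time_change[OF x y d] by blast
    have "t < r" "r < b" using r(1) \<open>\<delta> \<le> (b - t) / 2\<close> by (auto simp: s_def field_simps abs_less_iff)
    moreover have "t < s" "s < b" using b by (auto simp: s_def)
    ultimately have "dist (x s) (x t) < e / 3" "dist (y r) (y t) < e / 3" using b by auto
    with r(2) \<open>\<delta> \<le> e / 3\<close> show ?thesis
      using dist_triangle[of "x t" "y t" "x s"] dist_triangle[of "x s" "y t" "y r"]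
      by (simp add: dist_commute)
  qed
  then have "dist (x t) (y t) \<le> 0" by (rule field_le_epsilon)
  then show "x t = y t" by simp
qed

lemma Metric_space_skorohod: "Metric_space (skorohod_space E) skorohod_dist"
proof
  fix x y z :: "real \<Rightarrow> 'a"
  show "0 \<le> skorohod_dist x y" by (rule dist_nonneg)
  show "skorohod_dist x y = skorohod_dist y x" by (intro antisym dist_sym_le)
  show "skorohod_dist x y = 0 \<longleftrightarrow> x = y" if "x \<in> skorohod_space E" "y \<in> skorohod_space E"
    using dist_eq_0 that dist_refl by blast
  show "skorohod_dist x z \<le> skorohod_dist x y + skorohod_dist y z"
    if "x \<in> skorohod_space E" "y \<in> skorohod_space E" "z \<in> skorohod_space E"
    using dist_triangle_skorohod that by blast
qed

end

definition skorohod_topology :: "'a::metric_space set \<Rightarrow> (real \<Rightarrow> 'a) topology" where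
  "skorohod_topology E = Metric_space.mtopology (skorohod_space E) skorohod_dist"

definition topology_borel :: "'a topology \<Rightarrow> 'a measure" where
  "topology_borel T = sigma (topspace T) {U. openin T U}"

definition converges_weakly :: "'a topology \<Rightarrow> (nat \<Rightarrow> 'a measure) \<Rightarrow> 'a measure \<Rightarrow> bool" where
  "converges_weakly T Ms M \<longleftrightarrow>
     (\<forall>f. continuous_map T euclideanreal f \<longrightarrow> bounded (f ` topspace T) \<longrightarrow>
       (\<lambda>m. \<integral>\<omega>. f \<omega> \<partial>Ms m) \<longlonglongrightarrow> (\<integral>\<omega>. f \<omega> \<partial>M))"


section \<open>Brownian motion in \<open>\<int>\<^sub>p\<close>\<close>

definition bm_beta :: "nat \<Rightarrow> real \<Rightarrow> real" where
  "bm_beta p b = (real p powr (b + 1) - 1) / (real p powr b * (real p - 1))"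

definition bm_phi :: "real \<Rightarrow> real \<Rightarrow> real \<Rightarrow> 'p::prime_type padic set \<Rightarrow> real" where
  "bm_phi b D t C =
     (if C = Zp then 1
      else exp (- D * (coset_abs Zp C powr b - inverse (bm_beta CARD('p) b)) * t))"

definition bm_density :: "real \<Rightarrow> real \<Rightarrow> real \<Rightarrow> 'p::prime_type padic \<Rightarrow> complex" where
  "bm_density b D t x =
     (\<Sum>\<^sub>\<infinity>C\<in>QpZp. add_char (x * coset_rep C) * of_real (bm_phi b D t C))"

text \<open>
  \<open>iterated_integral \<mu> [U\<^sub>1, \<dots>, U\<^sub>k] f = \<integral>\<^bsub>U\<^sub>1\<^esub> \<dots> \<integral>\<^bsub>U\<^sub>k\<^esub> f [x\<^sub>1, \<dots>, x\<^sub>k] d\<mu>(x\<^sub>k) \<dots> d\<mu>(x\<^sub>1)\<close>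
\<close>

primrec iterated_integral :: "'a measure \<Rightarrow> 'a set list \<Rightarrow> ('a list \<Rightarrow> complex) \<Rightarrow> complex" where
  "iterated_integral \<mu> [] f = f []"
| "iterated_integral \<mu> (U # Us) f = (LINT x:U|\<mu>. iterated_integral \<mu> Us (\<lambda>xs. f (x # xs)))"

text \<open>
  In the finite-dimensional distributions \<open>(0 # ts) ! i\<close> and \<open>ts ! i\<close> are \<open>t\<^sub>i\<close> and \<open>t\<^bsub>i+1\<^esub>\<close>, with
  \<open>t\<^sub>0 = 0\<close>; likewise for \<open>xs\<close>.
\<close>

definition Brownian_law ::
    "real \<Rightarrow> real \<Rightarrow> 'p::prime_type padic measure \<Rightarrow> (real \<Rightarrow> 'p padic) measure \<Rightarrow> bool" where
  "Brownian_law b D \<mu> P \<longleftrightarrow>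
     prob_space P \<and> sets P = sets (topology_borel (skorohod_topology Zp)) \<and>
     (AE \<omega> in P. \<omega> 0 = 0) \<and>
     (\<forall>ts Us. sorted_wrt (<) (0 # ts) \<longrightarrow> length Us = length ts \<longrightarrow> set Us \<subseteq> sets Zp_borel \<longrightarrow>
        complex_of_real (measure P {\<omega> \<in> space P. \<forall>i<length ts. \<omega> (ts ! i) \<in> Us ! i}) =
        iterated_integral \<mu> Us (\<lambda>xs. \<Prod>i<length ts.
          bm_density b D (ts ! i - (0 # ts) ! i) (xs ! i - (0 # xs) ! i)))"


section \<open>The random walks\<close>

text \<open>
  Addition in \<^term>\<open>Gm m\<close> is the elementwise addition of cosets from \<^theory>\<open>HOL-Library.Set_Algebras\<close>,
  and \<^term>\<open>pZp m\<close> is the zero coset.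
\<close>

definition Gm_sphere :: "nat \<Rightarrow> nat \<Rightarrow> 'p::prime_type padic set set" where
  "Gm_sphere m l = {C \<in> Gm m. coset_abs (pZp m) C = real CARD('p) powi (int l - int m)}"

definition step_const :: "nat \<Rightarrow> real \<Rightarrow> nat \<Rightarrow> real" where
  "step_const p b m =
     real p powr (real m * b) / (real p powr (real m * b) - 1) * (real p powr b - 1)"

definition step_law :: "real \<Rightarrow> nat \<Rightarrow> 'w measure \<Rightarrow> ('w \<Rightarrow> 'p::prime_type padic set) \<Rightarrow> bool" where
  "step_law b m M X \<longleftrightarrow>
     X \<in> M \<rightarrow>\<^sub>M count_space (Gm m) \<and>
     (\<forall>l\<in>{1..m}. \<forall>g\<in>Gm_sphere m l. \<forall>h\<in>Gm_sphere m l.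
        measure M {w \<in> space M. X w = g} = measure M {w \<in> space M. X w = h}) \<and>
     (\<forall>l\<in>{1..m}. measure M {w \<in> space M. X w \<in> Gm_sphere m l} =
        step_const CARD('p) b m * real CARD('p) powr (- real l * b)) \<and>
     measure M {w \<in> space M. X w = pZp m} = 0"

definition random_walk ::
    "real \<Rightarrow> nat \<Rightarrow> 'w measure \<Rightarrow> ('w \<Rightarrow> 'p::prime_type padic set) \<Rightarrow>
     (nat \<Rightarrow> 'w \<Rightarrow> 'p padic set) \<Rightarrow> (nat \<Rightarrow> 'w \<Rightarrow> 'p padic set) \<Rightarrow> bool" where
  "random_walk b m M S\<^sub>0 X S \<longleftrightarrow>
     prob_space M \<and>
     S\<^sub>0 \<in> M \<rightarrow>\<^sub>M count_space (Gm m) \<and> (AE w in M. S\<^sub>0 w = pZp m) \<and>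
     (\<forall>i\<ge>1. step_law b m M (X i)) \<and>
     prob_space.indep_vars M (\<lambda>_. count_space (Gm m)) X {1..} \<and>
     (\<forall>n. \<forall>w\<in>space M. S n w = S\<^sub>0 w + (\<Sum>i=1..n. X i w))"

definition Gamma_embed :: "nat \<Rightarrow> 'p::prime_type padic set \<Rightarrow> 'p padic" where
  "Gamma_embed m C = (\<Sum>i<m. of_nat (digit (coset_rep C) (int i)) * of_nat CARD('p) ^ i)"

definition time_scale :: "nat \<Rightarrow> real \<Rightarrow> real \<Rightarrow> nat \<Rightarrow> real" where
  "time_scale p b D m = D / bm_beta p b * real p powr (real m * b)"

definition scaled_walk ::
    "real \<Rightarrow> real \<Rightarrow> nat \<Rightarrow> (nat \<Rightarrow> 'w \<Rightarrow> 'p::prime_type padic set) \<Rightarrow> real \<Rightarrow> 'w \<Rightarrow> 'p padic" where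
  "scaled_walk b D m S t w = Gamma_embed m (S (nat \<lfloor>t * time_scale CARD('p) b D m\<rfloor>) w)"

definition scaled_walk_law ::
    "real \<Rightarrow> real \<Rightarrow> nat \<Rightarrow> 'w measure \<Rightarrow> (nat \<Rightarrow> 'w \<Rightarrow> 'p::prime_type padic set) \<Rightarrow>
     (real \<Rightarrow> 'p padic) measure \<Rightarrow> bool" where
  "scaled_walk_law b D m M S P \<longleftrightarrow>
     prob_space P \<and> sets P = sets (topology_borel (skorohod_topology Zp)) \<and>
     (\<forall>J. finite J \<longrightarrow> J \<subseteq> {0..} \<longrightarrow>
        distr P (\<Pi>\<^sub>M t\<in>J. Zp_borel) (\<lambda>\<omega>. \<lambda>t\<in>J. \<omega> t) =
        distr M (\<Pi>\<^sub>M t\<in>J. Zp_borel) (\<lambda>w. \<lambda>t\<in>J. scaled_walk b D m S t w))"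

definition index_bound :: "nat \<Rightarrow> real \<Rightarrow> real" where
  "index_bound p b =
     max (1 + of_int \<lceil>1 / b * log (real p) ((real p powr (b + 1) - 1) / (real p powr b - 1))\<rceil>)
         (1 / b * log (real p) (2 * sqrt 2 * real p powr b))"

end

theory Submission
  imports Defs "HOL-Number_Theory.Cong"
begin

text \<open>
  All processes are looked at through their residues modulo \<open>p\<^sup>n\<close>, for fixed \<open>n\<close>. A path of residues is
  piecewise constant with values in the finite group \<open>\<int>/p\<^sup>n\<int>\<close>, and replacing a path in \<open>\<int>\<^sub>p\<close> by its residues
  moves it by at most \<open>p\<^sup>-\<^sup>n\<close>. Two facts about residues then give weak convergence: their joint laws on
  every finite grid of times converge, and their jumps do not accumulate, uniformly in \<open>m\<close>.

  \<^bold>\<open>Grid laws.\<close> Both processes have stationary independent increments with radial laws. The radial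
  functions on \<open>\<int>/p\<^sup>n\<int>\<close> are spanned by the uniform laws on the subgroups \<open>p\<^sup>j\<int>/p\<^sup>n\<int>\<close>; these multiply under
  convolution like a chain of projections, so that their successive differences are orthogonal
  idempotents and convolution powers of a radial law are powers of its eigenvalues
  (\<open>convolution_radial\<close>, \<open>residue_walk.prob_sum_cong\<close>). With \<open>q = p\<^sup>b\<close>, the \<open>j\<close>-th eigenvalue of a step of
  the walk is \<open>1 - c\<^sub>j / (q\<^sup>m - 1)\<close> (\<open>sphere_eigenvalue_step\<close>), and a time interval of length \<open>t\<close> contains
  about \<open>t D q\<^sup>m / \<beta>\<close> steps, so its power tends to \<open>exp (- t D c\<^sub>j / \<beta>)\<close>, which is the symbol \<open>\<phi>\<close> of the
  limiting semigroup because \<open>c\<^sub>j / \<beta> = q\<^sup>j - 1 / \<beta>\<close> (\<open>eigen_rate_scaled\<close>). On the side of the limit, summing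
  the characters of the cosets with \<open>|\<langle>y\<rangle>| \<le> p\<^sup>j\<close> yields \<open>p\<^sup>j\<close> times the indicator of the ball \<open>p\<^sup>j\<int>\<^sub>p\<close>. The
  density is therefore a series of the same idempotents, and integrating it over a residue class
  modulo \<open>p\<^sup>n\<close> kills all terms beyond the \<open>n\<close>-th (\<open>haar_Zp.integral_bm_density\<close>).

  \<^bold>\<open>Jumps.\<close> A step of the walk changes the residue with probability \<open>(q\<^sup>n - 1) / (q\<^sup>m - 1)\<close>, and steps are
  independent, so two changes in a window of length \<open>2 \<delta>\<close> have probability \<open>O(\<delta>\<^sup>2)\<close>, and \<open>T / \<delta>\<close> windows
  contribute \<open>O(\<delta>)\<close> (\<open>scaled_random_walk.walk_crowded_prob\<close>). Changes are detected on dyadic grids, so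
  the same bound passes to the limit law through the convergence of the grid laws.

  \<^bold>\<open>Conclusion.\<close> If all jumps of the residues up to time \<open>T\<close> are at least \<open>\<delta>\<close> apart, a time change with
  slopes within \<open>1/L\<close> of \<open>1\<close> moves them to the grid of mesh \<open>\<delta>/L\<close>. Hence the path is Skorohod close to the
  step function of its residues sampled on this grid (\<open>skorohod_dist_sample_path\<close>). Integrals of functions
  of the sampled path are finite sums over grid laws and converge. Testing with bounded Lipschitz
  functions, which suffices by \<open>Metric_space.converges_weakly_by_approximation\<close>, the sampling error is small
  for all large \<open>m\<close> and in the limit.
\<close>

section \<open>Residues of \<open>p\<close>-adic integers\<close>

lemma prime_gt_1_CARD: "CARD('p::prime_type) > 1"
  using prime_CARD[where 'a='p] by (rule prime_gt_1_nat)

lemma padic_of_nat: "(of_nat k :: 'p::prime_type padic) = abs_padic (\<lambda>_. of_nat k)"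
proof (induction k)
  case 0
  show ?case by (simp add: zero_padic.abs_eq)
next
  case (Suc k)
  then show ?case
    by (simp add: one_padic.abs_eq plus_padic.abs_eq padic_rel_refl prime_CARD)
qed

lemma padic_of_int: "(of_int k :: 'p::prime_type padic) = abs_padic (\<lambda>_. of_int k)"
  by (cases k rule: int_diff_cases)
    (simp add: padic_of_nat minus_padic_def uminus_padic.abs_eq plus_padic.abs_eq padic_rel_refl prime_CARD)

lemma padic_abs_const:
  "padic_abs (abs_padic (\<lambda>_. q) :: 'p::prime_type padic) = rat_padic_abs CARD('p) q"
  by (simp add: padic_abs.abs_eq padic_rel_refl prime_CARD)

lemma padic_abs_of_int: "padic_abs (of_int k :: 'p::prime_type padic) = rat_padic_abs CARD('p) (of_int k)"
  unfolding padic_of_int by (rule padic_abs_const)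

lemma padic_abs_zero [simp]: "padic_abs (0 :: 'p::prime_type padic) = 0"
  by (simp add: padic_abs_eq_0_iff)

lemma padic_abs_one [simp]: "padic_abs (1 :: 'p::prime_type padic) = 1"
  using padic_abs_of_int[of 1, where 'p='p] by (simp add: prime_CARD)

lemma padic_abs_diff_commute: "padic_abs (x - y) = padic_abs (y - x)"
  for x :: "'p::prime_type padic"
  using padic_abs_minus[of "x - y"] by simp

lemma padic_abs_add_le:
  "padic_abs x \<le> r \<Longrightarrow> padic_abs y \<le> r \<Longrightarrow> padic_abs (x + y :: 'p::prime_type padic) \<le> r"
  using padic_abs_ultrametric[of x y] by linarith

lemma padic_abs_diff_le:
  "padic_abs x \<le> r \<Longrightarrow> padic_abs y \<le> r \<Longrightarrow> padic_abs (x - y :: 'p::prime_type padic) \<le> r"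
  using padic_abs_add_le[of x r "- y"] by (simp add: padic_abs_minus)

lemma padic_abs_trans:
  "padic_abs (x - y) \<le> r \<Longrightarrow> padic_abs (y - z) \<le> r \<Longrightarrow> padic_abs (x - z :: 'p::prime_type padic) \<le> r"
  using padic_abs_add_le[of "x - y" r "y - z"] by simp

lemma padic_abs_sum_le:
  "finite A \<Longrightarrow> r \<ge> 0 \<Longrightarrow> (\<And>i. i \<in> A \<Longrightarrow> padic_abs (f i) \<le> r) \<Longrightarrow>
    padic_abs (\<Sum>i\<in>A. f i :: 'p::prime_type padic) \<le> r"
  by (induction A rule: finite_induct) (auto intro: padic_abs_add_le)

lemma padic_abs_inverse: "padic_abs (inverse x) = inverse (padic_abs x)" for x :: "'p::prime_type padic"
proof (cases "x = 0")
  case False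
  then have "padic_abs (inverse x) * padic_abs x = 1" by (simp flip: padic_abs_mult)
  then show ?thesis by (metis inverse_unique mult.commute)
qed simp

lemma padic_abs_divide: "padic_abs (x / y) = padic_abs x / padic_abs y" for x :: "'p::prime_type padic"
  by (simp add: field_class.field_divide_inverse padic_abs_mult padic_abs_inverse)

lemma padic_abs_power: "padic_abs (x ^ n) = padic_abs x ^ n" for x :: "'p::prime_type padic"
  by (induction n) (auto simp: padic_abs_mult)

lemma padic_abs_of_int_le_iff:
  "padic_abs (of_int k :: 'p::prime_type padic) \<le> (1 / real CARD('p)) ^ n \<longleftrightarrow> int CARD('p) ^ n dvd k"
proof (cases "k = 0")
  case False
  have nu: "\<not> is_unit (int CARD('p))" using prime_gt_1_CARD[where 'p='p] by auto
  have "rat_padic_abs CARD('p) (of_int k / of_int 1) =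
      real CARD('p) powi (- int (multiplicity (int CARD('p)) k))"
    using rat_padic_abs_frac[OF prime_CARD[where 'a='p], of k 1] False by simp
  then have "padic_abs (of_int k :: 'p padic) = (1 / real CARD('p)) ^ multiplicity (int CARD('p)) k"
    by (simp add: padic_abs_of_int power_int_minus power_divide field_simps)
  also have "\<dots> \<le> (1 / real CARD('p)) ^ n \<longleftrightarrow> n \<le> multiplicity (int CARD('p)) k"
    using prime_gt_1_CARD[where 'p='p] by (subst power_decreasing_iff) auto
  also have "\<dots> \<longleftrightarrow> int CARD('p) ^ n dvd k"
    using power_dvd_iff_le_multiplicity[of k "int CARD('p)" n] False nu by auto
  finally show ?thesis .
qed auto

lemma padic_abs_of_int_le_1: "padic_abs (of_int k :: 'p::prime_type padic) \<le> 1"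
  using padic_abs_of_int_le_iff[of k 0, where 'p='p] by simp

lemma padic_abs_of_nat_le_1: "padic_abs (of_nat k :: 'p::prime_type padic) \<le> 1"
  using padic_abs_of_int_le_1[of "int k"] by simp

lemma padic_abs_prime: "padic_abs (of_nat CARD('p) :: 'p::prime_type padic) = 1 / real CARD('p)"
proof -
  have nu: "\<not> is_unit (int CARD('p))" using prime_gt_1_CARD[where 'p='p] by auto
  have "rat_padic_abs CARD('p) (of_int (int CARD('p)) / of_int 1) =
      real CARD('p) powi (- int (multiplicity (int CARD('p)) (int CARD('p))))"
    using rat_padic_abs_frac[OF prime_CARD[where 'a='p], of "int CARD('p)" 1] by simp
  moreover have "multiplicity (int CARD('p)) (int CARD('p)) = 1"
    using nu by (intro multiplicity_self) auto
  ultimately show ?thesis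
    using padic_abs_of_int[of "int CARD('p)", where 'p='p] by (simp add: power_int_minus field_simps)
qed

lemma of_nat_CARD_padic_nonzero [simp]: "(of_nat CARD('p) :: 'p::prime_type padic) \<noteq> 0"
  using padic_abs_prime[where 'p='p] prime_gt_1_CARD[where 'p='p] by fastforce

lemma padic_abs_prime_power:
  "padic_abs (of_nat CARD('p) ^ n :: 'p::prime_type padic) = (1 / real CARD('p)) ^ n"
  by (simp only: padic_abs_power padic_abs_prime)

lemma padic_abs_of_int_eq_1:
  assumes "\<not> int CARD('p) dvd k"
  shows "padic_abs (of_int k :: 'p::prime_type padic) = 1"
proof -
  have "k \<noteq> 0" using assms by auto
  have "rat_padic_abs CARD('p) (of_int k / of_int 1) =
      real CARD('p) powi (- int (multiplicity (int CARD('p)) k))"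
    using rat_padic_abs_frac[OF prime_CARD[where 'a='p], of k 1] \<open>k \<noteq> 0\<close> by simp
  then show ?thesis using assms by (simp add: padic_abs_of_int not_dvd_imp_multiplicity_0)
qed

text \<open>
  A representing Cauchy sequence approximates the number it defines.
\<close>

lemma padic_rat_approx:
  fixes x :: "'p::prime_type padic"
  assumes "e > 0"
  obtains q where "padic_abs (x - abs_padic (\<lambda>_. q)) \<le> e"
proof -
  define X where "X = rep_padic x"
  have X: "padic_rel CARD('p) X X" "abs_padic X = x"
    using Quotient_rep_reflp[OF Quotient_padic, of x] Quotient_abs_rep[OF Quotient_padic, of x]
    by (simp_all add: X_def)
  then have C: "padic_Cauchy CARD('p) X" by (simp add: padic_rel_def)
  then obtain k where k: "\<forall>m\<ge>k. \<forall>n\<ge>k. rat_padic_abs CARD('p) (X m - X n) < e"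
    using assms by (auto simp: padic_Cauchy_def)
  define Y where "Y = (\<lambda>n. X n + - X k)"
  have Y: "padic_Cauchy CARD('p) Y"
    unfolding Y_def by (intro padic_Cauchy_add C prime_CARD padic_Cauchy_const)
  have "x - abs_padic (\<lambda>_. X k) = abs_padic Y"
    unfolding minus_padic_def Y_def X(2)[symmetric]
    using X(1) by (simp add: uminus_padic.abs_eq plus_padic.abs_eq padic_rel_refl prime_CARD)
  then have "padic_abs (x - abs_padic (\<lambda>_. X k)) = lim (\<lambda>n. rat_padic_abs CARD('p) (Y n))"
    using Y by (simp add: padic_abs.abs_eq padic_rel_refl prime_CARD)
  moreover have "lim (\<lambda>n. rat_padic_abs CARD('p) (Y n)) \<le> e"
    using padic_abs_LIMSEQ[OF Y]
    by (rule LIMSEQ_le_const2) (use k in \<open>auto simp: Y_def intro!: exI[of _ k] less_imp_le\<close>)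
  ultimately show ?thesis using that by metis
qed

text \<open>
  A rational approximation \<open>u / v\<close> in lowest terms of a \<open>p\<close>-adic integer has \<open>p\<close> not dividing \<open>v\<close>, so \<open>v\<close> is
  invertible modulo \<open>p\<^sup>n\<close> and \<open>u v\<^sup>-\<^sup>1 mod p\<^sup>n\<close> is the approximating natural number.
\<close>

lemma Zp_nat_approx:
  fixes x :: "'p::prime_type padic"
  assumes "x \<in> Zp"
  obtains r where "r < CARD('p) ^ n" "padic_abs (x - of_nat r) \<le> (1 / real CARD('p)) ^ n"
proof -
  let ?p = "int CARD('p)" and ?e = "(1 / real CARD('p)) ^ n"
  have p1: "CARD('p) > 1" by (rule prime_gt_1_CARD)
  have e: "0 < ?e" "?e \<le> 1" using p1 by (auto simp: power_le_one)
  obtain q where q: "padic_abs (x - abs_padic (\<lambda>_. q)) \<le> ?e"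
    using padic_rat_approx[OF e(1)] by blast
  define y :: "'p padic" where "y = abs_padic (\<lambda>_. q)"
  have "padic_abs (y - x) \<le> 1" using q e padic_abs_diff_commute[of x y] by (simp add: y_def)
  then have y1: "padic_abs y \<le> 1"
    using padic_abs_add_le[of "y - x" 1 x] assms by (simp add: Zp_def)
  obtain u v where uv: "quotient_of q = (u, v)" by (cases "quotient_of q")
  have v: "v > 0" and qd: "q = of_int u / of_int v" and cop: "coprime u v"
    using uv quotient_of_denom_pos quotient_of_div quotient_of_coprime by blast+
  have vy: "of_int v * y = of_int u"
    unfolding y_def padic_of_int using v
    by (simp add: times_padic.abs_eq padic_rel_refl prime_CARD qd)
  have pv: "\<not> ?p dvd v"
  proof
    assume pv: "?p dvd v"
    then have "padic_abs (of_int v :: 'p padic) \<le> 1 / real CARD('p)"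
      using padic_abs_of_int_le_iff[of v 1, where 'p='p] by simp
    then have "padic_abs (of_int v * y) \<le> 1 / real CARD('p) * 1"
      unfolding padic_abs_mult using y1 by (intro mult_mono) (auto simp: padic_abs_nonneg)
    then have "?p dvd u" using padic_abs_of_int_le_iff[of u 1, where 'p='p] by (simp add: vy)
    then show False using pv cop prime_CARD[where 'a='p] by (meson coprime_common_divisor not_prime_unit prime_nat_int_transfer)
  qed
  have v1: "padic_abs (of_int v :: 'p padic) = 1" by (rule padic_abs_of_int_eq_1[OF pv])
  have "coprime v (?p ^ n)"
    using prime_imp_coprime[of ?p v] pv prime_CARD[where 'a='p] by (simp add: coprime_commute)
  then obtain w where w: "[v * w = 1] (mod ?p ^ n)"
    using coprime_iff_invertible_int by blast
  define r where "r = nat ((u * w) mod ?p ^ n)"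
  have pn: "?p ^ n > 0" using p1 by simp
  have r: "int r = (u * w) mod ?p ^ n" unfolding r_def using pn by (simp add: pos_mod_sign)
  then have rlt: "r < CARD('p) ^ n"
    using pos_mod_bound[OF pn, of "u * w"] by (metis of_nat_less_iff of_nat_power)
  have "[v * int r = u * 1] (mod ?p ^ n)"
  proof -
    have "[v * int r = v * (u * w)] (mod ?p ^ n)" unfolding r by (simp add: cong_def mod_mult_right_eq)
    also have "v * (u * w) = u * (v * w)" by simp
    also have "[u * (v * w) = u * 1] (mod ?p ^ n)" by (rule cong_scalar_left[OF w])
    finally show ?thesis .
  qed
  then have "?p ^ n dvd u - v * int r" by (metis cong_iff_dvd_diff cong_sym mult.right_neutral)
  then have "padic_abs (of_int (u - v * int r) :: 'p padic) \<le> ?e"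
    by (simp only: padic_abs_of_int_le_iff)
  moreover have "(of_int (u - v * int r) :: 'p padic) = of_int v * (y - of_nat r)"
    by (simp add: algebra_simps flip: vy)
  ultimately have "padic_abs (y - of_nat r) \<le> ?e" by (simp add: padic_abs_mult v1)
  then have "padic_abs (x - of_nat r) \<le> ?e" using q padic_abs_trans unfolding y_def by blast
  with rlt show ?thesis by (rule that)
qed

definition residue :: "nat \<Rightarrow> 'p::prime_type padic \<Rightarrow> nat" where
  "residue n x = (SOME r. r < CARD('p) ^ n \<and> padic_abs (x - of_nat r) \<le> (1 / real CARD('p)) ^ n)"

lemma residue:
  assumes "x \<in> Zp"
  shows residue_less: "residue n x < CARD('p) ^ n"
    and residue_approx: "padic_abs (x - of_nat (residue n x) :: 'p::prime_type padic) \<le> (1 / real CARD('p)) ^ n"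
proof -
  have "\<exists>r. r < CARD('p) ^ n \<and> padic_abs (x - of_nat r) \<le> (1 / real CARD('p)) ^ n"
    using Zp_nat_approx[OF assms, of n] by blast
  from someI_ex[OF this]
  show "residue n x < CARD('p) ^ n" "padic_abs (x - of_nat (residue n x)) \<le> (1 / real CARD('p)) ^ n"
    unfolding residue_def by blast+
qed

text \<open>
  The ultrametric inequality lets both numbers be replaced by their integer approximations.
\<close>

lemma padic_close_iff_dvd:
  fixes x y :: "'p::prime_type padic"
  assumes x: "padic_abs (x - of_int r) \<le> (1 / real CARD('p)) ^ n"
    and y: "padic_abs (y - of_int s) \<le> (1 / real CARD('p)) ^ n" and j: "j \<le> n"
  shows "padic_abs (x - y) \<le> (1 / real CARD('p)) ^ j \<longleftrightarrow> int CARD('p) ^ j dvd r - s"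
proof -
  let ?e = "(1 / real CARD('p)) ^ j"
  have le: "(1 / real CARD('p)) ^ n \<le> ?e"
    using j prime_gt_1_CARD[where 'p='p] by (intro power_decreasing) auto
  have x': "padic_abs (x - of_int r) \<le> ?e" and y': "padic_abs (y - of_int s) \<le> ?e"
    using x y le by linarith+
  have "padic_abs (x - y) \<le> ?e \<longleftrightarrow> padic_abs (of_int r - of_int s :: 'p padic) \<le> ?e"
  proof
    assume "padic_abs (x - y) \<le> ?e"
    moreover have "padic_abs (of_int r - x) \<le> ?e" using x' padic_abs_diff_commute by metis
    ultimately show "padic_abs (of_int r - of_int s :: 'p padic) \<le> ?e"
      using padic_abs_trans y' by blast
  next
    assume "padic_abs (of_int r - of_int s :: 'p padic) \<le> ?e"
    moreover have "padic_abs (of_int s - y) \<le> ?e" using y' padic_abs_diff_commute by metis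
    ultimately show "padic_abs (x - y) \<le> ?e" using padic_abs_trans x' by blast
  qed
  also have "\<dots> \<longleftrightarrow> padic_abs (of_int (r - s) :: 'p padic) \<le> ?e" by simp
  also have "\<dots> \<longleftrightarrow> int CARD('p) ^ j dvd r - s" by (rule padic_abs_of_int_le_iff)
  finally show ?thesis .
qed

lemma residue_unique:
  fixes x :: "'p::prime_type padic"
  assumes "x \<in> Zp" "r < CARD('p) ^ n" "padic_abs (x - of_int (int r)) \<le> (1 / real CARD('p)) ^ n"
  shows "residue n x = r"
proof -
  have "int CARD('p) ^ n dvd int (residue n x) - int r"
    using padic_close_iff_dvd[of x "int (residue n x)" n x "int r" n] residue_approx[OF assms(1), of n] assms(3)
    by simp
  then have "[residue n x = r] (mod CARD('p) ^ n)"
    by (metis cong_iff_dvd_diff cong_int_iff of_nat_power)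
  then show ?thesis using residue_less[OF assms(1)] assms(2) by (metis cong_less_modulus_unique_nat)
qed

lemma padic_close_iff_residue:
  fixes x y :: "'p::prime_type padic"
  assumes "x \<in> Zp" "y \<in> Zp" "j \<le> n"
  shows "padic_abs (x - y) \<le> (1 / real CARD('p)) ^ j \<longleftrightarrow>
    int CARD('p) ^ j dvd int (residue n x) - int (residue n y)"
  using padic_close_iff_dvd[of x "int (residue n x)" n y "int (residue n y)" j]
    residue_approx[OF assms(1)] residue_approx[OF assms(2)] assms(3) by simp

lemma residue_eq_iff:
  fixes x y :: "'p::prime_type padic"
  assumes "x \<in> Zp" "y \<in> Zp"
  shows "residue n x = residue n y \<longleftrightarrow> padic_abs (x - y) \<le> (1 / real CARD('p)) ^ n"
proof
  assume "residue n x = residue n y"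
  then show "padic_abs (x - y) \<le> (1 / real CARD('p)) ^ n"
    by (simp add: padic_close_iff_residue[OF assms order_refl])
next
  assume "padic_abs (x - y) \<le> (1 / real CARD('p)) ^ n"
  then have "padic_abs (x - of_int (int (residue n y))) \<le> (1 / real CARD('p)) ^ n"
    using padic_abs_trans residue_approx[OF assms(2)] by (metis of_int_of_nat_eq)
  then show "residue n x = residue n y"
    using residue_unique[OF assms(1) residue_less[OF assms(2)]] by blast
qed

lemma of_nat_in_Zp [simp]: "of_nat k \<in> (Zp :: 'p::prime_type padic set)"
  by (simp add: Zp_def padic_abs_of_nat_le_1)

lemma residue_of_nat: "residue n (of_nat k :: 'p::prime_type padic) = k mod CARD('p) ^ n"
proof (rule residue_unique)
  show "k mod CARD('p) ^ n < CARD('p) ^ n" using prime_gt_1_CARD[where 'p='p] by simp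
  have "int CARD('p) ^ n dvd int k - int (k mod CARD('p) ^ n)"
    by (metis cong_iff_dvd_diff cong_int_iff cong_mod_right cong_refl of_nat_power)
  then show "padic_abs (of_nat k - of_int (int (k mod CARD('p) ^ n)) :: 'p padic) \<le> (1 / real CARD('p)) ^ n"
    using padic_abs_of_int_le_iff[of "int k - int (k mod CARD('p) ^ n)" n, where 'p='p] by simp
qed simp

section \<open>Digit expansions\<close>

lemma padic_abs_prime_powi:
  "padic_abs (of_nat CARD('p) powi k :: 'p::prime_type padic) = real CARD('p) powi (- k)"
proof (cases "k \<ge> 0")
  case True
  then show ?thesis
    by (simp add: power_int_def padic_abs_prime_power power_one_over inverse_eq_divide)
next
  case False
  then show ?thesis
    by (simp add: power_int_def padic_abs_inverse padic_abs_power padic_abs_prime)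
qed

lemma padic_abs_digit_term:
  assumes "a < CARD('p)"
  shows "padic_abs (of_nat a * of_nat CARD('p) powi k :: 'p::prime_type padic) =
    (if a = 0 then 0 else real CARD('p) powi (- k))"
proof (cases "a = 0")
  case False
  then have "\<not> int CARD('p) dvd int a" using assms by (auto dest: dvd_imp_le)
  from padic_abs_of_int_eq_1[OF this] show ?thesis
    using False by (simp add: padic_abs_mult padic_abs_prime_powi)
qed simp

definition padic_expansion :: "(int \<Rightarrow> nat) \<Rightarrow> 'p::prime_type padic \<Rightarrow> bool" where
  "padic_expansion a x \<longleftrightarrow> (\<forall>k. a k < CARD('p)) \<and>
     ((\<lambda>k. of_nat (a k) * of_nat CARD('p) powi k) has_sum x) UNIV"

lemma padic_expansionD:
  fixes x :: "'p::prime_type padic"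
  assumes "padic_expansion a x" "e > 0"
  obtains F where "finite F" "\<And>F'. finite F' \<Longrightarrow> F \<subseteq> F' \<Longrightarrow>
    padic_abs ((\<Sum>k\<in>F'. of_nat (a k) * of_nat CARD('p) powi k) - x) < e"
proof -
  have "\<exists>F. finite F \<and> (\<forall>F'. finite F' \<and> F \<subseteq> F' \<longrightarrow>
    padic_abs ((\<Sum>k\<in>F'. of_nat (a k) * of_nat CARD('p) powi k) - x) < e)"
    using assms
    by (simp add: padic_expansion_def has_sum_def tendsto_iff eventually_finite_subsets_at_top dist_padic_def)
  then show thesis using that by metis
qed

text \<open>
  Adding the single term at \<open>k\<close> to a large partial sum must keep it close to \<open>x\<close>, so nonzero digits at
  places \<open>k \<le> N\<close> already occur in one finite set.
\<close>

lemma padic_expansion_finite: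
  fixes x :: "'p::prime_type padic"
  assumes "padic_expansion a x"
  shows "finite {k. k \<le> N \<and> a k \<noteq> 0}"
proof -
  let ?t = "\<lambda>k. of_nat (a k) * of_nat CARD('p) powi k :: 'p padic"
  have p1: "real CARD('p) > 1" using prime_gt_1_CARD[where 'p='p] by simp
  have e: "real CARD('p) powi (- N) > 0" using p1 by simp
  obtain F where F: "finite F" "\<And>F'. finite F' \<Longrightarrow> F \<subseteq> F' \<Longrightarrow> padic_abs (sum ?t F' - x) < real CARD('p) powi (- N)"
    by (rule padic_expansionD[OF assms e]) blast
  have "k \<in> F" if "k \<le> N" "a k \<noteq> 0" for k
  proof (rule ccontr)
    assume k: "k \<notin> F"
    have "?t k = (sum ?t (insert k F) - x) - (sum ?t F - x)" using k F(1) by simp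
    also have "padic_abs \<dots> \<le> max (padic_abs (sum ?t (insert k F) - x)) (padic_abs (sum ?t F - x))"
      by (rule padic_abs_diff_le) simp_all
    also have "\<dots> < real CARD('p) powi (- N)"
      using F(2)[of "insert k F"] F(2)[of F] F(1) by (auto simp del: sum.insert)
    finally have "real CARD('p) powi (- k) < real CARD('p) powi (- N)"
      using padic_abs_digit_term[of "a k" k, where 'p='p] assms that by (simp add: padic_expansion_def)
    moreover have "real CARD('p) powi (- N) \<le> real CARD('p) powi (- k)"
      using p1 that by (intro power_int_increasing) auto
    ultimately show False by simp
  qed
  then have "{k. k \<le> N \<and> a k \<noteq> 0} \<subseteq> F" by auto
  then show ?thesis using F(1) finite_subset by blast
qed

text \<open>
  At the first place \<open>m\<close> where two digit sequences differ, the difference of the terms has absolute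
  value exactly \<open>p\<^sup>-\<^sup>m\<close>, and all later terms together are smaller; so the partial sums stay apart.
\<close>

lemma padic_expansion_unique:
  fixes x :: "'p::prime_type padic"
  assumes a: "padic_expansion a x" and b: "padic_expansion b x"
  shows "a = b"
proof (rule ccontr)
  let ?t = "\<lambda>a k. of_nat (a k) * of_nat CARD('p) powi k :: 'p padic"
  have p1: "real CARD('p) > 1" using prime_gt_1_CARD[where 'p='p] by simp
  have lt: "a k < CARD('p)" "b k < CARD('p)" for k using a b by (auto simp: padic_expansion_def)
  assume "a \<noteq> b"
  then obtain k1 where k1: "a k1 \<noteq> b k1" by auto
  define D where "D = {k. k \<le> k1 \<and> a k \<noteq> b k}"
  have "D \<subseteq> {k. k \<le> k1 \<and> a k \<noteq> 0} \<union> {k. k \<le> k1 \<and> b k \<noteq> 0}" by (auto simp: D_def)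
  then have D: "finite D"
    using padic_expansion_finite[OF a] padic_expansion_finite[OF b] finite_subset by blast
  have ne: "D \<noteq> {}" using k1 by (auto simp: D_def)
  define m where "m = Min D"
  have m: "m \<in> D" "\<And>k. k \<in> D \<Longrightarrow> m \<le> k" using Min_in[OF D ne] Min_le[OF D] by (auto simp: m_def)
  have eq: "a k = b k" if "k < m" for k using m(2)[of k] m(1) that by (fastforce simp: D_def)
  have e: "real CARD('p) powi (- m) > 0" using p1 by simp
  obtain F where F: "finite F" "\<And>F'. finite F' \<Longrightarrow> F \<subseteq> F' \<Longrightarrow> padic_abs (sum (?t a) F' - x) < real CARD('p) powi (- m)"
    by (rule padic_expansionD[OF a e]) blast
  obtain G where G: "finite G" "\<And>F'. finite F' \<Longrightarrow> G \<subseteq> F' \<Longrightarrow> padic_abs (sum (?t b) F' - x) < real CARD('p) powi (- m)"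
    by (rule padic_expansionD[OF b e]) blast
  define H where "H = F \<union> G \<union> {m}"
  have H: "finite H" "F \<subseteq> H" "G \<subseteq> H" "m \<in> H" using F(1) G(1) by (auto simp: H_def)
  define d where "d = (\<lambda>k. ?t a k - ?t b k)"
  have "sum d H = (sum (?t a) H - x) - (sum (?t b) H - x)" by (simp add: d_def sum_subtractf)
  also have "padic_abs \<dots> \<le> max (padic_abs (sum (?t a) H - x)) (padic_abs (sum (?t b) H - x))"
    by (rule padic_abs_diff_le) simp_all
  also have "\<dots> < real CARD('p) powi (- m)" using F(2) G(2) H by simp
  finally have small: "padic_abs (sum d H) < real CARD('p) powi (- m)" .
  have split: "sum d H = d m + sum d (H - {m})" by (rule sum.remove[OF H(1,4)])
  have rest: "padic_abs (sum d (H - {m})) \<le> real CARD('p) powi (- m - 1)"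
  proof (rule padic_abs_sum_le)
    fix k assume k: "k \<in> H - {m}"
    show "padic_abs (d k) \<le> real CARD('p) powi (- m - 1)"
    proof (cases "k < m")
      case True
      then show ?thesis using p1 by (simp add: d_def eq)
    next
      case False
      then have "real CARD('p) powi (- k) \<le> real CARD('p) powi (- m - 1)"
        using p1 k by (intro power_int_increasing) auto
      then show ?thesis
        unfolding d_def using p1 lt
        by (intro padic_abs_diff_le) (auto simp: padic_abs_digit_term)
    qed
  qed (use H p1 in auto)
  have lt': "real CARD('p) powi (- m - 1) < real CARD('p) powi (- m)"
    using p1 by (intro power_int_strict_increasing) auto
  have "d m = sum d H - sum d (H - {m})" using split by simp
  also have "padic_abs \<dots> \<le> max (padic_abs (sum d H)) (padic_abs (sum d (H - {m})))"
    by (rule padic_abs_diff_le) simp_all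
  also have "\<dots> < real CARD('p) powi (- m)" using small rest lt' by simp
  finally have "padic_abs (d m) < real CARD('p) powi (- m)" .
  moreover have "padic_abs (d m) = real CARD('p) powi (- m)"
  proof -
    have am: "a m \<noteq> b m" using m(1) by (simp add: D_def)
    have "\<not> int CARD('p) dvd int (a m) - int (b m)"
    proof
      assume "int CARD('p) dvd int (a m) - int (b m)"
      then have "[a m = b m] (mod CARD('p))" by (metis cong_iff_dvd_diff cong_int_iff)
      then show False using lt am by (metis cong_less_modulus_unique_nat)
    qed
    from padic_abs_of_int_eq_1[OF this]
    have "padic_abs (of_nat (a m) - of_nat (b m) :: 'p padic) = 1" by simp
    moreover have "d m = (of_nat (a m) - of_nat (b m)) * of_nat CARD('p) powi m"
      by (simp add: d_def algebra_simps)
    ultimately show ?thesis by (simp add: padic_abs_mult padic_abs_prime_powi)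
  qed
  ultimately show False by simp
qed

lemma residue_mod:
  fixes x :: "'p::prime_type padic"
  assumes "x \<in> Zp" "j \<le> n"
  shows "residue n x mod CARD('p) ^ j = residue j x"
proof -
  have "padic_abs (x - of_nat (residue n x)) \<le> (1 / real CARD('p)) ^ j"
    using residue_approx[OF assms(1), of n] power_decreasing[OF assms(2), of "1 / real CARD('p)"]
    by (rule order_trans) (use prime_gt_1_CARD[where 'p='p] in simp_all)
  then have "residue j x = residue j (of_nat (residue n x) :: 'p padic)"
    by (subst residue_eq_iff[OF assms(1)]) auto
  then show ?thesis by (simp add: residue_of_nat)
qed

text \<open>
  Multiplying by \<open>p\<^sup>K\<close> puts the digits at non-negative places, where the digit at place \<open>i\<close> is the leading
  base-\<open>p\<close> digit of the residue modulo \<open>p\<close> to the power \<open>i + 1\<close>. Here \<open>y\<close> stands for \<open>p\<^sup>K x\<close>.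
\<close>

definition shifted_digit :: "nat \<Rightarrow> 'p::prime_type padic \<Rightarrow> int \<Rightarrow> nat" where
  "shifted_digit K y k =
     (if k < - int K then 0
      else residue (Suc (nat (k + int K))) y div CARD('p) ^ nat (k + int K))"

lemma sum_residue_digits:
  fixes y :: "'p::prime_type padic"
  assumes "y \<in> Zp"
  shows "(\<Sum>i<n. residue (Suc i) y div CARD('p) ^ i * CARD('p) ^ i) = residue n y"
proof (induction n)
  case 0
  show ?case using residue_less[OF assms, of 0] by simp
next
  case (Suc n)
  have "residue (Suc n) y mod CARD('p) ^ n = residue n y" by (rule residue_mod[OF assms]) simp
  with Suc show ?case by (metis add.commute div_mult_mod_eq sum.lessThan_Suc)
qed

lemma shifted_digit_less:
  fixes y :: "'p::prime_type padic"
  assumes "y \<in> Zp"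
  shows "shifted_digit K y k < CARD('p)"
  using residue_less[OF assms, of "Suc (nat (k + int K))"] prime_gt_1_CARD[where 'p='p]
  by (auto simp: shifted_digit_def less_mult_imp_div_less)

text \<open>
  Over an interval of places the terms telescope to a residue. All further terms have small absolute
  value, so by the ultrametric inequality they may be added in any finite amount.
\<close>

lemma padic_expansion_shifted_digit:
  fixes x :: "'p::prime_type padic"
  assumes "of_nat CARD('p) ^ K * x \<in> Zp"
  shows "padic_expansion (shifted_digit K (of_nat CARD('p) ^ K * x)) x"
  unfolding padic_expansion_def
proof
  let ?y = "of_nat CARD('p) ^ K * x"
  let ?a = "shifted_digit K ?y" and ?P = "of_nat CARD('p) :: 'p padic"
  let ?t = "\<lambda>k. of_nat (?a k) * ?P powi k"
  have p1: "real CARD('p) > 1" using prime_gt_1_CARD[where 'p='p] by simp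
  show lt: "\<forall>k. ?a k < CARD('p)" using shifted_digit_less[OF assms] by blast
  show "(?t has_sum x) UNIV"
    unfolding has_sum_def tendsto_iff eventually_finite_subsets_at_top dist_padic_def
  proof (intro allI impI)
    fix e :: real assume e: "e > 0"
    obtain n where n: "(1 / real CARD('p)) ^ n < e * (1 / real CARD('p)) ^ K"
      using real_arch_pow_inv[of "e * (1 / real CARD('p)) ^ K" "1 / real CARD('p)"] e p1 by auto
    have small: "real CARD('p) powi (int K - int n) < e"
      using n p1 by (simp add: power_int_diff power_divide field_simps)
    define F where "F = {- int K..<int n - int K}"
    have Fsum: "padic_abs (sum ?t F - x) \<le> real CARD('p) powi (int K - int n)"
    proof -
      have "sum ?t F = (\<Sum>i<n. ?t (int i - int K))"
        by (rule sum.reindex_bij_witness[of _ "\<lambda>i. int i - int K" "\<lambda>k. nat (k + int K)"])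
          (auto simp: F_def)
      also have "\<dots> = (\<Sum>i<n. of_nat (residue (Suc i) ?y div CARD('p) ^ i * CARD('p) ^ i)) * ?P powi (- int K)"
        by (simp add: sum_distrib_right shifted_digit_def power_int_add mult.assoc flip: power_int_of_nat)
          (simp add: power_int_diff power_int_minus field_simps)
      also have "\<dots> = of_nat (residue n ?y) * ?P powi (- int K)"
        unfolding sum_residue_digits[OF assms, of n, symmetric] by simp
      also have "\<dots> - x = (of_nat (residue n ?y) - ?y) * ?P powi (- int K)"
        by (simp add: power_int_minus field_simps)
      finally have "padic_abs (sum ?t F - x) = padic_abs (?y - of_nat (residue n ?y)) * real CARD('p) powi (int K)"
        by (simp only: padic_abs_mult padic_abs_prime_powi padic_abs_diff_commute[of ?y]) simp
      also have "\<dots> \<le> (1 / real CARD('p)) ^ n * real CARD('p) powi (int K)"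
        by (intro mult_right_mono residue_approx[OF assms]) simp
      also have "\<dots> = real CARD('p) powi (int K - int n)"
        using p1 by (simp add: power_int_diff power_divide)
      finally show ?thesis .
    qed
    have "padic_abs (sum ?t F' - x) < e" if F': "finite F'" "F \<subseteq> F'" for F'
    proof -
      have "sum ?t F' - x = sum ?t (F' - F) + (sum ?t F - x)"
        using sum.subset_diff[OF F'(2,1), of ?t] by simp
      also have "padic_abs \<dots> \<le> real CARD('p) powi (int K - int n)"
      proof (rule padic_abs_add_le[OF padic_abs_sum_le Fsum])
        fix k assume k: "k \<in> F' - F"
        show "padic_abs (?t k) \<le> real CARD('p) powi (int K - int n)"
        proof (cases "k < - int K")
          case True
          then show ?thesis using p1 by (simp add: shifted_digit_def)
        next
          case False
          then have "real CARD('p) powi (- k) \<le> real CARD('p) powi (int K - int n)"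
            using k p1 by (intro power_int_increasing) (auto simp: F_def)
          then show ?thesis using lt p1 by (auto simp: padic_abs_digit_term)
        qed
      qed (use F' p1 in auto)
      finally show ?thesis using small by simp
    qed
    then show "\<exists>F. finite F \<and> F \<subseteq> UNIV \<and> (\<forall>F'. finite F' \<and> F \<subseteq> F' \<and> F' \<subseteq> UNIV \<longrightarrow> padic_abs (sum ?t F' - x) < e)"
      by (intro exI[of _ F]) (auto simp: F_def)
  qed
qed

lemma digit_eq_shifted_digit:
  fixes x :: "'p::prime_type padic"
  assumes "of_nat CARD('p) ^ K * x \<in> Zp"
  shows "digit x = shifted_digit K (of_nat CARD('p) ^ K * x)"
  unfolding digit_def padic_expansion_def[symmetric]
  using padic_expansion_shifted_digit[OF assms] padic_expansion_unique by (intro the_equality) auto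

text \<open>
  This is the form in which the additive character becomes a root of unity.
\<close>

lemma frac_part_eq_residue:
  fixes x :: "'p::prime_type padic"
  assumes "of_nat CARD('p) ^ K * x \<in> Zp"
  shows "frac_part x = real (residue K (of_nat CARD('p) ^ K * x)) / real CARD('p) ^ K"
proof -
  let ?y = "of_nat CARD('p) ^ K * x"
  have p1: "real CARD('p) > 1" using prime_gt_1_CARD[where 'p='p] by simp
  have "frac_part x = (\<Sum>\<^sub>\<infinity>k\<in>{- int K..<0}. real (digit x k) * real CARD('p) powi k)"
    unfolding frac_part_def
    by (rule infsum_cong_neutral) (auto simp: digit_eq_shifted_digit[OF assms] shifted_digit_def)
  also have "\<dots> = (\<Sum>k\<in>{- int K..<0}. real (digit x k) * real CARD('p) powi k)" by simp
  also have "\<dots> = (\<Sum>i<K. real (digit x (int i - int K)) * real CARD('p) powi (int i - int K))"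
    by (rule sum.reindex_bij_witness[of _ "\<lambda>i. int i - int K" "\<lambda>k. nat (k + int K)"]) auto
  also have "\<dots> = (\<Sum>i<K. real (residue (Suc i) ?y div CARD('p) ^ i * CARD('p) ^ i) / real CARD('p) ^ K)"
    using p1 by (intro sum.cong refl)
      (simp add: digit_eq_shifted_digit[OF assms] shifted_digit_def power_int_diff)
  also have "\<dots> = real (\<Sum>i<K. residue (Suc i) ?y div CARD('p) ^ i * CARD('p) ^ i) / real CARD('p) ^ K"
    by (simp add: sum_divide_distrib)
  finally show ?thesis unfolding sum_residue_digits[OF assms] .
qed

lemma Gamma_embed_eq_residue:
  assumes "coset_rep C \<in> Zp"
  shows "Gamma_embed m C = of_nat (residue m (coset_rep C) :: nat)"
proof -
  have 0: "of_nat CARD('a) ^ 0 * coset_rep C \<in> Zp" using assms by simp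
  have "Gamma_embed m C = of_nat (\<Sum>i<m. residue (Suc i) (coset_rep C) div CARD('a) ^ i * CARD('a) ^ i)"
    using digit_eq_shifted_digit[OF 0] by (simp add: Gamma_embed_def shifted_digit_def)
  then show ?thesis by (simp only: sum_residue_digits[OF assms])
qed

section \<open>Cosets and characters\<close>

lemma mem_coset_Zp_iff: "y \<in> x +o Zp \<longleftrightarrow> padic_abs (y - x) \<le> 1" for x :: "'p::prime_type padic"
proof
  assume "padic_abs (y - x) \<le> 1"
  then have "y - x \<in> Zp" "y = x + (y - x)" by (simp_all add: Zp_def)
  then show "y \<in> x +o Zp" unfolding elt_set_plus_def by blast
qed (auto simp: elt_set_plus_def Zp_def)

lemma mem_pZp_iff: "x \<in> pZp m \<longleftrightarrow> padic_abs x \<le> (1 / real CARD('p)) ^ m" for x :: "'p::prime_type padic"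
proof
  assume "x \<in> pZp m"
  then obtain z where z: "x = of_nat CARD('p) ^ m * z" "padic_abs z \<le> 1" by (auto simp: pZp_def Zp_def)
  then show "padic_abs x \<le> (1 / real CARD('p)) ^ m"
    using mult_left_mono[OF z(2), of "(1 / real CARD('p)) ^ m"] by (simp add: padic_abs_mult padic_abs_prime_power)
next
  let ?q = "of_nat CARD('p) ^ m :: 'p padic"
  assume x: "padic_abs x \<le> (1 / real CARD('p)) ^ m"
  have "padic_abs (x / ?q) \<le> 1"
    using x prime_gt_1_CARD[where 'p='p] by (simp add: padic_abs_divide padic_abs_prime_power divide_simps)
  moreover have "x = ?q * (x / ?q)" by simp
  ultimately show "x \<in> pZp m" unfolding pZp_def Zp_def by blast
qed

lemma coset_Zp_eq_iff: "x +o Zp = y +o Zp \<longleftrightarrow> padic_abs (x - y) \<le> 1" for x y :: "'p::prime_type padic"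
proof
  assume "x +o Zp = y +o Zp"
  moreover have "x \<in> x +o Zp" by (simp add: mem_coset_Zp_iff)
  ultimately show "padic_abs (x - y) \<le> 1" by (simp add: mem_coset_Zp_iff)
next
  assume *: "padic_abs (x - y) \<le> 1"
  show "x +o Zp = y +o Zp"
  proof (rule set_eqI)
    show "z \<in> x +o Zp \<longleftrightarrow> z \<in> y +o Zp" for z
      using * padic_abs_diff_commute[of x y] padic_abs_trans[of z x 1 y] padic_abs_trans[of z y 1 x]
      by (auto simp: mem_coset_Zp_iff)
  qed
qed

lemma coset_rep_coset_Zp: "padic_abs (coset_rep (x +o Zp) - x) \<le> 1" for x :: "'p::prime_type padic"
proof -
  have "x \<in> x +o Zp" by (simp add: mem_coset_Zp_iff)
  then have "coset_rep (x +o Zp) \<in> x +o Zp" unfolding coset_rep_def by (rule someI)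
  then show ?thesis by (simp add: mem_coset_Zp_iff)
qed

text \<open>
  The cosets in \<open>\<rat>\<^sub>p/\<int>\<^sub>p\<close> of absolute value at most \<open>p\<^sup>j\<close> are those of the fractions \<open>a / p\<^sup>j\<close> with \<open>0 \<le> a < p\<^sup>j\<close>.
\<close>

definition frac_coset :: "nat \<Rightarrow> nat \<Rightarrow> 'p::prime_type padic set" where
  "frac_coset j a = (of_nat a / of_nat CARD('p) ^ j) +o Zp"

definition cosets_upto :: "nat \<Rightarrow> 'p::prime_type padic set set" where
  "cosets_upto j = frac_coset j ` {..<CARD('p) ^ j}"

lemma inj_on_frac_coset: "inj_on (frac_coset j :: nat \<Rightarrow> 'p::prime_type padic set) {..<CARD('p) ^ j}"
proof (rule inj_onI)
  fix a c assume ac: "a \<in> {..<CARD('p) ^ j}" "c \<in> {..<CARD('p) ^ j}"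
    and eq: "(frac_coset j a :: 'p padic set) = frac_coset j c"
  let ?q = "of_nat CARD('p) ^ j :: 'p padic"
  have "padic_abs (of_nat a / ?q - of_nat c / ?q) \<le> 1" using eq by (simp add: frac_coset_def coset_Zp_eq_iff)
  also have "of_nat a / ?q - of_nat c / ?q = of_int (int a - int c) / ?q" by (simp add: diff_divide_distrib)
  finally have "padic_abs (of_int (int a - int c) :: 'p padic) \<le> (1 / real CARD('p)) ^ j"
    using prime_gt_1_CARD[where 'p='p] by (simp add: padic_abs_divide padic_abs_prime_power divide_simps)
  then have "[a = c] (mod CARD('p) ^ j)"
    unfolding padic_abs_of_int_le_iff by (metis cong_iff_dvd_diff cong_int_iff of_nat_power)
  then show "a = c" using ac by (auto intro: cong_less_modulus_unique_nat)
qed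

lemma finite_cosets_upto [simp]: "finite (cosets_upto j)"
  by (simp add: cosets_upto_def)

lemma frac_coset_Suc: "frac_coset (Suc j) (CARD('p) * a) = (frac_coset j a :: 'p::prime_type padic set)"
  by (simp add: frac_coset_def field_simps)

lemma cosets_upto_eq_Suc:
  "(cosets_upto j :: 'p::prime_type padic set set) = frac_coset (Suc j) ` {a. a < CARD('p) ^ Suc j \<and> CARD('p) dvd a}"
proof -
  have "{a. a < CARD('p) ^ Suc j \<and> CARD('p) dvd a} = (\<lambda>a. CARD('p) * a) ` {..<CARD('p) ^ j}"
    by (auto simp: dvd_def)
  then show ?thesis by (simp only: cosets_upto_def image_image frac_coset_Suc)
qed

lemma cosets_upto_Suc_diff:
  "(cosets_upto (Suc j) :: 'p::prime_type padic set set) - cosets_upto j =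
    frac_coset (Suc j) ` {a. a < CARD('p) ^ Suc j \<and> \<not> CARD('p) dvd a}"
proof -
  have "(cosets_upto (Suc j) :: 'p padic set set) - cosets_upto j =
      frac_coset (Suc j) ` ({..<CARD('p) ^ Suc j} - {a. a < CARD('p) ^ Suc j \<and> CARD('p) dvd a})"
    unfolding cosets_upto_eq_Suc[of j] cosets_upto_def[of "Suc j"]
    by (rule inj_on_image_set_diff[symmetric, OF inj_on_frac_coset]) auto
  also have "{..<CARD('p) ^ Suc j} - {a. a < CARD('p) ^ Suc j \<and> CARD('p) dvd a} =
      {a. a < CARD('p) ^ Suc j \<and> \<not> CARD('p) dvd a}" by auto
  finally show ?thesis .
qed

lemma cosets_upto_mono: "j \<le> k \<Longrightarrow> cosets_upto j \<subseteq> (cosets_upto k :: 'p::prime_type padic set set)"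
proof (induction k rule: dec_induct)
  case (step k)
  moreover have "(cosets_upto k :: 'p padic set set) \<subseteq> cosets_upto (Suc k)"
    unfolding cosets_upto_eq_Suc[of k] by (auto simp: cosets_upto_def)
  ultimately show ?case by blast
qed simp

lemma cosets_upto_subset: "cosets_upto j \<subseteq> QpZp"
  by (auto simp: cosets_upto_def QpZp_def frac_coset_def)

lemma cosets_upto_0: "cosets_upto 0 = {Zp :: 'p::prime_type padic set}"
proof -
  have "frac_coset 0 0 = (Zp :: 'p padic set)" by (simp add: frac_coset_def)
  then show ?thesis by (simp add: cosets_upto_def lessThan_Suc)
qed

lemma padic_scale_Zp:
  fixes y :: "'p::prime_type padic"
  obtains K where "of_nat CARD('p) ^ K * y \<in> Zp"
proof -
  have p1: "real CARD('p) > 1" using prime_gt_1_CARD[where 'p='p] by simp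
  then obtain K where "padic_abs y < real CARD('p) ^ K" using real_arch_pow by blast
  then have "padic_abs (of_nat CARD('p) ^ K * y) \<le> 1"
    using p1 by (simp add: padic_abs_mult padic_abs_prime_power power_one_over divide_simps)
  then show thesis using that by (simp add: Zp_def)
qed

lemma QpZp_eq_UN: "(QpZp :: 'p::prime_type padic set set) = (\<Union>j. cosets_upto j)"
proof (intro set_eqI iffI)
  fix C :: "'p padic set" assume "C \<in> QpZp"
  then obtain y where y: "C = y +o Zp" by (auto simp: QpZp_def)
  obtain K where K: "of_nat CARD('p) ^ K * y \<in> Zp" by (rule padic_scale_Zp)
  let ?q = "of_nat CARD('p) ^ K :: 'p padic"
  define a where "a = residue K (?q * y)"
  have "?q * y - of_nat a = ?q * (y - of_nat a / ?q)" by (simp add: field_simps)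
  then have "padic_abs (?q * (y - of_nat a / ?q)) \<le> (1 / real CARD('p)) ^ K"
    using residue_approx[OF K, of K] by (simp add: a_def)
  then have "padic_abs (y - of_nat a / ?q) \<le> 1"
    using prime_gt_1_CARD[where 'p='p] unfolding padic_abs_mult padic_abs_prime_power by (simp add: divide_simps power_one_over)
  then have "C = frac_coset K a" by (simp add: y frac_coset_def coset_Zp_eq_iff)
  moreover have "a < CARD('p) ^ K" unfolding a_def by (rule residue_less[OF K])
  ultimately show "C \<in> (\<Union>j. cosets_upto j)" by (auto simp: cosets_upto_def)
next
  fix C :: "'p padic set" assume "C \<in> (\<Union>j. cosets_upto j)"
  then show "C \<in> QpZp" using cosets_upto_subset by blast
qed

text \<open>
  Since \<open>|a / p\<^bsup>j+1\<^esup>| = p\<^bsup>j+1\<^esup> > 1\<close>, adding an element of \<open>\<int>\<^sub>p\<close> to it does not change the absolute value, so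
  that the choice of the representative is immaterial.
\<close>

lemma coset_abs_frac_coset:
  assumes "\<not> CARD('p) dvd a"
  shows "coset_abs Zp (frac_coset (Suc j) a :: 'p::prime_type padic set) = real CARD('p) ^ Suc j"
    and "(frac_coset (Suc j) a :: 'p padic set) \<noteq> Zp"
proof -
  let ?y = "of_nat a / of_nat CARD('p) ^ Suc j :: 'p padic"
  have p1: "real CARD('p) > 1" using prime_gt_1_CARD[where 'p='p] by simp
  have "\<not> int CARD('p) dvd int a" using assms by auto
  from padic_abs_of_int_eq_1[OF this] have y: "padic_abs ?y = real CARD('p) ^ Suc j"
    by (simp only: padic_abs_divide padic_abs_prime_power of_int_of_nat_eq) (simp add: power_one_over)
  have gt: "real CARD('p) ^ Suc j > 1" using p1 by (intro one_less_power) auto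
  have "padic_abs (?y - 0) > 1" using y gt by simp
  then have "?y +o Zp \<noteq> 0 +o Zp" unfolding coset_Zp_eq_iff by simp
  then show ne: "(frac_coset (Suc j) a :: 'p padic set) \<noteq> Zp" by (simp add: frac_coset_def)
  let ?r = "coset_rep (?y +o Zp)"
  have r: "padic_abs (?r - ?y) \<le> 1" by (rule coset_rep_coset_Zp)
  have "padic_abs ?r \<le> real CARD('p) ^ Suc j"
    using padic_abs_ultrametric[of "?r - ?y" ?y] r y gt by simp
  moreover have "real CARD('p) ^ Suc j \<le> padic_abs ?r"
    using padic_abs_ultrametric[of "?y - ?r" ?r] r y gt padic_abs_diff_commute[of ?r ?y] by simp
  ultimately show "coset_abs Zp (frac_coset (Suc j) a :: 'p padic set) = real CARD('p) ^ Suc j"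
    using ne by (simp add: coset_abs_def frac_coset_def)
qed

text \<open>
  Modulo \<open>p\<^sup>j\<close>, the number \<open>p\<^sup>j x y\<close> with \<open>y\<close> in the coset of \<open>a / p\<^sup>j\<close> is \<open>a\<close> times the residue of \<open>x\<close>, and the
  character only sees this residue.
\<close>

lemma add_char_frac_coset:
  fixes x :: "'p::prime_type padic"
  assumes x: "x \<in> Zp"
  shows "add_char (x * coset_rep (frac_coset j a)) = cis (2 * pi * real (residue j x) / real CARD('p) ^ j) ^ a"
proof -
  let ?q = "of_nat CARD('p) ^ j :: 'p padic"
  let ?y = "of_nat a / ?q" and ?p = "real CARD('p) ^ j"
  let ?r = "coset_rep (frac_coset j a :: 'p padic set)"
  have p0: "?p > 0" using prime_gt_1_CARD[where 'p='p] by simp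
  have x1: "padic_abs x \<le> 1" using x by (simp add: Zp_def)
  have "padic_abs (x * (?r - ?y)) \<le> 1 * 1"
    unfolding padic_abs_mult
    by (intro mult_mono x1) (use coset_rep_coset_Zp[of ?y] in \<open>auto simp: frac_coset_def padic_abs_nonneg\<close>)
  from mult_left_mono[OF this, of "(1 / real CARD('p)) ^ j"]
  have "padic_abs (?q * (x * (?r - ?y))) \<le> (1 / real CARD('p)) ^ j"
    unfolding padic_abs_mult[of ?q] padic_abs_prime_power by simp
  also have "?q * (x * (?r - ?y)) = ?q * (x * ?r) - of_nat a * x" by (simp add: field_simps)
  finally have close1: "padic_abs (?q * (x * ?r) - of_nat a * x) \<le> (1 / real CARD('p)) ^ j" .
  have "padic_abs (of_nat a * (x - of_nat (residue j x))) \<le> 1 * (1 / real CARD('p)) ^ j"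
    unfolding padic_abs_mult by (intro mult_mono padic_abs_of_nat_le_1 residue_approx x) (auto simp: padic_abs_nonneg)
  then have "padic_abs (of_nat a * x - of_nat (a * residue j x)) \<le> (1 / real CARD('p)) ^ j"
    by (simp add: algebra_simps)
  from padic_abs_trans[OF close1 this]
  have close: "padic_abs (?q * (x * ?r) - of_nat (a * residue j x)) \<le> (1 / real CARD('p)) ^ j" .
  have "padic_abs (?q * (x * ?r)) \<le> 1"
  proof -
    have "padic_abs (?q * (x * ?r) - of_nat (a * residue j x)) \<le> 1"
      using close by (rule order_trans) (use prime_gt_1_CARD[where 'p='p] in \<open>auto intro: power_le_one\<close>)
    from padic_abs_add_le[OF this padic_abs_of_nat_le_1[of "a * residue j x"]] show ?thesis by simp
  qed
  then have Z: "?q * (x * ?r) \<in> Zp" by (simp add: Zp_def)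
  have "residue j (?q * (x * ?r)) = (a * residue j x) mod CARD('p) ^ j"
    using close by (simp add: residue_eq_iff[OF Z of_nat_in_Zp, symmetric] residue_of_nat del: of_nat_mult)
  then have "frac_part (x * ?r) = real ((a * residue j x) mod CARD('p) ^ j) / ?p"
    by (simp add: frac_part_eq_residue[OF Z])
  also have "\<dots> = real (a * residue j x) / ?p - real ((a * residue j x) div CARD('p) ^ j)"
  proof -
    have "real (a * residue j x) =
        real ((a * residue j x) div CARD('p) ^ j) * ?p + real ((a * residue j x) mod CARD('p) ^ j)"
      by (metis of_nat_add of_nat_mult of_nat_power div_mult_mod_eq)
    then show ?thesis using p0 by (simp only: add_divide_distrib) simp
  qed
  finally have fp: "frac_part (x * ?r) = real (a * residue j x) / ?p - real ((a * residue j x) div CARD('p) ^ j)" .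
  have "add_char (x * ?r) = cis (2 * pi * frac_part (x * ?r))"
    by (simp add: add_char_def cis_conv_exp mult_ac)
  also have "2 * pi * frac_part (x * ?r) =
      real a * (2 * pi * real (residue j x) / ?p) - 2 * pi * real ((a * residue j x) div CARD('p) ^ j)"
    unfolding fp by (simp add: algebra_simps)
  also have "cis \<dots> = cis (real a * (2 * pi * real (residue j x) / ?p))"
    by (simp add: cis_divide[symmetric] cis_multiple_2pi)
  finally show ?thesis by (simp only: Complex.DeMoivre)
qed

text \<open>
  The density with respect to Haar measure of the uniform law on \<open>p\<^sup>j\<int>\<^sub>p\<close>.
\<close>

definition ball_kernel :: "nat \<Rightarrow> 'p::prime_type padic \<Rightarrow> real" where
  "ball_kernel j x = (if padic_abs x \<le> (1 / real CARD('p)) ^ j then real CARD('p) ^ j else 0)"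

text \<open>
  By \<open>add_char_frac_coset\<close> the sum runs over the powers of a \<open>p\<^sup>j\<close>-th root of unity, which is \<open>1\<close> exactly
  when \<open>p\<^sup>j\<close> divides \<open>x\<close>; otherwise the geometric sum vanishes.
\<close>

lemma sum_add_char_cosets_upto:
  fixes x :: "'p::prime_type padic"
  assumes x: "x \<in> Zp"
  shows "(\<Sum>C\<in>cosets_upto j. add_char (x * coset_rep C)) = of_real (ball_kernel j x)"
proof -
  let ?N = "CARD('p) ^ j"
  define z where "z = cis (2 * pi * real (residue j x) / real CARD('p) ^ j)"
  have N0: "?N > 0" using prime_gt_1_CARD[where 'p='p] by simp
  have "(\<Sum>C\<in>cosets_upto j. add_char (x * coset_rep C)) = (\<Sum>a<?N. z ^ a)"
    unfolding cosets_upto_def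
    by (simp add: sum.reindex[OF inj_on_frac_coset] add_char_frac_coset[OF x] z_def)
  also have "\<dots> = of_real (ball_kernel j x)"
  proof (cases "residue j x = 0")
    case True
    then have "padic_abs x \<le> (1 / real CARD('p)) ^ j" using residue_approx[OF x, of j] by simp
    then show ?thesis by (simp add: z_def True ball_kernel_def)
  next
    case False
    have zN: "z ^ ?N = 1"
    proof -
      have "real ?N * (2 * pi * real (residue j x) / real CARD('p) ^ j) = 2 * pi * real (residue j x)"
        using N0 by simp
      then have "z ^ ?N = cis (2 * pi * real (residue j x))" unfolding z_def Complex.DeMoivre by (rule arg_cong)
      then show ?thesis by (simp only: cis_multiple_2pi Ints_of_nat)
    qed
    have "z \<noteq> 1"
    proof
      assume "z = 1"
      then obtain k :: int where "2 * pi * real (residue j x) / real CARD('p) ^ j = 2 * pi * of_int k"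
        unfolding z_def cis_conv_exp exp_eq_1 by auto
      then have "real (residue j x) = of_int k * real CARD('p) ^ j" using N0 by (simp add: field_simps)
      then have "real_of_int (int (residue j x)) = real_of_int (k * int ?N)" by simp
      then have "int (residue j x) = k * int ?N" by (simp only: of_int_eq_iff)
      then have "int ?N dvd int (residue j x)" by simp
      then have "?N dvd residue j x" by (simp only: of_nat_dvd_iff)
      then show False using residue_less[OF x, of j] False by (auto dest: dvd_imp_le)
    qed
    moreover have "\<not> padic_abs x \<le> (1 / real CARD('p)) ^ j"
      using False residue_eq_iff[OF x of_nat_in_Zp[of 0], of j] residue_of_nat[of j 0, where 'p='p] by simp
    ultimately show ?thesis using zN by (simp add: sum_gp_strict ball_kernel_def)
  qed
  finally show ?thesis .
qed

section \<open>The transition density as a radial series\<close>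

text \<open>
  The symbol \<open>\<phi>\<close> at the cosets of absolute value \<open>p\<^sup>j\<close>.
\<close>

definition radial_phi :: "nat \<Rightarrow> real \<Rightarrow> real \<Rightarrow> real \<Rightarrow> nat \<Rightarrow> real" where
  "radial_phi p b D t j =
     (if j = 0 then 1 else exp (- D * ((real p ^ j) powr b - inverse (bm_beta p b)) * t))"

definition shell_kernel :: "nat \<Rightarrow> 'p::prime_type padic \<Rightarrow> real" where
  "shell_kernel j x = ball_kernel j x - (if j = 0 then 0 else ball_kernel (j - 1) x)"

lemma bm_phi_0: "bm_phi b D t (Zp :: 'p::prime_type padic set) = radial_phi CARD('p) b D t 0"
  by (simp add: bm_phi_def radial_phi_def)

lemma bm_phi_Suc:
  assumes "C \<in> cosets_upto (Suc j) - (cosets_upto j :: 'p::prime_type padic set set)"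
  shows "bm_phi b D t C = radial_phi CARD('p) b D t (Suc j)"
  using assms unfolding cosets_upto_Suc_diff
  by (auto simp: bm_phi_def radial_phi_def coset_abs_frac_coset)

text \<open>
  The symbol is constant on each shell of cosets, so a sum over cosets is a sum over shells.
\<close>

lemma sum_cosets_upto:
  fixes g :: "'p::prime_type padic set \<Rightarrow> 'a::real_normed_field"
  assumes "\<And>j. (\<Sum>C\<in>cosets_upto j. g C) = G j"
  shows "(\<Sum>C\<in>cosets_upto J. g C * of_real (bm_phi b D t C)) =
    (\<Sum>j\<le>J. of_real (radial_phi CARD('p) b D t j) * (G j - (if j = 0 then 0 else G (j - 1))))"
proof (induction J)
  case 0
  show ?case using assms[of 0] by (simp add: cosets_upto_0 bm_phi_0)
next
  case (Suc J)
  let ?D = "cosets_upto (Suc J) - cosets_upto J :: 'p padic set set"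
  have sub: "cosets_upto J \<subseteq> (cosets_upto (Suc J) :: 'p padic set set)" by (rule cosets_upto_mono) simp
  have D: "(\<Sum>C\<in>?D. g C) = G (Suc J) - G J"
    using sum_diff[OF finite_cosets_upto sub, of g] by (simp add: assms)
  have "(\<Sum>C\<in>cosets_upto (Suc J). g C * of_real (bm_phi b D t C)) =
      (\<Sum>C\<in>?D. g C * of_real (bm_phi b D t C)) + (\<Sum>C\<in>cosets_upto J. g C * of_real (bm_phi b D t C))"
    by (rule sum.subset_diff[OF sub finite_cosets_upto])
  also have "(\<Sum>C\<in>?D. g C * of_real (bm_phi b D t C)) = (\<Sum>C\<in>?D. g C * of_real (radial_phi CARD('p) b D t (Suc J)))"
    by (intro sum.cong refl) (simp only: bm_phi_Suc)
  also have "\<dots> = of_real (radial_phi CARD('p) b D t (Suc J)) * (G (Suc J) - G J)"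
    by (simp add: D mult.commute flip: sum_distrib_right)
  finally show ?case by (simp add: Suc)
qed

lemma card_cosets_upto: "card (cosets_upto j :: 'p::prime_type padic set set) = CARD('p) ^ j"
  by (simp add: cosets_upto_def card_image[OF inj_on_frac_coset])

lemma radial_phi_nonneg: "radial_phi p b D t j \<ge> 0"
  by (simp add: radial_phi_def)

lemma exp_minus_le:
  fixes y :: real
  assumes y: "y > 0"
  shows "exp (- y) \<le> fact k / y ^ k"
proof -
  have "(\<Sum>i\<in>{k}. y ^ i /\<^sub>R fact i) \<le> (\<Sum>i. y ^ i /\<^sub>R fact i)"
    using y summable_exp_generic[of y] by (intro sum_le_suminf) auto
  then have "y ^ k / fact k \<le> exp y" by (simp add: exp_def divide_inverse mult.commute)
  from le_imp_inverse_le[OF this] show ?thesis using y by (simp add: exp_minus)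
qed

text \<open>
  The symbol decays like \<open>exp (- c p\<^bsup>jb\<^esup>)\<close>, while there are fewer than \<open>p\<^sup>j\<close> cosets of absolute value \<open>p\<^sup>j\<close>. The
  estimate \<open>exp (- y) \<le> k! / y\<^sup>k\<close> with \<open>b k \<ge> 2\<close> leaves a geometric series.
\<close>

lemma summable_radial_phi:
  assumes p: "p > 1" and b: "b > 0" and D: "D > 0" and t: "t > 0"
  shows "summable (\<lambda>j. radial_phi p b D t j * real p ^ j)"
proof -
  \<comment> \<open>The exponent with \<open>b k \<ge> 2\<close>.\<close>
  define k where "k = nat \<lceil>2 / b\<rceil>"
  have "2 / b \<le> real k" unfolding k_def by linarith
  then have k: "b * real k \<ge> 2" using b by (simp add: field_simps)
  define c where "c = D * t"
  have c: "c > 0" using D t by (simp add: c_def)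
  define A where "A = exp (D * inverse (bm_beta p b) * t) * fact k / c ^ k"
  have A: "A \<ge> 0" using c by (simp add: A_def)
  have bound: "radial_phi p b D t (Suc j) * real p ^ Suc j \<le> A * (1 / real p) ^ Suc j" for j
  proof -
    let ?x = "real p ^ Suc j" and ?y = "c * (real p ^ Suc j) powr b"
    have x1: "?x \<ge> 1" using p by (intro one_le_power) auto
    have y0: "?y > 0" using c p by simp
    have "exp (- ?y) \<le> fact k / ?y ^ k" by (rule exp_minus_le[OF y0])
    also have "?y ^ k = c ^ k * ?x powr (b * real k)"
    proof -
      have "(?x powr b) ^ k = ?x powr (b * real k)"
        using x1 p by (subst powr_realpow[symmetric]) (auto simp: powr_powr)
      then show ?thesis by (simp only: power_mult_distrib)
    qed
    also have "fact k / \<dots> \<le> fact k / (c ^ k * ?x ^ 2)"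
    proof -
      have "?x powr 2 \<le> ?x powr (b * real k)" using x1 k by (intro powr_mono) auto
      then have "?x ^ 2 \<le> ?x powr (b * real k)" using x1 by simp
      then show ?thesis using c x1 p by (intro divide_left_mono mult_left_mono mult_pos_pos) auto
    qed
    finally have e: "exp (- ?y) \<le> fact k / (c ^ k * ?x ^ 2)" .
    have "radial_phi p b D t (Suc j) = exp (D * inverse (bm_beta p b) * t) * exp (- ?y)"
      by (simp add: radial_phi_def c_def exp_add[symmetric] algebra_simps)
    also have "\<dots> \<le> exp (D * inverse (bm_beta p b) * t) * (fact k / (c ^ k * ?x ^ 2))"
      by (intro mult_left_mono e) simp
    also have "\<dots> = A / ?x ^ 2" by (simp add: A_def field_simps)
    finally have "radial_phi p b D t (Suc j) * ?x \<le> A / ?x ^ 2 * ?x"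
      using x1 by (intro mult_right_mono) auto
    also have "\<dots> = A * (1 / real p) ^ Suc j"
      using p by (simp add: power2_eq_square power_one_over field_simps)
    finally show ?thesis .
  qed
  have "summable (\<lambda>j. A * (1 / real p) ^ Suc j)"
    using p by (intro summable_mult summable_ignore_initial_segment[where k = 1, simplified] summable_geometric) auto
  then have "summable (\<lambda>j. radial_phi p b D t (Suc j) * real p ^ Suc j)"
    by (rule summable_comparison_test_ev[rotated])
      (use bound in \<open>auto simp: radial_phi_nonneg abs_mult intro!: always_eventually\<close>)
  then show ?thesis by (subst (asm) summable_Suc_iff)
qed

definition density_bound :: "nat \<Rightarrow> real \<Rightarrow> real \<Rightarrow> real \<Rightarrow> real" where
  "density_bound p b D t = (\<Sum>j. radial_phi p b D t j * real p ^ j)"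

definition density_partial :: "real \<Rightarrow> real \<Rightarrow> real \<Rightarrow> nat \<Rightarrow> 'p::prime_type padic \<Rightarrow> real" where
  "density_partial b D t J x = (\<Sum>j\<le>J. radial_phi CARD('p) b D t j * shell_kernel j x)"

lemma density_partial_bound:
  assumes "b > 0" "D > 0" "t > 0"
  shows "\<bar>density_partial b D t J (x :: 'p::prime_type padic)\<bar> \<le> density_bound CARD('p) b D t"
proof -
  have p1: "CARD('p) > 1" by (rule prime_gt_1_CARD)
  have shell: "\<bar>shell_kernel j x\<bar> \<le> real CARD('p) ^ j" for j
  proof (cases j)
    case (Suc i)
    have "0 \<le> ball_kernel i x" "ball_kernel i x \<le> real CARD('p) ^ Suc i"
      "0 \<le> ball_kernel (Suc i) x" "ball_kernel (Suc i) x \<le> real CARD('p) ^ Suc i"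
      using p1 by (auto simp: ball_kernel_def)
    then show ?thesis by (simp add: shell_kernel_def Suc)
  qed (simp add: shell_kernel_def ball_kernel_def)
  have "\<bar>density_partial b D t J x\<bar> \<le> (\<Sum>j\<le>J. radial_phi CARD('p) b D t j * \<bar>shell_kernel j x\<bar>)"
    unfolding density_partial_def
    by (rule order_trans[OF sum_abs]) (simp add: abs_mult radial_phi_nonneg)
  also have "\<dots> \<le> (\<Sum>j\<le>J. radial_phi CARD('p) b D t j * real CARD('p) ^ j)"
    by (intro sum_mono mult_left_mono shell radial_phi_nonneg)
  also have "\<dots> \<le> density_bound CARD('p) b D t"
    unfolding density_bound_def
    by (rule sum_le_suminf[OF summable_radial_phi[OF p1 assms]]) (auto simp: radial_phi_nonneg)
  finally show ?thesis .
qed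

lemma norm_add_char [simp]: "norm (add_char x) = 1"
  unfolding add_char_def by (simp add: norm_exp_eq_Re)

lemma finite_subset_QpZp:
  fixes F :: "'p::prime_type padic set set"
  assumes "finite F" "F \<subseteq> QpZp"
  shows "\<exists>J. F \<subseteq> cosets_upto J"
proof -
  have "\<forall>C\<in>F. \<exists>j. C \<in> cosets_upto j" using assms(2) by (auto simp: QpZp_eq_UN)
  then obtain j where j: "\<And>C. C \<in> F \<Longrightarrow> C \<in> cosets_upto (j C)" by metis
  have "C \<in> cosets_upto (Max (insert 0 (j ` F)))" if "C \<in> F" for C
    using j[OF that] cosets_upto_mono[of "j C" "Max (insert 0 (j ` F))"] assms(1) that by auto
  then show ?thesis by blast
qed

text \<open>
  The sum over all cosets converges absolutely, hence along the exhausting sequence of the sets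
  of cosets of absolute value at most \<open>p\<^sup>J\<close>, where the characters have been summed in closed form.
\<close>

lemma density_partial_tendsto:
  fixes x :: "'p::prime_type padic"
  assumes pos: "b > 0" "D > 0" "t > 0" and x: "x \<in> Zp"
  shows "(\<lambda>J. complex_of_real (density_partial b D t J x)) \<longlonglongrightarrow> bm_density b D t x"
proof -
  let ?g = "\<lambda>C. add_char (x * coset_rep C) * complex_of_real (bm_phi b D t C)"
  have p1: "CARD('p) > 1" by (rule prime_gt_1_CARD)
  have phi0: "bm_phi b D t C \<ge> 0" for C :: "'p padic set" by (simp add: bm_phi_def)
  have "(\<lambda>C. norm (?g C)) summable_on QpZp"
  proof (rule nonneg_bdd_above_summable_on)
    show "bdd_above (sum (\<lambda>C. norm (?g C)) ` {F. F \<subseteq> QpZp \<and> finite F})"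
    proof (rule bdd_aboveI2)
      fix F :: "'p padic set set" assume "F \<in> {F. F \<subseteq> QpZp \<and> finite F}"
      then obtain J where J: "F \<subseteq> cosets_upto J" using finite_subset_QpZp by blast
      have "(\<Sum>C\<in>F. norm (?g C)) \<le> (\<Sum>C\<in>(cosets_upto J :: 'p padic set set). 1 * of_real (bm_phi b D t C))"
      proof -
        have "(\<Sum>C\<in>F. norm (?g C)) = (\<Sum>C\<in>F. bm_phi b D t C)" by (simp add: norm_mult phi0)
        also have "\<dots> \<le> (\<Sum>C\<in>(cosets_upto J :: 'p padic set set). bm_phi b D t C)"
          by (rule sum_mono2[OF finite_cosets_upto J]) (rule phi0)
        finally show ?thesis by simp
      qed
      also have "\<dots> = (\<Sum>j\<le>J. of_real (radial_phi CARD('p) b D t j) *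
          (real CARD('p) ^ j - (if j = 0 then 0 else real CARD('p) ^ (j - 1))))"
        by (rule sum_cosets_upto) (simp add: card_cosets_upto)
      also have "\<dots> \<le> (\<Sum>j\<le>J. radial_phi CARD('p) b D t j * real CARD('p) ^ j)"
        by (intro sum_mono) (auto intro!: mult_left_mono simp: radial_phi_nonneg)
      also have "\<dots> \<le> density_bound CARD('p) b D t"
        unfolding density_bound_def
        by (rule sum_le_suminf[OF summable_radial_phi[OF p1 pos]]) (auto simp: radial_phi_nonneg)
      finally show "(\<Sum>C\<in>F. norm (?g C)) \<le> density_bound CARD('p) b D t" .
    qed
  qed simp
  then have "(?g has_sum bm_density b D t x) QpZp"
    unfolding bm_density_def by (rule has_sum_infsum[OF abs_summable_summable])
  then have "(sum ?g \<longlongrightarrow> bm_density b D t x) (finite_subsets_at_top QpZp)" by (simp add: has_sum_def)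
  moreover have "filterlim cosets_upto (finite_subsets_at_top (QpZp :: 'p padic set set)) sequentially"
    unfolding filterlim_finite_subsets_at_top eventually_sequentially
  proof (intro allI impI)
    fix F :: "'p padic set set" assume "finite F \<and> F \<subseteq> QpZp"
    then obtain J where J: "F \<subseteq> cosets_upto J" using finite_subset_QpZp by blast
    show "\<exists>N. \<forall>n\<ge>N. finite (cosets_upto n :: 'p padic set set) \<and> F \<subseteq> cosets_upto n \<and>
        (cosets_upto n :: 'p padic set set) \<subseteq> QpZp"
      using J cosets_upto_mono[of J] cosets_upto_subset finite_cosets_upto
      by (intro exI[of _ J] allI impI conjI) (simp, blast, blast)
  qed
  ultimately have "(\<lambda>J. sum ?g (cosets_upto J)) \<longlonglongrightarrow> bm_density b D t x" by (rule filterlim_compose)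
  moreover have "sum ?g (cosets_upto J) = complex_of_real (density_partial b D t J x)" for J
    by (subst sum_cosets_upto[OF sum_add_char_cosets_upto[OF x]])
      (auto simp: density_partial_def shell_kernel_def intro!: sum.cong)
  ultimately show ?thesis by simp
qed

section \<open>Haar measure and the transition probabilities of the limit\<close>

definition res_ball :: "nat \<Rightarrow> nat \<Rightarrow> 'p::prime_type padic set" where
  "res_ball n r = {x \<in> Zp. residue n x = r}"

lemma res_ball_eq_cball:
  "r < CARD('p) ^ n \<Longrightarrow> res_ball n r = Zp \<inter> cball (of_nat r :: 'p::prime_type padic) ((1 / real CARD('p)) ^ n)"
proof (intro set_eqI)
  fix x :: "'p padic" assume "r < CARD('p) ^ n"
  then show "x \<in> res_ball n r \<longleftrightarrow> x \<in> Zp \<inter> cball (of_nat r) ((1 / real CARD('p)) ^ n)"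
    using residue_eq_iff[of x "of_nat r" n] residue_of_nat[of n r, where 'p='p]
    by (auto simp: res_ball_def dist_padic_def padic_abs_diff_commute)
qed

lemma res_ball_empty: "r \<ge> CARD('p) ^ n \<Longrightarrow> res_ball n r = ({} :: 'p::prime_type padic set)"
  unfolding res_ball_def using residue_less by (metis (mono_tags, lifting) Collect_empty_eq linorder_not_le)

lemma space_Zp_borel [simp]: "space Zp_borel = Zp"
  by (simp add: Zp_borel_def space_restrict_space)

lemma res_ball_sets [measurable]: "res_ball n r \<in> sets (Zp_borel :: 'p::prime_type padic measure)"
proof (cases "r < CARD('p) ^ n")
  case True
  have "cball (of_nat r :: 'p padic) ((1 / real CARD('p)) ^ n) \<in> sets borel" by (intro borel_closed closed_cball)
  then show ?thesis unfolding res_ball_eq_cball[OF True] Zp_borel_def sets_restrict_space by blast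
qed (simp add: res_ball_empty)

lemma Zp_add: "x \<in> Zp \<Longrightarrow> y \<in> Zp \<Longrightarrow> x + y \<in> (Zp :: 'p::prime_type padic set)"
  by (auto simp: Zp_def intro: padic_abs_add_le)

lemma Zp_diff: "x \<in> Zp \<Longrightarrow> y \<in> Zp \<Longrightarrow> x - y \<in> (Zp :: 'p::prime_type padic set)"
  by (auto simp: Zp_def intro: padic_abs_diff_le)

lemma Zp_translate_measurable:
  assumes "a \<in> Zp"
  shows "(\<lambda>x. a + x) \<in> Zp_borel \<rightarrow>\<^sub>M (Zp_borel :: 'p::prime_type padic measure)"
  unfolding Zp_borel_def
proof (rule measurable_restrict_space3)
  have "continuous_on UNIV (\<lambda>x. a + x)"
    unfolding continuous_on_iff by (auto simp: dist_padic_def)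
  then show "(\<lambda>x. a + x) \<in> borel_measurable borel" by (rule borel_measurable_continuous_onI)
qed (use assms in \<open>auto intro: Zp_add\<close>)

locale haar_Zp =
  fixes \<mu> :: "'p::prime_type padic measure"
  assumes haar: "Haar_Zp \<mu>"
begin

sublocale prob_space \<mu> using haar by (simp add: Haar_Zp_def)

lemma sets_haar [measurable_cong]: "sets \<mu> = sets Zp_borel" using haar by (simp add: Haar_Zp_def)

lemma space_haar [simp]: "space \<mu> = Zp" using sets_eq_imp_space_eq[OF sets_haar] by simp

lemma res_ball_events [simp]: "res_ball n r \<in> events"
  unfolding sets_haar by (rule res_ball_sets)

lemma measure_res_ball:
  assumes "r < CARD('p) ^ n"
  shows "prob (res_ball n r) = 1 / real CARD('p) ^ n"
proof -
  have eq: "prob (res_ball n r) = prob (res_ball n 0)" if r: "r < CARD('p) ^ n" for r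
  proof -
    have t: "(\<lambda>x. of_nat r + x) \<in> \<mu> \<rightarrow>\<^sub>M Zp_borel"
      using Zp_translate_measurable[OF of_nat_in_Zp] measurable_cong_sets[OF sets_haar refl] by blast
    have "\<mu> = distr \<mu> Zp_borel (\<lambda>x. of_nat r + x)" using haar by (simp add: Haar_Zp_def)
    then have "prob (res_ball n r) = measure (distr \<mu> Zp_borel (\<lambda>x. of_nat r + x)) (res_ball n r)" by simp
    also have "\<dots> = prob ((\<lambda>x. of_nat r + x) -` res_ball n r \<inter> Zp)"
      using measure_distr[OF t res_ball_sets] by simp
    also have "(\<lambda>x. of_nat r + x) -` res_ball n r \<inter> Zp = (res_ball n 0 :: 'p padic set)"
    proof (intro set_eqI)
      fix x :: "'p padic"
      have 1: "residue n (of_nat r :: 'p padic) = r" "residue n (0 :: 'p padic) = 0"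
        using residue_of_nat[of n r, where 'p='p] residue_of_nat[of n 0, where 'p='p] r by simp_all
      have 0: "(0 :: 'p padic) \<in> Zp" by (simp add: Zp_def)
      show "x \<in> (\<lambda>x. of_nat r + x) -` res_ball n r \<inter> Zp \<longleftrightarrow> x \<in> res_ball n 0"
        using residue_eq_iff[of "of_nat r + x" "of_nat r" n] residue_eq_iff[of x 0 n] 1 0
          Zp_add[OF of_nat_in_Zp[of r], of x]
        by (auto simp: res_ball_def)
    qed
    finally show ?thesis .
  qed
  have "1 = prob (\<Union>r<CARD('p) ^ n. res_ball n r)"
  proof -
    have "(\<Union>r<CARD('p) ^ n. res_ball n r) = (Zp :: 'p padic set)"
      by (auto simp: res_ball_def residue_less)
    then show ?thesis using prob_space by simp
  qed
  also have "\<dots> = (\<Sum>r<CARD('p) ^ n. prob (res_ball n r))"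
  proof (rule finite_measure_finite_Union)
    show "disjoint_family_on (res_ball n :: nat \<Rightarrow> 'p padic set) {..<CARD('p) ^ n}"
      unfolding disjoint_family_on_def res_ball_def by blast
    show "res_ball n ` {..<CARD('p) ^ n} \<subseteq> events"
      by (rule image_subsetI) (rule res_ball_events)
  qed simp
  also have "\<dots> = (\<Sum>r<CARD('p) ^ n. prob (res_ball n 0))"
    by (intro sum.cong refl eq) simp
  also have "\<dots> = real CARD('p) ^ n * prob (res_ball n 0)" by simp
  finally have "prob (res_ball n 0) = 1 / real CARD('p) ^ n" using prime_gt_1_CARD[where 'p='p] by (simp add: field_simps)
  then show ?thesis using eq[OF assms] by simp
qed

end

text \<open>
  The value at the class of \<open>d\<close> of the uniform law on the subgroup \<open>p\<^sup>j\<int>/p\<^sup>n\<int>\<close> of \<open>\<int>/p\<^sup>n\<int>\<close>.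
\<close>

definition ball_wt :: "nat \<Rightarrow> nat \<Rightarrow> nat \<Rightarrow> int \<Rightarrow> real" where
  "ball_wt p n j d = (if int p ^ j dvd d then real p ^ j / real p ^ n else 0)"

definition shell_wt :: "nat \<Rightarrow> nat \<Rightarrow> nat \<Rightarrow> int \<Rightarrow> real" where
  "shell_wt p n j d = ball_wt p n j d - (if j = 0 then 0 else ball_wt p n (j - 1) d)"

definition bm_trans :: "nat \<Rightarrow> real \<Rightarrow> real \<Rightarrow> real \<Rightarrow> nat \<Rightarrow> int \<Rightarrow> real" where
  "bm_trans p b D t n d = (\<Sum>j\<le>n. radial_phi p b D t j * shell_wt p n j d)"

context haar_Zp
begin

lemma ball_kernel_eq_indicator:
  fixes x x0 :: "'p padic"
  assumes "x \<in> Zp" "x0 \<in> Zp"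
  shows "ball_kernel j (x - x0) = real CARD('p) ^ j * indicator (res_ball j (residue j x0)) x"
  using residue_eq_iff[OF assms, of j] assms by (auto simp: ball_kernel_def res_ball_def indicator_def)

text \<open>
  The ball of radius \<open>p\<^sup>-\<^sup>j\<close> around \<open>x\<^sub>0\<close> either contains the residue class modulo \<open>p\<^sup>n\<close>, or lies in it, or is
  disjoint from it. For \<open>j \<ge> n\<close> the integral no longer depends on \<open>j\<close>, which is why all shells beyond
  the \<open>n\<close>-th integrate to \<open>0\<close>.
\<close>

lemma integral_ball_kernel:
  fixes x0 :: "'p padic"
  assumes x0: "x0 \<in> Zp" and r: "r < CARD('p) ^ n"
  shows "integrable \<mu> (\<lambda>x. indicator (res_ball n r) x * ball_kernel j (x - x0))"
    and "(\<integral>x. indicator (res_ball n r) x * ball_kernel j (x - x0) \<partial>\<mu>) =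
      ball_wt CARD('p) n (min j n) (int r - int (residue n x0))"
proof -
  let ?B = "res_ball n r \<inter> res_ball j (residue j x0)"
  have eq: "indicator (res_ball n r) x * ball_kernel j (x - x0) = real CARD('p) ^ j * indicator ?B x"
    if "x \<in> space \<mu>" for x
    using that ball_kernel_eq_indicator[of x x0 j] x0 by (simp add: indicator_inter_arith)
  have sets: "?B \<in> sets \<mu>" by simp
  have "integrable \<mu> (\<lambda>x. real CARD('p) ^ j * indicator ?B x)"
    using sets by (intro integrable_mult_right integrable_real_indicator) (auto simp: emeasure_eq_measure)
  then show "integrable \<mu> (\<lambda>x. indicator (res_ball n r) x * ball_kernel j (x - x0))"
    by (subst Bochner_Integration.integrable_cong[OF refl eq]) auto
  have "(\<integral>x. indicator (res_ball n r) x * ball_kernel j (x - x0) \<partial>\<mu>) =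
      (\<integral>x. real CARD('p) ^ j * indicator ?B x \<partial>\<mu>)"
    by (rule Bochner_Integration.integral_cong[OF refl eq])
  also have "\<dots> = real CARD('p) ^ j * prob (?B \<inter> space \<mu>)" by simp
  also have "?B \<inter> space \<mu> = ?B" using sets by (rule sets.Int_space_eq2)
  also have "real CARD('p) ^ j * prob ?B = ball_wt CARD('p) n (min j n) (int r - int (residue n x0))"
  proof (cases "j \<le> n")
    case True
    have close: "int CARD('p) ^ j dvd int r - int (residue n x0) \<longleftrightarrow> residue j (of_nat r :: 'p padic) = residue j x0"
    proof -
      have "int CARD('p) ^ j dvd int r - int (residue n x0) \<longleftrightarrow>
          int CARD('p) ^ j dvd int (residue n (of_nat r :: 'p padic)) - int (residue n x0)"
        using r by (simp add: residue_of_nat)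
      also have "\<dots> \<longleftrightarrow> residue j (of_nat r :: 'p padic) = residue j x0"
        using padic_close_iff_residue[OF of_nat_in_Zp x0 True, of r] residue_eq_iff[OF of_nat_in_Zp x0, of j r] by simp
      finally show ?thesis .
    qed
    have key: "residue j x = residue j (of_nat r :: 'p padic)" if "x \<in> res_ball n r" for x :: "'p padic"
      using that residue_mod[OF _ True, of x] by (auto simp: res_ball_def residue_of_nat)
    have "?B = (if int CARD('p) ^ j dvd int r - int (residue n x0) then res_ball n r else {} :: 'p padic set)"
    proof (rule set_eqI)
      fix x :: "'p padic"
      show "x \<in> ?B \<longleftrightarrow> x \<in> (if int CARD('p) ^ j dvd int r - int (residue n x0) then res_ball n r else {} :: 'p padic set)"
        using key[of x] close by (auto simp: res_ball_def)
    qed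
    then show ?thesis using True measure_res_ball[OF r] by (simp add: ball_wt_def)
  next
    case False
    then have nj: "n \<le> j" by simp
    have dvd: "int CARD('p) ^ n dvd int r - int (residue n x0) \<longleftrightarrow> r = residue n x0"
    proof
      assume "int CARD('p) ^ n dvd int r - int (residue n x0)"
      then have "[r = residue n x0] (mod CARD('p) ^ n)"
        by (metis cong_iff_dvd_diff cong_int_iff of_nat_power)
      then show "r = residue n x0" using r residue_less[OF x0] by (metis cong_less_modulus_unique_nat)
    qed simp
    have key: "residue n x = residue n x0" if "x \<in> res_ball j (residue j x0)" for x :: "'p padic"
      using that residue_mod[OF _ nj, of x] residue_mod[OF x0 nj] by (auto simp: res_ball_def)
    have "?B = (if r = residue n x0 then res_ball j (residue j x0) else {} :: 'p padic set)"
    proof (rule set_eqI)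
      fix x :: "'p padic"
      show "x \<in> ?B \<longleftrightarrow> x \<in> (if r = residue n x0 then res_ball j (residue j x0) else {} :: 'p padic set)"
        using key[of x] by (auto simp: res_ball_def)
    qed
    then show ?thesis
      using nj measure_res_ball[OF residue_less[OF x0], of j] prime_gt_1_CARD[where 'p='p]
      by (simp add: ball_wt_def dvd)
  qed
  finally show "(\<integral>x. indicator (res_ball n r) x * ball_kernel j (x - x0) \<partial>\<mu>) =
      ball_wt CARD('p) n (min j n) (int r - int (residue n x0))" .
qed

lemma integral_density_partial:
  fixes x0 :: "'p padic"
  assumes x0: "x0 \<in> Zp" and r: "r < CARD('p) ^ n" and J: "J \<ge> n"
  shows "integrable \<mu> (\<lambda>x. indicator (res_ball n r) x * density_partial b D t J (x - x0))"
    and "(\<integral>x. indicator (res_ball n r) x * density_partial b D t J (x - x0) \<partial>\<mu>) =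
      bm_trans CARD('p) b D t n (int r - int (residue n x0))"
proof -
  let ?I = "\<lambda>x. indicator (res_ball n r) x :: real" and ?d = "int r - int (residue n x0)"
  have shell: "integrable \<mu> (\<lambda>x. ?I x * shell_kernel j (x - x0))"
    "(\<integral>x. ?I x * shell_kernel j (x - x0) \<partial>\<mu>) = (if j \<le> n then shell_wt CARD('p) n j ?d else 0)" for j
  proof -
    note int = integral_ball_kernel[OF x0 r]
    have "integrable \<mu> (\<lambda>x. ?I x * shell_kernel j (x - x0)) \<and>
      (\<integral>x. ?I x * shell_kernel j (x - x0) \<partial>\<mu>) = (if j \<le> n then shell_wt CARD('p) n j ?d else 0)"
    proof (cases j)
      case 0
      then show ?thesis using int[of 0] by (simp add: shell_kernel_def shell_wt_def)
    next
      case (Suc i)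
      have "?I x * shell_kernel j (x - x0) = ?I x * ball_kernel (Suc i) (x - x0) - ?I x * ball_kernel i (x - x0)" for x
        by (simp add: shell_kernel_def Suc right_diff_distrib)
      then show ?thesis using int[of "Suc i"] int[of i] by (simp add: shell_wt_def Suc min_def not_less_eq_eq)
    qed
    then show "integrable \<mu> (\<lambda>x. ?I x * shell_kernel j (x - x0))"
      "(\<integral>x. ?I x * shell_kernel j (x - x0) \<partial>\<mu>) = (if j \<le> n then shell_wt CARD('p) n j ?d else 0)"
      by blast+
  qed
  have eq: "?I x * density_partial b D t J (x - x0) =
      (\<Sum>j\<le>J. radial_phi CARD('p) b D t j * (?I x * shell_kernel j (x - x0)))" for x
    by (simp add: density_partial_def sum_distrib_left mult_ac)
  show "integrable \<mu> (\<lambda>x. ?I x * density_partial b D t J (x - x0))"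
    unfolding eq by (intro Bochner_Integration.integrable_sum integrable_mult_right shell)
  have "(\<integral>x. ?I x * density_partial b D t J (x - x0) \<partial>\<mu>) =
      (\<Sum>j\<le>J. radial_phi CARD('p) b D t j * (if j \<le> n then shell_wt CARD('p) n j ?d else 0))"
    unfolding eq by (subst Bochner_Integration.integral_sum) (simp_all add: shell)
  also have "\<dots> = bm_trans CARD('p) b D t n ?d"
    unfolding bm_trans_def using J by (intro sum.mono_neutral_cong_right) auto
  finally show "(\<integral>x. ?I x * density_partial b D t J (x - x0) \<partial>\<mu>) = bm_trans CARD('p) b D t n ?d" .
qed

lemma integral_bm_density:
  fixes x0 :: "'p padic"
  assumes pos: "b > 0" "D > 0" "t > 0" and x0: "x0 \<in> Zp" and r: "r < CARD('p) ^ n"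
  shows "(LINT x:res_ball n r|\<mu>. bm_density b D t (x - x0)) =
    complex_of_real (bm_trans CARD('p) b D t n (int r - int (residue n x0)))"
proof -
  let ?I = "\<lambda>x. indicator (res_ball n r) x :: real"
  define f where "f J x = complex_of_real (?I x * density_partial b D t (J + n) (x - x0))" for J x
  have int: "integrable \<mu> (f J)" for J
    unfolding f_def by (intro integrable_of_real integral_density_partial x0 r) simp
  have lim: "(\<lambda>J. f J x) \<longlonglongrightarrow> ?I x *\<^sub>R bm_density b D t (x - x0)" if "x \<in> space \<mu>" for x
  proof -
    have "(\<lambda>J. complex_of_real (density_partial b D t (J + n) (x - x0))) \<longlonglongrightarrow> bm_density b D t (x - x0)"
      using density_partial_tendsto[OF pos Zp_diff[of x x0]] that x0 by (intro LIMSEQ_ignore_initial_segment) auto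
    then show ?thesis unfolding f_def by (auto simp: scaleR_conv_of_real intro!: tendsto_mult_left)
  qed
  have lim': "(\<lambda>J. (\<integral>x. f J x \<partial>\<mu>)) \<longlonglongrightarrow> (\<integral>x. ?I x *\<^sub>R bm_density b D t (x - x0) \<partial>\<mu>)"
  proof (rule integral_dominated_convergence[where w = "\<lambda>_. density_bound CARD('p) b D t"])
    show "(\<lambda>x. ?I x *\<^sub>R bm_density b D t (x - x0)) \<in> borel_measurable \<mu>"
      by (rule borel_measurable_LIMSEQ_metric[OF borel_measurable_integrable[OF int] lim])
    show "f J \<in> borel_measurable \<mu>" for J by (rule borel_measurable_integrable[OF int])
    show "AE x in \<mu>. (\<lambda>J. f J x) \<longlonglongrightarrow> ?I x *\<^sub>R bm_density b D t (x - x0)" by (intro AE_I2 lim)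
    have "density_bound CARD('p) b D t \<ge> 0"
      using density_partial_bound[OF pos, of 0 x0] by linarith
    then show "AE x in \<mu>. norm (f J x) \<le> density_bound CARD('p) b D t" for J
      using density_partial_bound[OF pos] by (auto simp: f_def indicator_def norm_of_real simp del: of_real_mult)
  qed simp
  have val: "(\<integral>x. f J x \<partial>\<mu>) = complex_of_real (bm_trans CARD('p) b D t n (int r - int (residue n x0)))" for J
    unfolding f_def integral_complex_of_real
    by (subst integral_density_partial(2)[OF x0 r]) simp_all
  show ?thesis
    unfolding set_lebesgue_integral_def
    using lim'[unfolded val] by (rule LIMSEQ_unique[OF _ tendsto_const])
qed

end

lemma iterated_integral_mult:
  "iterated_integral \<mu> Us (\<lambda>xs. c * f xs) = c * iterated_integral \<mu> Us f"
  by (induction Us arbitrary: f) (simp_all add: set_integral_mult_right)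

text \<open>
  The innermost integral depends on the preceding point only through its residue, which is constant
  on the ball over which that point is integrated. So the iterated integral factorizes.
\<close>

lemma (in haar_Zp) iterated_integral_bm_density:
  assumes pos: "b > 0" "D > 0"
  shows "sorted_wrt (<) (t0 # ts) \<Longrightarrow> length rs = length ts \<Longrightarrow> \<forall>r\<in>set rs. r < CARD('p) ^ n \<Longrightarrow> x0 \<in> Zp \<Longrightarrow>
    iterated_integral \<mu> (map (res_ball n) rs) (\<lambda>xs. \<Prod>i<length ts.
        bm_density b D (ts ! i - (t0 # ts) ! i) (xs ! i - (x0 # xs) ! i)) =
    complex_of_real (\<Prod>i<length ts. bm_trans CARD('p) b D (ts ! i - (t0 # ts) ! i) n
        (int (rs ! i) - int ((residue n x0 # rs) ! i)))"
proof (induction ts arbitrary: t0 x0 rs)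
  case Nil
  then show ?case by simp
next
  case (Cons t ts)
  obtain r rs' where rs: "rs = r # rs'" using Cons.prems by (cases rs) auto
  have r: "r < CARD('p) ^ n" using Cons.prems by (simp add: rs)
  let ?c = "complex_of_real (\<Prod>i<length ts. bm_trans CARD('p) b D (ts ! i - (t # ts) ! i) n
        (int (rs' ! i) - int ((r # rs') ! i)))"
  have inner: "iterated_integral \<mu> (map (res_ball n) rs') (\<lambda>xs. \<Prod>i<length (t # ts).
        bm_density b D ((t # ts) ! i - (t0 # t # ts) ! i) ((x # xs) ! i - (x0 # x # xs) ! i)) =
      bm_density b D (t - t0) (x - x0) * ?c" if x: "x \<in> res_ball n r" for x
  proof -
    have xZ: "x \<in> Zp" "residue n x = r" using x by (auto simp: res_ball_def)
    have "(\<lambda>xs. \<Prod>i<length (t # ts).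
        bm_density b D ((t # ts) ! i - (t0 # t # ts) ! i) ((x # xs) ! i - (x0 # x # xs) ! i)) =
      (\<lambda>xs. bm_density b D (t - t0) (x - x0) * (\<Prod>i<length ts.
        bm_density b D (ts ! i - (t # ts) ! i) (xs ! i - (x # xs) ! i)))"
      by (rule ext) (simp add: prod.lessThan_Suc_shift del: prod.lessThan_Suc)
    then show ?thesis
      using Cons.IH[of t rs' x] Cons.prems xZ by (simp add: iterated_integral_mult rs del: of_real_prod)
  qed
  have "iterated_integral \<mu> (map (res_ball n) rs) (\<lambda>xs. \<Prod>i<length (t # ts).
        bm_density b D ((t # ts) ! i - (t0 # t # ts) ! i) (xs ! i - (x0 # xs) ! i)) =
      (LINT x:res_ball n r|\<mu>. bm_density b D (t - t0) (x - x0) * ?c)"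
    unfolding rs list.map iterated_integral.simps
    by (rule set_lebesgue_integral_cong) (use inner in auto)
  also have "\<dots> = (LINT x:res_ball n r|\<mu>. bm_density b D (t - t0) (x - x0)) * ?c" by simp
  also have "(LINT x:res_ball n r|\<mu>. bm_density b D (t - t0) (x - x0)) =
      complex_of_real (bm_trans CARD('p) b D (t - t0) n (int r - int (residue n x0)))"
    using Cons.prems by (intro integral_bm_density pos r) auto
  finally show ?case
    by (simp add: rs prod.lessThan_Suc_shift del: prod.lessThan_Suc of_real_prod)
qed

section \<open>Convolution of radial laws and walks with radial steps\<close>

lemma card_dvd_diff:
  assumes p: "p > 0" and i: "i \<le> n"
  shows "card {g. g < p ^ n \<and> int p ^ i dvd a - int g} = p ^ (n - i)"
proof -
  define r where "r = nat (a mod int p ^ i)"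
  have pi: "int p ^ i > 0" using p by simp
  have r: "int r = a mod int p ^ i" using pi by (simp add: r_def)
  have "int r < int p ^ i" using pi r by simp
  then have rlt: "r < p ^ i" by (metis of_nat_less_iff of_nat_power)
  have pn: "p ^ n = p ^ i * p ^ (n - i)" using i by (simp flip: power_add)
  have mod: "int p ^ i dvd a - int g \<longleftrightarrow> g mod p ^ i = r" for g
  proof -
    have "int p ^ i dvd a - int g \<longleftrightarrow> a mod int p ^ i = int g mod int p ^ i" by (simp add: mod_eq_dvd_iff)
    also have "\<dots> \<longleftrightarrow> int r = int (g mod p ^ i)" by (simp add: r zmod_int)
    finally show ?thesis by auto
  qed
  have "{g. g < p ^ n \<and> int p ^ i dvd a - int g} = (\<lambda>k. r + p ^ i * k) ` {..<p ^ (n - i)}"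
  proof (intro set_eqI iffI)
    fix g assume "g \<in> {g. g < p ^ n \<and> int p ^ i dvd a - int g}"
    then have g: "g < p ^ n" "g mod p ^ i = r" by (auto simp: mod)
    have "g = r + p ^ i * (g div p ^ i)" using g(2) by (metis add.commute mult.commute div_mult_mod_eq)
    moreover have "g div p ^ i < p ^ (n - i)" using g(1) pn by (simp add: less_mult_imp_div_less mult.commute)
    ultimately show "g \<in> (\<lambda>k. r + p ^ i * k) ` {..<p ^ (n - i)}" by blast
  next
    fix g assume "g \<in> (\<lambda>k. r + p ^ i * k) ` {..<p ^ (n - i)}"
    then obtain k where "g = r + p ^ i * k" "k < p ^ (n - i)" by blast
    then have k: "g = r + p ^ i * k" "Suc k \<le> p ^ (n - i)" by auto
    have "g < p ^ i * Suc k" using k rlt by simp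
    also have "\<dots> \<le> p ^ n" unfolding pn using k(2) by (rule mult_le_mono2)
    finally show "g \<in> {g. g < p ^ n \<and> int p ^ i dvd a - int g}" using k rlt by (simp add: mod)
  qed
  moreover have "inj_on (\<lambda>k. r + p ^ i * k) {..<p ^ (n - i)}" using p by (auto simp: inj_on_def)
  ultimately show ?thesis by (simp add: card_image)
qed

text \<open>
  The convolution of the uniform laws on two nested subgroups is the uniform law on the larger one: on
  the support of one factor, the divisibility condition of the other does not depend on \<open>g\<close>.
\<close>

lemma convolution_ball_wt:
  assumes p: "p > 0" and ij: "i \<le> n" "j \<le> n"
  shows "(\<Sum>g<p ^ n. ball_wt p n i (a - int g) * ball_wt p n j (int g)) = ball_wt p n (min i j) a"
proof (cases "i \<le> j")
  case True
  have "int p ^ i dvd a - int g \<longleftrightarrow> int p ^ i dvd a" if "int p ^ j dvd int g" for g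
  proof -
    have "int p ^ i dvd int g" using that True by (meson dvd_trans le_imp_power_dvd)
    then show ?thesis by (simp add: dvd_diff_left_iff)
  qed
  then have "(\<Sum>g<p ^ n. ball_wt p n i (a - int g) * ball_wt p n j (int g)) =
      (\<Sum>g\<in>{g. g < p ^ n \<and> int p ^ j dvd 0 - int g}. ball_wt p n i a * (real p ^ j / real p ^ n))"
    by (intro sum.mono_neutral_cong_right) (auto simp: ball_wt_def)
  also have "\<dots> = real (p ^ (n - j)) * (ball_wt p n i a * (real p ^ j / real p ^ n))"
    by (simp only: sum_constant card_dvd_diff[OF p ij(2)])
  also have "\<dots> = ball_wt p n i a * (real (p ^ (n - j)) * real p ^ j / real p ^ n)" by simp
  also have "real (p ^ (n - j)) * real p ^ j = real p ^ n" using ij by (simp flip: power_add)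
  also have "ball_wt p n i a * (real p ^ n / real p ^ n) = ball_wt p n i a" using p by simp
  finally show ?thesis using True by (simp add: min_def)
next
  case False
  have "int p ^ j dvd int g \<longleftrightarrow> int p ^ j dvd a" if "int p ^ i dvd a - int g" for g
  proof -
    have "int p ^ j dvd a - int g" using that False by (meson dvd_trans le_imp_power_dvd nat_le_linear)
    then show ?thesis by (metis dvd_diff_left_iff dvd_diff_right_iff)
  qed
  then have "(\<Sum>g<p ^ n. ball_wt p n i (a - int g) * ball_wt p n j (int g)) =
      (\<Sum>g\<in>{g. g < p ^ n \<and> int p ^ i dvd a - int g}. ball_wt p n j a * (real p ^ i / real p ^ n))"
    by (intro sum.mono_neutral_cong_right) (auto simp: ball_wt_def)
  also have "\<dots> = real (p ^ (n - i)) * (ball_wt p n j a * (real p ^ i / real p ^ n))"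
    by (simp only: sum_constant card_dvd_diff[OF p ij(1)])
  also have "\<dots> = ball_wt p n j a * (real (p ^ (n - i)) * real p ^ i / real p ^ n)" by simp
  also have "real (p ^ (n - i)) * real p ^ i = real p ^ n" using ij by (simp flip: power_add)
  also have "ball_wt p n j a * (real p ^ n / real p ^ n) = ball_wt p n j a" using p by simp
  finally show ?thesis using False by (simp add: min_def)
qed

text \<open>
  Differences of successive projections of a chain are orthogonal idempotents.
\<close>

lemma convolution_shell_wt:
  assumes p: "p > 0" and ij: "i \<le> n" "j \<le> n"
  shows "(\<Sum>g<p ^ n. shell_wt p n i (a - int g) * shell_wt p n j (int g)) =
    (if i = j then shell_wt p n i a else 0)"
proof -
  note conv = convolution_ball_wt[OF p, of _ n _ a]
  show ?thesis
  proof (cases i; cases j)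
    fix i' j' assume "i = Suc i'" "j = Suc j'"
    then show ?thesis using ij
      by (simp add: shell_wt_def left_diff_distrib right_diff_distrib sum_subtractf conv)
        (auto simp: min_def le_Suc_eq)
  qed (use ij in \<open>auto simp: shell_wt_def left_diff_distrib right_diff_distrib sum_subtractf conv\<close>)
qed

lemma convolution_radial:
  assumes p: "p > 0"
  shows "(\<Sum>g<p ^ n. (\<Sum>i\<le>n. c i * shell_wt p n i (a - int g)) * (\<Sum>j\<le>n. d j * shell_wt p n j (int g))) =
    (\<Sum>j\<le>n. c j * d j * shell_wt p n j a)"
proof -
  have "(\<Sum>g<p ^ n. (\<Sum>i\<le>n. c i * shell_wt p n i (a - int g)) * (\<Sum>j\<le>n. d j * shell_wt p n j (int g))) =
      (\<Sum>g<p ^ n. \<Sum>i\<le>n. \<Sum>j\<le>n. c i * d j * (shell_wt p n i (a - int g) * shell_wt p n j (int g)))"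
    unfolding sum_product by (intro sum.cong refl) simp
  also have "\<dots> = (\<Sum>i\<le>n. \<Sum>j\<le>n. \<Sum>g<p ^ n. c i * d j * (shell_wt p n i (a - int g) * shell_wt p n j (int g)))"
    by (rule trans[OF sum.swap]) (intro sum.cong refl sum.swap)
  also have "\<dots> = (\<Sum>i\<le>n. \<Sum>j\<le>n. if i = j then c i * d j * shell_wt p n i a else 0)"
    by (intro sum.cong refl) (simp add: convolution_shell_wt[OF p] flip: sum_distrib_left)
  also have "\<dots> = (\<Sum>j\<le>n. c j * d j * shell_wt p n j a)"
    by simp
  finally show ?thesis .
qed

lemma sum_shell_wt: "(\<Sum>j\<le>k. shell_wt p n j a) = ball_wt p n k a"
  by (induction k) (simp_all add: shell_wt_def)

text \<open>
  Independent residues whose common law has eigenvalue \<open>E j\<close> on the \<open>j\<close>-th idempotent.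
\<close>

locale residue_walk = prob_space M for M :: "'w measure" +
  fixes Z :: "nat \<Rightarrow> 'w \<Rightarrow> nat" and p n :: nat and E :: "nat \<Rightarrow> real"
  assumes p: "p > 1"
    and indep: "indep_vars (\<lambda>_. count_space UNIV) Z {1..}"
    and Z_less: "\<And>i w. i \<ge> 1 \<Longrightarrow> w \<in> space M \<Longrightarrow> Z i w < p ^ n"
    and law: "\<And>i g. i \<ge> 1 \<Longrightarrow> g < p ^ n \<Longrightarrow>
      prob {w \<in> space M. Z i w = g} = (\<Sum>j\<le>n. E j * shell_wt p n j (int g))"
begin

lemma indep_real: "indep_vars (\<lambda>_. borel) (\<lambda>i w. real (Z i w)) {1..}"
  by (rule indep_vars_compose2[OF indep]) simp

lemma Z_measurable: "i \<ge> 1 \<Longrightarrow> (\<lambda>w. real (Z i w)) \<in> borel_measurable M"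
  using indep_real by (auto simp: indep_vars_def)

text \<open>
  Sums of residues are handled as real random variables, and this Borel set expresses a congruence
  between integers.
\<close>

definition cong_set :: "int \<Rightarrow> real set" where
  "cong_set a = of_int ` {z. int p ^ n dvd a - z}"

lemma cong_set_borel [measurable]: "cong_set a \<in> sets borel"
  unfolding cong_set_def by (rule sets.countable) auto

lemma mem_cong_set: "real k \<in> cong_set a \<longleftrightarrow> int p ^ n dvd a - int k"
proof
  assume "real k \<in> cong_set a"
  then obtain z where z: "real k = of_int z" "int p ^ n dvd a - z" by (auto simp: cong_set_def)
  then have "real_of_int (int k) = of_int z" by simp
  then have "int k = z" by (simp only: of_int_eq_iff)
  then show "int p ^ n dvd a - int k" using z(2) by metis
next
  assume "int p ^ n dvd a - int k"
  then have "real_of_int (int k) \<in> cong_set a" unfolding cong_set_def by blast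
  then show "real k \<in> cong_set a" by simp
qed

lemma sum_Z_in_cong_set: "(\<Sum>i\<in>I. real (Z i w)) \<in> cong_set a \<longleftrightarrow> int p ^ n dvd a - int (\<Sum>i\<in>I. Z i w)"
  using mem_cong_set[of "\<Sum>i\<in>I. Z i w" a] by simp

lemma sum_measurable: "I \<subseteq> {1..} \<Longrightarrow> (\<lambda>w. \<Sum>i\<in>I. real (Z i w)) \<in> borel_measurable M"
  using Z_measurable by (intro borel_measurable_sum) auto

lemma cong_event [measurable]:
  "I \<subseteq> {1..} \<Longrightarrow> {w \<in> space M. int p ^ n dvd a - int (\<Sum>i\<in>I. Z i w)} \<in> events"
  unfolding sum_Z_in_cong_set[symmetric] using sum_measurable[of I] by measurable

lemma prob_sum_cong:
  assumes "finite I" "I \<subseteq> {1..}"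
  shows "prob {w \<in> space M. int p ^ n dvd a - int (\<Sum>i\<in>I. Z i w)} = (\<Sum>j\<le>n. E j ^ card I * shell_wt p n j a)"
  using assms
proof (induction I arbitrary: a rule: finite_induct)
  case empty
  have "prob {w \<in> space M. int p ^ n dvd a} = ball_wt p n n a"
    using p prob_space by (cases "int p ^ n dvd a") (auto simp: ball_wt_def)
  then show ?case by (simp add: sum_shell_wt)
next
  case (insert k I)
  have k: "k \<ge> 1" and I: "I \<subseteq> {1..}" using insert.prems by auto
  let ?S = "\<lambda>w. \<Sum>i\<in>I. Z i w"
  have ind: "indep_var borel (\<lambda>w. real (Z k w)) borel (\<lambda>w. \<Sum>i\<in>I. real (Z i w))"
    by (rule indep_vars_sum[OF insert.hyps indep_vars_subset[OF indep_real insert.prems]])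
  have prod: "prob {w \<in> space M. Z k w = g \<and> int p ^ n dvd a - int g - int (?S w)} =
      prob {w \<in> space M. Z k w = g} * prob {w \<in> space M. int p ^ n dvd (a - int g) - int (?S w)}" for g
  proof -
    have eq1: "(\<lambda>w. (real (Z k w), \<Sum>i\<in>I. real (Z i w))) -` ({real g} \<times> cong_set (a - int g)) \<inter> space M =
        {w \<in> space M. Z k w = g \<and> int p ^ n dvd a - int g - int (?S w)}"
      by (auto simp: sum_Z_in_cong_set simp del: of_nat_sum)
    have eq2: "(\<lambda>w. real (Z k w)) -` {real g} \<inter> space M = {w \<in> space M. Z k w = g}"
      "(\<lambda>w. \<Sum>i\<in>I. real (Z i w)) -` cong_set (a - int g) \<inter> space M =
        {w \<in> space M. int p ^ n dvd (a - int g) - int (?S w)}"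
      by (auto simp: sum_Z_in_cong_set simp del: of_nat_sum)
    from indep_varD[OF ind, of "{real g}" "cong_set (a - int g)"]
    show ?thesis unfolding eq1 eq2 by simp
  qed
  have ev: "{w \<in> space M. Z k w = g \<and> int p ^ n dvd a - int g - int (?S w)} \<in> events" for g
  proof -
    have "{w \<in> space M. Z k w = g} \<in> events"
    proof -
      have "{w \<in> space M. Z k w = g} = (\<lambda>w. real (Z k w)) -` {real g} \<inter> space M" by auto
      then show ?thesis using Z_measurable[OF k] by simp
    qed
    moreover have "{w \<in> space M. Z k w = g \<and> int p ^ n dvd a - int g - int (?S w)} =
      {w \<in> space M. Z k w = g} \<inter> {w \<in> space M. int p ^ n dvd (a - int g) - int (?S w)}" by auto
    ultimately show ?thesis using cong_event[OF I] by simp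
  qed
  have "{w \<in> space M. int p ^ n dvd a - int (\<Sum>i\<in>insert k I. Z i w)} =
      (\<Union>g<p ^ n. {w \<in> space M. Z k w = g \<and> int p ^ n dvd a - int g - int (?S w)})"
    using insert.hyps Z_less[OF k] by (auto simp: algebra_simps)
  then have "prob {w \<in> space M. int p ^ n dvd a - int (\<Sum>i\<in>insert k I. Z i w)} =
      prob (\<Union>g<p ^ n. {w \<in> space M. Z k w = g \<and> int p ^ n dvd a - int g - int (?S w)})" by simp
  also have "\<dots> = (\<Sum>g<p ^ n. prob {w \<in> space M. Z k w = g \<and> int p ^ n dvd a - int g - int (?S w)})"
  proof (rule finite_measure_finite_Union)
    show "disjoint_family_on (\<lambda>g. {w \<in> space M. Z k w = g \<and> int p ^ n dvd a - int g - int (?S w)}) {..<p ^ n}"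
      by (auto simp: disjoint_family_on_def)
  qed (use ev in auto)
  also have "\<dots> = (\<Sum>g<p ^ n. (\<Sum>i\<le>n. E i ^ card I * shell_wt p n i (a - int g)) * (\<Sum>j\<le>n. E j * shell_wt p n j (int g)))"
    by (intro sum.cong refl) (simp only: prod law[OF k] insert.IH[OF I] lessThan_iff mult.commute)
  also have "\<dots> = (\<Sum>j\<le>n. E j ^ card (insert k I) * shell_wt p n j a)"
    using p insert.hyps by (subst convolution_radial) (simp_all add: mult_ac)
  finally show ?case .
qed

text \<open>
  Increments over consecutive blocks of steps are functions of disjoint families of independent
  variables.
\<close>

lemma prob_increments_cong:
  fixes k :: "nat \<Rightarrow> nat" and a :: "nat \<Rightarrow> int"
  assumes k: "\<And>i j. i \<le> j \<Longrightarrow> k i \<le> k j"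
  shows "prob {w \<in> space M. \<forall>i<N. int p ^ n dvd a i - int (\<Sum>l\<in>{k i<..k (Suc i)}. Z l w)} =
    (\<Prod>i<N. \<Sum>j\<le>n. E j ^ (k (Suc i) - k i) * shell_wt p n j (a i))"
proof (cases "N = 0")
  case True
  then show ?thesis using prob_space by simp
next
  case False
  let ?K = "\<lambda>i. {k i<..k (Suc i)}"
  have "disjoint_family_on ?K {..<N}"
    unfolding disjoint_family_on_def
  proof (intro ballI impI)
    fix i j :: nat assume "i \<noteq> j"
    then have "Suc i \<le> j \<or> Suc j \<le> i" by auto
    then show "?K i \<inter> ?K j = {}" using k[of "Suc i" j] k[of "Suc j" i] by fastforce
  qed
  then have "indep_vars (\<lambda>i. PiM (?K i) (\<lambda>_. borel)) (\<lambda>i w. restrict (\<lambda>l. real (Z l w)) (?K i)) {..<N}"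
    by (intro indep_vars_restrict[OF indep_real]) auto
  then have "indep_vars (\<lambda>_. borel) (\<lambda>i w. \<Sum>l\<in>?K i. restrict (\<lambda>l. real (Z l w)) (?K i) l) {..<N}"
    by (rule indep_vars_compose2) simp
  from indep_varsD_finite[OF this, of "\<lambda>i. cong_set (a i)"] False
  have "prob (\<Inter>i\<in>{..<N}. (\<lambda>w. \<Sum>l\<in>?K i. real (Z l w)) -` cong_set (a i) \<inter> space M) =
      (\<Prod>i\<in>{..<N}. prob ((\<lambda>w. \<Sum>l\<in>?K i. real (Z l w)) -` cong_set (a i) \<inter> space M))"
    by (simp add: lessThan_empty_iff)
  also have "(\<Inter>i\<in>{..<N}. (\<lambda>w. \<Sum>l\<in>?K i. real (Z l w)) -` cong_set (a i) \<inter> space M) =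
      {w \<in> space M. \<forall>i<N. int p ^ n dvd a i - int (\<Sum>l\<in>?K i. Z l w)}"
    using False by (auto simp: sum_Z_in_cong_set simp del: of_nat_sum)
  also have "(\<Prod>i\<in>{..<N}. prob ((\<lambda>w. \<Sum>l\<in>?K i. real (Z l w)) -` cong_set (a i) \<inter> space M)) =
      (\<Prod>i<N. prob {w \<in> space M. int p ^ n dvd a i - int (\<Sum>l\<in>?K i. Z l w)})"
    by (intro prod.cong refl arg_cong[where f = prob]) (auto simp: sum_Z_in_cong_set simp del: of_nat_sum)
  also have "\<dots> = (\<Prod>i<N. \<Sum>j\<le>n. E j ^ (k (Suc i) - k i) * shell_wt p n j (a i))"
    by (intro prod.cong refl, subst prob_sum_cong) auto
  finally show ?thesis .
qed

text \<open>
  The square of the probability of a single change is what makes two changes in a short time unlikely.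
\<close>

lemma prob_two_steps:
  assumes "i \<noteq> j" "i \<ge> 1" "j \<ge> 1"
  shows "prob {w \<in> space M. Z i w \<noteq> 0 \<and> Z j w \<noteq> 0} = prob {w \<in> space M. Z i w \<noteq> 0} * prob {w \<in> space M. Z j w \<noteq> 0}"
proof -
  have "prob (\<Inter>l\<in>{i, j}. Z l -` (- {0}) \<inter> space M) = (\<Prod>l\<in>{i, j}. prob (Z l -` (- {0}) \<inter> space M))"
    by (rule indep_varsD[OF indep]) (use assms in auto)
  moreover have "(\<Inter>l\<in>{i, j}. Z l -` (- {0}) \<inter> space M) = {w \<in> space M. Z i w \<noteq> 0 \<and> Z j w \<noteq> 0}" by auto
  moreover have "Z l -` (- {0}) \<inter> space M = {w \<in> space M. Z l w \<noteq> 0}" for l by auto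
  ultimately show ?thesis using assms(1) by simp
qed

lemma nonzero_event: "i \<ge> 1 \<Longrightarrow> {w \<in> space M. Z i w \<noteq> 0} \<in> events"
proof -
  assume i: "i \<ge> 1"
  have "{w \<in> space M. Z i w \<noteq> 0} = space M - (\<lambda>w. real (Z i w)) -` {0} \<inter> space M" by auto
  then show ?thesis using Z_measurable[OF i] by simp
qed

end

section \<open>Eigenvalues of laws that are uniform on spheres\<close>

text \<open>
  Let a law on \<open>\<int>/p\<^sup>n\<int>\<close> give mass \<open>s i\<close>, spread uniformly, to the sphere of elements of valuation \<open>i\<close>. A
  character of order \<open>p\<^sup>j\<close> has mean \<open>1\<close> on the spheres with \<open>i \<ge> j\<close>, mean \<open>- 1 / (p - 1)\<close> on the sphere with \<open>i = j - 1\<close>,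
  and mean \<open>0\<close> on those with \<open>i < j - 1\<close>; its mean under the law is this number.
\<close>

definition sphere_eigenvalue :: "nat \<Rightarrow> (nat \<Rightarrow> real) \<Rightarrow> nat \<Rightarrow> real" where
  "sphere_eigenvalue p s j = 1 - (\<Sum>i<j. s i) - (if j = 0 then 0 else s (j - 1) / (real p - 1))"

text \<open>
  Fourier inversion for the mass of the multiples of \<open>p\<^sup>k\<close>, as there are \<open>p\<^sup>j - p\<^bsup>j-1\<^esup>\<close> characters of order \<open>p\<^sup>j\<close>.
\<close>

lemma sum_sphere_eigenvalue:
  assumes "p > 1"
  shows "(\<Sum>j\<le>k. sphere_eigenvalue p s j * (real p ^ j - (if j = 0 then 0 else real p ^ (j - 1)))) =
    real p ^ k * (1 - (\<Sum>i<k. s i))"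
proof (induction k)
  case (Suc k)
  have "sphere_eigenvalue p s (Suc k) * (real p ^ Suc k - real p ^ k) =
      real p ^ k * ((1 - (\<Sum>i<Suc k. s i)) * (real p - 1) - s k)"
    using assms by (simp add: sphere_eigenvalue_def field_simps)
  with Suc show ?case by (simp add: algebra_simps)
qed (simp add: sphere_eigenvalue_def)

lemma dvd_power_cases:
  fixes g :: nat
  assumes p: "p > 1" and g: "g \<noteq> 0" "g < p ^ n"
  obtains i where "i < n" "p ^ i dvd g" "\<not> p ^ Suc i dvd g"
proof -
  \<comment> \<open>The valuation is one less than the first exponent that fails to divide.\<close>
  define P where "P k \<longleftrightarrow> \<not> p ^ k dvd g" for k
  have "P n" using g by (auto simp: P_def dest: dvd_imp_le)
  then have L: "P (LEAST k. P k)" "(LEAST k. P k) \<le> n" by (rule LeastI, rule Least_le)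
  obtain i where i: "(LEAST k. P k) = Suc i" using L(1) by (cases "LEAST k. P k") (auto simp: P_def)
  then have "\<not> P i" using not_less_Least[of i P] by simp
  then show thesis using that[of i] L i by (auto simp: P_def)
qed

text \<open>
  For an argument of valuation \<open>i\<close>, the idempotents beyond the \<open>(i + 1)\<close>-st vanish, and the last remaining one
  contributes only its negative part.
\<close>

lemma radial_sum_at_valuation:
  assumes p: "p > 1" and i: "i < n" "p ^ i dvd g" "\<not> p ^ Suc i dvd g"
  shows "(\<Sum>j\<le>n. sphere_eigenvalue p s j * shell_wt p n j (int g)) =
    s i / (real p ^ (n - i) - real p ^ (n - Suc i))"
proof -
  let ?E = "sphere_eigenvalue p s"
  have dvd: "int p ^ j dvd int g \<longleftrightarrow> j \<le> i" for j
  proof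
    show "j \<le> i" if "int p ^ j dvd int g"
    proof (rule ccontr)
      assume "\<not> j \<le> i"
      then have "p ^ Suc i dvd p ^ j" by (intro le_imp_power_dvd) simp
      moreover have "p ^ j dvd g" using that by (metis of_nat_dvd_iff of_nat_power)
      ultimately show False using i(3) dvd_trans by blast
    qed
    show "int p ^ j dvd int g" if "j \<le> i"
      using i(2) le_imp_power_dvd[OF that, of p] by (metis dvd_trans of_nat_dvd_iff of_nat_power)
  qed
  have "(\<Sum>j\<le>n. ?E j * shell_wt p n j (int g)) = (\<Sum>j\<le>Suc i. ?E j * shell_wt p n j (int g))"
    using i(1) by (intro sum.mono_neutral_right) (auto simp: shell_wt_def ball_wt_def dvd)
  also have "\<dots> = (\<Sum>j\<le>i. ?E j * shell_wt p n j (int g)) - ?E (Suc i) * (real p ^ i / real p ^ n)"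
    by (simp add: shell_wt_def ball_wt_def dvd)
  also have "(\<Sum>j\<le>i. ?E j * shell_wt p n j (int g)) =
      (\<Sum>j\<le>i. ?E j * (real p ^ j - (if j = 0 then 0 else real p ^ (j - 1))) / real p ^ n)"
    by (intro sum.cong refl) (auto simp: shell_wt_def ball_wt_def dvd diff_divide_distrib right_diff_distrib)
  also have "\<dots> = real p ^ i * (1 - (\<Sum>i<i. s i)) / real p ^ n"
    by (simp only: sum_divide_distrib[symmetric] sum_sphere_eigenvalue[OF p])
  also have "\<dots> - ?E (Suc i) * (real p ^ i / real p ^ n) = s i * (real p / (real p - 1)) * (real p ^ i / real p ^ n)"
    using p by (simp add: sphere_eigenvalue_def field_simps)
  also have "\<dots> = s i / (real p ^ (n - i) - real p ^ (n - Suc i))"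
  proof -
    obtain d where d: "n = i + Suc d" using i(1) less_iff_Suc_add by auto
    have "real p ^ (n - i) - real p ^ (n - Suc i) = (real p - 1) * real p ^ d"
      by (simp add: d algebra_simps)
    moreover have "real p ^ n = real p ^ i * (real p * real p ^ d)" by (simp add: d power_add)
    ultimately show ?thesis using p by simp
  qed
  finally show ?thesis .
qed

lemma radial_sum_at_0:
  assumes p: "p > 1"
  shows "(\<Sum>j\<le>n. sphere_eigenvalue p s j * shell_wt p n j 0) = 1 - (\<Sum>i<n. s i)"
proof -
  have "(\<Sum>j\<le>n. sphere_eigenvalue p s j * shell_wt p n j 0) =
      (\<Sum>j\<le>n. sphere_eigenvalue p s j * (real p ^ j - (if j = 0 then 0 else real p ^ (j - 1))) / real p ^ n)"
    by (intro sum.cong refl) (auto simp: shell_wt_def ball_wt_def diff_divide_distrib right_diff_distrib)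
  then show ?thesis
    using p by (simp only: sum_divide_distrib[symmetric] sum_sphere_eigenvalue[OF p]) simp
qed

section \<open>Cosets of \<open>p\<^sup>m \<int>\<^sub>p\<close>\<close>

lemma mem_coset_pZp_iff:
  "y \<in> x +o pZp m \<longleftrightarrow> padic_abs (y - x) \<le> (1 / real CARD('p)) ^ m" for x :: "'p::prime_type padic"
proof
  assume "padic_abs (y - x) \<le> (1 / real CARD('p)) ^ m"
  then have "y - x \<in> pZp m" "y = x + (y - x)" by (simp_all add: mem_pZp_iff)
  then show "y \<in> x +o pZp m" unfolding elt_set_plus_def by blast
qed (auto simp: elt_set_plus_def mem_pZp_iff)

lemma coset_pZp_eqI:
  fixes x y :: "'p::prime_type padic"
  assumes "padic_abs (x - y) \<le> (1 / real CARD('p)) ^ m"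
  shows "x +o pZp m = y +o pZp m"
proof (rule set_eqI)
  show "z \<in> x +o pZp m \<longleftrightarrow> z \<in> y +o pZp m" for z
    using assms padic_abs_diff_commute[of x y] padic_abs_trans[of z x _ y] padic_abs_trans[of z y _ x]
    by (auto simp: mem_coset_pZp_iff)
qed

lemma GmE:
  assumes "C \<in> (Gm m :: 'p::prime_type padic set set)" "x \<in> C"
  shows "x \<in> Zp" "C = x +o pZp m"
proof -
  obtain y where y: "C = y +o pZp m" "y \<in> Zp" using assms(1) by (auto simp: Gm_def)
  have xy: "padic_abs (x - y) \<le> (1 / real CARD('p)) ^ m" using assms(2) by (simp add: y mem_coset_pZp_iff)
  then show "C = x +o pZp m" unfolding y by (intro coset_pZp_eqI[symmetric])
  have "(1 / real CARD('p)) ^ m \<le> 1" using prime_gt_1_CARD[where 'p='p] by (intro power_le_one) auto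
  then have "padic_abs (x - y) \<le> 1" using xy by linarith
  then show "x \<in> Zp" using y(2) padic_abs_add_le[of "x - y" 1 y] by (simp add: Zp_def)
qed

lemma coset_rep_mem:
  assumes "C \<in> (Gm m :: 'p::prime_type padic set set)"
  shows "coset_rep C \<in> C"
proof -
  obtain y where "C = y +o pZp m" using assms by (auto simp: Gm_def)
  then have "y \<in> C" by (simp add: mem_coset_pZp_iff)
  then show ?thesis unfolding coset_rep_def by (rule someI)
qed

lemma pZp_in_Gm: "pZp m \<in> (Gm m :: 'p::prime_type padic set set)"
proof -
  have "(0 :: 'p padic) +o pZp m = pZp m" by simp
  moreover have "(0 :: 'p padic) \<in> Zp" by (simp add: Zp_def)
  ultimately show ?thesis unfolding Gm_def by (metis image_eqI)
qed

definition coset_res :: "nat \<Rightarrow> 'p::prime_type padic set \<Rightarrow> nat" where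
  "coset_res n C = residue n (coset_rep C)"

lemma coset_res_eq:
  assumes "C \<in> (Gm m :: 'p::prime_type padic set set)" "x \<in> C" "n \<le> m"
  shows "coset_res n C = residue n x"
proof -
  note rep = coset_rep_mem[OF assms(1)]
  have "padic_abs (coset_rep C - x) \<le> (1 / real CARD('p)) ^ m"
    using rep GmE(2)[OF assms(1,2)] by (metis mem_coset_pZp_iff)
  also have "\<dots> \<le> (1 / real CARD('p)) ^ n"
    using assms(3) prime_gt_1_CARD[where 'p='p] by (intro power_decreasing) auto
  finally show ?thesis
    unfolding coset_res_def by (simp only: residue_eq_iff[OF GmE(1)[OF assms(1) rep] GmE(1)[OF assms(1,2)]])
qed

lemma coset_res_less:
  "C \<in> (Gm m :: 'p::prime_type padic set set) \<Longrightarrow> coset_res n C < CARD('p) ^ n"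
  unfolding coset_res_def using residue_less GmE(1) coset_rep_mem by blast

lemma residue_add:
  fixes x y :: "'p::prime_type padic"
  assumes "x \<in> Zp" "y \<in> Zp"
  shows "residue n (x + y) = (residue n x + residue n y) mod CARD('p) ^ n"
proof -
  have "padic_abs ((x - of_nat (residue n x)) + (y - of_nat (residue n y))) \<le> (1 / real CARD('p)) ^ n"
    by (intro padic_abs_add_le residue_approx assms)
  also have "(x - of_nat (residue n x)) + (y - of_nat (residue n y)) = x + y - of_nat (residue n x + residue n y)"
    by simp
  finally have "residue n (x + y) = residue n (of_nat (residue n x + residue n y) :: 'p padic)"
    by (simp only: residue_eq_iff[OF Zp_add[OF assms] of_nat_in_Zp])
  then show ?thesis by (simp only: residue_of_nat)
qed

lemma Gm_add:
  assumes C: "C \<in> (Gm m :: 'p::prime_type padic set set)" and B: "B \<in> Gm m"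
  shows "C + B \<in> Gm m"
    and "n \<le> m \<Longrightarrow> coset_res n (C + B) = (coset_res n C + coset_res n B) mod CARD('p) ^ n"
proof -
  let ?x = "coset_rep C" and ?y = "coset_rep B"
  note x = coset_rep_mem[OF C] and y = coset_rep_mem[OF B]
  have xZ: "?x \<in> Zp" and yZ: "?y \<in> Zp" using GmE(1) C B x y by blast+
  have eq: "C + B = (?x + ?y) +o pZp m"
  proof (rule set_eqI)
    fix z
    have "z \<in> C + B \<longleftrightarrow> (\<exists>u\<in>C. z - u \<in> B)"
    proof
      assume "z \<in> C + B"
      then show "\<exists>u\<in>C. z - u \<in> B" by (elim set_plus_elim) (auto intro!: bexI)
    next
      assume "\<exists>u\<in>C. z - u \<in> B"
      then obtain u where "u \<in> C" "z - u \<in> B" by blast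
      from set_plus_intro[OF this] show "z \<in> C + B" by simp
    qed
    also have "\<dots> \<longleftrightarrow> padic_abs (z - (?x + ?y)) \<le> (1 / real CARD('p)) ^ m"
    proof
      assume "\<exists>u\<in>C. z - u \<in> B"
      then obtain u where u: "u \<in> C" "z - u \<in> B" by blast
      have "padic_abs (u - ?x) \<le> (1 / real CARD('p)) ^ m" "padic_abs (z - u - ?y) \<le> (1 / real CARD('p)) ^ m"
        using u GmE(2)[OF C x] GmE(2)[OF B y] by (metis mem_coset_pZp_iff)+
      from padic_abs_add_le[OF this] show "padic_abs (z - (?x + ?y)) \<le> (1 / real CARD('p)) ^ m"
        by (simp add: algebra_simps)
    next
      assume "padic_abs (z - (?x + ?y)) \<le> (1 / real CARD('p)) ^ m"
      then have "z - ?x \<in> ?y +o pZp m" by (simp add: mem_coset_pZp_iff algebra_simps)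
      then show "\<exists>u\<in>C. z - u \<in> B" using x GmE(2)[OF B y] by auto
    qed
    finally show "z \<in> C + B \<longleftrightarrow> z \<in> (?x + ?y) +o pZp m" by (simp only: mem_coset_pZp_iff)
  qed
  then show CB: "C + B \<in> Gm m" unfolding Gm_def using Zp_add[OF xZ yZ] by blast
  show "coset_res n (C + B) = (coset_res n C + coset_res n B) mod CARD('p) ^ n" if "n \<le> m"
    using coset_res_eq[OF CB set_plus_intro[OF x y] that] residue_add[OF xZ yZ] by (simp add: coset_res_def)
qed

lemma coset_res_pZp: "n \<le> m \<Longrightarrow> coset_res n (pZp m :: 'p::prime_type padic set) = 0"
proof -
  assume n: "n \<le> m"
  have "(0 :: 'p padic) \<in> pZp m" by (simp add: mem_pZp_iff)
  from coset_res_eq[OF pZp_in_Gm this n] show ?thesis using residue_of_nat[of n 0, where 'p='p] by simp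
qed

lemma Gamma_embed_coset_res:
  assumes "C \<in> (Gm m :: 'p::prime_type padic set set)"
  shows "Gamma_embed m C = of_nat (coset_res m C)"
  using Gamma_embed_eq_residue GmE(1)[OF assms coset_rep_mem[OF assms]] by (simp add: coset_res_def)

lemma residue_Gamma_embed:
  assumes "C \<in> (Gm m :: 'p::prime_type padic set set)" "n \<le> m"
  shows "residue n (Gamma_embed m C) = coset_res n C"
proof -
  have Z: "coset_rep C \<in> Zp" using GmE(1)[OF assms(1) coset_rep_mem[OF assms(1)]] .
  show ?thesis
    using residue_mod[OF Z assms(2)] by (simp add: Gamma_embed_coset_res[OF assms(1)] residue_of_nat coset_res_def)
qed

text \<open>
  Every coset of \<open>p\<^sup>m\<int>\<^sub>p\<close> in \<open>\<int>\<^sub>p\<close> is that of a unique \<open>r < p\<^sup>m\<close>; this makes fibres of residues countable by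
  counting congruent numbers.
\<close>

definition nat_coset :: "nat \<Rightarrow> nat \<Rightarrow> 'p::prime_type padic set" where
  "nat_coset m r = of_nat r +o pZp m"

lemma nat_coset_in_Gm: "nat_coset m r \<in> Gm m"
  by (auto simp: nat_coset_def Gm_def)

lemma coset_res_nat_coset: "n \<le> m \<Longrightarrow> coset_res n (nat_coset m r :: 'p::prime_type padic set) = r mod CARD('p) ^ n"
  using coset_res_eq[OF nat_coset_in_Gm, of "of_nat r" m r n]
  by (simp add: residue_of_nat nat_coset_def mem_coset_pZp_iff)

lemma nat_coset_coset_res:
  assumes "C \<in> (Gm m :: 'p::prime_type padic set set)"
  shows "nat_coset m (coset_res m C) = C"
proof -
  note x = coset_rep_mem[OF assms]
  have "padic_abs (of_nat (coset_res m C) - coset_rep C) \<le> (1 / real CARD('p)) ^ m"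
    using residue_approx[OF GmE(1)[OF assms x], of m] padic_abs_diff_commute by (metis coset_res_def)
  from coset_pZp_eqI[OF this] show ?thesis using GmE(2)[OF assms x] by (simp add: nat_coset_def)
qed

text \<open>
  A number whose residue modulo \<open>p\<^sup>n\<close> has valuation \<open>i < n\<close> has the same absolute value \<open>p\<^sup>-\<^sup>i\<close> as that residue, and
  \<open>p\<^sup>-\<^sup>i\<close> is the radius of the sphere with index \<open>m - i\<close>.
\<close>

lemma Gm_sphere_iff:
  assumes C: "C \<in> (Gm m :: 'p::prime_type padic set set)" and i: "i < n" "n \<le> m"
  shows "C \<in> Gm_sphere m (m - i) \<longleftrightarrow>
    CARD('p) ^ i dvd coset_res n C \<and> \<not> CARD('p) ^ Suc i dvd coset_res n C"
proof -
  let ?z = "coset_rep C" and ?e = "1 / real CARD('p)"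
  note z = coset_rep_mem[OF C]
  have p1: "real CARD('p) > 1" using prime_gt_1_CARD[where 'p='p] by simp
  have zZ: "?z \<in> Zp" by (rule GmE(1)[OF C z])
  have dvd: "padic_abs ?z \<le> ?e ^ k \<longleftrightarrow> CARD('p) ^ k dvd coset_res n C" if "k \<le> n" for k
  proof -
    have "padic_abs (?z - of_nat 0) \<le> ?e ^ k \<longleftrightarrow>
        int CARD('p) ^ k dvd int (residue n ?z) - int (residue n (of_nat 0 :: 'p padic))"
      by (rule padic_close_iff_residue[OF zZ of_nat_in_Zp that])
    also have "\<dots> \<longleftrightarrow> int (CARD('p) ^ k) dvd int (coset_res n C)"
      unfolding residue_of_nat by (simp add: coset_res_def)
    finally show ?thesis by (simp only: of_nat_dvd_iff of_nat_0 diff_zero)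
  qed
  have abs: "C \<in> Gm_sphere m (m - i) \<longleftrightarrow> coset_abs (pZp m) C = ?e ^ i"
    using C i p1 by (simp add: Gm_sphere_def power_int_diff power_one_over of_nat_diff power_int_minus divide_simps)
  have strict: "?e ^ Suc i < ?e ^ i" "?e ^ m \<le> ?e ^ Suc i"
    using p1 i by (auto intro!: power_strict_decreasing power_decreasing simp del: power_Suc)
  show ?thesis
  proof
    assume "C \<in> Gm_sphere m (m - i)"
    then have a: "coset_abs (pZp m) C = ?e ^ i" by (simp only: abs)
    then have "padic_abs ?z = ?e ^ i" using p1 by (auto simp: coset_abs_def split: if_splits)
    then show "CARD('p) ^ i dvd coset_res n C \<and> \<not> CARD('p) ^ Suc i dvd coset_res n C"
      using dvd[of i] dvd[of "Suc i"] i strict by auto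
  next
    assume *: "CARD('p) ^ i dvd coset_res n C \<and> \<not> CARD('p) ^ Suc i dvd coset_res n C"
    then have le: "padic_abs ?z \<le> ?e ^ i" and gt: "\<not> padic_abs ?z \<le> ?e ^ Suc i"
      using dvd[of i] dvd[of "Suc i"] i by auto
    obtain u where u: "coset_res n C = CARD('p) ^ i * u" using * by (auto simp: dvd_def)
    have "\<not> CARD('p) dvd u" using * by (auto simp: u dvd_def)
    then have "padic_abs (of_nat (coset_res n C) :: 'p padic) = ?e ^ i"
      using padic_abs_of_int_eq_1[of "int u", where 'p='p]
      by (simp add: u padic_abs_mult padic_abs_power padic_abs_prime)
    moreover have "padic_abs (?z - of_nat (coset_res n C)) \<le> ?e ^ Suc i"
    proof -
      have "?e ^ n \<le> ?e ^ Suc i" using p1 i by (intro power_decreasing) auto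
      then show ?thesis using residue_approx[OF zZ, of n] by (simp add: coset_res_def)
    qed
    ultimately have "?e ^ i \<le> max (padic_abs ?z) (padic_abs (of_nat (coset_res n C) - ?z))"
      "padic_abs (of_nat (coset_res n C) - ?z) \<le> ?e ^ Suc i"
      using padic_abs_ultrametric[of ?z "of_nat (coset_res n C) - ?z"]
        padic_abs_diff_commute[of ?z "of_nat (coset_res n C)"] by simp_all
    then have "?e ^ i \<le> padic_abs ?z" using strict by linarith
    then have "padic_abs ?z = ?e ^ i" using le strict by linarith
    moreover have "C \<noteq> pZp m"
    proof
      assume "C = pZp m"
      then have "padic_abs ?z \<le> ?e ^ m" using z mem_pZp_iff by metis
      then show False using gt strict by linarith
    qed
    ultimately show "C \<in> Gm_sphere m (m - i)" by (simp add: abs coset_abs_def)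
  qed
qed

section \<open>Residues of the random walk\<close>

text \<open>
  With \<open>q = p\<^sup>b\<close>, the probability of a step of absolute value \<open>p\<^sup>-\<^sup>i\<close>.
\<close>

definition step_sphere_prob :: "real \<Rightarrow> nat \<Rightarrow> nat \<Rightarrow> real" where
  "step_sphere_prob q m i = q ^ i * (q - 1) / (q ^ m - 1)"

lemma step_const_eq:
  assumes p: "p > 1" and b: "b > 0" and i: "i < m"
  shows "step_const p b m * real p powr (- real (m - i) * b) = step_sphere_prob (real p powr b) m i"
proof -
  let ?q = "real p powr b"
  have q0: "?q > 0" using p by simp
  have pow: "real p powr (real k * b) = ?q ^ k" for k
    using q0 by (simp add: powr_powr mult.commute flip: powr_realpow)
  have "real p powr (- real (m - i) * b) = inverse (?q ^ (m - i))"
    using pow[of "m - i"] by (simp add: powr_minus del: of_nat_diff)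
  moreover have "?q ^ m = ?q ^ i * ?q ^ (m - i)" using i by (simp flip: power_add)
  ultimately show ?thesis
    unfolding step_const_def pow step_sphere_prob_def using q0 by (simp add: field_simps)
qed

lemma card_valuation:
  assumes p: "p > 0" and i: "i < n"
  shows "card {g. g < p ^ n \<and> p ^ i dvd g \<and> \<not> p ^ Suc i dvd g} = p ^ (n - i) - p ^ (n - Suc i)"
proof -
  have dvd: "int p ^ k dvd 0 - int g \<longleftrightarrow> p ^ k dvd g" for k g
    by (metis diff_0 dvd_minus_iff of_nat_dvd_iff of_nat_power)
  have "{g. g < p ^ n \<and> p ^ i dvd g \<and> \<not> p ^ Suc i dvd g} =
      {g. g < p ^ n \<and> p ^ i dvd g} - {g. g < p ^ n \<and> p ^ Suc i dvd g}" by auto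
  moreover have "p ^ i dvd p ^ Suc i" by simp
  then have "{g. g < p ^ n \<and> p ^ Suc i dvd g} \<subseteq> {g. g < p ^ n \<and> p ^ i dvd g}" using dvd_trans by blast
  ultimately show ?thesis
    using card_dvd_diff[OF p, of i n 0] card_dvd_diff[OF p, of "Suc i" n 0] i
    by (simp only: dvd) (simp add: card_Diff_subset)
qed

context
  fixes b :: real and m n :: nat and M :: "'w measure" and X :: "'w \<Rightarrow> 'p::prime_type padic set"
  assumes P: "prob_space M" and step: "step_law b m M X" and n: "n \<le> m" and b: "b > 0"
begin

interpretation prob_space M by (rule P)

lemma step_measurable: "X \<in> M \<rightarrow>\<^sub>M count_space (Gm m)"
  using step by (simp add: step_law_def)

lemma step_in_Gm: "w \<in> space M \<Longrightarrow> X w \<in> Gm m"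
  using measurable_space[OF step_measurable] by simp

lemma step_event: "{w \<in> space M. Q (X w)} \<in> events"
proof -
  have "{w \<in> space M. Q (X w)} = X -` {C \<in> Gm m. Q C} \<inter> space M" using step_in_Gm by auto
  then show ?thesis using measurable_sets[OF step_measurable, of "{C \<in> Gm m. Q C}"] by auto
qed

lemma step_sphere_law:
  assumes "i < n"
  shows "prob {w \<in> space M. X w \<in> Gm_sphere m (m - i)} = step_sphere_prob (real CARD('p) powr b) m i"
proof -
  have "m - i \<in> {1..m}" using assms n by auto
  then have "prob {w \<in> space M. X w \<in> Gm_sphere m (m - i)} =
      step_const CARD('p) b m * real CARD('p) powr (- real (m - i) * b)"
    using step unfolding step_law_def by blast
  then show ?thesis unfolding step_const_eq[OF prime_gt_1_CARD b less_le_trans[OF assms n]] .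
qed

text \<open>
  Every residue of valuation \<open>i\<close> is the residue of \<open>p\<^bsup>m-n\<^esup>\<close> cosets, all on one sphere and hence equally likely. So
  these residues are equally likely and share the mass of the sphere.
\<close>

lemma step_residue_law_valuation:
  assumes i: "i < n" and g: "g < CARD('p) ^ n" "CARD('p) ^ i dvd g" "\<not> CARD('p) ^ Suc i dvd g"
  shows "prob {w \<in> space M. coset_res n (X w) = g} =
    step_sphere_prob (real CARD('p) powr b) m i / (real CARD('p) ^ (n - i) - real CARD('p) ^ (n - Suc i))"
proof -
  let ?V = "{g. g < CARD('p) ^ n \<and> CARD('p) ^ i dvd g \<and> \<not> CARD('p) ^ Suc i dvd g}"
  have p1: "CARD('p) > 1" by (rule prime_gt_1_CARD)
  have sphere: "nat_coset m r \<in> (Gm_sphere m (m - i) :: 'p padic set set) \<longleftrightarrow> r mod CARD('p) ^ n \<in> ?V" for r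
    using p1 by (simp add: Gm_sphere_iff[OF nat_coset_in_Gm i n] coset_res_nat_coset[OF n])
  define \<kappa> where "\<kappa> = prob {w \<in> space M. X w = nat_coset m g}"
  have const: "prob {w \<in> space M. X w = nat_coset m r} = \<kappa>" if "r mod CARD('p) ^ n \<in> ?V" for r
  proof -
    have "m - i \<in> {1..m}" using i n by auto
    moreover have "nat_coset m r \<in> (Gm_sphere m (m - i) :: 'p padic set set)" using that by (simp only: sphere)
    moreover have "nat_coset m g \<in> (Gm_sphere m (m - i) :: 'p padic set set)"
      unfolding sphere using g by simp
    ultimately show ?thesis using step unfolding step_law_def \<kappa>_def by blast
  qed
  have fibre: "prob {w \<in> space M. coset_res n (X w) = h} = real (CARD('p) ^ (m - n)) * \<kappa>" if h: "h \<in> ?V" for h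
  proof -
    let ?R = "{r. r < CARD('p) ^ m \<and> int CARD('p) ^ n dvd int h - int r}"
    have R: "r \<in> ?R \<longleftrightarrow> r < CARD('p) ^ m \<and> r mod CARD('p) ^ n = h" for r
    proof -
      have "int CARD('p) ^ n dvd int h - int r \<longleftrightarrow> int r mod int (CARD('p) ^ n) = int h mod int (CARD('p) ^ n)"
        by (simp add: mod_eq_dvd_iff dvd_diff_commute)
      also have "\<dots> \<longleftrightarrow> r mod CARD('p) ^ n = h mod CARD('p) ^ n" by (simp only: zmod_int[symmetric] of_nat_eq_iff)
      also have "h mod CARD('p) ^ n = h" using h by simp
      finally show ?thesis by (simp only: mem_Collect_eq)
    qed
    have inj: "r = r'" if "nat_coset m r = (nat_coset m r' :: 'p padic set)" "r < CARD('p) ^ m" "r' < CARD('p) ^ m" for r r'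
    proof -
      have "coset_res m (nat_coset m r :: 'p padic set) = coset_res m (nat_coset m r' :: 'p padic set)"
        by (simp only: that(1))
      then show ?thesis using that(2,3) by (simp only: coset_res_nat_coset[OF order_refl] mod_less)
    qed
    have "{w \<in> space M. coset_res n (X w) = h} = (\<Union>r\<in>?R. {w \<in> space M. X w = nat_coset m r})"
    proof (intro set_eqI iffI)
      fix w assume w: "w \<in> {w \<in> space M. coset_res n (X w) = h}"
      let ?r = "coset_res m (X w)"
      have G: "X w \<in> Gm m" using w step_in_Gm by simp
      have "?r mod CARD('p) ^ n = h"
        using w coset_res_nat_coset[OF n, of ?r, where 'p='p] nat_coset_coset_res[OF G] by simp
      then have "?r \<in> ?R" using coset_res_less[OF G, of m] by (simp only: R)
      moreover have "X w = nat_coset m ?r" using nat_coset_coset_res[OF G] by simp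
      ultimately show "w \<in> (\<Union>r\<in>?R. {w \<in> space M. X w = nat_coset m r})" using w by blast
    next
      fix w assume "w \<in> (\<Union>r\<in>?R. {w \<in> space M. X w = nat_coset m r})"
      then obtain r where "r \<in> ?R" "w \<in> space M" "X w = nat_coset m r" by blast
      then show "w \<in> {w \<in> space M. coset_res n (X w) = h}" by (simp only: R) (simp add: coset_res_nat_coset[OF n])
    qed
    then have "prob {w \<in> space M. coset_res n (X w) = h} = prob (\<Union>r\<in>?R. {w \<in> space M. X w = nat_coset m r})" by simp
    also have "\<dots> = (\<Sum>r\<in>?R. prob {w \<in> space M. X w = nat_coset m r})"
    proof (rule finite_measure_finite_Union)
      show "disjoint_family_on (\<lambda>r. {w \<in> space M. X w = nat_coset m r}) ?R"
        using inj by (auto simp: disjoint_family_on_def)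
    qed (auto intro: step_event)
    also have "\<dots> = (\<Sum>r\<in>?R. \<kappa>)"
      by (intro sum.cong refl const) (use h in \<open>simp only: R\<close>)
    also have "\<dots> = real (CARD('p) ^ (m - n)) * \<kappa>"
      using p1 by (simp only: sum_constant card_dvd_diff[OF _ n])
    finally show ?thesis .
  qed
  have "{w \<in> space M. X w \<in> Gm_sphere m (m - i)} = (\<Union>h\<in>?V. {w \<in> space M. coset_res n (X w) = h})"
    using Gm_sphere_iff[OF step_in_Gm i n] coset_res_less[OF step_in_Gm] by auto
  then have "step_sphere_prob (real CARD('p) powr b) m i = prob (\<Union>h\<in>?V. {w \<in> space M. coset_res n (X w) = h})"
    using step_sphere_law[OF i] by simp
  also have "\<dots> = (\<Sum>h\<in>?V. prob {w \<in> space M. coset_res n (X w) = h})"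
  proof (rule finite_measure_finite_Union)
    show "disjoint_family_on (\<lambda>h. {w \<in> space M. coset_res n (X w) = h}) ?V" by (auto simp: disjoint_family_on_def)
  qed (auto intro: step_event)
  also have "\<dots> = real (card ?V) * (real (CARD('p) ^ (m - n)) * \<kappa>)"
    using fibre by simp
  also have "real (card ?V) = real CARD('p) ^ (n - i) - real CARD('p) ^ (n - Suc i)"
  proof -
    have "CARD('p) ^ (n - Suc i) \<le> CARD('p) ^ (n - i)" using p1 by (intro power_increasing) auto
    then show ?thesis using card_valuation[OF _ i, of "CARD('p)"] p1 by (simp add: of_nat_diff)
  qed
  finally have "step_sphere_prob (real CARD('p) powr b) m i =
      (real CARD('p) ^ (n - i) - real CARD('p) ^ (n - Suc i)) * prob {w \<in> space M. coset_res n (X w) = g}"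
    using fibre[of g] g by simp
  moreover have "real CARD('p) ^ (n - Suc i) < real CARD('p) ^ (n - i)"
    using p1 i by (intro power_strict_increasing) auto
  ultimately show ?thesis by simp
qed

lemma prob_step_nonzero:
  "prob {w \<in> space M. coset_res n (X w) \<noteq> 0} = (\<Sum>i<n. step_sphere_prob (real CARD('p) powr b) m i)"
proof -
  have p1: "CARD('p) > 1" by (rule prime_gt_1_CARD)
  have eq: "{w \<in> space M. coset_res n (X w) \<noteq> 0} = (\<Union>i<n. {w \<in> space M. X w \<in> Gm_sphere m (m - i)})"
  proof (intro set_eqI iffI)
    fix w assume w: "w \<in> {w \<in> space M. coset_res n (X w) \<noteq> 0}"
    then obtain i where "i < n" "CARD('p) ^ i dvd coset_res n (X w)" "\<not> CARD('p) ^ Suc i dvd coset_res n (X w)"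
      using dvd_power_cases[OF p1, of "coset_res n (X w)" n] coset_res_less[OF step_in_Gm] by auto
    then show "w \<in> (\<Union>i<n. {w \<in> space M. X w \<in> Gm_sphere m (m - i)})"
      using w Gm_sphere_iff[OF step_in_Gm _ n] by auto
  next
    fix w assume "w \<in> (\<Union>i<n. {w \<in> space M. X w \<in> Gm_sphere m (m - i)})"
    then obtain i where i: "i < n" "w \<in> space M" "X w \<in> Gm_sphere m (m - i)" by auto
    then have "\<not> CARD('p) ^ Suc i dvd coset_res n (X w)" using Gm_sphere_iff[OF step_in_Gm[OF i(2)] i(1) n] by blast
    then show "w \<in> {w \<in> space M. coset_res n (X w) \<noteq> 0}" using i by (metis (mono_tags, lifting) dvd_0_right mem_Collect_eq)
  qed
  have "prob {w \<in> space M. coset_res n (X w) \<noteq> 0} = (\<Sum>i<n. prob {w \<in> space M. X w \<in> Gm_sphere m (m - i)})"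
    unfolding eq
  proof (rule finite_measure_finite_Union)
    show "disjoint_family_on (\<lambda>i. {w \<in> space M. X w \<in> Gm_sphere m (m - i)}) {..<n}"
      unfolding disjoint_family_on_def
    proof (intro ballI impI equals0I)
      fix i j w assume ij: "i \<in> {..<n}" "j \<in> {..<n}" "i \<noteq> j"
        and "w \<in> {w \<in> space M. X w \<in> Gm_sphere m (m - i)} \<inter> {w \<in> space M. X w \<in> Gm_sphere m (m - j)}"
      then have w: "w \<in> space M" "X w \<in> Gm_sphere m (m - i)" "X w \<in> Gm_sphere m (m - j)" by auto
      have dvd: "CARD('p) ^ i dvd coset_res n (X w)" "CARD('p) ^ j dvd coset_res n (X w)"
        "\<not> CARD('p) ^ Suc i dvd coset_res n (X w)" "\<not> CARD('p) ^ Suc j dvd coset_res n (X w)"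
        using Gm_sphere_iff[OF step_in_Gm[OF w(1)] _ n] ij w by blast+
      have "Suc i \<le> j \<or> Suc j \<le> i" using ij(3) by auto
      then show False using dvd le_imp_power_dvd dvd_trans by metis
    qed
  qed (auto intro: step_event)
  then show ?thesis by (simp add: step_sphere_law)
qed

lemma step_residue_law:
  assumes g: "g < CARD('p) ^ n"
  shows "prob {w \<in> space M. coset_res n (X w) = g} =
    (\<Sum>j\<le>n. sphere_eigenvalue CARD('p) (step_sphere_prob (real CARD('p) powr b) m) j *
      shell_wt CARD('p) n j (int g))"
proof (cases "g = 0")
  case True
  have "{w \<in> space M. coset_res n (X w) = 0} = space M - {w \<in> space M. coset_res n (X w) \<noteq> 0}" by auto
  then have "prob {w \<in> space M. coset_res n (X w) = 0} = 1 - (\<Sum>i<n. step_sphere_prob (real CARD('p) powr b) m i)"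
    using prob_compl[OF step_event[of "\<lambda>C. coset_res n C \<noteq> 0"]] by (simp only: prob_step_nonzero)
  then show ?thesis using True by (simp add: radial_sum_at_0[OF prime_gt_1_CARD])
next
  case False
  then obtain i where i: "i < n" "CARD('p) ^ i dvd g" "\<not> CARD('p) ^ Suc i dvd g"
    using dvd_power_cases[OF prime_gt_1_CARD _ g] by blast
  then show ?thesis
    using step_residue_law_valuation[OF i(1) g i(2,3)] radial_sum_at_valuation[OF prime_gt_1_CARD i] by simp
qed

end

lemma random_walk_in_Gm:
  fixes X S :: "nat \<Rightarrow> 'w \<Rightarrow> 'p::prime_type padic set"
  assumes rw: "random_walk b m M S\<^sub>0 X S" and w: "w \<in> space M" and n: "n \<le> m"
  shows "S k w \<in> Gm m"
    and "coset_res n (S k w) = (coset_res n (S\<^sub>0 w) + (\<Sum>i\<in>{0<..k}. coset_res n (X i w))) mod CARD('p) ^ n"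
proof -
  have S0: "S\<^sub>0 w \<in> Gm m" using rw w by (auto simp: random_walk_def dest: measurable_space)
  have X: "X i w \<in> Gm m" if "i \<ge> 1" for i
    using rw w that measurable_space[of "X i" M "count_space (Gm m)" w] by (auto simp: random_walk_def step_law_def)
  have S: "S k w = S\<^sub>0 w + (\<Sum>i=1..k. X i w)" for k using rw w by (auto simp: random_walk_def)
  have "S k w \<in> Gm m \<and>
    coset_res n (S k w) = (coset_res n (S\<^sub>0 w) + (\<Sum>i\<in>{0<..k}. coset_res n (X i w))) mod CARD('p) ^ n"
  proof (induction k)
    case 0
    show ?case using S0 coset_res_less[OF S0, of n] by (simp add: S)
  next
    case (Suc k)
    have "S (Suc k) w = S k w + X (Suc k) w" by (simp add: S add.assoc)
    moreover have "{0<..Suc k} = insert (Suc k) {0<..k}" by auto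
    ultimately show ?case
      using Suc Gm_add(1)[of "S k w" m "X (Suc k) w"] Gm_add(2)[of "S k w" m "X (Suc k) w" n] X[of "Suc k"] n by (simp add: mod_simps ac_simps)
  qed
  then show "S k w \<in> Gm m"
    "coset_res n (S k w) = (coset_res n (S\<^sub>0 w) + (\<Sum>i\<in>{0<..k}. coset_res n (X i w))) mod CARD('p) ^ n"
    by blast+
qed

lemma random_walk_residue_walk:
  fixes X S :: "nat \<Rightarrow> 'w \<Rightarrow> 'p::prime_type padic set"
  assumes rw: "random_walk b m M S\<^sub>0 X S" and n: "n \<le> m" and b: "b > 0"
  shows "residue_walk M (\<lambda>i w. coset_res n (X i w)) CARD('p) n
    (sphere_eigenvalue CARD('p) (step_sphere_prob (real CARD('p) powr b) m))"
proof -
  have P: "prob_space M" using rw by (simp add: random_walk_def)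
  interpret prob_space M by (rule P)
  have step: "step_law b m M (X i)" if "i \<ge> 1" for i using rw that by (simp add: random_walk_def)
  show ?thesis
  proof
    show "1 < CARD('p)" by (rule prime_gt_1_CARD)
    have "indep_vars (\<lambda>_. count_space (Gm m)) X {1..}" using rw by (simp add: random_walk_def)
    then show "indep_vars (\<lambda>_. count_space UNIV) (\<lambda>i w. coset_res n (X i w)) {1..}"
      by (rule indep_vars_compose2) simp
    show "coset_res n (X i w) < CARD('p) ^ n" if "1 \<le> i" "w \<in> space M" for i w
      using coset_res_less[OF step_in_Gm[OF P step n b]] that by blast
    show "prob {w \<in> space M. coset_res n (X i w) = g} =
        (\<Sum>j\<le>n. sphere_eigenvalue CARD('p) (step_sphere_prob (real CARD('p) powr b) m) j * shell_wt CARD('p) n j (int g))"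
      if "1 \<le> i" "g < CARD('p) ^ n" for i g
      by (rule step_residue_law[OF P step[OF that(1)] n b that(2)])
  qed
qed

section \<open>Scaling limit of the eigenvalues\<close>

text \<open>
  The constants \<open>c\<^sub>j\<close> in the eigenvalues \<open>1 - c\<^sub>j / (q\<^sup>m - 1)\<close> of a step.
\<close>

definition eigen_rate :: "nat \<Rightarrow> real \<Rightarrow> nat \<Rightarrow> real" where
  "eigen_rate p q j = (if j = 0 then 0 else q ^ j - 1 + q ^ (j - 1) * (q - 1) / (real p - 1))"

lemma sum_step_sphere_prob: "(\<Sum>i<n. step_sphere_prob q m i) = (q ^ n - 1) / (q ^ m - 1)"
proof -
  have "(\<Sum>i<n. q ^ i * (q - 1)) = q ^ n - 1"
    by (induction n) (simp_all add: algebra_simps)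
  then show ?thesis by (simp add: step_sphere_prob_def flip: sum_divide_distrib)
qed

lemma sphere_eigenvalue_step:
  "sphere_eigenvalue p (step_sphere_prob q m) j = 1 - eigen_rate p q j / (q ^ m - 1)"
  unfolding sphere_eigenvalue_def sum_step_sphere_prob
  by (simp add: eigen_rate_def step_sphere_prob_def add_divide_distrib)

text \<open>
  The definition of \<open>\<beta>\<close> is exactly what makes \<open>c\<^sub>j = \<beta> q\<^sup>j - 1\<close> hold for all \<open>j > 0\<close>.
\<close>

lemma eigen_rate_scaled:
  assumes p: "p > 1" and b: "b > 0" and j: "j > 0"
  shows "D / bm_beta p b * eigen_rate p (real p powr b) j = D * ((real p ^ j) powr b - inverse (bm_beta p b))"
proof -
  let ?q = "real p powr b"
  have q0: "?q > 0" using p by simp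
  have p1: "real p - 1 > 0" using p by simp
  have "real p powr (b + 1) > 1" using p b by (intro gr_one_powr) auto
  then have beta0: "bm_beta p b > 0" using p q0 by (simp add: bm_beta_def)
  have "real p powr (b + 1) = real p * ?q" using p by (simp add: powr_add)
  then have beta: "bm_beta p b * (?q * (real p - 1)) = real p * ?q - 1"
    using p1 q0 by (simp add: bm_beta_def)
  have qj: "(real p ^ j) powr b = ?q ^ j"
    using p by (simp add: powr_powr mult.commute flip: powr_realpow)
  obtain k where k: "j = Suc k" using j by (cases j) auto
  have rate: "eigen_rate p ?q j = bm_beta p b * ?q ^ j - 1"
  proof -
    have "bm_beta p b * ?q ^ j * (real p - 1) = (real p * ?q - 1) * ?q ^ k"
      unfolding beta[symmetric] by (simp add: k)
    moreover have "eigen_rate p ?q j * (real p - 1) = (?q ^ j - 1) * (real p - 1) + ?q ^ k * (?q - 1)"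
      using p1 by (simp add: eigen_rate_def k distrib_right)
    ultimately have "eigen_rate p ?q j * (real p - 1) = (bm_beta p b * ?q ^ j - 1) * (real p - 1)"
      by (simp add: k algebra_simps)
    then show ?thesis using p1 by simp
  qed
  show ?thesis unfolding rate qj using beta0 by (simp add: field_simps)
qed

text \<open>
  Since \<open>|ln (1 - \<delta>) + \<delta>| \<le> 2 \<delta>\<^sup>2\<close>, the logarithm of the power differs from \<open>- k \<delta>\<close> by at most \<open>2 (k \<delta>) \<delta>\<close>.
\<close>

lemma one_minus_power_tendsto_exp:
  fixes \<delta> :: "nat \<Rightarrow> real" and k :: "nat \<Rightarrow> nat"
  assumes \<delta>: "\<delta> \<longlonglongrightarrow> 0" and k: "(\<lambda>m. real (k m) * \<delta> m) \<longlonglongrightarrow> x"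
  shows "(\<lambda>m. (1 - \<delta> m) ^ k m) \<longlonglongrightarrow> exp (- x)"
proof -
  have small: "eventually (\<lambda>m. \<bar>\<delta> m\<bar> < 1 / 2) sequentially"
    using tendstoD[OF \<delta>, of "1 / 2"] by (simp add: dist_real_def)
  have "(\<lambda>m. real (k m) * ln (1 - \<delta> m) + real (k m) * \<delta> m) \<longlonglongrightarrow> 0"
  proof (rule Lim_null_comparison)
    show "eventually (\<lambda>m. norm (real (k m) * ln (1 - \<delta> m) + real (k m) * \<delta> m) \<le>
        2 * (\<bar>real (k m) * \<delta> m\<bar> * \<bar>\<delta> m\<bar>)) sequentially"
      using small
    proof eventually_elim
      case (elim m)
      have "\<bar>ln (1 + (- \<delta> m)) - (- \<delta> m)\<bar> \<le> 2 * (- \<delta> m)\<^sup>2"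
        using elim by (intro abs_ln_one_plus_x_minus_x_bound) simp
      then have "real (k m) * \<bar>ln (1 - \<delta> m) + \<delta> m\<bar> \<le> real (k m) * (2 * (\<delta> m)\<^sup>2)"
        by (intro mult_left_mono) simp_all
      moreover have "real (k m) * ln (1 - \<delta> m) + real (k m) * \<delta> m = real (k m) * (ln (1 - \<delta> m) + \<delta> m)"
        by (simp add: distrib_left)
      moreover have "real (k m) * (2 * (\<delta> m)\<^sup>2) = 2 * (\<bar>real (k m) * \<delta> m\<bar> * \<bar>\<delta> m\<bar>)"
        by (simp add: abs_mult power2_eq_square)
      ultimately show ?case by (simp add: abs_mult)
    qed
    show "(\<lambda>m. 2 * (\<bar>real (k m) * \<delta> m\<bar> * \<bar>\<delta> m\<bar>)) \<longlonglongrightarrow> 0"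
      using tendsto_mult[OF tendsto_const[of 2] tendsto_mult[OF tendsto_rabs[OF k] tendsto_rabs[OF \<delta>]]] by simp
  qed
  from tendsto_diff[OF this k] have "(\<lambda>m. real (k m) * ln (1 - \<delta> m)) \<longlonglongrightarrow> - x" by simp
  then have "(\<lambda>m. exp (real (k m) * ln (1 - \<delta> m))) \<longlonglongrightarrow> exp (- x)" by (rule tendsto_exp)
  moreover have "eventually (\<lambda>m. exp (real (k m) * ln (1 - \<delta> m)) = (1 - \<delta> m) ^ k m) sequentially"
    using small by eventually_elim (simp add: exp_of_nat_mult)
  ultimately show ?thesis by (rule Lim_transform_eventually)
qed

lemma time_scale_eq:
  assumes "p > 1"
  shows "time_scale p b D m = D / bm_beta p b * (real p powr b) ^ m"
proof -
  have "real p powr (real m * b) = (real p powr b) ^ m"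
    using assms by (simp add: powr_powr mult.commute flip: powr_realpow)
  then show ?thesis by (simp add: time_scale_def)
qed

context
  fixes p :: nat and b D :: real
  assumes p: "p > 1" and b: "b > 0" and D: "D > 0"
begin

lemma powr_gt_1: "real p powr b > 1"
  using p b by (intro gr_one_powr) auto

lemma bm_beta_pos: "bm_beta p b > 0"
proof -
  have "real p powr (b + 1) > 1" using p b by (intro gr_one_powr) auto
  then show ?thesis using p by (simp add: bm_beta_def)
qed

lemma power_m_at_top: "filterlim (\<lambda>m. (real p powr b) ^ m) at_top sequentially"
proof (rule filterlim_at_infinity_imp_filterlim_at_top)
  show "filterlim (\<lambda>m. (real p powr b) ^ m) at_infinity sequentially"
    using powr_gt_1 by (intro filterlim_realpow_sequentially_gt1) simp
  show "eventually (\<lambda>m. (real p powr b) ^ m > 0) sequentially"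
    using powr_gt_1 p by (intro always_eventually allI zero_less_power) simp
qed

lemma time_scale_at_top: "filterlim (\<lambda>m. time_scale p b D m) at_top sequentially"
  unfolding time_scale_eq[OF p]
  by (rule filterlim_tendsto_pos_mult_at_top[OF tendsto_const _ power_m_at_top]) (use D bm_beta_pos in simp)

lemma time_scale_pos: "time_scale p b D m > 0"
  unfolding time_scale_eq[OF p] using p D bm_beta_pos powr_gt_1
  by (intro mult_pos_pos divide_pos_pos zero_less_power) linarith+

lemma over_power_null: "(\<lambda>m. c / ((real p powr b) ^ m - 1)) \<longlonglongrightarrow> 0"
proof (rule real_tendsto_divide_at_top[OF tendsto_const])
  show "filterlim (\<lambda>m. (real p powr b) ^ m - 1) at_top sequentially"
    using filterlim_tendsto_add_at_top[OF tendsto_const[of "-1"] power_m_at_top] by simp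
qed

lemma time_scale_over_power:
  "(\<lambda>m. time_scale p b D m * (c / ((real p powr b) ^ m - 1))) \<longlonglongrightarrow> D / bm_beta p b * c"
proof -
  let ?q = "real p powr b"
  have "(\<lambda>m. D / bm_beta p b * c * (1 + 1 / (?q ^ m - 1))) \<longlonglongrightarrow> D / bm_beta p b * c * (1 + 0)"
    by (intro tendsto_intros over_power_null)
  moreover have "eventually (\<lambda>m. D / bm_beta p b * c * (1 + 1 / (?q ^ m - 1)) =
      time_scale p b D m * (c / (?q ^ m - 1))) sequentially"
    using eventually_gt_at_top[of 0]
  proof eventually_elim
    case (elim m)
    have "?q ^ m > 1" using powr_gt_1 elim by (intro one_less_power) auto
    then have "1 + 1 / (?q ^ m - 1) = ?q ^ m / (?q ^ m - 1)" by (simp add: field_simps)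
    then show ?case by (simp add: time_scale_eq[OF p])
  qed
  ultimately show ?thesis by (simp add: Lim_transform_eventually)
qed

lemma eigenvalue_power_tendsto:
  fixes k :: "nat \<Rightarrow> nat"
  assumes k: "(\<lambda>m. real (k m) / time_scale p b D m) \<longlonglongrightarrow> t"
  shows "(\<lambda>m. sphere_eigenvalue p (step_sphere_prob (real p powr b) m) j ^ k m) \<longlonglongrightarrow> radial_phi p b D t j"
proof -
  let ?q = "real p powr b" and ?r = "eigen_rate p (real p powr b) j"
  have "(\<lambda>m. (real (k m) / time_scale p b D m) * (time_scale p b D m * (?r / (?q ^ m - 1)))) \<longlonglongrightarrow>
      t * (D / bm_beta p b * ?r)"
    by (intro tendsto_mult k time_scale_over_power)
  also have "(\<lambda>m. (real (k m) / time_scale p b D m) * (time_scale p b D m * (?r / (?q ^ m - 1)))) =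
      (\<lambda>m. real (k m) * (?r / (?q ^ m - 1)))"
    using time_scale_pos by (simp add: less_imp_neq[symmetric])
  finally have "(\<lambda>m. real (k m) * (?r / (?q ^ m - 1))) \<longlonglongrightarrow> t * (D / bm_beta p b * ?r)" .
  from one_minus_power_tendsto_exp[OF over_power_null this]
  have "(\<lambda>m. sphere_eigenvalue p (step_sphere_prob ?q m) j ^ k m) \<longlonglongrightarrow> exp (- (t * (D / bm_beta p b * ?r)))"
    by (simp only: sphere_eigenvalue_step)
  also have "exp (- (t * (D / bm_beta p b * ?r))) = radial_phi p b D t j"
  proof (cases "j = 0")
    case False
    then have "D / bm_beta p b * ?r = D * ((real p ^ j) powr b - inverse (bm_beta p b))"
      by (intro eigen_rate_scaled p b) simp
    then show ?thesis using False by (simp only: radial_phi_def) (simp add: mult_ac)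
  qed (simp add: radial_phi_def eigen_rate_def)
  finally show ?thesis .
qed

lemma floor_steps_tendsto:
  assumes "0 \<le> s" "s \<le> t"
  shows "(\<lambda>m. real (nat \<lfloor>t * time_scale p b D m\<rfloor> - nat \<lfloor>s * time_scale p b D m\<rfloor>) / time_scale p b D m) \<longlonglongrightarrow> t - s"
proof -
  let ?L = "time_scale p b D"
  have diff: "real (nat \<lfloor>t * ?L m\<rfloor> - nat \<lfloor>s * ?L m\<rfloor>) = of_int \<lfloor>t * ?L m\<rfloor> - of_int \<lfloor>s * ?L m\<rfloor>" for m
  proof -
    have "s * ?L m \<le> t * ?L m" using assms time_scale_pos[of m] by (intro mult_right_mono) auto
    then have "\<lfloor>s * ?L m\<rfloor> \<le> \<lfloor>t * ?L m\<rfloor>" by (rule floor_mono)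
    moreover have "0 \<le> \<lfloor>s * ?L m\<rfloor>" using assms time_scale_pos[of m] by simp
    moreover from calculation have "0 \<le> \<lfloor>t * ?L m\<rfloor>" by linarith
    ultimately show ?thesis by (simp add: of_nat_diff nat_mono)
  qed
  have "(\<lambda>m. real (nat \<lfloor>t * ?L m\<rfloor> - nat \<lfloor>s * ?L m\<rfloor>) / ?L m - (t - s)) \<longlonglongrightarrow> 0"
  proof (rule Lim_null_comparison)
    show "eventually (\<lambda>m. norm (real (nat \<lfloor>t * ?L m\<rfloor> - nat \<lfloor>s * ?L m\<rfloor>) / ?L m - (t - s)) \<le> 1 / ?L m) sequentially"
    proof (intro always_eventually allI)
      fix m
      have L: "?L m > 0" by (rule time_scale_pos)
      have "real (nat \<lfloor>t * ?L m\<rfloor> - nat \<lfloor>s * ?L m\<rfloor>) / ?L m - (t - s) =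
          (of_int \<lfloor>t * ?L m\<rfloor> - of_int \<lfloor>s * ?L m\<rfloor> - (t * ?L m - s * ?L m)) / ?L m"
        unfolding diff using L by (simp add: field_simps)
      moreover have "\<bar>of_int \<lfloor>t * ?L m\<rfloor> - of_int \<lfloor>s * ?L m\<rfloor> - (t * ?L m - s * ?L m)\<bar> \<le> 1"
        by linarith
      ultimately show "norm (real (nat \<lfloor>t * ?L m\<rfloor> - nat \<lfloor>s * ?L m\<rfloor>) / ?L m - (t - s)) \<le> 1 / ?L m"
        using L by (simp add: abs_divide divide_right_mono del: of_nat_diff)
    qed
    show "(\<lambda>m. 1 / ?L m) \<longlonglongrightarrow> 0"
      by (rule real_tendsto_divide_at_top[OF tendsto_const time_scale_at_top])
  qed
  then show ?thesis by (simp only: LIM_zero_iff)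
qed

lemma walk_trans_tendsto:
  assumes "0 \<le> s" "s \<le> t"
  shows "(\<lambda>m. \<Sum>j\<le>n. sphere_eigenvalue p (step_sphere_prob (real p powr b) m) j ^
        (nat \<lfloor>t * time_scale p b D m\<rfloor> - nat \<lfloor>s * time_scale p b D m\<rfloor>) * shell_wt p n j d)
    \<longlonglongrightarrow> bm_trans p b D (t - s) n d"
  unfolding bm_trans_def
  by (intro tendsto_sum tendsto_mult_right eigenvalue_power_tendsto floor_steps_tendsto assms)

end

text \<open>
  Turns an event on the positions of a walk into one on its increments, which are independent.
\<close>

lemma residues_iff_increments:
  fixes A \<Delta> :: "nat \<Rightarrow> nat"
  assumes A: "\<And>i. A (Suc i) = A i + \<Delta> i" and A0: "A 0 = 0" and p: "p > 0" and g: "\<And>i. i \<le> N \<Longrightarrow> g i < p ^ n"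
  shows "(\<forall>i\<le>N. A i mod p ^ n = g i) \<longleftrightarrow>
    g 0 = 0 \<and> (\<forall>i<N. int p ^ n dvd (int (g (Suc i)) - int (g i)) - int (\<Delta> i))"
  using g
proof (induction N)
  case 0
  then show ?case using A0 by auto
next
  case (Suc N)
  have dvd: "int p ^ n dvd (int (g (Suc N)) - int (g N)) - int (\<Delta> N) \<longleftrightarrow> A (Suc N) mod p ^ n = g (Suc N)"
    if "A N mod p ^ n = g N"
  proof -
    have "int p ^ n dvd (int (g (Suc N)) - int (g N)) - int (\<Delta> N) \<longleftrightarrow>
        int (g (Suc N)) mod int (p ^ n) = (int (g N) + int (\<Delta> N)) mod int (p ^ n)"
      by (simp add: mod_eq_dvd_iff algebra_simps)
    also have "\<dots> \<longleftrightarrow> g (Suc N) mod p ^ n = (g N + \<Delta> N) mod p ^ n"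
      by (simp only: of_nat_add[symmetric] zmod_int[symmetric] of_nat_eq_iff)
    also have "(g N + \<Delta> N) mod p ^ n = A (Suc N) mod p ^ n" by (simp add: A mod_add_left_eq flip: that)
    also have "g (Suc N) mod p ^ n = g (Suc N)" using Suc.prems[of "Suc N"] by simp
    finally show ?thesis by auto
  qed
  have IH: "(\<forall>i\<le>N. A i mod p ^ n = g i) \<longleftrightarrow>
    g 0 = 0 \<and> (\<forall>i<N. int p ^ n dvd (int (g (Suc i)) - int (g i)) - int (\<Delta> i))"
    using Suc by simp
  show ?case
    unfolding le_Suc_eq less_Suc_eq using dvd IH by blast
qed

section \<open>Measurability in Skorohod space\<close>

lemma identity_time_change: "(\<lambda>t. t) \<in> time_changes"
proof -
  have "bdd_above (log_slopes (\<lambda>t. t))"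
    by (rule bdd_aboveI[of _ 0]) (auto simp: log_slopes_def)
  then show ?thesis by (auto simp: time_changes_def strict_mono_on_def)
qed

lemma skorohod_cost_nonneg: "0 \<le> skorohod_cost x y \<theta>"
proof -
  have "0 \<le> (LBINT u:{0..}. exp (- u) * skorohod_gap x y \<theta> u)"
    unfolding set_lebesgue_integral_def by (rule integral_nonneg_AE) (auto simp: skorohod_gap_bounds)
  then show ?thesis by (simp add: skorohod_cost_def le_max_iff_disj)
qed

lemma skorohod_dist_lessE:
  assumes "skorohod_dist x y < e"
  obtains \<theta> where "\<theta> \<in> time_changes" "skorohod_cost x y \<theta> < e"
proof -
  have "bdd_below (skorohod_cost x y ` time_changes)"
    by (rule bdd_belowI[of _ 0]) (auto simp: skorohod_cost_nonneg)
  then have "\<exists>\<theta>\<in>time_changes. skorohod_cost x y \<theta> < e"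
    using assms identity_time_change unfolding skorohod_dist_def by (subst (asm) cINF_less_iff) auto
  then show thesis using that by blast
qed

lemma time_change_facts:
  assumes "\<theta> \<in> time_changes"
  shows "\<theta> 0 = 0" and "0 \<le> s \<Longrightarrow> s < t \<Longrightarrow> \<theta> s < \<theta> t" and "0 \<le> s \<Longrightarrow> 0 \<le> \<theta> s"
    and "0 < s \<Longrightarrow> \<bar>ln (\<theta> s / s)\<bar> \<le> skorohod_gamma \<theta>"
proof -
  have im: "\<theta> ` {0..} = {0..}" using assms by (simp add: time_changes_def)
  show mono: "\<theta> s < \<theta> t" if "0 \<le> s" "s < t" for s t
    using assms that by (auto simp: time_changes_def strict_mono_on_def)
  show nonneg: "0 \<le> \<theta> s" if "0 \<le> s" for s using that im by auto
  obtain t where t: "t \<ge> 0" "\<theta> t = 0" using im by (metis atLeast_iff image_iff order_refl)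
  then show 0: "\<theta> 0 = 0" using mono[of 0 t] nonneg[of 0] by (cases "t = 0") auto
  assume s: "0 < s"
  then have "\<bar>ln ((\<theta> s - \<theta> 0) / (s - 0))\<bar> \<in> log_slopes \<theta>" unfolding log_slopes_def by blast
  then show "\<bar>ln (\<theta> s / s)\<bar> \<le> skorohod_gamma \<theta>"
    unfolding skorohod_gamma_def using assms 0 by (auto intro!: cSup_upper simp: time_changes_def)
qed

text \<open>
  A small cost bounds the integral of the gap, so the gap is small at some stopping level \<open>u\<close> in \<open>[T, T + 1]\<close>.
  If \<open>T\<close> lies beyond \<open>s\<close> and its time change, stopping has no effect at \<open>s\<close>, and \<open>r\<close> can be taken to be the
  changed time of \<open>s\<close>. The bound on the logarithmic slopes gives \<open>|r - s| < e\<close>.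
\<close>

lemma skorohod_close_value:
  fixes x :: "real \<Rightarrow> 'a::metric_space"
  assumes x: "x \<in> skorohod_space E" and s: "s \<ge> 0" and e: "0 < e" "e < 1"
  obtains c where "c > 0" "\<And>y. y \<in> skorohod_space E \<Longrightarrow> skorohod_dist x y < c \<Longrightarrow>
    \<exists>r\<ge>0. \<bar>r - s\<bar> < e \<and> dist (x s) (y r) < e"
proof -
  define T where "T = s + 1"
  have T: "T > 0" "s < T" using s by (auto simp: T_def)
  \<comment> \<open>The first bound keeps the changed time within \<open>e\<close>; the second is \<open>e\<close> times the least weight \<open>exp (- u)\<close> on \<open>[T, T + 1]\<close>.\<close>
  define c where "c = min (ln (1 + e / T)) (exp (- (T + 1)) * e)"
  have eT: "1 + e / T > 1" using e T by simp
  show thesis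
  proof (rule that[of c])
    show "c > 0" unfolding c_def using eT e by (simp only: min_less_iff_conj ln_gt_zero) simp
    fix y assume y: "y \<in> skorohod_space E" and d: "skorohod_dist x y < c"
    obtain \<theta> where \<theta>: "\<theta> \<in> time_changes" "skorohod_cost x y \<theta> < c" using d by (rule skorohod_dist_lessE)
    have \<gamma>: "skorohod_gamma \<theta> < ln (1 + e / T)"
      and int: "(LBINT u:{0..}. exp (- u) * skorohod_gap x y \<theta> u) < exp (- (T + 1)) * e"
      using \<theta>(2) by (auto simp: skorohod_cost_def c_def)
    define r where "r = \<theta> s"
    have r0: "r \<ge> 0" unfolding r_def by (rule time_change_facts(3)[OF \<theta>(1) s])
    have rs: "\<bar>r - s\<bar> < e"
    proof (cases "s = 0")
      case True
      then show ?thesis using time_change_facts(1)[OF \<theta>(1)] e by (simp add: r_def)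
    next
      case False
      then have s0: "s > 0" using s by simp
      have rpos: "r > 0" using time_change_facts(1,2)[OF \<theta>(1)] s0 unfolding r_def by (metis order_refl)
      have "\<bar>ln (r / s)\<bar> < ln (1 + e / T)" using time_change_facts(4)[OF \<theta>(1) s0] \<gamma> by (simp add: r_def)
      then have "ln (r / s) < ln (1 + e / T)" "ln (s / r) < ln (1 + e / T)"
        using s0 rpos by (simp_all add: ln_div abs_less_iff)
      then have "r / s < 1 + e / T" "s / r < 1 + e / T"
        using s0 rpos eT by (simp_all add: ln_less_cancel_iff)
      then have "r < s + s * (e / T)" "s < r + r * (e / T)"
        using s0 rpos by (simp_all add: pos_divide_less_eq algebra_simps)
      moreover have small: "u * (e / T) < e" if "u < T" for u
        using that T e by (simp add: pos_divide_less_eq mult.commute)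
      moreover have "r < T" using calculation(1) small[OF T(2)] e by (simp add: T_def)
      ultimately show ?thesis using small[OF T(2)] small[of r] by linarith
    qed
    have "\<exists>u\<in>{T..T + 1}. skorohod_gap x y \<theta> u < e"
    proof (rule ccontr)
      assume "\<not> ?thesis"
      then have ge: "e \<le> skorohod_gap x y \<theta> u" if "u \<in> {T..T + 1}" for u using that by force
      note gi = skorohod_gap_set_integrable[OF x y \<theta>(1)]
      have "exp (- (T + 1)) * e = (LBINT u:{T..T + 1}. exp (- (T + 1)) * e)"
        by (simp add: set_lebesgue_integral_def)
      also have "\<dots> \<le> (LBINT u:{T..T + 1}. exp (- u) * skorohod_gap x y \<theta> u)"
      proof (rule set_integral_mono)
        show "set_integrable lborel {T..T + 1} (\<lambda>u. exp (- (T + 1)) * e)"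
          by (simp add: set_integrable_def)
        show "set_integrable lborel {T..T + 1} (\<lambda>u. exp (- u) * skorohod_gap x y \<theta> u)"
          by (rule set_integrable_subset[OF gi]) (use T in auto)
        show "exp (- (T + 1)) * e \<le> exp (- u) * skorohod_gap x y \<theta> u" if "u \<in> {T..T + 1}" for u
          using that e ge by (intro mult_mono) auto
      qed
      also have "\<dots> \<le> (LBINT u:{0..}. exp (- u) * skorohod_gap x y \<theta> u)"
        unfolding set_lebesgue_integral_def
      proof (rule integral_mono)
        show "integrable lborel (\<lambda>u. indicator {T..T + 1} u *\<^sub>R (exp (- u) * skorohod_gap x y \<theta> u))"
          using set_integrable_subset[OF gi, of "{T..T + 1}"] T by (auto simp: set_integrable_def)
        show "integrable lborel (\<lambda>u. indicator {0..} u *\<^sub>R (exp (- u) * skorohod_gap x y \<theta> u))"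
          using gi by (simp add: set_integrable_def)
        show "indicator {T..T + 1} u *\<^sub>R (exp (- u) * skorohod_gap x y \<theta> u) \<le>
            indicator {0..} u *\<^sub>R (exp (- u) * skorohod_gap x y \<theta> u)" for u
          using T by (auto simp: indicator_def skorohod_gap_bounds)
      qed
      finally show False using int by simp
    qed
    then obtain u where u: "T \<le> u" "skorohod_gap x y \<theta> u < e" by auto
    have "min s u = s" "min r u = r" using u rs e by (auto simp: T_def)
    moreover have "min 1 (dist (x (min s u)) (y (min (\<theta> s) u))) \<le> skorohod_gap x y \<theta> u"
      unfolding skorohod_gap_def by (rule cSUP_upper) (use s in \<open>auto intro!: bdd_aboveI[of _ 1]\<close>)
    ultimately have "min 1 (dist (x s) (y r)) < e" using u(2) by (simp add: r_def)
    then have "dist (x s) (y r) < e" using e by (simp add: min_def split: if_splits)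
    then show "\<exists>r\<ge>0. \<bar>r - s\<bar> < e \<and> dist (x s) (y r) < e" using r0 rs by blast
  qed
qed

abbreviation path_space :: "(real \<Rightarrow> 'p::prime_type padic) set" where
  "path_space \<equiv> skorohod_space Zp"

abbreviation path_topology :: "(real \<Rightarrow> 'p::prime_type padic) topology" where
  "path_topology \<equiv> skorohod_topology Zp"

lemma path_in_Zp: "\<omega> \<in> path_space \<Longrightarrow> t \<ge> 0 \<Longrightarrow> \<omega> t \<in> Zp"
  by (auto simp: skorohod_space_def PiE_def Pi_def)

lemma residue_eq_if_close:
  fixes x y :: "'p::prime_type padic"
  assumes "x \<in> Zp" "y \<in> Zp" "dist x y < (1 / real CARD('p)) ^ n"
  shows "residue n y = residue n x"
  using residue_eq_iff[OF assms(1,2), of n] assms(3) by (simp add: dist_padic_def)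

lemma residue_right_constant:
  fixes \<omega> :: "real \<Rightarrow> 'p::prime_type padic"
  assumes "\<omega> \<in> path_space" "t \<ge> 0"
  obtains d where "d > 0" "\<And>s. t \<le> s \<Longrightarrow> s < t + d \<Longrightarrow> residue n (\<omega> s) = residue n (\<omega> t)"
proof -
  have e: "(1 / real CARD('p)) ^ n > 0" using prime_gt_1_CARD[where 'p='p] by simp
  have "(\<omega> \<longlongrightarrow> \<omega> t) (at_right t)" using assms by (auto simp: skorohod_space_def)
  from tendstoD[OF this e] obtain b where b: "b > t" "\<And>s. t < s \<Longrightarrow> s < b \<Longrightarrow> dist (\<omega> s) (\<omega> t) < (1 / real CARD('p)) ^ n"
    unfolding eventually_at_right_field by blast
  show thesis
  proof (rule that[of "b - t"])
    fix s assume s: "t \<le> s" "s < t + (b - t)"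
    show "residue n (\<omega> s) = residue n (\<omega> t)"
    proof (cases "s = t")
      case False
      then show ?thesis
        using s assms b(2)[of s] residue_eq_if_close[OF path_in_Zp[of \<omega> t] path_in_Zp[of \<omega> s], of n]
        by (simp add: dist_commute)
    qed simp
  qed (use b in simp)
qed

lemma topspace_path_topology: "topspace path_topology = path_space"
  unfolding skorohod_topology_def using Metric_space.topspace_mtopology[OF Metric_space_skorohod] by blast

lemma space_path_borel: "space (topology_borel path_topology) = path_space"
  unfolding topology_borel_def by (simp add: topspace_path_topology space_measure_of_conv)

lemma sets_path_borel:
  "sets (topology_borel path_topology) =
    sigma_sets path_space {U. openin (path_topology :: (real \<Rightarrow> 'a::prime_type padic) topology) U}"
proof -
  have "{U. openin path_topology U} \<subseteq> Pow (topspace (path_topology :: (real \<Rightarrow> 'a padic) topology))"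
    using openin_subset by blast
  then show ?thesis unfolding topology_borel_def by (simp add: topspace_path_topology)
qed

lemma openin_path_borel: "openin path_topology U \<Longrightarrow> U \<in> sets (topology_borel path_topology)"
  unfolding sets_path_borel by (rule sigma_sets.Basic) simp

text \<open>
  A path outside this set has another residue at some time in the open interval. By
  \<open>skorohod_close_value\<close>, every close path attains nearly the same value, hence the same residue, at a nearby time, which
  still lies in the interval. So the set is closed. Evaluations at a fixed time are not continuous in
  the Skorohod topology, but right-continuity expresses them through such sets.
\<close>

lemma constant_residue_measurable:
  fixes r n :: nat
  assumes a: "a \<ge> 0"
  shows "{\<omega> \<in> path_space. \<forall>s. a < s \<and> s < c \<longrightarrow> residue n (\<omega> s :: 'p::prime_type padic) = r} \<in> sets (topology_borel path_topology)"
    (is "?F \<in> _")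
proof -
  interpret sk: Metric_space "path_space :: (real \<Rightarrow> 'p padic) set" skorohod_dist by (rule Metric_space_skorohod)
  have "openin path_topology (path_space - ?F)"
    unfolding skorohod_topology_def sk.openin_mtopology
  proof (intro conjI allI impI)
    fix \<omega> assume "\<omega> \<in> path_space - ?F"
    then obtain s where \<omega>: "\<omega> \<in> path_space" and s: "a < s" "s < c" "residue n (\<omega> s) \<noteq> r" by auto
    define e where "e = Min {(1 / real CARD('p)) ^ n, s - a, c - s, 1 / 2}"
    have e: "0 < e" "e < 1" "e \<le> (1 / real CARD('p)) ^ n" "e \<le> s - a" "e \<le> c - s"
      using s prime_gt_1_CARD[where 'p='p] by (auto simp: e_def)
    have "0 \<le> s" using a s by simp
    then obtain k where k: "k > 0" "\<And>y. y \<in> path_space \<Longrightarrow> skorohod_dist \<omega> y < k \<Longrightarrow>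
      \<exists>r\<ge>0. \<bar>r - s\<bar> < e \<and> dist (\<omega> s) (y r) < e"
      using skorohod_close_value[OF \<omega> _ e(1,2), of s] by blast
    have "sk.mball \<omega> k \<subseteq> path_space - ?F"
    proof
      fix y assume "y \<in> sk.mball \<omega> k"
      then have y: "y \<in> path_space" "skorohod_dist \<omega> y < k" by (auto simp: sk.in_mball)
      then obtain t where t: "t \<ge> 0" "\<bar>t - s\<bar> < e" "dist (\<omega> s) (y t) < e" using k(2) by blast
      have "residue n (y t) = residue n (\<omega> s)"
        using t e \<omega> y \<open>0 \<le> s\<close> by (intro residue_eq_if_close path_in_Zp) auto
      moreover have "a < t" "t < c" using t(2) e by (auto simp: abs_less_iff)
      ultimately show "y \<in> path_space - ?F" using s y by auto
    qed
    then show "\<exists>r>0. sk.mball \<omega> r \<subseteq> path_space - ?F" using k(1) by blast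
  qed auto
  then have "path_space - ?F \<in> sets (topology_borel path_topology)" by (rule openin_path_borel)
  then have "space (topology_borel path_topology) - (path_space - ?F) \<in> sets (topology_borel path_topology)"
    by (rule sets.compl_sets)
  also have "space (topology_borel path_topology) - (path_space - ?F) = ?F" by (auto simp: space_path_borel)
  finally show ?thesis .
qed

lemma residue_event_measurable:
  fixes r n :: nat
  assumes t: "t \<ge> 0"
  shows "{\<omega> \<in> path_space. residue n (\<omega> t :: 'p::prime_type padic) = r} \<in> sets (topology_borel path_topology)"
proof -
  let ?F = "\<lambda>k. {\<omega> \<in> path_space. \<forall>s. t < s \<and> s < t + 1 / real (Suc k) \<longrightarrow> residue n (\<omega> s :: 'p padic) = r}"
  have "{\<omega> \<in> path_space. residue n (\<omega> t :: 'p padic) = r} = (\<Union>k. ?F k)"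
  proof (intro set_eqI iffI)
    fix \<omega> :: "real \<Rightarrow> 'p padic" assume "\<omega> \<in> {\<omega> \<in> path_space. residue n (\<omega> t) = r}"
    then have \<omega>: "\<omega> \<in> path_space" "residue n (\<omega> t) = r" by auto
    obtain d where d: "d > 0" "\<And>s. t \<le> s \<Longrightarrow> s < t + d \<Longrightarrow> residue n (\<omega> s) = residue n (\<omega> t)"
      by (rule residue_right_constant[OF \<omega>(1) t]) (rule that)
    obtain k where k: "1 / real (Suc k) < d" by (rule nat_approx_posE[OF d(1)]) (rule that)
    have "residue n (\<omega> s) = r" if "t < s" "s < t + 1 / real (Suc k)" for s
      using d(2)[of s] that k \<omega>(2) by linarith
    then show "\<omega> \<in> (\<Union>k. ?F k)" using \<omega>(1) by blast
  next
    fix \<omega> :: "real \<Rightarrow> 'p padic" assume "\<omega> \<in> (\<Union>k. ?F k)"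
    then obtain k where \<omega>: "\<omega> \<in> path_space" "\<And>s. t < s \<Longrightarrow> s < t + 1 / real (Suc k) \<Longrightarrow> residue n (\<omega> s) = r"
      by auto
    obtain d where d: "d > 0" "\<And>s. t \<le> s \<Longrightarrow> s < t + d \<Longrightarrow> residue n (\<omega> s) = residue n (\<omega> t)"
      by (rule residue_right_constant[OF \<omega>(1) t]) (rule that)
    define e where "e = min d (1 / real (Suc k))"
    have e: "0 < e" "e \<le> d" "e \<le> 1 / real (Suc k)" using d(1) by (auto simp: e_def)
    define s where "s = t + e / 2"
    have "t < s" "s < t + d" "s < t + 1 / real (Suc k)" using e by (simp_all add: s_def)
    then show "\<omega> \<in> {\<omega> \<in> path_space. residue n (\<omega> t) = r}" using \<omega> d(2)[of s] by auto
  qed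
  also have "\<dots> \<in> sets (topology_borel path_topology)"
    by (intro sets.countable_UN image_subsetI constant_residue_measurable t)
  finally show ?thesis .
qed

text \<open>
  The residue classes form a countable base of the topology.
\<close>

lemma measurable_Zp_residue:
  fixes f :: "'a \<Rightarrow> 'p::prime_type padic"
  assumes f: "\<And>w. w \<in> space M \<Longrightarrow> f w \<in> Zp"
    and meas: "\<And>n r. {w \<in> space M. residue n (f w) = r} \<in> sets M"
  shows "f \<in> M \<rightarrow>\<^sub>M Zp_borel"
  unfolding Zp_borel_def
proof (rule measurable_restrict_space2)
  show "f \<in> space M \<rightarrow> Zp" using f by auto
  show "f \<in> borel_measurable M"
  proof (rule borel_measurableI)
    fix U :: "'p padic set" assume U: "open U"
    define I where "I = {(n, r). res_ball n r \<subseteq> U}"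
    have "f -` U \<inter> space M = (\<Union>(n, r)\<in>I. {w \<in> space M. residue n (f w) = r})"
    proof (intro set_eqI iffI)
      fix w assume w: "w \<in> f -` U \<inter> space M"
      then obtain e where e: "e > 0" "ball (f w) e \<subseteq> U" using U openE by blast
      obtain n where n: "(1 / real CARD('p)) ^ n < e"
        using real_arch_pow_inv[OF e(1), of "1 / real CARD('p)"] prime_gt_1_CARD[where 'p='p] by auto
      have "res_ball n (residue n (f w)) \<subseteq> U"
      proof
        fix x :: "'p padic" assume "x \<in> res_ball n (residue n (f w))"
        then have "padic_abs (f w - x) \<le> (1 / real CARD('p)) ^ n"
          using residue_eq_iff[OF f, of w x n] w by (auto simp: res_ball_def)
        then show "x \<in> U" using n e(2) by (auto simp: dist_padic_def ball_def)
      qed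
      then show "w \<in> (\<Union>(n, r)\<in>I. {w \<in> space M. residue n (f w) = r})" using w by (auto simp: I_def)
    next
      fix w assume "w \<in> (\<Union>(n, r)\<in>I. {w \<in> space M. residue n (f w) = r})"
      then obtain n where "w \<in> space M" "res_ball n (residue n (f w)) \<subseteq> U" by (auto simp: I_def)
      then show "w \<in> f -` U \<inter> space M" using f by (auto simp: res_ball_def)
    qed
    also have "\<dots> \<in> sets M"
      using meas by (intro sets.countable_UN') auto
    finally show "f -` U \<inter> space M \<in> sets M" .
  qed
qed

locale path_law = prob_space Q for Q :: "(real \<Rightarrow> 'p::prime_type padic) measure" +
  assumes sets_law: "sets Q = sets (topology_borel path_topology)"
begin

lemma space_law [simp]: "space Q = path_space"
  using sets_eq_imp_space_eq[OF sets_law] space_path_borel by simp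

lemma residue_event: "t \<ge> 0 \<Longrightarrow> {\<omega> \<in> path_space. residue n (\<omega> t) = r} \<in> events"
  unfolding sets_law by (rule residue_event_measurable)

lemma evaluation_measurable: "t \<ge> 0 \<Longrightarrow> (\<lambda>\<omega>. \<omega> t) \<in> Q \<rightarrow>\<^sub>M Zp_borel"
  using residue_event by (intro measurable_Zp_residue) (auto intro: path_in_Zp)

end

section \<open>The distance between a path and its samples\<close>

text \<open>
  A right-continuous path with discrete values that changes at most once in each interval of
  length \<open>\<delta>\<close> up to time \<open>T\<close>, and not at all in \<open>[0, \<delta>]\<close>. It will be sampled with mesh \<open>h = \<delta>/L\<close>.
\<close>

locale sparse_jumps =
  fixes \<xi> :: "real \<Rightarrow> 'b" and T \<delta> :: real and L :: nat
  assumes right_constant: "\<And>t. t \<ge> 0 \<Longrightarrow> \<exists>d>0. \<forall>s. t \<le> s \<and> s < t + d \<longrightarrow> \<xi> s = \<xi> t"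
    and \<delta>: "\<delta> > 0" and L: "L \<ge> 4"
    and start: "\<And>s. 0 \<le> s \<Longrightarrow> s \<le> \<delta> \<Longrightarrow> \<xi> s = \<xi> 0"
    and sparse: "\<And>r s t. 0 \<le> r \<Longrightarrow> r < s \<Longrightarrow> s < t \<Longrightarrow> t \<le> T \<Longrightarrow> t - r \<le> \<delta> \<Longrightarrow> \<xi> r = \<xi> s \<or> \<xi> s = \<xi> t"
begin

definition jump :: "real \<Rightarrow> bool" where
  "jump \<tau> \<longleftrightarrow> 0 < \<tau> \<and> \<tau> \<le> T \<and> (\<exists>a. 0 \<le> a \<and> a < \<tau> \<and> (\<forall>s. a \<le> s \<and> s < \<tau> \<longrightarrow> \<xi> s \<noteq> \<xi> \<tau>))"

text \<open>
  The infimum of the times with a value different from that at \<open>s\<close> is a jump, by right-continuity.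
\<close>

lemma jump_between:
  assumes "0 \<le> s" "s \<le> t" "t \<le> T" "\<xi> s \<noteq> \<xi> t"
  shows "\<exists>\<tau>. jump \<tau> \<and> s < \<tau> \<and> \<tau> \<le> t"
proof -
  define A where "A = {v. s \<le> v \<and> v \<le> t \<and> \<xi> v \<noteq> \<xi> s}"
  define \<tau> where "\<tau> = Inf A"
  have tA: "t \<in> A" using assms by (auto simp: A_def)
  have bdd: "bdd_below A" by (rule bdd_belowI[of _ s]) (auto simp: A_def)
  have s\<tau>: "s \<le> \<tau>" unfolding \<tau>_def using tA by (intro cInf_greatest) (auto simp: A_def)
  have \<tau>t: "\<tau> \<le> t" unfolding \<tau>_def using tA bdd by (rule cInf_lower)
  have ne: "\<xi> \<tau> \<noteq> \<xi> s"
  proof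
    assume eq: "\<xi> \<tau> = \<xi> s"
    obtain d where d: "d > 0" "\<And>v. \<tau> \<le> v \<Longrightarrow> v < \<tau> + d \<Longrightarrow> \<xi> v = \<xi> \<tau>"
      using right_constant[of \<tau>] s\<tau> assms(1) by auto
    have "\<tau> + d \<le> Inf A"
    proof (rule cInf_greatest)
      fix v assume v: "v \<in> A"
      then have "\<tau> \<le> v" unfolding \<tau>_def using bdd by (rule cInf_lower)
      then show "\<tau> + d \<le> v" using d(2)[of v] v eq by (force simp: A_def)
    qed (use tA in auto)
    then show False using d(1) by (simp add: \<tau>_def)
  qed
  then have "s < \<tau>" using s\<tau> by (cases "s = \<tau>") auto
  moreover have "\<xi> v \<noteq> \<xi> \<tau>" if "s \<le> v" "v < \<tau>" for v
  proof -
    have "v \<notin> A" using cInf_lower[OF _ bdd, of v] that by (auto simp: \<tau>_def)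
    then show ?thesis using that \<tau>t ne by (auto simp: A_def)
  qed
  ultimately have "jump \<tau>" unfolding jump_def using assms \<tau>t by (intro conjI exI[of _ s]) auto
  then show ?thesis using \<open>s < \<tau>\<close> \<tau>t by blast
qed

lemma jumps_apart:
  assumes "jump \<sigma>" "jump \<tau>" "\<sigma> < \<tau>"
  shows "\<tau> - \<sigma> \<ge> \<delta>"
proof (rule ccontr)
  assume close: "\<not> ?thesis"
  obtain a where a: "0 \<le> a" "a < \<sigma>" "\<And>s. a \<le> s \<Longrightarrow> s < \<sigma> \<Longrightarrow> \<xi> s \<noteq> \<xi> \<sigma>" using assms(1) by (auto simp: jump_def)
  obtain c where c: "0 \<le> c" "c < \<tau>" "\<And>s. c \<le> s \<Longrightarrow> s < \<tau> \<Longrightarrow> \<xi> s \<noteq> \<xi> \<tau>" using assms(2) by (auto simp: jump_def)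
  have \<tau>T: "\<tau> \<le> T" "0 < \<sigma>" using assms by (auto simp: jump_def)
  show False
  proof (cases "\<xi> \<sigma> = \<xi> \<tau>")
    case True
    \<comment> \<open>Between two equal values there is a different one just before \<open>\<tau>\<close>.\<close>
    define s where "s = max c ((\<sigma> + \<tau>) / 2)"
    have "\<sigma> < s" "s < \<tau>" "c \<le> s" using assms(3) c(2) by (auto simp: s_def less_max_iff_disj)
    then show False using sparse[of \<sigma> s \<tau>] c(3)[of s] True close \<tau>T by auto
  next
    case False
    \<comment> \<open>A time before \<open>\<sigma>\<close> with another value, still within \<open>\<delta>\<close> of \<open>\<tau>\<close>.\<close>
    define r where "r = max a (\<tau> - \<delta>)"
    have "0 \<le> r" "a \<le> r" "r < \<sigma>" "\<tau> - r \<le> \<delta>" using a(1,2) close by (auto simp: r_def)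
    then show False using sparse[of r \<sigma> \<tau>] a(3)[of r] False assms(3) \<tau>T by auto
  qed
qed

lemma jump_gt: "jump \<tau> \<Longrightarrow> \<delta> < \<tau>"
proof (rule ccontr)
  assume j: "jump \<tau>" and le: "\<not> \<delta> < \<tau>"
  obtain a where a: "0 \<le> a" "a < \<tau>" "\<And>s. a \<le> s \<Longrightarrow> s < \<tau> \<Longrightarrow> \<xi> s \<noteq> \<xi> \<tau>" using j by (auto simp: jump_def)
  then show False using start[of a] start[of \<tau>] le by force
qed

definition h :: real where "h = \<delta> / real L"

lemma h_pos: "h > 0" using \<delta> L by (simp add: h_def)

definition round_up :: "real \<Rightarrow> real" where "round_up \<tau> = h * of_int \<lceil>\<tau> / h\<rceil>"

lemma round_up: "\<tau> \<le> round_up \<tau>" "round_up \<tau> < \<tau> + h"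
proof -
  have "h * (\<tau> / h) \<le> round_up \<tau>"
    unfolding round_up_def using h_pos by (intro mult_left_mono) auto
  then show "\<tau> \<le> round_up \<tau>" using h_pos by simp
  have "round_up \<tau> < h * (\<tau> / h + 1)"
    unfolding round_up_def using h_pos by (intro mult_strict_left_mono) linarith+
  then show "round_up \<tau> < \<tau> + h" using h_pos by (simp add: distrib_left)
qed

text \<open>
  The time change adds to the identity a supremum of tents of slope \<open>1/L\<close>, one at each jump \<open>\<tau>\<close>, whose
  height is the distance from \<open>\<tau>\<close> to the next grid point. Being less than \<open>h = \<delta>/L\<close> high, a tent vanishes at
  distance \<open>\<delta>\<close>, so at the jumps themselves the tents do not interfere and each jump is moved to the grid.
\<close>

definition tent :: "real \<Rightarrow> real \<Rightarrow> real" where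
  "tent \<tau> t = max 0 (round_up \<tau> - \<tau> - \<bar>t - \<tau>\<bar> / real L)"

text \<open>
  The tent at \<open>0\<close> is the zero function on \<open>[0, \<infinity>)\<close>; it keeps the supremum defined when there are no jumps.
\<close>

definition displacement :: "real \<Rightarrow> real" where
  "displacement t = (SUP \<tau>\<in>insert 0 (Collect jump). tent \<tau> t)"

lemma tent_bounds: "0 \<le> tent \<tau> t" "tent \<tau> t \<le> h"
proof -
  have "0 \<le> \<bar>t - \<tau>\<bar> / real L" by simp
  then show "0 \<le> tent \<tau> t" "tent \<tau> t \<le> h"
    using round_up[of \<tau>] h_pos unfolding tent_def by (simp, linarith)
qed

lemma tent_le_displacement: "\<tau> \<in> insert 0 (Collect jump) \<Longrightarrow> tent \<tau> t \<le> displacement t"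
  unfolding displacement_def by (rule cSUP_upper) (auto intro!: bdd_aboveI[of _ h] simp: tent_bounds)

lemma displacement_least: "(\<And>\<tau>. \<tau> \<in> insert 0 (Collect jump) \<Longrightarrow> tent \<tau> t \<le> B) \<Longrightarrow> displacement t \<le> B"
  unfolding displacement_def by (rule cSUP_least) auto

lemma displacement_bounds: "0 \<le> displacement t" "displacement t \<le> h"
  using order_trans[OF tent_bounds(1) tent_le_displacement[of 0 t]] by (auto intro: displacement_least tent_bounds)

lemma displacement_lipschitz: "\<bar>displacement t - displacement s\<bar> \<le> \<bar>t - s\<bar> / real L"
proof -
  have le: "displacement t \<le> displacement s + \<bar>t - s\<bar> / real L" for s t
  proof (rule displacement_least)
    fix \<tau> assume \<tau>: "\<tau> \<in> insert 0 (Collect jump)"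
    have "\<bar>s - \<tau>\<bar> / real L \<le> (\<bar>t - \<tau>\<bar> + \<bar>t - s\<bar>) / real L" by (intro divide_right_mono) auto
    moreover have "0 \<le> \<bar>t - s\<bar> / real L" by simp
    ultimately have "tent \<tau> t \<le> tent \<tau> s + \<bar>t - s\<bar> / real L"
      unfolding tent_def by (auto simp: add_divide_distrib max_def)
    then show "tent \<tau> t \<le> displacement s + \<bar>t - s\<bar> / real L" using tent_le_displacement[OF \<tau>, of s] by linarith
  qed
  show ?thesis using le[of t s] le[of s t] by (simp add: abs_le_iff abs_minus_commute)
qed

lemma tent_far: "\<bar>t - \<tau>\<bar> \<ge> \<delta> \<Longrightarrow> tent \<tau> t = 0"
proof -
  assume "\<bar>t - \<tau>\<bar> \<ge> \<delta>"
  then have "h \<le> \<bar>t - \<tau>\<bar> / real L" unfolding h_def by (intro divide_right_mono) auto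
  then show ?thesis using round_up(2)[of \<tau>] by (simp add: tent_def)
qed

lemma tent_0: "t \<ge> 0 \<Longrightarrow> tent 0 t = 0"
  by (simp add: tent_def round_up_def)

lemma displacement_0: "displacement 0 = 0"
proof (rule antisym[OF displacement_least displacement_bounds(1)])
  fix \<tau> assume "\<tau> \<in> insert 0 (Collect jump)"
  then show "tent \<tau> 0 \<le> 0" using tent_far[of 0 \<tau>] tent_0[of 0] jump_gt[of \<tau>] \<delta> by auto
qed

lemma displacement_jump:
  assumes j: "jump \<tau>"
  shows "displacement \<tau> = round_up \<tau> - \<tau>"
proof (rule antisym[OF displacement_least])
  have "tent \<tau> \<tau> = round_up \<tau> - \<tau>" using round_up(1)[of \<tau>] by (simp add: tent_def)
  then show "round_up \<tau> - \<tau> \<le> displacement \<tau>" using tent_le_displacement[of \<tau> \<tau>] j by simp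
  fix \<sigma> assume "\<sigma> \<in> insert 0 (Collect jump)"
  then consider "\<sigma> = 0" | "\<sigma> = \<tau>" | "jump \<sigma>" "\<sigma> \<noteq> \<tau>" by auto
  then show "tent \<sigma> \<tau> \<le> round_up \<tau> - \<tau>"
  proof cases
    case 1
    then show ?thesis using tent_0[of \<tau>] round_up(1)[of \<tau>] j by (simp add: jump_def)
  next
    case 2
    then show ?thesis using \<open>tent \<tau> \<tau> = round_up \<tau> - \<tau>\<close> by simp
  next
    case 3
    then have "\<bar>\<tau> - \<sigma>\<bar> \<ge> \<delta>" using jumps_apart[of \<sigma> \<tau>] jumps_apart[of \<tau> \<sigma>] j by linarith
    then show ?thesis using tent_far round_up(1)[of \<tau>] by simp
  qed
qed

definition \<theta> :: "real \<Rightarrow> real" where "\<theta> t = t + displacement t"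

lemma \<theta>_bounds: "t \<le> \<theta> t" "\<theta> t \<le> t + h"
  using displacement_bounds[of t] by (auto simp: \<theta>_def)

lemma \<theta>_slope:
  assumes "s < t"
  shows "\<bar>(\<theta> t - \<theta> s) / (t - s) - 1\<bar> \<le> 1 / real L"
proof -
  have "(\<theta> t - \<theta> s) / (t - s) - 1 = (displacement t - displacement s) / (t - s)"
    using assms by (simp add: \<theta>_def field_simps)
  also have "\<bar>\<dots>\<bar> = \<bar>displacement t - displacement s\<bar> / (t - s)" using assms by simp
  also have "\<dots> \<le> (t - s) / real L / (t - s)"
    using displacement_lipschitz[of t s] assms by (intro divide_right_mono) auto
  also have "\<dots> = 1 / real L" using assms by simp
  finally show ?thesis .
qed

lemma \<theta>_mono: assumes "s < t" shows "\<theta> s < \<theta> t"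
proof -
  have "1 / real L \<le> 1 / 4" using L by simp
  then have "(\<theta> t - \<theta> s) / (t - s) > 0" using \<theta>_slope[OF assms] by linarith
  then show ?thesis using assms by (simp add: zero_less_divide_iff)
qed

lemma \<theta>_log_slope: assumes "s < t" shows "\<bar>ln ((\<theta> t - \<theta> s) / (t - s))\<bar> \<le> 2 / real L"
proof -
  define x where "x = (\<theta> t - \<theta> s) / (t - s) - 1"
  have L4: "1 / real L \<le> 1 / 4" using L by simp
  have x: "\<bar>x\<bar> \<le> 1 / real L" unfolding x_def by (rule \<theta>_slope[OF assms])
  have "\<bar>ln (1 + x) - x\<bar> \<le> 2 * x\<^sup>2" using x L4 by (intro abs_ln_one_plus_x_minus_x_bound) linarith
  moreover have "2 * x\<^sup>2 \<le> \<bar>x\<bar>"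
  proof -
    have "\<bar>x\<bar> * (2 * \<bar>x\<bar>) \<le> \<bar>x\<bar> * 1" using x L4 by (intro mult_left_mono) linarith+
    then show ?thesis by (simp add: power2_eq_square)
  qed
  moreover have "2 / real L = 1 / real L + 1 / real L" by simp
  ultimately have "\<bar>ln (1 + x)\<bar> \<le> 2 / real L" using x by linarith
  then show ?thesis by (simp add: x_def)
qed

lemma \<theta>_time_change: "\<theta> \<in> time_changes" "skorohod_gamma \<theta> \<le> 2 / real L"
proof -
  have cont: "continuous_on A \<theta>" for A
  proof -
    have "isCont \<theta> t" for t
    proof -
      have "(\<lambda>s. \<bar>s - t\<bar> / real L) \<midarrow>t\<rightarrow> 0"
        by (rule tendsto_eq_intros refl | use L in simp)+
      then have "(\<lambda>s. displacement s - displacement t) \<midarrow>t\<rightarrow> 0"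
        by (rule Lim_null_comparison[rotated]) (simp add: displacement_lipschitz)
      then have "displacement \<midarrow>t\<rightarrow> displacement t" by (simp add: LIM_zero_iff)
      then show ?thesis unfolding isCont_def \<theta>_def by (intro tendsto_intros)
    qed
    then show ?thesis by (simp add: continuous_at_imp_continuous_on)
  qed
  have \<theta>0: "\<theta> 0 = 0" by (simp add: \<theta>_def displacement_0)
  have "\<theta> ` {0..} = {0..}"
  proof (intro set_eqI iffI)
    fix v assume "v \<in> \<theta> ` {0..}"
    then show "v \<in> {0..}" using \<theta>_bounds(1) by (auto intro: order_trans)
  next
    fix v :: real assume v: "v \<in> {0..}"
    have "\<exists>t. 0 \<le> t \<and> t \<le> v \<and> \<theta> t = v"
      using v \<theta>_bounds(1)[of v] \<theta>0 cont[of "{0..v}"] by (intro IVT') auto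
    then show "v \<in> \<theta> ` {0..}" by auto
  qed
  moreover have "bdd_above (log_slopes \<theta>)"
    by (rule bdd_aboveI[of _ "2 / real L"]) (auto simp: log_slopes_def \<theta>_log_slope)
  ultimately show "\<theta> \<in> time_changes" using \<theta>_mono by (auto simp: time_changes_def strict_mono_on_def)
  have "\<bar>ln ((\<theta> 1 - \<theta> 0) / (1 - 0))\<bar> \<in> log_slopes \<theta>"
    unfolding log_slopes_def by (intro CollectI exI[of _ 0] exI[of _ 1]) simp
  then show "skorohod_gamma \<theta> \<le> 2 / real L"
    unfolding skorohod_gamma_def by (intro cSup_least) (auto simp: log_slopes_def \<theta>_log_slope)
qed

definition grid :: "real \<Rightarrow> real" where "grid s = h * of_int \<lfloor>s / h\<rfloor>"

lemma grid: "grid s \<le> s" "s < grid s + h" "s \<ge> 0 \<Longrightarrow> 0 \<le> grid s"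
proof -
  have "grid s \<le> h * (s / h)"
    unfolding grid_def using h_pos by (intro mult_left_mono) auto
  then show "grid s \<le> s" using h_pos by simp
  have "h * (s / h) < h * (of_int \<lfloor>s / h\<rfloor> + 1)" using h_pos by (intro mult_strict_left_mono) linarith+
  then show "s < grid s + h" using h_pos by (simp add: grid_def distrib_left)
  show "s \<ge> 0 \<Longrightarrow> 0 \<le> grid s" using h_pos by (simp add: grid_def)
qed

lemma grid_le_grid:
  assumes "h * of_int k \<le> s" shows "h * of_int k \<le> grid s"
proof -
  have "of_int k \<le> s / h" using assms h_pos by (simp add: field_simps)
  then have "k \<le> \<lfloor>s / h\<rfloor>" by linarith
  then show ?thesis using h_pos by (simp add: grid_def)
qed

text \<open>
  A jump between \<open>t\<close> and the last grid point before the changed time of \<open>t\<close> would be carried to a grid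
  point on the wrong side of that changed time, because the time change is increasing.
\<close>

lemma sampled_value:
  assumes t: "t \<ge> 0" "\<theta> t \<le> T"
  shows "\<xi> (grid (\<theta> t)) = \<xi> t"
proof (rule ccontr)
  assume ne: "\<xi> (grid (\<theta> t)) \<noteq> \<xi> t"
  have \<theta>0: "0 \<le> \<theta> t" using \<theta>_bounds(1)[of t] t by simp
  have \<theta>j: "\<theta> \<tau> = round_up \<tau>" if "jump \<tau>" for \<tau> using displacement_jump[OF that] by (simp add: \<theta>_def)
  consider "grid (\<theta> t) \<le> t" | "t < grid (\<theta> t)" by linarith
  then show False
  proof cases
    case 1
    have "t \<le> T" using \<theta>_bounds(1)[of t] t by simp
    then obtain \<tau> where \<tau>: "jump \<tau>" "grid (\<theta> t) < \<tau>" "\<tau> \<le> t"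
      using jump_between[OF grid(3)[OF \<theta>0] 1 _ ne] by blast
    have "\<theta> \<tau> \<le> \<theta> t" using \<theta>_mono[of \<tau> t] \<tau>(3) by (cases "\<tau> = t") auto
    then have "round_up \<tau> \<le> grid (\<theta> t)" unfolding \<theta>j[OF \<tau>(1)] round_up_def by (rule grid_le_grid)
    then show False using round_up(1)[of \<tau>] \<tau>(2) by simp
  next
    case 2
    have "grid (\<theta> t) \<le> T" using grid(1)[of "\<theta> t"] t by simp
    then obtain \<tau> where \<tau>: "jump \<tau>" "t < \<tau>" "\<tau> \<le> grid (\<theta> t)"
      using jump_between[of t "grid (\<theta> t)"] 2 t ne by auto
    have "round_up \<tau> \<le> grid (\<theta> t)"
    proof -
      have "\<tau> / h \<le> of_int \<lfloor>\<theta> t / h\<rfloor>" using \<tau>(3) h_pos by (simp add: grid_def field_simps)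
      then have "\<lceil>\<tau> / h\<rceil> \<le> \<lfloor>\<theta> t / h\<rfloor>" by (simp add: ceiling_le_iff)
      then show ?thesis using h_pos by (simp add: round_up_def grid_def)
    qed
    then have "\<theta> \<tau> \<le> \<theta> t" using grid(1)[of "\<theta> t"] by (simp add: \<theta>j[OF \<tau>(1)])
    then show False using \<theta>_mono[OF \<tau>(2)] by simp
  qed
qed

text \<open>
  Stopping at \<open>u\<close> can only separate the two paths when \<open>t\<close> lies before \<open>u\<close> and its changed time after \<open>u\<close>;
  then \<open>t\<close> and the last grid point before \<open>u\<close> are both within \<open>h\<close> of \<open>u\<close>, where the path does not jump.
\<close>

lemma sampled_value_stopped:
  assumes u: "0 \<le> u" "u \<le> T" and t: "t \<ge> 0" and no: "\<And>\<tau>. jump \<tau> \<Longrightarrow> u \<notin> {\<tau>..<\<tau> + h}"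
  shows "\<xi> (grid (min (\<theta> t) u)) = \<xi> (min t u)"
proof (cases "\<theta> t \<le> u")
  case True
  then show ?thesis using sampled_value[OF t] u \<theta>_bounds(1)[of t] by (simp add: min_def)
next
  case False
  have const: "\<xi> v = \<xi> w" if vw: "0 \<le> v" "v \<le> w" "u - h < v" "w \<le> u" for v w
  proof (rule ccontr)
    assume "\<xi> v \<noteq> \<xi> w"
    then obtain \<tau> where "jump \<tau>" "v < \<tau>" "\<tau> \<le> w" using jump_between[of v w] vw u by auto
    then show False using no[of \<tau>] vw by auto
  qed
  have tu: "0 \<le> min t u" "min t u > u - h" "min t u \<le> u"
    using False \<theta>_bounds(2)[of t] h_pos t u by auto
  have gu: "0 \<le> grid u" "grid u > u - h" "grid u \<le> u" using grid[of u] u by auto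
  consider "grid u \<le> min t u" | "min t u \<le> grid u" by linarith
  then have "\<xi> (grid u) = \<xi> (min t u)"
  proof cases
    case 1
    then show ?thesis using const[OF gu(1) 1 gu(2) tu(3)] by simp
  next
    case 2
    then show ?thesis using const[OF tu(1) 2 tu(2) gu(3)] by simp
  qed
  then show ?thesis using False by simp
qed

lemma finite_jumps:
  assumes R: "T = real R * \<delta>"
  shows "finite (Collect jump)" "card (Collect jump) \<le> R"
proof -
  define f where "f \<tau> = nat \<lceil>\<tau> / \<delta>\<rceil>" for \<tau>
  have inj: "inj_on f (Collect jump)"
  proof (rule inj_onI)
    fix \<sigma> \<tau> assume st: "\<sigma> \<in> Collect jump" "\<tau> \<in> Collect jump" "f \<sigma> = f \<tau>"
    then have "\<sigma> / \<delta> > 0" "\<tau> / \<delta> > 0" using \<delta> by (auto simp: jump_def)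
    then have "\<lceil>\<sigma> / \<delta>\<rceil> = \<lceil>\<tau> / \<delta>\<rceil>" using st(3) by (simp add: f_def eq_nat_nat_iff)
    then have "\<bar>\<sigma> / \<delta> - \<tau> / \<delta>\<bar> < 1" by linarith
    then have "\<bar>\<sigma> - \<tau>\<bar> < \<delta>" using \<delta> by (simp add: abs_less_iff field_simps)
    then show "\<sigma> = \<tau>" using jumps_apart[of \<sigma> \<tau>] jumps_apart[of \<tau> \<sigma>] st by (cases \<sigma> \<tau> rule: linorder_cases) auto
  qed
  have sub: "f ` Collect jump \<subseteq> {1..R}"
  proof
    fix k assume "k \<in> f ` Collect jump"
    then obtain \<tau> where \<tau>: "jump \<tau>" "k = f \<tau>" by auto
    have "0 < \<tau>" "\<tau> \<le> T" using \<tau>(1) by (auto simp: jump_def)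
    then have "0 < \<tau> / \<delta>" "\<tau> / \<delta> \<le> real R" using \<delta> R by (simp_all add: pos_divide_le_eq)
    then have "1 \<le> \<lceil>\<tau> / \<delta>\<rceil>" "\<lceil>\<tau> / \<delta>\<rceil> \<le> int R" by linarith+
    then have "1 \<le> nat \<lceil>\<tau> / \<delta>\<rceil>" "nat \<lceil>\<tau> / \<delta>\<rceil> \<le> R" by linarith+
    then show "k \<in> {1..R}" by (simp only: \<tau>(2) f_def atLeastAtMost_iff)
  qed
  show "finite (Collect jump)" using finite_imageD[OF finite_subset[OF sub] inj] by simp
  show "card (Collect jump) \<le> R" using card_inj_on_le[OF inj sub] by simp
qed

end

lemma has_integral_exp_tail:
  "has_bochner_integral lborel (\<lambda>u. indicator {a..} u * exp (- u)) (exp (- a :: real))"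
proof -
  have "(\<integral>\<^sup>+u. ennreal (exp (- u)) * indicator {a..} u \<partial>lborel) = ennreal (0 - (- exp (- a)))"
  proof (rule nn_integral_FTC_atLeast)
    show "((\<lambda>u. - exp (- u)) \<longlongrightarrow> (0 :: real)) at_top"
      using tendsto_minus[OF filterlim_compose[OF exp_at_bot filterlim_uminus_at_bot_at_top]] by simp
  qed (auto intro!: derivative_eq_intros)
  then have "(\<integral>\<^sup>+u. ennreal (indicator {a..} u * exp (- u)) \<partial>lborel) = ennreal (exp (- a))"
    by (simp add: ennreal_mult' ennreal_indicator mult.commute)
  then show ?thesis by (intro has_bochner_integral_nn_integral) auto
qed

text \<open>
  Sampling stops after \<open>N\<close> steps, so that the path depends on finitely many values.
\<close>

definition sample_path :: "real \<Rightarrow> nat \<Rightarrow> (nat \<Rightarrow> 'a) \<Rightarrow> real \<Rightarrow> 'a" where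
  "sample_path h N c = (\<lambda>t\<in>{0..}. c (min (nat \<lfloor>t / h\<rfloor>) N))"

lemma sample_path_in_skorohod_space:
  fixes c :: "nat \<Rightarrow> 'a::metric_space"
  assumes h: "h > 0" and c: "\<And>i. c i \<in> E"
  shows "sample_path h N c \<in> skorohod_space E"
proof -
  have "(sample_path h N c \<longlongrightarrow> sample_path h N c t) (at_right t)" if t: "t \<ge> 0" for t
  proof (rule tendsto_eventually)
    have "h * (t / h) < h * (of_int \<lfloor>t / h\<rfloor> + 1)" using h by (intro mult_strict_left_mono) linarith+
    then have "t < h * (of_int \<lfloor>t / h\<rfloor> + 1)" using h by simp
    moreover have "sample_path h N c s = sample_path h N c t" if "t < s" "s < h * (of_int \<lfloor>t / h\<rfloor> + 1)" for s
    proof -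
      have "t / h \<le> s / h" "s / h < of_int \<lfloor>t / h\<rfloor> + 1" using that h by (simp_all add: divide_right_mono pos_divide_less_eq mult.commute)
      then have "\<lfloor>s / h\<rfloor> = \<lfloor>t / h\<rfloor>" by linarith
      then show ?thesis using that t by (simp add: sample_path_def)
    qed
    ultimately show "eventually (\<lambda>s. sample_path h N c s = sample_path h N c t) (at_right t)"
      unfolding eventually_at_right_field by blast
  qed
  moreover have "\<exists>l\<in>E. (sample_path h N c \<longlongrightarrow> l) (at_left t)" if t: "t > 0" for t
  proof
    let ?k = "\<lceil>t / h\<rceil> - 1"
    show "c (min (nat ?k) N) \<in> E" by (rule c)
    show "(sample_path h N c \<longlongrightarrow> c (min (nat ?k) N)) (at_left t)"
    proof (rule tendsto_eventually)
      have th: "t / h > 0" using t h by simp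
      have k: "of_int ?k < t / h" "t / h \<le> of_int ?k + 1" "0 \<le> ?k" using th by linarith+
      have "h * of_int ?k < t" using k(1) h by (simp only: pos_less_divide_eq mult.commute)
      moreover have "sample_path h N c s = c (min (nat ?k) N)" if "h * of_int ?k < s" "s < t" for s
      proof -
        have "of_int ?k \<le> s / h" "s / h < t / h"
          using that h by (simp_all only: pos_le_divide_eq mult.commute[of h] less_imp_le divide_strict_right_mono)
        then have "\<lfloor>s / h\<rfloor> = ?k" using k by linarith
        moreover have "0 \<le> h * of_int ?k" using h k(3) by simp
        ultimately show ?thesis using that by (simp add: sample_path_def)
      qed
      ultimately show "eventually (\<lambda>s. sample_path h N c s = c (min (nat ?k) N)) (at_left t)"
        unfolding eventually_at_left_field by blast
    qed
  qed
  ultimately show ?thesis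
    using c by (auto simp: skorohod_space_def sample_path_def)
qed

text \<open>
  For stopping levels \<open>u\<close> up to \<open>T = R \<delta>\<close> that are not within \<open>h\<close> after a jump, the gap is at most \<open>p\<^sup>-\<^sup>n\<close>. There are
  at most \<open>R\<close> jumps, so the exceptional levels have measure at most \<open>R h\<close>, and the levels beyond \<open>T\<close> weigh
  \<open>exp (- T)\<close>.
\<close>

lemma skorohod_dist_sample_path:
  fixes x :: "real \<Rightarrow> 'p::prime_type padic"
  assumes x: "x \<in> path_space"
    and sp: "sparse_jumps (\<lambda>t. residue n (x t)) (real R * \<delta>) \<delta> L"
  shows "skorohod_dist x (sample_path (\<delta> / real L) (R * L) (\<lambda>i. of_nat (residue n (x (real i * (\<delta> / real L))))))
    \<le> max (2 / real L) ((1 / real CARD('p)) ^ n + real R * \<delta> / real L + exp (- (real R * \<delta>)))"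
proof -
  let ?T = "real R * \<delta>" and ?e = "(1 / real CARD('p)) ^ n"
  interpret sparse_jumps "\<lambda>t. residue n (x t)" ?T \<delta> L by (rule sp)
  have hL: "\<delta> / real L = h" by (simp add: h_def)
  define y :: "real \<Rightarrow> 'p padic" where "y = sample_path h (R * L) (\<lambda>i. of_nat (residue n (x (real i * h))))"
  have y: "y \<in> path_space" unfolding y_def by (rule sample_path_in_skorohod_space[OF h_pos of_nat_in_Zp])
  have T: "?T = real (R * L) * h" using L by (simp add: h_def)
  have yval: "y s = of_nat (residue n (x (grid s)))" if s: "0 \<le> s" "s \<le> ?T" for s
  proof -
    have "s / h \<le> real (R * L)" using s(2) h_pos unfolding T by (simp add: field_simps)
    then have "\<lfloor>s / h\<rfloor> \<le> int (R * L)" by linarith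
    moreover have "0 \<le> \<lfloor>s / h\<rfloor>" using s h_pos by simp
    ultimately show ?thesis using s by (simp add: y_def sample_path_def grid_def min_def mult.commute nat_le_iff)
  qed
  have gap: "skorohod_gap x y \<theta> u \<le> ?e" if u: "0 \<le> u" "u \<le> ?T" "\<And>\<tau>. jump \<tau> \<Longrightarrow> u \<notin> {\<tau>..<\<tau> + h}" for u
    unfolding skorohod_gap_def
  proof (rule cSUP_least)
    fix t :: real assume "t \<in> {0..}"
    then have t: "t \<ge> 0" by simp
    have \<theta>t: "0 \<le> \<theta> t" using \<theta>_bounds(1)[of t] t by simp
    have "y (min (\<theta> t) u) = of_nat (residue n (x (min t u)))"
      using yval[of "min (\<theta> t) u"] sampled_value_stopped[OF u(1,2) t u(3)] \<theta>t u by simp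
    then have "dist (x (min t u)) (y (min (\<theta> t) u)) \<le> ?e"
      using residue_approx[OF path_in_Zp[OF x, of "min t u"], of n] t u by (simp add: dist_padic_def)
    then show "min 1 (dist (x (min t u)) (y (min (\<theta> t) u))) \<le> ?e" by simp
  qed simp
  let ?J = "Collect jump"
  note fin = finite_jumps[OF refl]
  let ?g = "\<lambda>u. ?e * (indicator {0..} u * exp (- u)) + (\<Sum>\<tau>\<in>?J. indicator {\<tau>..<\<tau> + h} u) + indicator {?T..} u * exp (- u) :: real"
  have "has_bochner_integral lborel (indicator {\<tau>..<\<tau> + h} :: real \<Rightarrow> real) h" for \<tau>
    using has_bochner_integral_real_indicator[of "{\<tau>..<\<tau> + h}" lborel] h_pos by simp
  then have g: "has_bochner_integral lborel ?g (?e * exp (- 0) + (\<Sum>\<tau>\<in>?J. h) + exp (- ?T))"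
    by (intro has_bochner_integral_add has_bochner_integral_mult_right has_bochner_integral_sum has_integral_exp_tail)
  have "(LBINT u:{0..}. exp (- u) * skorohod_gap x y \<theta> u) \<le> (\<integral>u. ?g u \<partial>lborel)"
    unfolding set_lebesgue_integral_def
  proof (rule integral_mono)
    show "integrable lborel (\<lambda>u. indicator {0..} u *\<^sub>R (exp (- u) * skorohod_gap x y \<theta> u))"
      using skorohod_gap_set_integrable[OF x y \<theta>_time_change(1)] by (simp add: set_integrable_def)
    show "integrable lborel ?g" using g by (simp add: has_bochner_integral_iff)
    fix u :: real
    note gb = skorohod_gap_bounds[of x y \<theta> u]
    have e0: "0 \<le> ?e" by simp
    have J0: "0 \<le> (\<Sum>\<tau>\<in>?J. indicator {\<tau>..<\<tau> + h} u :: real)" by (intro sum_nonneg) simp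
    consider "u < 0" | "0 \<le> u" "?T \<le> u" | "0 \<le> u" "u < ?T" "\<exists>\<tau>. jump \<tau> \<and> u \<in> {\<tau>..<\<tau> + h}"
      | "0 \<le> u" "u < ?T" "\<And>\<tau>. jump \<tau> \<Longrightarrow> u \<notin> {\<tau>..<\<tau> + h}" by force
    then show "indicator {0..} u *\<^sub>R (exp (- u) * skorohod_gap x y \<theta> u) \<le> ?g u"
    proof cases
      case 1
      then show ?thesis using J0 by (simp add: indicator_def)
    next
      case 2
      have "exp (- u) * skorohod_gap x y \<theta> u \<le> exp (- u) * 1" using gb by (intro mult_left_mono) auto
      moreover have "0 \<le> ?e * exp (- u)" by simp
      moreover have "indicator {0..} u = (1 :: real)" "indicator {?T..} u = (1 :: real)" using 2 by simp_all
      ultimately show ?thesis unfolding real_scaleR_def using J0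
        by (simp only: mult_1_left mult_1_right)
    next
      case 3
      then obtain \<tau> where \<tau>: "\<tau> \<in> ?J" "u \<in> {\<tau>..<\<tau> + h}" by blast
      have "indicator {\<tau>..<\<tau> + h} u \<le> (\<Sum>\<tau>\<in>?J. indicator {\<tau>..<\<tau> + h} u :: real)"
        by (rule member_le_sum[OF \<tau>(1) _ fin(1)]) simp
      then have "1 \<le> (\<Sum>\<tau>\<in>?J. indicator {\<tau>..<\<tau> + h} u :: real)" using \<tau>(2) by simp
      moreover have "exp (- u) * skorohod_gap x y \<theta> u \<le> 1 * 1" using gb 3 by (intro mult_mono) auto
      moreover have "0 \<le> ?e * exp (- u)" by simp
      moreover have "indicator {0..} u = (1 :: real)" "indicator {?T..} u = (0 :: real)" using 3 by simp_all
      ultimately show ?thesis unfolding real_scaleR_def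
        by (simp only: mult_1_left mult_1_right mult_zero_left)
    next
      case 4
      have "exp (- u) * skorohod_gap x y \<theta> u \<le> exp (- u) * ?e" using gap[of u] 4 by (intro mult_left_mono) auto
      then show ?thesis using 4 J0 by (simp add: mult.commute)
    qed
  qed
  also have "\<dots> = ?e * exp (- 0) + (\<Sum>\<tau>\<in>?J. h) + exp (- ?T)"
    using g by (rule has_bochner_integral_integral_eq)
  also have "\<dots> \<le> ?e + real R * h + exp (- ?T)"
    using fin(2) h_pos by (simp add: mult_right_mono)
  finally have int: "(LBINT u:{0..}. exp (- u) * skorohod_gap x y \<theta> u) \<le> ?e + real R * h + exp (- ?T)" .
  have "skorohod_dist x y \<le> skorohod_cost x y \<theta>" by (rule skorohod_dist_le_cost[OF \<theta>_time_change(1)])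
  also have "\<dots> \<le> max (2 / real L) (?e + real R * h + exp (- ?T))"
    unfolding skorohod_cost_def using int \<theta>_time_change(2) by (rule max.mono[rotated])
  finally show ?thesis unfolding hL y_def[symmetric] by (simp add: h_def)
qed

section \<open>A criterion for weak convergence\<close>

context Metric_space
begin

lemma space_topology_borel: "space (topology_borel mtopology) = M"
  by (simp add: topology_borel_def space_measure_of_conv)

lemma open_topology_borel: "openin mtopology U \<Longrightarrow> U \<in> sets (topology_borel mtopology)"
proof -
  have "{U. openin mtopology U} \<subseteq> Pow (topspace mtopology)" using openin_subset by blast
  then show "openin mtopology U \<Longrightarrow> U \<in> sets (topology_borel mtopology)"
    unfolding topology_borel_def by (simp add: sigma_sets.Basic)
qed

lemma continuous_map_topology_borel:
  assumes "continuous_map mtopology euclideanreal f"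
  shows "f \<in> borel_measurable (topology_borel mtopology)"
proof (rule borel_measurableI)
  fix U :: "real set" assume "open U"
  then have "openin mtopology {x \<in> topspace mtopology. f x \<in> U}"
    using assms by (auto simp: continuous_map_def)
  moreover have "f -` U \<inter> space (topology_borel mtopology) = {x \<in> topspace mtopology. f x \<in> U}"
    by (auto simp: space_topology_borel)
  ultimately show "f -` U \<inter> space (topology_borel mtopology) \<in> sets (topology_borel mtopology)"
    using open_topology_borel by simp
qed

lemma continuous_mapD_real:
  assumes f: "continuous_map mtopology euclideanreal f" and x: "x \<in> M" and e: "e > 0"
  obtains r where "r > 0" "\<And>y. y \<in> M \<Longrightarrow> d x y < r \<Longrightarrow> \<bar>f y - f x\<bar> < e"
proof -
  have "openin mtopology {y \<in> topspace mtopology. f y \<in> ball (f x) e}"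
    using f by (auto simp: continuous_map_def)
  then have "openin mtopology {y \<in> M. f y \<in> ball (f x) e}" by simp
  moreover have "x \<in> {y \<in> M. f y \<in> ball (f x) e}" using x e by simp
  ultimately obtain r where r: "r > 0" "mball x r \<subseteq> {y \<in> M. f y \<in> ball (f x) e}"
    unfolding openin_mtopology by blast
  show thesis
  proof (rule that[OF r(1)])
    fix y assume "y \<in> M" "d x y < r"
    then have "y \<in> mball x r" using x by (simp add: in_mball)
    then show "\<bar>f y - f x\<bar> < e" using r(2) by (auto simp: dist_real_def abs_minus_commute)
  qed
qed

lemma lipschitz_continuous_map:
  assumes g: "\<And>x y. x \<in> M \<Longrightarrow> y \<in> M \<Longrightarrow> \<bar>g x - g y\<bar> \<le> K * d x y"
  shows "continuous_map mtopology euclideanreal g"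
  unfolding continuous_map_def
proof (intro conjI allI impI)
  fix U :: "real set" assume "openin euclideanreal U"
  then have U: "open U" by simp
  show "openin mtopology {x \<in> topspace mtopology. g x \<in> U}"
    unfolding openin_mtopology
  proof (intro conjI allI impI)
    fix x assume "x \<in> {x \<in> topspace mtopology. g x \<in> U}"
    then have x: "x \<in> M" "g x \<in> U" by auto
    obtain e where e: "e > 0" "ball (g x) e \<subseteq> U" using U x(2) openE by blast
    define r where "r = e / (\<bar>K\<bar> + 1)"
    have "mball x r \<subseteq> {x \<in> topspace mtopology. g x \<in> U}"
    proof
      fix y assume "y \<in> mball x r"
      then have y: "y \<in> M" "d x y < r" by (auto simp: in_mball)
      have "\<bar>g x - g y\<bar> \<le> K * d x y" by (rule g[OF x(1) y(1)])
      also have "\<dots> \<le> (\<bar>K\<bar> + 1) * d x y" by (intro mult_right_mono) auto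
      also have "\<dots> < (\<bar>K\<bar> + 1) * r" using y(2) by (intro mult_strict_left_mono) auto
      also have "\<dots> = e" by (simp add: r_def)
      finally have "g y \<in> ball (g x) e" by (simp add: dist_real_def)
      then show "y \<in> {x \<in> topspace mtopology. g x \<in> U}" using e(2) y(1) by auto
    qed
    moreover have "r > 0" using e by (simp add: r_def)
    ultimately show "\<exists>r>0. mball x r \<subseteq> {x \<in> topspace mtopology. g x \<in> U}" by blast
  qed auto
qed auto

text \<open>
  The infimal convolution with a multiple of the metric.
\<close>

definition lipschitz_minorant :: "('a \<Rightarrow> real) \<Rightarrow> nat \<Rightarrow> 'a \<Rightarrow> real" where
  "lipschitz_minorant f k x = (INF y\<in>M. f y + real k * d x y)"

context
  fixes f :: "'a \<Rightarrow> real" and C :: real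
  assumes bound: "\<And>x. x \<in> M \<Longrightarrow> \<bar>f x\<bar> \<le> C"
begin

lemma minorant_bdd: "bdd_below ((\<lambda>y. f y + real k * d x y) ` M)"
proof (rule bdd_belowI2)
  fix y assume "y \<in> M"
  have "0 \<le> real k * d x y" by simp
  then show "- C \<le> f y + real k * d x y" using bound[OF \<open>y \<in> M\<close>] by linarith
qed

lemma minorant_le: "x \<in> M \<Longrightarrow> lipschitz_minorant f k x \<le> f x"
  unfolding lipschitz_minorant_def by (rule cINF_lower2[OF minorant_bdd, of x]) auto

lemma minorant_bound: assumes "x \<in> M" shows "\<bar>lipschitz_minorant f k x\<bar> \<le> C"
proof -
  have "- C \<le> lipschitz_minorant f k x"
    unfolding lipschitz_minorant_def
  proof (rule cINF_greatest)
    fix y assume "y \<in> M"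
    have "0 \<le> real k * d x y" by simp
    then show "- C \<le> f y + real k * d x y" using bound[OF \<open>y \<in> M\<close>] by linarith
  qed (use assms in auto)
  then show ?thesis using minorant_le[OF assms, of k] bound[OF assms] by linarith
qed

lemma minorant_lipschitz:
  assumes "x \<in> M" "y \<in> M"
  shows "\<bar>lipschitz_minorant f k x - lipschitz_minorant f k y\<bar> \<le> real k * d x y"
proof -
  have le: "lipschitz_minorant f k x - real k * d x y \<le> lipschitz_minorant f k y" if "x \<in> M" "y \<in> M" for x y
    unfolding lipschitz_minorant_def[of f k y]
  proof (rule cINF_greatest)
    fix z assume z: "z \<in> M"
    have "lipschitz_minorant f k x \<le> f z + real k * d x z"
      unfolding lipschitz_minorant_def by (rule cINF_lower[OF minorant_bdd z])
    moreover have "real k * d x z \<le> real k * (d x y + d y z)"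
      using triangle[OF that z] by (intro mult_left_mono) auto
    ultimately show "lipschitz_minorant f k x - real k * d x y \<le> f z + real k * d y z"
      by (simp add: distrib_left)
  qed (use that in auto)
  show ?thesis using le[OF assms] le[OF assms(2,1)] commute[of x y] by (simp add: abs_le_iff)
qed

lemma minorant_tendsto:
  assumes f: "continuous_map mtopology euclideanreal f" and x: "x \<in> M"
  shows "(\<lambda>k. lipschitz_minorant f k x) \<longlonglongrightarrow> f x"
proof (rule LIMSEQ_I)
  fix e :: real assume e: "e > 0"
  then have e2: "e / 2 > 0" by simp
  obtain r where r: "r > 0" "\<And>y. y \<in> M \<Longrightarrow> d x y < r \<Longrightarrow> \<bar>f y - f x\<bar> < e / 2"
    by (rule continuous_mapD_real[OF f x e2]) (rule that)
  obtain k0 :: nat where k0: "2 * C / r \<le> real k0" using real_arch_simple by blast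
  have "\<bar>lipschitz_minorant f k x - f x\<bar> < e" if k: "k \<ge> k0" for k
  proof -
    have "f x - e / 2 \<le> lipschitz_minorant f k x"
      unfolding lipschitz_minorant_def
    proof (rule cINF_greatest)
      fix y assume y: "y \<in> M"
      have k0d: "0 \<le> real k * d x y" by simp
      show "f x - e / 2 \<le> f y + real k * d x y"
      proof (cases "d x y < r")
        case True
        then show ?thesis using r(2)[OF y True] k0d by linarith
      next
        case False
        have "2 * C / r \<le> real k" using k0 k by linarith
        then have "2 * C \<le> real k * r" using r(1) by (simp add: pos_divide_le_eq)
        also have "\<dots> \<le> real k * d x y" using False by (intro mult_left_mono) auto
        finally show ?thesis using bound[OF x] bound[OF y] e by linarith
      qed
    qed (use x in auto)
    then show ?thesis using minorant_le[OF x, of k] e by linarith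
  qed
  then show "\<exists>k0. \<forall>k\<ge>k0. norm (lipschitz_minorant f k x - f x) < e" by auto
qed

end

text \<open>
  On a Lipschitz function, composing with a map \<open>\<alpha>\<close> that moves all points outside a set of small measure by
  little changes the integrals by little. This gives convergence for bounded Lipschitz functions. A
  bounded continuous \<open>f\<close> is the increasing limit of its Lipschitz minorants, so that its integral with
  respect to \<open>N\<close> is at most the lower limit of the integrals; applying this to \<open>- f\<close> as well gives convergence.
\<close>

lemma converges_weakly_by_approximation:
  fixes Ms :: "nat \<Rightarrow> 'a measure" and N :: "'a measure"
  assumes Ms: "eventually (\<lambda>m. prob_space (Ms m) \<and> sets (Ms m) = sets (topology_borel mtopology)) sequentially"
    and N: "prob_space N" "sets N = sets (topology_borel mtopology)"
    and approx: "\<And>\<epsilon>. \<epsilon> > 0 \<Longrightarrow> \<exists>\<alpha> B. \<alpha> \<in> M \<rightarrow> M \<and> B \<in> sets (topology_borel mtopology) \<and>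
        (\<forall>x\<in>M - B. d x (\<alpha> x) \<le> \<epsilon>) \<and>
        eventually (\<lambda>m. measure (Ms m) B \<le> \<epsilon>) sequentially \<and> measure N B \<le> \<epsilon> \<and>
        (\<forall>g :: 'a \<Rightarrow> real. (\<lambda>x. g (\<alpha> x)) \<in> borel_measurable (topology_borel mtopology) \<and>
          (\<lambda>m. \<integral>x. g (\<alpha> x) \<partial>Ms m) \<longlonglongrightarrow> (\<integral>x. g (\<alpha> x) \<partial>N))"
  shows "converges_weakly mtopology Ms N"
proof -
  have spaces: "space Q = M" if "sets Q = sets (topology_borel mtopology)" for Q :: "'a measure"
    using sets_eq_imp_space_eq[OF that] space_topology_borel by simp
  have integ: "integrable Q g" if "prob_space Q" "sets Q = sets (topology_borel mtopology)"
    "g \<in> borel_measurable (topology_borel mtopology)" "\<And>x. x \<in> M \<Longrightarrow> \<bar>g x\<bar> \<le> C" for Q :: "'a measure" and g :: "'a \<Rightarrow> real" and C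
  proof -
    interpret prob_space Q by (rule that)
    have "g \<in> borel_measurable Q" using that(3) measurable_cong_sets[OF that(2) refl] by blast
    then show ?thesis using that spaces[OF that(2)] by (intro integrable_const_bound[of _ C]) auto
  qed
  have lip: "(\<lambda>m. \<integral>x. g x \<partial>Ms m) \<longlonglongrightarrow> (\<integral>x. g x \<partial>N)"
    if g: "\<And>x y. x \<in> M \<Longrightarrow> y \<in> M \<Longrightarrow> \<bar>g x - g y\<bar> \<le> K * d x y" and C: "\<And>x. x \<in> M \<Longrightarrow> \<bar>g x\<bar> \<le> C" and K: "K \<ge> 0"
    for g :: "'a \<Rightarrow> real" and K C
  proof (rule tendstoI)
    fix e :: real assume e: "e > 0"
    have "M \<noteq> {}" using prob_space.not_empty[OF N(1)] spaces[OF N(2)] by simp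
    then have C0: "C \<ge> 0" using C by force
    \<comment> \<open>Two replacement errors of \<open>(K + 2 C) \<epsilon>\<close> and one limit error of \<open>\<epsilon>\<close> stay below \<open>e\<close>.\<close>
    define \<epsilon> where "\<epsilon> = e / (2 * (K + 2 * C) + 2)"
    have \<epsilon>: "\<epsilon> > 0" using e K C0 by (simp add: \<epsilon>_def)
    obtain \<alpha> B where \<alpha>: "\<alpha> \<in> M \<rightarrow> M" and B: "B \<in> sets (topology_borel mtopology)"
      and close: "\<And>x. x \<in> M - B \<Longrightarrow> d x (\<alpha> x) \<le> \<epsilon>"
      and MsB: "eventually (\<lambda>m. measure (Ms m) B \<le> \<epsilon>) sequentially" and NB: "measure N B \<le> \<epsilon>"
      and meas: "(\<lambda>x. g (\<alpha> x)) \<in> borel_measurable (topology_borel mtopology)"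
      and conv: "(\<lambda>m. \<integral>x. g (\<alpha> x) \<partial>Ms m) \<longlonglongrightarrow> (\<integral>x. g (\<alpha> x) \<partial>N)"
      using approx[OF \<epsilon>] by metis
    have gm: "g \<in> borel_measurable (topology_borel mtopology)"
      by (rule continuous_map_topology_borel[OF lipschitz_continuous_map[OF g]])
    have diff: "\<bar>(\<integral>x. g x \<partial>Q) - (\<integral>x. g (\<alpha> x) \<partial>Q)\<bar> \<le> (K + 2 * C) * \<epsilon>"
      if Q: "prob_space Q" "sets Q = sets (topology_borel mtopology)" "measure Q B \<le> \<epsilon>" for Q :: "'a measure"
    proof -
      interpret prob_space Q by (rule Q(1))
      have sp: "space Q = M" by (rule spaces[OF Q(2)])
      have BQ: "B \<in> sets Q" using B Q(2) by simp
      have i1: "integrable Q g" by (rule integ[OF Q(1,2) gm C])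
      have i2: "integrable Q (\<lambda>x. g (\<alpha> x))" by (rule integ[OF Q(1,2) meas]) (use \<alpha> C in auto)
      have i3: "integrable Q (\<lambda>x. K * \<epsilon> + 2 * C * indicator B x)"
        using BQ by (intro Bochner_Integration.integrable_add integrable_mult_right) (auto simp: emeasure_eq_measure)
      have "\<bar>(\<integral>x. g x \<partial>Q) - (\<integral>x. g (\<alpha> x) \<partial>Q)\<bar> = \<bar>\<integral>x. g x - g (\<alpha> x) \<partial>Q\<bar>"
        by (simp add: Bochner_Integration.integral_diff[OF i1 i2])
      also have "\<dots> \<le> (\<integral>x. \<bar>g x - g (\<alpha> x)\<bar> \<partial>Q)" by (rule integral_abs_bound)
      also have "\<dots> \<le> (\<integral>x. K * \<epsilon> + 2 * C * indicator B x \<partial>Q)"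
      proof (rule integral_mono[OF _ i3])
        show "integrable Q (\<lambda>x. \<bar>g x - g (\<alpha> x)\<bar>)" using i1 i2 by (intro integrable_abs Bochner_Integration.integrable_diff)
        fix x assume "x \<in> space Q"
        then have x: "x \<in> M" "\<alpha> x \<in> M" using sp \<alpha> by auto
        show "\<bar>g x - g (\<alpha> x)\<bar> \<le> K * \<epsilon> + 2 * C * indicator B x"
        proof (cases "x \<in> B")
          case True
          have "\<bar>g x - g (\<alpha> x)\<bar> \<le> 2 * C" using C[OF x(1)] C[OF x(2)] by linarith
          moreover have "0 \<le> K * \<epsilon>" using K \<epsilon> by simp
          ultimately show ?thesis using True by simp
        next
          case False
          have "K * d x (\<alpha> x) \<le> K * \<epsilon>" using close[of x] x False K by (intro mult_left_mono) auto
          then show ?thesis using g[OF x] False by simp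
        qed
      qed
      also have "\<dots> = K * \<epsilon> + 2 * C * prob B"
      proof -
        have "B \<inter> M = B" "prob M = 1" using sets.sets_into_space[OF BQ] prob_space by (auto simp: sp)
        then show ?thesis
          using BQ by (subst Bochner_Integration.integral_add) (auto simp: emeasure_eq_measure sp)
      qed
      also have "\<dots> \<le> K * \<epsilon> + 2 * C * \<epsilon>" using Q(3) C0 by (intro add_left_mono mult_left_mono) auto
      finally show ?thesis by (simp add: algebra_simps)
    qed
    from tendstoD[OF conv \<epsilon>] MsB Ms
    show "eventually (\<lambda>m. dist (\<integral>x. g x \<partial>Ms m) (\<integral>x. g x \<partial>N) < e) sequentially"
    proof eventually_elim
      case (elim m)
      have 1: "\<bar>(\<integral>x. g x \<partial>Ms m) - (\<integral>x. g (\<alpha> x) \<partial>Ms m)\<bar> \<le> (K + 2 * C) * \<epsilon>" using elim diff[of "Ms m"] by blast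
      have 2: "\<bar>(\<integral>x. g x \<partial>N) - (\<integral>x. g (\<alpha> x) \<partial>N)\<bar> \<le> (K + 2 * C) * \<epsilon>" by (rule diff[OF N NB])
      have 3: "\<bar>(\<integral>x. g (\<alpha> x) \<partial>Ms m) - (\<integral>x. g (\<alpha> x) \<partial>N)\<bar> < \<epsilon>" using elim(1) by (simp add: dist_real_def)
      have "(2 * (K + 2 * C) + 2) * \<epsilon> = e" using K C0 by (simp add: \<epsilon>_def)
      then have "2 * ((K + 2 * C) * \<epsilon>) + 2 * \<epsilon> = e" by (simp add: algebra_simps)
      then show ?case using 1 2 3 \<epsilon> unfolding dist_real_def by linarith
    qed
  qed
  have lower: "eventually (\<lambda>m. (\<integral>x. f x \<partial>N) - e < (\<integral>x. f x \<partial>Ms m)) sequentially"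
    if f: "continuous_map mtopology euclideanreal f" and C: "\<And>x. x \<in> M \<Longrightarrow> \<bar>f x\<bar> \<le> C" and e: "e > 0" for f C e
  proof -
    let ?f = "lipschitz_minorant f"
    have fm: "f \<in> borel_measurable (topology_borel mtopology)" by (rule continuous_map_topology_borel[OF f])
    have fkm: "?f k \<in> borel_measurable (topology_borel mtopology)" for k
      by (rule continuous_map_topology_borel[OF lipschitz_continuous_map[OF minorant_lipschitz[OF C]]])
    have "(\<lambda>k. \<integral>x. ?f k x \<partial>N) \<longlonglongrightarrow> (\<integral>x. f x \<partial>N)"
    proof (rule integral_dominated_convergence[where w = "\<lambda>_. C"])
      show "f \<in> borel_measurable N" "?f k \<in> borel_measurable N" for k
        using fm fkm measurable_cong_sets[OF N(2) refl] by blast+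
      interpret prob_space N by (rule N(1))
      show "integrable N (\<lambda>_. C)" by simp
      show "AE x in N. (\<lambda>k. ?f k x) \<longlonglongrightarrow> f x"
        using spaces[OF N(2)] by (intro AE_I2 minorant_tendsto[OF C f]) auto
      show "AE x in N. norm (?f k x) \<le> C" for k
        using spaces[OF N(2)] minorant_bound[OF C] by (intro AE_I2) auto
    qed
    then have "eventually (\<lambda>k. (\<integral>x. f x \<partial>N) - e / 2 < (\<integral>x. ?f k x \<partial>N)) sequentially"
      using e by (intro order_tendstoD(1)) auto
    then obtain k where k: "(\<integral>x. f x \<partial>N) - e / 2 < (\<integral>x. ?f k x \<partial>N)" by (auto simp: eventually_sequentially)
    have "(\<lambda>m. \<integral>x. ?f k x \<partial>Ms m) \<longlonglongrightarrow> (\<integral>x. ?f k x \<partial>N)"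
      by (rule lip[OF minorant_lipschitz[OF C] minorant_bound[OF C]]) auto
    then have "eventually (\<lambda>m. (\<integral>x. ?f k x \<partial>N) - e / 2 < (\<integral>x. ?f k x \<partial>Ms m)) sequentially"
      using e by (intro order_tendstoD(1)) auto
    then show ?thesis using Ms
    proof eventually_elim
      case (elim m)
      then have P: "prob_space (Ms m)" "sets (Ms m) = sets (topology_borel mtopology)" by auto
      have "(\<integral>x. ?f k x \<partial>Ms m) \<le> (\<integral>x. f x \<partial>Ms m)"
        using integ[OF P fkm minorant_bound[OF C]] integ[OF P fm C] minorant_le[OF C] spaces[OF P(2)]
        by (intro integral_mono) auto
      then show ?case using elim(1) k by linarith
    qed
  qed
  show ?thesis
    unfolding converges_weakly_def
  proof (intro allI impI)
    fix f assume f: "continuous_map mtopology euclideanreal f" and "bounded (f ` topspace mtopology)"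
    then obtain C where C: "\<And>x. x \<in> M \<Longrightarrow> \<bar>f x\<bar> \<le> C" by (auto simp: bounded_iff)
    have mf: "continuous_map mtopology euclideanreal (\<lambda>x. - f x)" using f by (intro continuous_map_minus)
    show "(\<lambda>m. \<integral>x. f x \<partial>Ms m) \<longlonglongrightarrow> (\<integral>x. f x \<partial>N)"
    proof (rule tendstoI)
      fix e :: real assume e: "e > 0"
      have "eventually (\<lambda>m. (\<integral>x. f x \<partial>N) - e < (\<integral>x. f x \<partial>Ms m)) sequentially"
        by (rule lower[OF f _ e]) (rule C)
      moreover have "eventually (\<lambda>m. (\<integral>x. - f x \<partial>N) - e < (\<integral>x. - f x \<partial>Ms m)) sequentially"
        by (rule lower[OF mf _ e, of C]) (use C in auto)
      ultimately show "eventually (\<lambda>m. dist (\<integral>x. f x \<partial>Ms m) (\<integral>x. f x \<partial>N) < e) sequentially"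
        by eventually_elim (auto simp: dist_real_def abs_less_iff)
    qed
  qed
qed

end

section \<open>Distributions on a grid of times\<close>

lemma (in prob_space) integral_finite_vector:
  fixes V :: "'a \<Rightarrow> nat \<Rightarrow> nat" and \<Phi> :: "(nat \<Rightarrow> nat) \<Rightarrow> real"
  assumes V: "\<And>i r. i \<le> N \<Longrightarrow> {w \<in> space M. V w i = r} \<in> events"
    and less: "\<And>w i. w \<in> space M \<Longrightarrow> i \<le> N \<Longrightarrow> V w i < K"
    and dep: "\<And>v v'. (\<And>i. i \<le> N \<Longrightarrow> v i = v' i) \<Longrightarrow> \<Phi> v = \<Phi> v'"
  shows "(\<lambda>w. \<Phi> (V w)) \<in> borel_measurable M"
    and "(\<integral>w. \<Phi> (V w) \<partial>M) =
      (\<Sum>g\<in>PiE {..N} (\<lambda>_. {..<K}). \<Phi> g * prob {w \<in> space M. \<forall>i\<le>N. V w i = g i})"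
proof -
  let ?G = "PiE {..N} (\<lambda>_. {..<K})" and ?A = "\<lambda>g. {w \<in> space M. \<forall>i\<le>N. V w i = g i}"
  have G: "finite ?G" by (rule finite_PiE) simp_all
  have A: "?A g \<in> events" for g
  proof -
    have "{w \<in> space M. \<forall>i\<in>{..N}. V w i = g i} \<in> events"
      by (rule sets.sets_Collect_finite_All') (simp_all add: V)
    then show ?thesis by (simp only: Ball_def atMost_iff)
  qed
  have eq: "\<Phi> (V w) = (\<Sum>g\<in>?G. \<Phi> g * indicator (?A g) w)" if w: "w \<in> space M" for w
  proof -
    let ?g = "restrict (V w) {..N}"
    have g: "?g \<in> ?G" using less[OF w] by auto
    have "(\<Sum>g\<in>?G. \<Phi> g * indicator (?A g) w) = (\<Sum>g\<in>{?g}. \<Phi> g * indicator (?A g) w)"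
    proof (rule sum.mono_neutral_right[OF G])
      show "\<forall>g\<in>?G - {?g}. \<Phi> g * indicator (?A g) w = 0"
      proof
        fix g assume g': "g \<in> ?G - {?g}"
        have "w \<notin> ?A g"
        proof
          assume wA: "w \<in> ?A g"
          have "g = ?g"
          proof (rule extensionalityI[of _ "{..N}"])
            show "g \<in> extensional {..N}" using g' by (simp add: PiE_def)
            show "g i = ?g i" if "i \<in> {..N}" for i
              using wA that by (auto simp: restrict_def)
            show "?g \<in> extensional {..N}" by (rule restrict_extensional)
          qed
          then show False using g' by blast
        qed
        then show "\<Phi> g * indicator (?A g) w = 0" by simp
      qed
    qed (use g in auto)
    also have "\<dots> = \<Phi> ?g" using w by simp
    also have "\<dots> = \<Phi> (V w)" by (rule dep) simp
    finally show ?thesis by simp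
  qed
  have "(\<lambda>w. \<Sum>g\<in>?G. \<Phi> g * indicator (?A g) w) \<in> borel_measurable M"
    by (intro borel_measurable_sum borel_measurable_times borel_measurable_const borel_measurable_indicator A)
  then show "(\<lambda>w. \<Phi> (V w)) \<in> borel_measurable M"
    by (subst measurable_cong[OF eq])
  have "(\<integral>w. \<Phi> (V w) \<partial>M) = (\<integral>w. (\<Sum>g\<in>?G. \<Phi> g * indicator (?A g) w) \<partial>M)"
    by (rule Bochner_Integration.integral_cong[OF refl eq])
  also have "\<dots> = (\<Sum>g\<in>?G. \<Phi> g * prob (?A g))"
  proof (subst Bochner_Integration.integral_sum)
    show "integrable M (\<lambda>w. \<Phi> g * indicator (?A g) w)" for g
      by (intro integrable_mult_right integrable_real_indicator A) (simp add: emeasure_eq_measure)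
    show "(\<Sum>g\<in>?G. \<integral>w. \<Phi> g * indicator (?A g) w \<partial>M) = (\<Sum>g\<in>?G. \<Phi> g * prob (?A g))"
      by (intro sum.cong refl) (simp only: integral_mult_right_zero Bochner_Integration.integral_indicator sets.Int_space_eq2[OF A])
  qed
  finally show "(\<integral>w. \<Phi> (V w) \<partial>M) = (\<Sum>g\<in>?G. \<Phi> g * prob (?A g))" .
qed

lemma (in prob_space) prob_finite_vector:
  fixes V :: "'a \<Rightarrow> nat \<Rightarrow> nat"
  assumes V: "\<And>i r. i \<le> N \<Longrightarrow> {w \<in> space M. V w i = r} \<in> events"
    and less: "\<And>w i. w \<in> space M \<Longrightarrow> i \<le> N \<Longrightarrow> V w i < K"
    and dep: "\<And>v v'. (\<And>i. i \<le> N \<Longrightarrow> v i = v' i) \<Longrightarrow> \<Phi> v = \<Phi> v'"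
  shows "{w \<in> space M. \<Phi> (V w)} \<in> events"
    and "prob {w \<in> space M. \<Phi> (V w)} =
      (\<Sum>g\<in>PiE {..N} (\<lambda>_. {..<K}). of_bool (\<Phi> g) * prob {w \<in> space M. \<forall>i\<le>N. V w i = g i})"
proof -
  let ?F = "\<lambda>v. of_bool (\<Phi> v) :: real"
  have dep': "?F v = ?F v'" if "\<And>i. i \<le> N \<Longrightarrow> v i = v' i" for v v' using dep[OF that] by simp
  note iv = integral_finite_vector[where N = N and V = V and K = K and \<Phi> = ?F]
  have *: "(\<lambda>w. ?F (V w)) \<in> borel_measurable M" by (rule iv(1)) (fact V, fact less, fact dep')
  have "(\<lambda>w. ?F (V w)) -` {1} \<inter> space M \<in> events" using * by (rule measurable_sets) (intro borel_singleton sets.empty_sets)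
  moreover have "(\<lambda>w. ?F (V w)) -` {1} \<inter> space M = {w \<in> space M. \<Phi> (V w)}" by auto
  ultimately show ev: "{w \<in> space M. \<Phi> (V w)} \<in> events" by simp
  have "prob {w \<in> space M. \<Phi> (V w)} = (\<integral>w. indicator {w \<in> space M. \<Phi> (V w)} w \<partial>M)"
    by (simp only: Bochner_Integration.integral_indicator sets.Int_space_eq2[OF ev])
  also have "\<dots> = (\<integral>w. ?F (V w) \<partial>M)"
    by (rule Bochner_Integration.integral_cong) (simp_all add: indicator_def)
  also have "(\<integral>w. ?F (V w) \<partial>M) =
      (\<Sum>g\<in>PiE {..N} (\<lambda>_. {..<K}). ?F g * prob {w \<in> space M. \<forall>i\<le>N. V w i = g i})"
    by (rule iv(2)) (fact V, fact less, fact dep')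
  finally show "prob {w \<in> space M. \<Phi> (V w)} =
      (\<Sum>g\<in>PiE {..N} (\<lambda>_. {..<K}). of_bool (\<Phi> g) * prob {w \<in> space M. \<forall>i\<le>N. V w i = g i})" .
qed

definition grid_residue :: "nat \<Rightarrow> real \<Rightarrow> (real \<Rightarrow> 'p::prime_type padic) \<Rightarrow> nat \<Rightarrow> nat" where
  "grid_residue n h \<omega> i = residue n (\<omega> (real i * h))"

lemma grid_residue_less:
  fixes \<omega> :: "real \<Rightarrow> 'p::prime_type padic"
  assumes "\<omega> \<in> path_space" "h \<ge> 0"
  shows "grid_residue n h \<omega> i < CARD('p) ^ n"
  unfolding grid_residue_def using assms by (intro residue_less path_in_Zp) auto

text \<open>
  The probability that a chain started at \<open>0\<close>, whose \<open>i\<close>-th increment has law \<open>K i\<close>, follows \<open>g\<close>.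
\<close>

definition chain_prob :: "nat \<Rightarrow> (nat \<Rightarrow> int \<Rightarrow> real) \<Rightarrow> (nat \<Rightarrow> nat) \<Rightarrow> real" where
  "chain_prob N K g = (if g 0 = 0 then \<Prod>i<N. K i (int (g (Suc i)) - int (g i)) else 0)"

lemma (in path_law) grid_residue_event:
  "h \<ge> 0 \<Longrightarrow> {\<omega> \<in> path_space. grid_residue n h \<omega> i = r} \<in> events"
  unfolding grid_residue_def by (intro residue_event) simp

text \<open>
  The defining formula of the law covers positive times; the almost sure value \<open>0\<close> at time \<open>0\<close> accounts for
  the first grid point.
\<close>

lemma brownian_grid_prob:
  fixes \<mu> :: "'p::prime_type padic measure"
  assumes haar: "Haar_Zp \<mu>" and P: "Brownian_law b D \<mu> P" and pos: "b > 0" "D > 0" and h: "h > 0"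
    and g: "\<And>i. i \<le> N \<Longrightarrow> g i < CARD('p) ^ n"
  shows "measure P {\<omega> \<in> path_space. \<forall>i\<le>N. grid_residue n h \<omega> i = g i} =
    chain_prob N (\<lambda>_. bm_trans CARD('p) b D h n) g"
proof -
  interpret haar_Zp \<mu> by unfold_locales (rule haar)
  interpret P: path_law P
    using P by (auto simp: Brownian_law_def path_law_def path_law_axioms_def)
  have AE0: "AE \<omega> in P. \<omega> 0 = 0" using P by (simp add: Brownian_law_def)
  have res0: "residue n (0 :: 'p padic) = 0" using residue_of_nat[of n 0, where 'p='p] by simp
  have all_event: "{\<omega> \<in> path_space. \<forall>i\<le>N. grid_residue n h \<omega> i = g i} \<in> sets P"
  proof -
    have "{\<omega> \<in> space P. \<forall>i\<in>{..N}. grid_residue n h \<omega> i = g i} \<in> sets P"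
      by (rule sets.sets_Collect_finite_All') (use P.grid_residue_event h in \<open>simp_all\<close>)
    then show ?thesis by (simp only: P.space_law Ball_def atMost_iff)
  qed
  show ?thesis
  proof (cases "g 0 = 0")
    case False
    have empty: "\<omega> \<notin> {\<omega> \<in> path_space. \<forall>i\<le>N. grid_residue n h \<omega> i = g i}" if "\<omega> 0 = 0" for \<omega> :: "real \<Rightarrow> 'p padic"
    proof -
      have "grid_residue n h \<omega> 0 \<noteq> g 0" using that False res0 by (simp add: grid_residue_def)
      then show ?thesis by blast
    qed
    from AE0 have "AE \<omega> in P. (\<omega> \<in> {\<omega> \<in> path_space. \<forall>i\<le>N. grid_residue n h \<omega> i = g i}) = (\<omega> \<in> {})"
    proof eventually_elim
      case (elim \<omega>)
      then show ?case using empty[of \<omega>] by blast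
    qed
    then have "measure P {\<omega> \<in> path_space. \<forall>i\<le>N. grid_residue n h \<omega> i = g i} = measure P {}"
      by (rule P.finite_measure_eq_AE[OF _ all_event sets.empty_sets])
    then show ?thesis using False by (simp add: chain_prob_def)
  next
    case True
    define ts where "ts = map (\<lambda>i. real (Suc i) * h) [0..<N]"
    define rs where "rs = map (\<lambda>i. g (Suc i)) [0..<N]"
    have len: "length ts = N" "length rs = N" by (simp_all add: ts_def rs_def)
    have nth: "ts ! i = real (Suc i) * h" "rs ! i = g (Suc i)" if "i < N" for i
      using that by (simp_all add: ts_def rs_def)
    have nth0: "(0 # ts) ! i = real i * h" "(0 # rs) ! i = (if i = 0 then 0 else g i)" if "i < N" for i
      using that nth[of "i - 1"] by (cases i; simp)+
    have sorted: "sorted_wrt (<) (0 # ts)"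
    proof -
      have "sorted_wrt (<) ts"
        unfolding sorted_wrt_iff_nth_less len using nth h by (auto simp: mult_strict_right_mono simp del: of_nat_Suc)
      moreover have "0 < t" if "t \<in> set ts" for t using that h by (auto simp: ts_def simp del: of_nat_Suc)
      ultimately show ?thesis by simp
    qed
    let ?Us = "map (res_ball n) rs :: 'p padic set list"
    have Us: "length ?Us = length ts" "set ?Us \<subseteq> sets Zp_borel" using len by auto
    have "complex_of_real (measure P {\<omega> \<in> space P. \<forall>i<length ts. \<omega> (ts ! i) \<in> ?Us ! i}) =
        iterated_integral \<mu> ?Us (\<lambda>xs. \<Prod>i<length ts.
          bm_density b D (ts ! i - (0 # ts) ! i) (xs ! i - (0 # xs) ! i))"
      using P sorted Us unfolding Brownian_law_def by blast
    also have "\<dots> = complex_of_real (\<Prod>i<length ts. bm_trans CARD('p) b D (ts ! i - (0 # ts) ! i) n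
        (int (rs ! i) - int ((residue n (0 :: 'p padic) # rs) ! i)))"
      using g len
      by (intro iterated_integral_bm_density pos sorted) (auto simp: rs_def Zp_def)
    also have "(\<Prod>i<length ts. bm_trans CARD('p) b D (ts ! i - (0 # ts) ! i) n
        (int (rs ! i) - int ((residue n (0 :: 'p padic) # rs) ! i))) =
        (\<Prod>i<N. bm_trans CARD('p) b D h n (int (g (Suc i)) - int (g i)))"
      unfolding res0 len
      by (intro prod.cong refl) (auto simp: nth nth0 True algebra_simps)
    finally have "measure P {\<omega> \<in> space P. \<forall>i<length ts. \<omega> (ts ! i) \<in> ?Us ! i} =
        (\<Prod>i<N. bm_trans CARD('p) b D h n (int (g (Suc i)) - int (g i)))"
      by (simp only: of_real_eq_iff)
    moreover have "measure P {\<omega> \<in> path_space. \<forall>i\<le>N. grid_residue n h \<omega> i = g i} =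
        measure P {\<omega> \<in> space P. \<forall>i<length ts. \<omega> (ts ! i) \<in> ?Us ! i}"
    proof (rule P.finite_measure_eq_AE)
      have eq: "(\<omega> \<in> {\<omega> \<in> path_space. \<forall>i\<le>N. grid_residue n h \<omega> i = g i}) =
          (\<omega> \<in> {\<omega> \<in> space P. \<forall>i<length ts. \<omega> (ts ! i) \<in> ?Us ! i})" if "\<omega> 0 = 0" for \<omega> :: "real \<Rightarrow> 'p padic"
      proof -
        have "\<omega> (ts ! i) \<in> ?Us ! i \<longleftrightarrow> grid_residue n h \<omega> (Suc i) = g (Suc i)"
          if "i < N" "\<omega> \<in> path_space" for i
          using that h len path_in_Zp[OF that(2), of "real (Suc i) * h"]
          by (simp add: nth res_ball_def grid_residue_def del: of_nat_Suc)
        moreover have "grid_residue n h \<omega> 0 = g 0" using that res0 True by (simp add: grid_residue_def)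
        moreover have "(\<forall>i\<le>N. Q i) \<longleftrightarrow> Q 0 \<and> (\<forall>i<N. Q (Suc i))" for Q
          by (metis Suc_le_eq less_eq_nat.simps(1) not0_implies_Suc)
        ultimately show ?thesis by (auto simp: len)
      qed
      show "AE \<omega> in P. (\<omega> \<in> {\<omega> \<in> path_space. \<forall>i\<le>N. grid_residue n h \<omega> i = g i}) =
          (\<omega> \<in> {\<omega> \<in> space P. \<forall>i<length ts. \<omega> (ts ! i) \<in> ?Us ! i})"
        using AE0 by eventually_elim (rule eq)
      show "{\<omega> \<in> path_space. \<forall>i\<le>N. grid_residue n h \<omega> i = g i} \<in> sets P" by (rule all_event)
      have "{\<omega> \<in> space P. \<forall>i\<in>{..<N}. \<omega> (ts ! i) \<in> ?Us ! i} \<in> sets P"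
      proof (rule sets.sets_Collect_finite_All)
        fix i assume "i \<in> {..<N}"
        then have i: "i < N" by simp
        have "(\<lambda>\<omega>. \<omega> (real (Suc i) * h)) -` res_ball n (g (Suc i)) \<inter> space P \<in> sets P"
          using h by (intro measurable_sets[OF P.evaluation_measurable]) auto
        then show "{\<omega> \<in> space P. \<omega> (ts ! i) \<in> ?Us ! i} \<in> sets P"
          using i len by (simp add: nth vimage_def Int_def conj_commute del: of_nat_Suc)
      qed auto
      then show "{\<omega> \<in> space P. \<forall>i<length ts. \<omega> (ts ! i) \<in> ?Us ! i} \<in> sets P" by (simp only: len Ball_def lessThan_iff)
    qed
    ultimately show ?thesis using True by (simp add: chain_prob_def)
  qed
qed

definition steps_until :: "nat \<Rightarrow> real \<Rightarrow> real \<Rightarrow> nat \<Rightarrow> real \<Rightarrow> nat" where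
  "steps_until p b D m t = nat \<lfloor>t * time_scale p b D m\<rfloor>"

definition walk_trans :: "nat \<Rightarrow> real \<Rightarrow> real \<Rightarrow> nat \<Rightarrow> nat \<Rightarrow> real \<Rightarrow> nat \<Rightarrow> int \<Rightarrow> real" where
  "walk_trans p b D m n h i d = (\<Sum>j\<le>n. sphere_eigenvalue p (step_sphere_prob (real p powr b) m) j ^
     (steps_until p b D m (real (Suc i) * h) - steps_until p b D m (real i * h)) * shell_wt p n j d)"

locale scaled_random_walk =
  fixes b D :: real and m n :: nat and M :: "'w measure" and S\<^sub>0 :: "'w \<Rightarrow> 'p::prime_type padic set"
    and X S :: "nat \<Rightarrow> 'w \<Rightarrow> 'p padic set"
  assumes walk: "random_walk b m M S\<^sub>0 X S" and b: "b > 0" and D: "D > 0" and nm: "n \<le> m"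
begin

abbreviation "Z \<equiv> \<lambda>i w. coset_res n (X i w)"

sublocale residue_walk M Z "CARD('p)" n "sphere_eigenvalue CARD('p) (step_sphere_prob (real CARD('p) powr b) m)"
  by (rule random_walk_residue_walk[OF walk nm b])

lemma steps_mono: "0 \<le> s \<Longrightarrow> s \<le> t \<Longrightarrow> steps_until CARD('p) b D m s \<le> steps_until CARD('p) b D m t"
  unfolding steps_until_def using time_scale_pos[OF prime_gt_1_CARD[where 'p='p] b D, of m]
  by (intro nat_mono floor_mono mult_right_mono) auto

lemma steps_0: "steps_until CARD('p) b D m 0 = 0" by (simp add: steps_until_def)

lemma residue_scaled_walk:
  assumes "w \<in> space M"
  shows "residue n (scaled_walk b D m S t w) =
    (coset_res n (S\<^sub>0 w) + (\<Sum>i\<in>{0<..steps_until CARD('p) b D m t}. Z i w)) mod CARD('p) ^ n"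
  unfolding scaled_walk_def steps_until_def[symmetric]
  using residue_Gamma_embed[OF random_walk_in_Gm(1)[OF walk assms nm] nm] random_walk_in_Gm(2)[OF walk assms nm] by simp

lemma scaled_walk_measurable: "scaled_walk b D m S t \<in> M \<rightarrow>\<^sub>M Zp_borel"
proof -
  interpret full: residue_walk M "\<lambda>i w. coset_res m (X i w)" "CARD('p)" m
    "sphere_eigenvalue CARD('p) (step_sphere_prob (real CARD('p) powr b) m)"
    by (rule random_walk_residue_walk[OF walk order_refl b])
  let ?f = "\<lambda>w. real (coset_res m (S\<^sub>0 w)) + (\<Sum>i\<in>{0<..steps_until CARD('p) b D m t}. real (coset_res m (X i w)))"
  have "(\<lambda>w. real (coset_res m (S\<^sub>0 w))) \<in> borel_measurable M"
  proof (rule measurable_compose[where f = S\<^sub>0 and g = "\<lambda>C. real (coset_res m C)"])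
    show "S\<^sub>0 \<in> M \<rightarrow>\<^sub>M count_space (Gm m)" using walk by (simp add: random_walk_def)
  qed simp
  then have f: "?f \<in> borel_measurable M"
    by (intro borel_measurable_add full.sum_measurable) auto
  have "(\<lambda>w. \<lfloor>?f w\<rfloor>) \<in> M \<rightarrow>\<^sub>M count_space UNIV"
    by (rule measurable_compose[OF f measurable_real_floor])
  then have "(\<lambda>w. of_nat (nat \<lfloor>?f w\<rfloor> mod CARD('p) ^ m) :: 'p padic) \<in> M \<rightarrow>\<^sub>M Zp_borel"
    by (rule measurable_compose) simp
  then show ?thesis
  proof (rule measurable_cong[THEN iffD1, rotated])
    fix w assume w: "w \<in> space M"
    have "?f w = real (coset_res m (S\<^sub>0 w) + (\<Sum>i\<in>{0<..steps_until CARD('p) b D m t}. coset_res m (X i w)))" by simp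
    then have "nat \<lfloor>?f w\<rfloor> = coset_res m (S\<^sub>0 w) + (\<Sum>i\<in>{0<..steps_until CARD('p) b D m t}. coset_res m (X i w))"
      by (simp only: floor_of_nat nat_int)
    then show "(of_nat (nat \<lfloor>?f w\<rfloor> mod CARD('p) ^ m) :: 'p padic) = scaled_walk b D m S t w"
      unfolding scaled_walk_def steps_until_def[symmetric]
      using Gamma_embed_coset_res[OF random_walk_in_Gm(1)[OF walk w nm]] random_walk_in_Gm(2)[OF walk w order_refl]
      by simp
  qed
qed

lemma residue_scaled_walk_event: "{w \<in> space M. residue n' (scaled_walk b D m S t w) = r} \<in> events"
proof -
  have "scaled_walk b D m S t -` res_ball n' r \<inter> space M \<in> events"
    by (rule measurable_sets[OF scaled_walk_measurable res_ball_sets])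
  moreover have "scaled_walk b D m S t -` res_ball n' r \<inter> space M = {w \<in> space M. residue n' (scaled_walk b D m S t w) = r}"
    using measurable_space[OF scaled_walk_measurable] by (auto simp: res_ball_def)
  ultimately show ?thesis by simp
qed

lemma residue_scaled_walk_less: "w \<in> space M \<Longrightarrow> residue n (scaled_walk b D m S t w) < CARD('p) ^ n"
  using measurable_space[OF scaled_walk_measurable, of w t] by (intro residue_less) simp

text \<open>
  Almost surely the walk starts in the zero coset, and then the residues on the grid are determined
  by the increments over consecutive blocks of steps.
\<close>

lemma walk_grid_prob:
  assumes h: "h > 0" and g: "\<And>i. i \<le> N \<Longrightarrow> g i < CARD('p) ^ n"
  shows "prob {w \<in> space M. \<forall>i\<le>N. residue n (scaled_walk b D m S (real i * h) w) = g i} =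
    chain_prob N (walk_trans CARD('p) b D m n h) g"
proof -
  let ?k = "\<lambda>i. steps_until CARD('p) b D m (real i * h)"
  let ?A = "{w \<in> space M. \<forall>i\<le>N. residue n (scaled_walk b D m S (real i * h) w) = g i}"
  let ?B = "{w \<in> space M. \<forall>i<N. int CARD('p) ^ n dvd (int (g (Suc i)) - int (g i)) - int (\<Sum>l\<in>{?k i<..?k (Suc i)}. Z l w)}"
  have kmono: "?k i \<le> ?k j" if "i \<le> j" for i j using that h by (intro steps_mono mult_right_mono) auto
  have AE0: "AE w in M. S\<^sub>0 w = pZp m" using walk by (simp add: random_walk_def)
  have A_event: "?A \<in> events"
  proof -
    have "{w \<in> space M. \<forall>i\<in>{..N}. residue n (scaled_walk b D m S (real i * h) w) = g i} \<in> events"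
      by (rule sets.sets_Collect_finite_All) (simp_all add: residue_scaled_walk_event)
    then show ?thesis by (simp only: Ball_def atMost_iff)
  qed
  have B_event: "?B \<in> events"
  proof -
    have "{w \<in> space M. \<forall>i\<in>{..<N}. int CARD('p) ^ n dvd (int (g (Suc i)) - int (g i)) - int (\<Sum>l\<in>{?k i<..?k (Suc i)}. Z l w)} \<in> events"
      by (rule sets.sets_Collect_finite_All, rule cong_event) auto
    then show ?thesis by (simp only: Ball_def lessThan_iff)
  qed
  have pointwise: "w \<in> ?A \<longleftrightarrow> w \<in> (if g 0 = 0 then ?B else {})" if w: "w \<in> space M" and w0: "S\<^sub>0 w = pZp m" for w
  proof -
    have res: "residue n (scaled_walk b D m S (real i * h) w) = (\<Sum>l\<in>{0<..?k i}. Z l w) mod CARD('p) ^ n" for i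
      using residue_scaled_walk[OF w, of "real i * h"] by (simp add: w0 coset_res_pZp[OF nm])
    have "(\<forall>i\<le>N. (\<Sum>l\<in>{0<..?k i}. Z l w) mod CARD('p) ^ n = g i) \<longleftrightarrow>
        g 0 = 0 \<and> (\<forall>i<N. int CARD('p) ^ n dvd (int (g (Suc i)) - int (g i)) - int (\<Sum>l\<in>{?k i<..?k (Suc i)}. Z l w))"
    proof (rule residues_iff_increments)
      fix i
      have "{0<..?k (Suc i)} = {0<..?k i} \<union> {?k i<..?k (Suc i)}" using kmono[of i "Suc i"] by auto
      then show "(\<Sum>l\<in>{0<..?k (Suc i)}. Z l w) = (\<Sum>l\<in>{0<..?k i}. Z l w) + (\<Sum>l\<in>{?k i<..?k (Suc i)}. Z l w)"
        by (simp add: sum.union_disjoint)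
    qed (use g p steps_0 in auto)
    then show ?thesis using w by (simp add: res)
  qed
  have "AE w in M. (w \<in> ?A) = (w \<in> (if g 0 = 0 then ?B else {}))"
  proof (rule AE_mp[OF AE0 AE_I2], rule impI)
    fix w assume "w \<in> space M" "S\<^sub>0 w = pZp m"
    then show "(w \<in> ?A) = (w \<in> (if g 0 = 0 then ?B else {}))" by (rule pointwise)
  qed
  moreover have "(if g 0 = 0 then ?B else {}) \<in> events"
    using B_event sets.empty_sets by (rule if_split[THEN iffD2, OF conjI, OF impI impI])
  ultimately have "prob ?A = prob (if g 0 = 0 then ?B else {})"
    using A_event by (intro finite_measure_eq_AE)
  moreover have "prob ?B = (\<Prod>i<N. walk_trans CARD('p) b D m n h i (int (g (Suc i)) - int (g i)))"
    unfolding walk_trans_def by (rule prob_increments_cong[OF kmono])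
  ultimately show ?thesis by (simp add: chain_prob_def)
qed

lemma law_grid_prob:
  assumes law: "scaled_walk_law b D m M S Q" and h: "h > 0"
  shows "measure Q {\<omega> \<in> path_space. \<forall>i\<le>N. grid_residue n h \<omega> i = g i} =
    prob {w \<in> space M. \<forall>i\<le>N. residue n (scaled_walk b D m S (real i * h) w) = g i}"
proof -
  interpret Q: path_law Q using law by (auto simp: scaled_walk_law_def path_law_def path_law_axioms_def)
  define J where "J = (\<lambda>i. real i * h) ` {..N}"
  have J: "finite J" "J \<subseteq> {0..}" using h by (auto simp: J_def)
  let ?PM = "\<Pi>\<^sub>M t\<in>J. (Zp_borel :: 'p padic measure)"
  have eq: "distr Q ?PM (\<lambda>\<omega>. \<lambda>t\<in>J. \<omega> t) = distr M ?PM (\<lambda>w. \<lambda>t\<in>J. scaled_walk b D m S t w)"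
    using law J unfolding scaled_walk_law_def by blast
  have mQ: "(\<lambda>\<omega>. \<lambda>t\<in>J. \<omega> t) \<in> Q \<rightarrow>\<^sub>M ?PM"
    by (rule measurable_restrict) (use J(2) Q.evaluation_measurable in auto)
  have mM: "(\<lambda>w. \<lambda>t\<in>J. scaled_walk b D m S t w) \<in> M \<rightarrow>\<^sub>M ?PM"
    by (rule measurable_restrict) (rule scaled_walk_measurable)
  define E where "E = {x \<in> space ?PM. \<forall>i\<in>{..N}. x (real i * h) \<in> res_ball n (g i)}"
  have E: "E \<in> sets ?PM"
    unfolding E_def
  proof (rule sets.sets_Collect_finite_All)
    fix i assume "i \<in> {..N}"
    then have "(\<lambda>x. x (real i * h)) \<in> ?PM \<rightarrow>\<^sub>M Zp_borel"
      by (intro measurable_component_singleton) (auto simp: J_def)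
    from measurable_sets[OF this res_ball_sets]
    show "{x \<in> space ?PM. x (real i * h) \<in> res_ball n (g i)} \<in> sets ?PM"
      by (simp add: vimage_def Int_def conj_commute)
  qed simp
  have "measure Q ((\<lambda>\<omega>. \<lambda>t\<in>J. \<omega> t) -` E \<inter> space Q) = measure M ((\<lambda>w. \<lambda>t\<in>J. scaled_walk b D m S t w) -` E \<inter> space M)"
    using measure_distr[OF mQ E] measure_distr[OF mM E] eq by simp
  moreover have "(\<lambda>\<omega>. \<lambda>t\<in>J. \<omega> t) -` E \<inter> space Q = {\<omega> \<in> path_space. \<forall>i\<le>N. grid_residue n h \<omega> i = g i}"
  proof (intro set_eqI)
    fix \<omega> :: "real \<Rightarrow> 'p padic"
    have "\<omega> (real i * h) \<in> res_ball n (g i) \<longleftrightarrow> grid_residue n h \<omega> i = g i" if "\<omega> \<in> path_space" for i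
      using path_in_Zp[OF that, of "real i * h"] h by (simp add: res_ball_def grid_residue_def)
    moreover have "real i * h \<in> J" if "i \<le> N" for i using that by (auto simp: J_def)
    moreover have "\<omega> \<in> space Q \<Longrightarrow> (\<lambda>t\<in>J. \<omega> t) \<in> space ?PM" using measurable_space[OF mQ] by simp
    ultimately show "\<omega> \<in> (\<lambda>\<omega>. \<lambda>t\<in>J. \<omega> t) -` E \<inter> space Q \<longleftrightarrow>
        \<omega> \<in> {\<omega> \<in> path_space. \<forall>i\<le>N. grid_residue n h \<omega> i = g i}"
      by (simp add: E_def) blast
  qed
  moreover have "(\<lambda>w. \<lambda>t\<in>J. scaled_walk b D m S t w) -` E \<inter> space M =
      {w \<in> space M. \<forall>i\<le>N. residue n (scaled_walk b D m S (real i * h) w) = g i}"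
  proof (intro set_eqI)
    fix w
    have "scaled_walk b D m S t w \<in> res_ball n r \<longleftrightarrow> residue n (scaled_walk b D m S t w) = r" if "w \<in> space M" for t r
      using measurable_space[OF scaled_walk_measurable that, of t] by (simp add: res_ball_def)
    moreover have "real i * h \<in> J" if "i \<le> N" for i using that by (auto simp: J_def)
    moreover have "w \<in> space M \<Longrightarrow> (\<lambda>t\<in>J. scaled_walk b D m S t w) \<in> space ?PM" using measurable_space[OF mM] by simp
    ultimately show "w \<in> (\<lambda>w. \<lambda>t\<in>J. scaled_walk b D m S t w) -` E \<inter> space M \<longleftrightarrow>
        w \<in> {w \<in> space M. \<forall>i\<le>N. residue n (scaled_walk b D m S (real i * h) w) = g i}"
      by (simp add: E_def) blast
  qed
  ultimately show ?thesis by simp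
qed

lemma change_imp_step:
  assumes w: "w \<in> space M" and st: "0 \<le> s" "s \<le> t"
    and ne: "residue n (scaled_walk b D m S s w) \<noteq> residue n (scaled_walk b D m S t w)"
  shows "\<exists>i\<in>{steps_until CARD('p) b D m s<..steps_until CARD('p) b D m t}. Z i w \<noteq> 0"
proof (rule ccontr)
  assume no: "\<not> ?thesis"
  have "(\<Sum>i\<in>{0<..steps_until CARD('p) b D m t}. Z i w) = (\<Sum>i\<in>{0<..steps_until CARD('p) b D m s}. Z i w)"
    using steps_mono[OF st] no by (intro sum.mono_neutral_right) auto
  then show False using ne by (simp add: residue_scaled_walk[OF w])
qed

end

section \<open>Crowded jumps\<close>

text \<open>
  Evaluated at the residues on the grid of mesh \<open>\<delta> / 2\<^sup>J\<close>, this says that the residue changes in \<open>[0, \<delta>]\<close> or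
  changes twice in one of the overlapping windows \<open>[l \<delta>, (l + 2) \<delta>]\<close>. Because the windows overlap, any two
  changes within distance \<open>\<delta>\<close> fall into a common window.
\<close>

definition crowded :: "nat \<Rightarrow> nat \<Rightarrow> (nat \<Rightarrow> nat) \<Rightarrow> bool" where
  "crowded R J v \<longleftrightarrow> (\<exists>i\<le>2 ^ J. v 0 \<noteq> v i) \<or>
     (\<exists>l<R. \<exists>i j k. l * 2 ^ J \<le> i \<and> i < j \<and> j < k \<and> k \<le> (l + 2) * 2 ^ J \<and> v i \<noteq> v j \<and> v j \<noteq> v k)"

lemma crowded_cong:
  assumes v: "\<And>i. i \<le> (R + 1) * 2 ^ J \<Longrightarrow> v i = v' i"
  shows "crowded R J v = crowded R J v'"
proof -
  have imp: "crowded R J v'" if c: "crowded R J v" and v: "\<And>i. i \<le> (R + 1) * 2 ^ J \<Longrightarrow> v i = v' i" for v v'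
    using c unfolding crowded_def
  proof (elim disjE exE conjE)
    fix i assume i: "i \<le> 2 ^ J" "v 0 \<noteq> v i"
    then have "v' 0 \<noteq> v' i" using v[of 0] v[of i] by simp
    then show "(\<exists>i\<le>2 ^ J. v' 0 \<noteq> v' i) \<or> (\<exists>l<R. \<exists>i j k. l * 2 ^ J \<le> i \<and> i < j \<and> j < k \<and>
      k \<le> (l + 2) * 2 ^ J \<and> v' i \<noteq> v' j \<and> v' j \<noteq> v' k)" using i(1) by blast
  next
    fix l i j k assume l: "l < R" "l * 2 ^ J \<le> i" "i < j" "j < k" "k \<le> (l + 2) * 2 ^ J" "v i \<noteq> v j" "v j \<noteq> v k"
    have "(l + 2) * 2 ^ J \<le> (R + 1) * 2 ^ J" using l(1) by (intro mult_le_mono1) simp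
    then have "v i = v' i" "v j = v' j" "v k = v' k" using v l by auto
    then show "(\<exists>i\<le>2 ^ J. v' 0 \<noteq> v' i) \<or> (\<exists>l<R. \<exists>i j k. l * 2 ^ J \<le> i \<and> i < j \<and> j < k \<and>
      k \<le> (l + 2) * 2 ^ J \<and> v' i \<noteq> v' j \<and> v' j \<noteq> v' k)" using l by metis
  qed
  show ?thesis using imp[of v v'] imp[of v' v] v by metis
qed

definition crowded_event :: "nat \<Rightarrow> nat \<Rightarrow> real \<Rightarrow> nat \<Rightarrow> (real \<Rightarrow> 'p::prime_type padic) set" where
  "crowded_event n R \<delta> J = {\<omega> \<in> path_space. crowded R J (grid_residue n (\<delta> / 2 ^ J) \<omega>)}"

lemma crowded_event_mono: "crowded_event n R \<delta> J \<subseteq> crowded_event n R \<delta> (Suc J)"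
proof
  fix \<omega> :: "real \<Rightarrow> 'a padic" assume "\<omega> \<in> crowded_event n R \<delta> J"
  then have \<omega>: "\<omega> \<in> path_space" "crowded R J (grid_residue n (\<delta> / 2 ^ J) \<omega>)" by (auto simp: crowded_event_def)
  let ?v = "grid_residue n (\<delta> / 2 ^ J) \<omega>" and ?v' = "grid_residue n (\<delta> / 2 ^ Suc J) \<omega>"
  have v: "?v i = ?v' (2 * i)" for i by (simp add: grid_residue_def)
  from \<omega>(2) have "crowded R (Suc J) ?v'"
    unfolding crowded_def
  proof (elim disjE exE conjE)
    fix i assume "i \<le> 2 ^ J" "?v 0 \<noteq> ?v i"
    then have "2 * i \<le> 2 ^ Suc J" "?v' 0 \<noteq> ?v' (2 * i)" using v[of 0] v[of i] by auto
    then show "(\<exists>i\<le>2 ^ Suc J. ?v' 0 \<noteq> ?v' i) \<or> (\<exists>l<R. \<exists>i j k. l * 2 ^ Suc J \<le> i \<and> i < j \<and> j < k \<and>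
      k \<le> (l + 2) * 2 ^ Suc J \<and> ?v' i \<noteq> ?v' j \<and> ?v' j \<noteq> ?v' k)" by blast
  next
    fix l i j k assume l: "l < R" "l * 2 ^ J \<le> i" "i < j" "j < k" "k \<le> (l + 2) * 2 ^ J" "?v i \<noteq> ?v j" "?v j \<noteq> ?v k"
    have "l * 2 ^ Suc J \<le> 2 * i" "2 * i < 2 * j" "2 * j < 2 * k" "2 * k \<le> (l + 2) * 2 ^ Suc J"
      "?v' (2 * i) \<noteq> ?v' (2 * j)" "?v' (2 * j) \<noteq> ?v' (2 * k)"
      using l v by (simp_all add: mult.left_commute)
    then show "(\<exists>i\<le>2 ^ Suc J. ?v' 0 \<noteq> ?v' i) \<or> (\<exists>l<R. \<exists>i j k. l * 2 ^ Suc J \<le> i \<and> i < j \<and> j < k \<and>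
      k \<le> (l + 2) * 2 ^ Suc J \<and> ?v' i \<noteq> ?v' j \<and> ?v' j \<noteq> ?v' k)" using l(1) by blast
  qed
  then show "\<omega> \<in> crowded_event n R \<delta> (Suc J)" using \<omega>(1) by (simp add: crowded_event_def)
qed

text \<open>
  By right-continuity the values at any three times are also attained at later points of a sufficiently
  fine dyadic grid, so a violation of sparseness shows up on some grid.
\<close>

lemma sparse_jumps_if_not_crowded:
  fixes \<omega> :: "real \<Rightarrow> 'p::prime_type padic"
  assumes \<omega>: "\<omega> \<in> path_space" "\<And>J. \<omega> \<notin> crowded_event n R \<delta> J" and \<delta>: "\<delta> > 0" and L: "L \<ge> 4"
  shows "sparse_jumps (\<lambda>t. residue n (\<omega> t)) (real R * \<delta>) \<delta> L"
proof
  let ?\<xi> = "\<lambda>t. residue n (\<omega> t)"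
  have rc: "\<exists>d>0. \<forall>s. t \<le> s \<and> s < t + d \<longrightarrow> ?\<xi> s = ?\<xi> t" if t: "t \<ge> 0" for t
  proof -
    obtain d where "d > 0" "\<And>s. t \<le> s \<Longrightarrow> s < t + d \<Longrightarrow> ?\<xi> s = ?\<xi> t"
      by (rule residue_right_constant[OF \<omega>(1) t]) (rule that)
    then show ?thesis by blast
  qed
  show "\<exists>d>0. \<forall>s. t \<le> s \<and> s < t + d \<longrightarrow> ?\<xi> s = ?\<xi> t" if "t \<ge> 0" for t by (rule rc[OF that])
  show "\<delta> > 0" "4 \<le> L" by (rule \<delta>, rule L)
  have small: "\<exists>J. \<delta> / 2 ^ J < d" if d: "d > 0" for d
  proof -
    have "0 < d / \<delta>" using d \<delta> by simp
    then obtain J where "(1 / 2 :: real) ^ J < d / \<delta>" using real_arch_pow_inv[of "d / \<delta>" "1 / 2"] by auto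
    then have "\<delta> / 2 ^ J < d" using \<delta> by (simp add: power_one_over field_simps)
    then show ?thesis by blast
  qed
  define idx where "idx J t = nat \<lceil>t / (\<delta> / 2 ^ J)\<rceil>" for J :: nat and t
  have idx: "t \<le> real (idx J t) * (\<delta> / 2 ^ J)" "real (idx J t) * (\<delta> / 2 ^ J) < t + \<delta> / 2 ^ J" if t: "t \<ge> 0" for J t
  proof -
    define \<eta> where "\<eta> = \<delta> / 2 ^ J"
    have \<eta>: "\<eta> > 0" using \<delta> by (simp add: \<eta>_def)
    have "0 \<le> t / \<eta>" using t \<eta> by simp
    then have "0 \<le> \<lceil>t / \<eta>\<rceil>" by linarith
    then have "real (idx J t) = of_int \<lceil>t / \<eta>\<rceil>" unfolding idx_def \<eta>_def[symmetric] by (rule of_nat_nat)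
    then have 1: "t / \<eta> \<le> real (idx J t)" "real (idx J t) < t / \<eta> + 1" by linarith+
    show "t \<le> real (idx J t) * (\<delta> / 2 ^ J)"
      unfolding \<eta>_def[symmetric] using 1(1) \<eta> by (simp only: pos_divide_le_eq)
    have "real (idx J t) * \<eta> < (t / \<eta> + 1) * \<eta>" using 1(2) \<eta> by (rule mult_strict_right_mono)
    also have "\<dots> = t + \<eta>" using \<eta> by (simp add: distrib_right)
    finally show "real (idx J t) * (\<delta> / 2 ^ J) < t + \<delta> / 2 ^ J" unfolding \<eta>_def .
  qed
  have idx_mono: "idx J s \<le> idx J t" if "s \<le> t" for J s t
    unfolding idx_def using that \<delta> by (intro nat_mono ceiling_mono divide_right_mono) auto
  have idx_le: "idx J t \<le> k * 2 ^ J" if "t \<le> real k * \<delta>" for J t k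
  proof -
    have "t / (\<delta> / 2 ^ J) \<le> real (k * 2 ^ J)" using that \<delta> by (simp add: field_simps)
    then have "\<lceil>t / (\<delta> / 2 ^ J)\<rceil> \<le> int (k * 2 ^ J)" by (simp only: ceiling_le_iff of_int_of_nat_eq)
    then show ?thesis unfolding idx_def by linarith
  qed
  have le_idx: "k * 2 ^ J \<le> idx J t" if "real k * \<delta> \<le> t" for J t k
  proof -
    have "real (k * 2 ^ J) \<le> t / (\<delta> / 2 ^ J)" using that \<delta> by (simp add: field_simps)
    then have "int (k * 2 ^ J) \<le> \<lceil>t / (\<delta> / 2 ^ J)\<rceil>" by linarith
    then show ?thesis unfolding idx_def by linarith
  qed
  have sampled: "grid_residue n (\<delta> / 2 ^ J) \<omega> (idx J t) = ?\<xi> t"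
    if t: "t \<ge> 0" and d: "\<And>s. t \<le> s \<Longrightarrow> s < t + d \<Longrightarrow> ?\<xi> s = ?\<xi> t" and J: "\<delta> / 2 ^ J \<le> d" for J t d
    unfolding grid_residue_def using idx[OF t, of J] J by (intro d) auto
  have not_crowded: "\<not> crowded R J (grid_residue n (\<delta> / 2 ^ J) \<omega>)" for J
    using \<omega> by (simp add: crowded_event_def)
  show "?\<xi> s = ?\<xi> 0" if s: "0 \<le> s" "s \<le> \<delta>" for s
  proof (rule ccontr)
    assume ne: "?\<xi> s \<noteq> ?\<xi> 0"
    obtain d where d: "d > 0" "\<And>u. s \<le> u \<Longrightarrow> u < s + d \<Longrightarrow> ?\<xi> u = ?\<xi> s" using rc[OF s(1)] by blast
    obtain J where J: "\<delta> / 2 ^ J < d" using small[OF d(1)] by blast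
    let ?v = "grid_residue n (\<delta> / 2 ^ J) \<omega>"
    have "?v (idx J s) = ?\<xi> s" by (rule sampled[OF s(1) d(2)]) (use J in auto)
    moreover have "?v 0 = ?\<xi> 0" by (simp add: grid_residue_def)
    moreover have "idx J s \<le> 2 ^ J" using idx_le[of s 1 J] s by simp
    ultimately have "crowded R J ?v" unfolding crowded_def using ne by metis
    then show False using not_crowded by blast
  qed
  show "?\<xi> r = ?\<xi> s \<or> ?\<xi> s = ?\<xi> t"
    if r: "0 \<le> r" "r < s" "s < t" "t \<le> real R * \<delta>" "t - r \<le> \<delta>" for r s t
  proof (rule ccontr)
    assume "\<not> ?thesis"
    then have ne: "?\<xi> r \<noteq> ?\<xi> s" "?\<xi> s \<noteq> ?\<xi> t" by auto
    have st: "0 \<le> s" "0 \<le> t" using r by auto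
    obtain d1 where d1: "d1 > 0" "\<And>u. r \<le> u \<Longrightarrow> u < r + d1 \<Longrightarrow> ?\<xi> u = ?\<xi> r" using rc[OF r(1)] by blast
    obtain d2 where d2: "d2 > 0" "\<And>u. s \<le> u \<Longrightarrow> u < s + d2 \<Longrightarrow> ?\<xi> u = ?\<xi> s" using rc[OF st(1)] by blast
    obtain d3 where d3: "d3 > 0" "\<And>u. t \<le> u \<Longrightarrow> u < t + d3 \<Longrightarrow> ?\<xi> u = ?\<xi> t" using rc[OF st(2)] by blast
    obtain J where J: "\<delta> / 2 ^ J < min d1 (min d2 d3)" using small[of "min d1 (min d2 d3)"] d1(1) d2(1) d3(1) by auto
    let ?v = "grid_residue n (\<delta> / 2 ^ J) \<omega>"
    have v: "?v (idx J r) = ?\<xi> r" "?v (idx J s) = ?\<xi> s" "?v (idx J t) = ?\<xi> t"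
      by (rule sampled[OF r(1) d1(2)], use J in auto)
        (rule sampled[OF st(1) d2(2)], use J in auto, rule sampled[OF st(2) d3(2)], use J in auto)
    have lt: "idx J r < idx J s" "idx J s < idx J t"
      using idx_mono[of r s J] idx_mono[of s t J] r v ne by (metis less_imp_le le_neq_implies_less)+
    \<comment> \<open>The window that begins last before \<open>r\<close> also contains \<open>t\<close>.\<close>
    define l where "l = nat \<lfloor>r / \<delta>\<rfloor>"
    have "0 \<le> r / \<delta>" using r \<delta> by simp
    then have "real l = of_int \<lfloor>r / \<delta>\<rfloor>" by (simp add: l_def)
    then have "real l \<le> r / \<delta>" "r / \<delta> < real l + 1" by linarith+
    then have l: "real l * \<delta> \<le> r" "r < (real l + 1) * \<delta>"
      using \<delta> by (simp_all only: pos_le_divide_eq pos_divide_less_eq)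
    have "real l * \<delta> < real R * \<delta>" using l(1) r by linarith
    then have "l < R" using \<delta> by simp
    moreover have "l * 2 ^ J \<le> idx J r" by (rule le_idx[OF l(1)])
    moreover have "idx J t \<le> (l + 2) * 2 ^ J"
      using l(2) r by (intro idx_le) (simp add: algebra_simps)
    ultimately have "crowded R J ?v" unfolding crowded_def using lt v ne by metis
    then show False using not_crowded by blast
  qed
qed

definition crowding_bound :: "nat \<Rightarrow> real \<Rightarrow> real \<Rightarrow> nat \<Rightarrow> nat \<Rightarrow> real \<Rightarrow> nat \<Rightarrow> real" where
  "crowding_bound p b D n R \<delta> m =
     (let \<kappa> = ((real p powr b) ^ n - 1) / ((real p powr b) ^ m - 1) in
      \<delta> * (time_scale p b D m * \<kappa>) + real R * (2 * \<delta> * (time_scale p b D m * \<kappa>) + \<kappa>)\<^sup>2)"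

context scaled_random_walk
begin

text \<open>
  A crowded path has a step with nonzero residue before time \<open>\<delta>\<close>, or two such steps in one window. A
  window contains at most \<open>2 \<delta> \<lambda>\<^sub>m + 1\<close> steps, and each pair of steps contributes \<open>\<kappa>\<^sup>2\<close>. The bound does not
  depend on the mesh of the grid.
\<close>

lemma walk_crowded_prob:
  assumes \<delta>: "\<delta> > 0"
  shows "prob {w \<in> space M. crowded R J (\<lambda>i. residue n (scaled_walk b D m S (real i * (\<delta> / 2 ^ J)) w))}
    \<le> crowding_bound CARD('p) b D n R \<delta> m"
proof -
  let ?k = "steps_until CARD('p) b D m" and ?L = "time_scale CARD('p) b D m"
  define \<eta> where "\<eta> = \<delta> / 2 ^ J"
  let ?v = "\<lambda>w i. residue n (scaled_walk b D m S (real i * \<eta>) w)"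
  let ?N = "\<lambda>i. {w \<in> space M. Z i w \<noteq> 0}" and ?T = "\<lambda>l. {?k (real l * \<delta>)<..?k (real (l + 2) * \<delta>)}"
  define \<kappa> where "\<kappa> = ((real CARD('p) powr b) ^ n - 1) / ((real CARD('p) powr b) ^ m - 1)"
  have L: "?L > 0" by (rule time_scale_pos[OF p b D])
  have \<eta>: "\<eta> > 0" "2 ^ J * \<eta> = \<delta>" using \<delta> by (simp_all add: \<eta>_def)
  have step: "step_law b m M (X i)" if "i \<ge> 1" for i using walk that by (simp add: random_walk_def)
  have N: "prob (?N i) = \<kappa>" if "i \<ge> 1" for i
    using prob_step_nonzero[OF prob_space_axioms step[OF that] nm b] by (simp add: sum_step_sphere_prob \<kappa>_def)
  have \<kappa>0: "\<kappa> \<ge> 0" using N[of 1] measure_nonneg[of M "?N 1"] by simp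
  have NN: "prob (?N i \<inter> ?N j) = \<kappa> * \<kappa>" if "i \<noteq> j" "i \<ge> 1" "j \<ge> 1" for i j
  proof -
    have "?N i \<inter> ?N j = {w \<in> space M. Z i w \<noteq> 0 \<and> Z j w \<noteq> 0}" by auto
    then show ?thesis using prob_two_steps[OF that] N that by simp
  qed
  have change: "\<exists>t\<in>{?k (real i * \<eta>)<..?k (real j * \<eta>)}. Z t w \<noteq> 0"
    if "w \<in> space M" "i \<le> j" "?v w i \<noteq> ?v w j" for w i j
    using that \<eta> by (intro change_imp_step) (auto intro!: mult_right_mono)
  define A where "A = (\<Union>t\<in>{0<..?k \<delta>}. ?N t)"
  define B where "B l = (\<Union>(t, u)\<in>{(t, u). t \<in> ?T l \<and> u \<in> ?T l \<and> t < u}. ?N t \<inter> ?N u)" for l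
  have finT: "finite {(t, u). t \<in> ?T l \<and> u \<in> ?T l \<and> t < u}" for l
    by (rule finite_subset[of _ "?T l \<times> ?T l"]) auto
  have A_ev: "A \<in> events" unfolding A_def by (intro sets.finite_UN nonzero_event) auto
  have pair_ev: "(case x of (t, u) \<Rightarrow> ?N t \<inter> ?N u) \<in> events" if xP: "x \<in> {(t, u). t \<in> ?T l \<and> u \<in> ?T l \<and> t < u}" for x l
  proof -
    obtain t u where x: "x = (t, u)" "t \<ge> 1" "u \<ge> 1" using xP by (cases x) auto
    show ?thesis unfolding x(1) prod.case by (rule sets.Int[OF nonzero_event[OF x(2)] nonzero_event[OF x(3)]])
  qed
  have B_ev: "B l \<in> events" for l
    unfolding B_def by (rule sets.finite_UN[OF finT pair_ev])
  have sub: "{w \<in> space M. crowded R J (?v w)} \<subseteq> A \<union> (\<Union>l<R. B l)"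
  proof
    fix w assume "w \<in> {w \<in> space M. crowded R J (?v w)}"
    then have w: "w \<in> space M" "crowded R J (?v w)" by auto
    from w(2) show "w \<in> A \<union> (\<Union>l<R. B l)"
      unfolding crowded_def
    proof (elim disjE exE conjE)
      fix i :: nat assume i: "i \<le> 2 ^ J" "?v w 0 \<noteq> ?v w i"
      obtain t where t: "t \<in> {?k (real 0 * \<eta>)<..?k (real i * \<eta>)}" "Z t w \<noteq> 0"
        using change[OF w(1) _ i(2)] by blast
      have "real i \<le> 2 ^ J" using i(1) by (metis of_nat_le_iff of_nat_numeral of_nat_power)
      then have "real i * \<eta> \<le> 2 ^ J * \<eta>" using \<eta> by (intro mult_right_mono) auto
      then have "?k (real i * \<eta>) \<le> ?k \<delta>" using \<eta> by (intro steps_mono) auto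
      then have "w \<in> A" unfolding A_def using t w(1) by auto
      then show ?thesis by blast
    next
      fix l i j k :: nat
      assume l: "l < R" "l * 2 ^ J \<le> i" "i < j" "j < k" "k \<le> (l + 2) * 2 ^ J" "?v w i \<noteq> ?v w j" "?v w j \<noteq> ?v w k"
      obtain t where t: "t \<in> {?k (real i * \<eta>)<..?k (real j * \<eta>)}" "Z t w \<noteq> 0"
        using change[OF w(1) _ l(6)] l(3) by (metis less_imp_le)
      obtain u where u: "u \<in> {?k (real j * \<eta>)<..?k (real k * \<eta>)}" "Z u w \<noteq> 0"
        using change[OF w(1) _ l(7)] l(4) by (metis less_imp_le)
      have pt: "real (x * 2 ^ J) * \<eta> = real x * \<delta>" for x
        using \<eta>(2) by (simp add: mult.assoc)
      have "real (l * 2 ^ J) * \<eta> \<le> real i * \<eta>" "real k * \<eta> \<le> real ((l + 2) * 2 ^ J) * \<eta>"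
        using \<eta> l(2,5) by (intro mult_right_mono of_nat_mono; simp)+
      then have "?k (real l * \<delta>) \<le> ?k (real i * \<eta>)" "?k (real k * \<eta>) \<le> ?k (real (l + 2) * \<delta>)"
        unfolding pt using \<eta> \<delta> by (intro steps_mono; simp)+
      then have "(t, u) \<in> {(t, u). t \<in> ?T l \<and> u \<in> ?T l \<and> t < u}" using t(1) u(1) by auto
      then have "w \<in> B l" unfolding B_def using t(2) u(2) w(1) by blast
      then show ?thesis using l(1) by blast
    qed
  qed
  have "prob {w \<in> space M. crowded R J (?v w)} \<le> prob (A \<union> (\<Union>l<R. B l))"
    using A_ev B_ev by (intro finite_measure_mono[OF sub] sets.Un sets.finite_UN) auto
  also have "\<dots> \<le> prob A + prob (\<Union>l<R. B l)"
    using A_ev B_ev by (intro measure_Un_le sets.finite_UN) auto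
  also have "prob A \<le> (\<Sum>t\<in>{0<..?k \<delta>}. prob (?N t))"
    unfolding A_def by (intro finite_measure_subadditive_finite image_subsetI nonzero_event) auto
  also have "(\<Sum>t\<in>{0<..?k \<delta>}. prob (?N t)) = (\<Sum>t\<in>{0<..?k \<delta>}. \<kappa>)"
    by (intro sum.cong refl N) simp
  also have "\<dots> = real (?k \<delta>) * \<kappa>" by simp
  also have "\<dots> \<le> \<delta> * ?L * \<kappa>"
  proof -
    have "0 \<le> \<delta> * ?L" using \<delta> L by simp
    then have "real (?k \<delta>) \<le> \<delta> * ?L" unfolding steps_until_def by linarith
    then show ?thesis using \<kappa>0 by (intro mult_right_mono)
  qed
  also have "prob (\<Union>l<R. B l) \<le> (\<Sum>l<R. prob (B l))"
    using B_ev by (intro finite_measure_subadditive_finite) auto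
  also have "\<dots> \<le> (\<Sum>l<R. ((2 * \<delta> * ?L + 1) * \<kappa>)\<^sup>2)"
  proof (rule sum_mono)
    fix l
    let ?P = "{(t, u). t \<in> ?T l \<and> u \<in> ?T l \<and> t < u}"
    have "prob (B l) \<le> (\<Sum>x\<in>?P. prob (case x of (t, u) \<Rightarrow> ?N t \<inter> ?N u))"
      unfolding B_def by (rule finite_measure_subadditive_finite[OF finT]) (use pair_ev in blast)
    also have "\<dots> = (\<Sum>x\<in>?P. \<kappa> * \<kappa>)"
    proof (rule sum.cong[OF refl])
      fix x assume "x \<in> ?P"
      then obtain t u where x: "x = (t, u)" "t \<noteq> u" "t \<ge> 1" "u \<ge> 1" by (cases x) auto
      show "prob (case x of (t, u) \<Rightarrow> ?N t \<inter> ?N u) = \<kappa> * \<kappa>"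
        unfolding x(1) prod.case by (rule NN[OF x(2-4)])
    qed
    also have "\<dots> = real (card ?P) * (\<kappa> * \<kappa>)" by simp
    also have "\<dots> \<le> (real (card (?T l)) * real (card (?T l))) * (\<kappa> * \<kappa>)"
    proof -
      have "card ?P \<le> card (?T l \<times> ?T l)" by (intro card_mono) auto
      then have "real (card ?P) \<le> real (card (?T l) * card (?T l))" by (simp only: card_cartesian_product of_nat_le_iff)
      then show ?thesis using \<kappa>0 by (intro mult_right_mono) auto
    qed
    also have "\<dots> = (real (card (?T l)) * \<kappa>)\<^sup>2" by (simp add: power2_eq_square)
    also have "\<dots> \<le> ((2 * \<delta> * ?L + 1) * \<kappa>)\<^sup>2"
    proof -
      define x where "x = real l * \<delta> * ?L"
      have x0: "x \<ge> 0" using \<delta> L by (simp add: x_def)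
      have y: "real (l + 2) * \<delta> * ?L = x + 2 * \<delta> * ?L" by (simp add: x_def algebra_simps)
      have y0: "0 \<le> 2 * \<delta> * ?L" using \<delta> L by simp
      have "real (card (?T l)) \<le> 2 * \<delta> * ?L + 1"
        unfolding card_greaterThanAtMost steps_until_def y x_def[symmetric] using x0 y0 by linarith
      then show ?thesis using \<kappa>0 by (intro power_mono mult_right_mono) auto
    qed
    finally show "prob (B l) \<le> ((2 * \<delta> * ?L + 1) * \<kappa>)\<^sup>2" .
  qed
  finally show ?thesis
    unfolding \<eta>_def by (simp add: crowding_bound_def Let_def \<kappa>_def[symmetric] algebra_simps)
qed

end

lemma crowding_bound_tendsto:
  fixes n :: nat
  assumes p: "p > 1" and b: "b > 0" and D: "D > 0"
  defines "C \<equiv> D / bm_beta p b * ((real p powr b) ^ n - 1)"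
  shows "crowding_bound p b D n R \<delta> \<longlonglongrightarrow> \<delta> * C + real R * (2 * \<delta> * C)\<^sup>2"
proof -
  have "crowding_bound p b D n R \<delta> \<longlonglongrightarrow> \<delta> * C + real R * (2 * \<delta> * C + 0)\<^sup>2"
    unfolding crowding_bound_def Let_def C_def
    by (intro tendsto_add tendsto_mult[OF tendsto_const] tendsto_power
        time_scale_over_power[OF p b D] over_power_null[OF p b D])
  then show ?thesis by simp
qed

section \<open>Weak convergence\<close>

lemma (in path_law) crowded_event_prob:
  assumes \<delta>: "\<delta> > 0"
  shows "crowded_event n R \<delta> J \<in> events"
    and "prob (crowded_event n R \<delta> J) =
      (\<Sum>g\<in>PiE {..(R + 1) * 2 ^ J} (\<lambda>_. {..<CARD('p) ^ n}). of_bool (crowded R J g) *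
        prob {\<omega> \<in> path_space. \<forall>i\<le>(R + 1) * 2 ^ J. grid_residue n (\<delta> / 2 ^ J) \<omega> i = g i})"
proof -
  let ?h = "\<delta> / 2 ^ J"
  have h: "?h \<ge> 0" using \<delta> by simp
  have ev: "{\<omega> \<in> space Q. grid_residue n ?h \<omega> i = r} \<in> events" for i r
    unfolding space_law by (rule grid_residue_event[OF h])
  have less: "grid_residue n ?h \<omega> i < CARD('p) ^ n" if "\<omega> \<in> space Q" for \<omega> i
    using that by (intro grid_residue_less h) simp
  show "crowded_event n R \<delta> J \<in> events"
    unfolding crowded_event_def space_law[symmetric]
    by (rule prob_finite_vector(1)[where K = "CARD('p) ^ n"]) (rule ev, rule less, assumption, rule crowded_cong)
  show "prob (crowded_event n R \<delta> J) =
      (\<Sum>g\<in>PiE {..(R + 1) * 2 ^ J} (\<lambda>_. {..<CARD('p) ^ n}). of_bool (crowded R J g) *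
        prob {\<omega> \<in> path_space. \<forall>i\<le>(R + 1) * 2 ^ J. grid_residue n (\<delta> / 2 ^ J) \<omega> i = g i})"
    unfolding crowded_event_def space_law[symmetric]
    by (rule prob_finite_vector(2)) (rule ev, rule less, assumption, rule crowded_cong)
qed

lemma (in path_law) prob_crowded_limit_le:
  assumes \<delta>: "\<delta> > 0" and le: "\<And>J. prob (crowded_event n R \<delta> J) \<le> c"
  shows "prob (\<Union>J. crowded_event n R \<delta> J) \<le> c"
proof (rule LIMSEQ_le_const2)
  show "(\<lambda>J. prob (crowded_event n R \<delta> J)) \<longlonglongrightarrow> prob (\<Union>J. crowded_event n R \<delta> J)"
    by (rule finite_Lim_measure_incseq)
      (auto intro: crowded_event_prob(1)[OF \<delta>] incseq_SucI crowded_event_mono[THEN subsetD])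
qed (use le in blast)

lemma (in path_law) integral_sample_path:
  fixes n N :: nat
  assumes h: "h > 0"
  defines "\<alpha> \<equiv> \<lambda>\<omega>. sample_path h N (\<lambda>i. of_nat (grid_residue n h \<omega> i) :: 'p padic)"
  shows "(\<lambda>\<omega>. g (\<alpha> \<omega>) :: real) \<in> borel_measurable Q"
    and "(\<integral>\<omega>. g (\<alpha> \<omega>) \<partial>Q) = (\<Sum>v\<in>PiE {..N} (\<lambda>_. {..<CARD('p) ^ n}).
      g (sample_path h N (\<lambda>i. of_nat (v i))) * prob {\<omega> \<in> path_space. \<forall>i\<le>N. grid_residue n h \<omega> i = v i})"
proof -
  have h0: "h \<ge> 0" using h by simp
  let ?\<Phi> = "\<lambda>v. g (sample_path h N (\<lambda>i. of_nat (v i) :: 'p padic))"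
  have ev: "{\<omega> \<in> space Q. grid_residue n h \<omega> i = r} \<in> events" for i r
    unfolding space_law by (rule grid_residue_event[OF h0])
  have less: "grid_residue n h \<omega> i < CARD('p) ^ n" if "\<omega> \<in> space Q" for \<omega> i
    using that by (intro grid_residue_less h0) simp
  have dep: "?\<Phi> v = ?\<Phi> v'" if "\<And>i. i \<le> N \<Longrightarrow> v i = v' i" for v v'
  proof -
    have "sample_path h N (\<lambda>i. of_nat (v i) :: 'p padic) = sample_path h N (\<lambda>i. of_nat (v' i))"
      unfolding sample_path_def by (intro restrict_ext arg_cong[where f = of_nat] that) simp
    then show ?thesis by simp
  qed
  note iv = integral_finite_vector[where \<Phi> = ?\<Phi> and N = N and K = "CARD('p) ^ n" and V = "grid_residue n h"]
  show "(\<lambda>\<omega>. g (\<alpha> \<omega>)) \<in> borel_measurable Q"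
    unfolding \<alpha>_def by (rule iv(1)) (rule ev, rule less, assumption, rule dep)
  show "(\<integral>\<omega>. g (\<alpha> \<omega>) \<partial>Q) = (\<Sum>v\<in>PiE {..N} (\<lambda>_. {..<CARD('p) ^ n}).
      g (sample_path h N (\<lambda>i. of_nat (v i))) * prob {\<omega> \<in> path_space. \<forall>i\<le>N. grid_residue n h \<omega> i = v i})"
    unfolding \<alpha>_def space_law[symmetric] by (rule iv(2)) (rule ev, rule less, assumption, rule dep)
qed

text \<open>
  The approximating map samples the residues. First \<open>n\<close>, \<open>T\<close> and \<open>L\<close> are chosen to make the error of sampling
  a sparse path small, then \<open>\<delta> = T / R\<close> to make crowded paths unlikely; for fixed parameters, integrals of
  functions of the sampled path are finite sums over grid laws. For the limit law the bound on crowded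
  paths is obtained on each dyadic grid as a limit of the bounds for the approximating laws.
\<close>

lemma converges_weakly_by_grid:
  fixes Ms :: "nat \<Rightarrow> (real \<Rightarrow> 'p::prime_type padic) measure" and Q :: "(real \<Rightarrow> 'p padic) measure"
    and C :: "nat \<Rightarrow> real" and bound :: "nat \<Rightarrow> nat \<Rightarrow> real \<Rightarrow> nat \<Rightarrow> real"
  assumes Ms: "eventually (\<lambda>m. path_law (Ms m)) sequentially" and Q: "path_law Q"
    and conv: "\<And>n h K g. h > 0 \<Longrightarrow> (\<And>i. i \<le> K \<Longrightarrow> g i < CARD('p) ^ n) \<Longrightarrow>
      (\<lambda>m. measure (Ms m) {\<omega> \<in> path_space. \<forall>i\<le>K. grid_residue n h \<omega> i = g i}) \<longlonglongrightarrow>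
        measure Q {\<omega> \<in> path_space. \<forall>i\<le>K. grid_residue n h \<omega> i = g i}"
    and crowd: "\<And>n R \<delta>. \<delta> > 0 \<Longrightarrow>
      eventually (\<lambda>m. \<forall>J. measure (Ms m) (crowded_event n R \<delta> J) \<le> bound n R \<delta> m) sequentially"
    and bound: "\<And>n R \<delta>. \<delta> > 0 \<Longrightarrow> bound n R \<delta> \<longlonglongrightarrow> \<delta> * C n + real R * (2 * \<delta> * C n)\<^sup>2"
  shows "converges_weakly path_topology Ms Q"
proof -
  interpret sk: Metric_space "path_space :: (real \<Rightarrow> 'p padic) set" skorohod_dist by (rule Metric_space_skorohod)
  interpret Q: path_law Q by (rule Q)
  have top: "(path_topology :: (real \<Rightarrow> 'p padic) topology) = sk.mtopology" by (simp add: skorohod_topology_def)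
  have p1: "real CARD('p) > 1" using prime_gt_1_CARD[where 'p='p] by simp
  have PiE_less: "v i < CARD('p) ^ n" if "v \<in> PiE {..K} (\<lambda>_. {..<CARD('p) ^ n})" "i \<le> K" for v :: "nat \<Rightarrow> nat" and i K n
    using that by (auto simp: PiE_def Pi_def)
  show ?thesis
    unfolding top
  proof (rule sk.converges_weakly_by_approximation)
    show "eventually (\<lambda>m. prob_space (Ms m) \<and> sets (Ms m) = sets (topology_borel sk.mtopology)) sequentially"
      using Ms by eventually_elim (simp add: path_law_def path_law_axioms_def top)
    show "prob_space Q" by (rule Q.prob_space_axioms)
    show "sets Q = sets (topology_borel sk.mtopology)" using Q.sets_law by (simp add: top)
    fix \<epsilon> :: real assume \<epsilon>: "\<epsilon> > 0"
    then have e4: "\<epsilon> / 4 > 0" by simp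
    obtain n where n: "(1 / real CARD('p)) ^ n < \<epsilon> / 4"
      using real_arch_pow_inv[OF e4, of "1 / real CARD('p)"] p1 by auto
    obtain T0 where "exp (- 1 :: real) ^ T0 < \<epsilon> / 4" using real_arch_pow_inv[OF e4, of "exp (- 1)"] by auto
    then have T0: "exp (- real T0) < \<epsilon> / 4" by (simp add: exp_of_nat_mult[symmetric])
    define T where "T = real (Suc T0)"
    have T: "T > 0" "exp (- T) < \<epsilon> / 4" using T0 by (auto simp: T_def intro: le_less_trans[rotated])
    obtain L0 :: nat where L0: "4 + 4 * T / \<epsilon> + 2 / \<epsilon> \<le> real L0" using real_arch_simple by blast
    have frac: "0 < 4 * T / \<epsilon>" "0 < 2 / \<epsilon>" using T \<epsilon> by auto
    have L: "L0 \<ge> 4" "4 * T / \<epsilon> \<le> real L0" "2 / \<epsilon> \<le> real L0" using L0 frac by linarith+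
    then have L': "2 / real L0 \<le> \<epsilon>" "T / real L0 \<le> \<epsilon> / 4" using \<epsilon> by (simp_all add: field_simps)
    \<comment> \<open>With \<open>\<delta> = T / R\<close> the limiting bound on crowding is \<open>c / R\<close>.\<close>
    define c where "c = T * C n + 4 * T\<^sup>2 * (C n)\<^sup>2"
    obtain R0 :: nat where R0: "\<bar>c\<bar> / \<epsilon> < real R0" using reals_Archimedean2 by blast
    define R where "R = Suc R0"
    define \<delta> where "\<delta> = T / real R"
    have R: "\<bar>c\<bar> / \<epsilon> < real R" "real R > 0" using R0 by (auto simp: R_def)
    have \<delta>: "\<delta> > 0" "real R * \<delta> = T" using T R by (simp_all add: \<delta>_def)
    have "\<delta> * C n + real R * (2 * \<delta> * C n)\<^sup>2 = c / real R"
      using R by (simp add: \<delta>_def c_def power2_eq_square field_simps)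
    also have "\<dots> < \<epsilon>"
    proof -
      have "\<bar>c\<bar> < real R * \<epsilon>" using R(1) \<epsilon> by (simp add: pos_divide_less_eq)
      then have "c < \<epsilon> * real R" by (simp add: mult.commute)
      then show ?thesis using R(2) by (simp add: pos_divide_less_eq)
    qed
    finally have lim: "\<delta> * C n + real R * (2 * \<delta> * C n)\<^sup>2 < \<epsilon>" .
    define h where "h = \<delta> / real L0"
    have h: "h > 0" using \<delta> L by (simp add: h_def)
    define N where "N = R * L0"
    define \<alpha> :: "(real \<Rightarrow> 'p padic) \<Rightarrow> real \<Rightarrow> 'p padic" where "\<alpha> = (\<lambda>\<omega>. sample_path h N (\<lambda>i. of_nat (grid_residue n h \<omega> i) :: 'p padic))"
    define B where "B = (\<Union>J. crowded_event n R \<delta> J :: (real \<Rightarrow> 'p padic) set)"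
    have \<alpha>: "\<alpha> \<in> path_space \<rightarrow> path_space"
      unfolding \<alpha>_def using sample_path_in_skorohod_space[OF h of_nat_in_Zp] by auto
    have "B \<in> sets Q" unfolding B_def using Q.crowded_event_prob(1)[OF \<delta>(1)] by (intro sets.countable_UN) auto
    then have B: "B \<in> sets (topology_borel sk.mtopology)" using Q.sets_law by (simp add: top)
    have close: "\<forall>\<omega>\<in>path_space - B. skorohod_dist \<omega> (\<alpha> \<omega>) \<le> \<epsilon>"
    proof
      fix \<omega> :: "real \<Rightarrow> 'p padic" assume "\<omega> \<in> path_space - B"
      then have \<omega>: "\<omega> \<in> path_space" "\<And>J. \<omega> \<notin> crowded_event n R \<delta> J" unfolding B_def by blast+
      have "skorohod_dist \<omega> (\<alpha> \<omega>) \<le>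
          max (2 / real L0) ((1 / real CARD('p)) ^ n + real R * \<delta> / real L0 + exp (- (real R * \<delta>)))"
        unfolding \<alpha>_def h_def N_def grid_residue_def
        by (rule skorohod_dist_sample_path[OF \<omega>(1) sparse_jumps_if_not_crowded[OF \<omega> \<delta>(1) L(1)]])
      also have "\<dots> \<le> \<epsilon>" using L' n T e4 unfolding \<delta>(2) by (intro max.boundedI) linarith+
      finally show "skorohod_dist \<omega> (\<alpha> \<omega>) \<le> \<epsilon>" .
    qed
    have Ms_small: "eventually (\<lambda>m. (\<forall>J. measure (Ms m) (crowded_event n R \<delta> J) \<le> \<epsilon>)) sequentially"
    proof -
      have "eventually (\<lambda>m. bound n R \<delta> m < \<epsilon>) sequentially"
        by (rule order_tendstoD(2)[OF bound[OF \<delta>(1)] lim])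
      then show ?thesis using crowd[OF \<delta>(1), of n R]
        by eventually_elim (meson less_imp_le order_trans)
    qed
    have MsB: "eventually (\<lambda>m. measure (Ms m) B \<le> \<epsilon>) sequentially"
      using Ms_small Ms unfolding B_def
      by eventually_elim (blast intro: path_law.prob_crowded_limit_le[OF _ \<delta>(1)])
    have QB: "measure Q B \<le> \<epsilon>"
      unfolding B_def
    proof (rule Q.prob_crowded_limit_le[OF \<delta>(1)])
      fix J
      let ?K = "(R + 1) * 2 ^ J" and ?h = "\<delta> / 2 ^ J"
      have h': "?h > 0" using \<delta> by simp
      have "(\<lambda>m. \<Sum>g\<in>PiE {..?K} (\<lambda>_. {..<CARD('p) ^ n}). of_bool (crowded R J g) *
          measure (Ms m) {\<omega> \<in> path_space. \<forall>i\<le>?K. grid_residue n ?h \<omega> i = g i}) \<longlonglongrightarrow>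
        (\<Sum>g\<in>PiE {..?K} (\<lambda>_. {..<CARD('p) ^ n}). of_bool (crowded R J g) *
          measure Q {\<omega> \<in> path_space. \<forall>i\<le>?K. grid_residue n ?h \<omega> i = g i})"
        by (intro tendsto_sum tendsto_mult_left conv[OF h'] PiE_less)
      moreover have "eventually (\<lambda>m. (\<Sum>g\<in>PiE {..?K} (\<lambda>_. {..<CARD('p) ^ n}). of_bool (crowded R J g) *
          measure (Ms m) {\<omega> \<in> path_space. \<forall>i\<le>?K. grid_residue n ?h \<omega> i = g i}) \<le> \<epsilon>) sequentially"
        using Ms Ms_small
      proof eventually_elim
        case (elim m)
        then show ?case using path_law.crowded_event_prob(2)[OF elim(1) \<delta>(1), of n R J] by metis
      qed
      ultimately have "(\<Sum>g\<in>PiE {..?K} (\<lambda>_. {..<CARD('p) ^ n}). of_bool (crowded R J g) *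
          measure Q {\<omega> \<in> path_space. \<forall>i\<le>?K. grid_residue n ?h \<omega> i = g i}) \<le> \<epsilon>"
        by (rule tendsto_upperbound) simp
      then show "measure Q (crowded_event n R \<delta> J) \<le> \<epsilon>"
        using Q.crowded_event_prob(2)[OF \<delta>(1), of n R J] by metis
    qed
    have test: "(\<lambda>\<omega>. g (\<alpha> \<omega>)) \<in> borel_measurable (topology_borel sk.mtopology) \<and>
        (\<lambda>m. \<integral>\<omega>. g (\<alpha> \<omega>) \<partial>Ms m) \<longlonglongrightarrow> (\<integral>\<omega>. g (\<alpha> \<omega>) \<partial>Q)" for g :: "(real \<Rightarrow> 'p padic) \<Rightarrow> real"
    proof
      have "(\<lambda>\<omega>. g (\<alpha> \<omega>)) \<in> borel_measurable Q" unfolding \<alpha>_def by (rule Q.integral_sample_path(1)[OF h])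
      then show "(\<lambda>\<omega>. g (\<alpha> \<omega>)) \<in> borel_measurable (topology_borel sk.mtopology)"
        unfolding measurable_cong_sets[OF Q.sets_law refl] top .
      let ?I = "\<lambda>Q. \<Sum>v\<in>PiE {..N} (\<lambda>_. {..<CARD('p) ^ n}). g (sample_path h N (\<lambda>i. of_nat (v i))) *
          measure Q {\<omega> \<in> path_space. \<forall>i\<le>N. grid_residue n h \<omega> i = v i}"
      have "(\<lambda>m. ?I (Ms m)) \<longlonglongrightarrow> ?I Q"
        by (intro tendsto_sum tendsto_mult_left conv[OF h] PiE_less)
      also have "?I Q = (\<integral>\<omega>. g (\<alpha> \<omega>) \<partial>Q)" unfolding \<alpha>_def by (rule Q.integral_sample_path(2)[OF h, symmetric])
      finally show "(\<lambda>m. \<integral>\<omega>. g (\<alpha> \<omega>) \<partial>Ms m) \<longlonglongrightarrow> (\<integral>\<omega>. g (\<alpha> \<omega>) \<partial>Q)"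
      proof (rule Lim_transform_eventually)
        show "eventually (\<lambda>m. ?I (Ms m) = (\<integral>\<omega>. g (\<alpha> \<omega>) \<partial>Ms m)) sequentially"
          using Ms unfolding \<alpha>_def by eventually_elim (rule path_law.integral_sample_path(2)[OF _ h, symmetric])
      qed
    qed
    show "\<exists>\<alpha> B. \<alpha> \<in> path_space \<rightarrow> path_space \<and> B \<in> sets (topology_borel sk.mtopology) \<and>
        (\<forall>x\<in>path_space - B. skorohod_dist x (\<alpha> x) \<le> \<epsilon>) \<and>
        eventually (\<lambda>m. measure (Ms m) B \<le> \<epsilon>) sequentially \<and> measure Q B \<le> \<epsilon> \<and>
        (\<forall>g :: (real \<Rightarrow> 'p padic) \<Rightarrow> real. (\<lambda>x. g (\<alpha> x)) \<in> borel_measurable (topology_borel sk.mtopology) \<and>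
          (\<lambda>m. \<integral>x. g (\<alpha> x) \<partial>Ms m) \<longlonglongrightarrow> (\<integral>x. g (\<alpha> x) \<partial>Q))"
      by (intro exI[of _ \<alpha>] exI[of _ B] conjI \<alpha> B close MsB QB allI)
        (use test in blast)+
  qed
qed

lemma (in scaled_random_walk) law_crowded_prob:
  assumes law: "scaled_walk_law b D m M S Q" and \<delta>: "\<delta> > 0"
  shows "measure Q (crowded_event n R \<delta> J) \<le> crowding_bound CARD('p) b D n R \<delta> m"
proof -
  interpret Q: path_law Q using law by (auto simp: scaled_walk_law_def path_law_def path_law_axioms_def)
  let ?K = "(R + 1) * 2 ^ J" and ?h = "\<delta> / 2 ^ J"
  have h: "?h > 0" using \<delta> by simp
  have "measure Q (crowded_event n R \<delta> J) =
      (\<Sum>g\<in>PiE {..?K} (\<lambda>_. {..<CARD('p) ^ n}). of_bool (crowded R J g) *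
        prob {w \<in> space M. \<forall>i\<le>?K. residue n (scaled_walk b D m S (real i * ?h) w) = g i})"
    unfolding Q.crowded_event_prob(2)[OF \<delta>] law_grid_prob[OF law h] ..
  also have "\<dots> = prob {w \<in> space M. crowded R J (\<lambda>i. residue n (scaled_walk b D m S (real i * ?h) w))}"
    by (rule prob_finite_vector(2)[symmetric])
      (rule residue_scaled_walk_event, rule residue_scaled_walk_less, assumption, rule crowded_cong)
  also have "\<dots> \<le> crowding_bound CARD('p) b D n R \<delta> m" by (rule walk_crowded_prob[OF \<delta>])
  finally show ?thesis .
qed

theorem theorem1p1:
  fixes b D :: real
    and \<mu> :: "'p::prime_type padic measure"
    and P :: "(real \<Rightarrow> 'p padic) measure"
    and M :: "nat \<Rightarrow> 'w measure"
    and S\<^sub>0 :: "nat \<Rightarrow> 'w \<Rightarrow> 'p padic set"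
    and X S :: "nat \<Rightarrow> nat \<Rightarrow> 'w \<Rightarrow> 'p padic set"
    and Pm :: "nat \<Rightarrow> (real \<Rightarrow> 'p padic) measure"
  assumes "b > 0" and "D > 0"
    and "Haar_Zp \<mu>"
    and "Brownian_law b D \<mu> P"
    and "\<And>m. real m \<ge> index_bound CARD('p) b \<Longrightarrow> random_walk b m (M m) (S\<^sub>0 m) (X m) (S m)"
    and "\<And>m. real m \<ge> index_bound CARD('p) b \<Longrightarrow> scaled_walk_law b D m (M m) (S m) (Pm m)"
  shows "converges_weakly (skorohod_topology Zp) Pm P"
proof (rule converges_weakly_by_grid)
  note b = assms(1) and D = assms(2)
  have p1: "CARD('p) > 1" by (rule prime_gt_1_CARD)
  have large: "eventually (\<lambda>m. real m \<ge> index_bound CARD('p) b) sequentially"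
    using filterlim_real_sequentially by (simp add: filterlim_at_top)
  have walk: "scaled_random_walk b D m n (M m) (S\<^sub>0 m) (X m) (S m)"
    if "real m \<ge> index_bound CARD('p) b" "n \<le> m" for m n
    using assms(5)[OF that(1)] b D that(2) by unfold_locales
  show "eventually (\<lambda>m. path_law (Pm m)) sequentially"
    using large
  proof eventually_elim
    case (elim m)
    then show ?case using assms(6)[OF elim] by (simp add: scaled_walk_law_def path_law_def path_law_axioms_def)
  qed
  show "path_law P" using assms(4) by (simp add: Brownian_law_def path_law_def path_law_axioms_def)
  show "(\<lambda>m. measure (Pm m) {\<omega> \<in> path_space. \<forall>i\<le>K. grid_residue n h \<omega> i = g i}) \<longlonglongrightarrow>
      measure P {\<omega> \<in> path_space. \<forall>i\<le>K. grid_residue n h \<omega> i = g i}"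
    if h: "h > 0" and g: "\<And>i. i \<le> K \<Longrightarrow> g i < CARD('p) ^ n" for n h K g
  proof -
    have "(\<lambda>m. walk_trans CARD('p) b D m n h i d) \<longlonglongrightarrow> bm_trans CARD('p) b D h n d" for i d
    proof -
      have "(\<lambda>m. walk_trans CARD('p) b D m n h i d) \<longlonglongrightarrow>
          bm_trans CARD('p) b D (real (Suc i) * h - real i * h) n d"
        unfolding walk_trans_def steps_until_def
        by (rule walk_trans_tendsto[OF p1 b D]) (use h in auto)
      also have "real (Suc i) * h - real i * h = h" by (simp add: algebra_simps)
      finally show ?thesis .
    qed
    then have "(\<lambda>m. chain_prob K (walk_trans CARD('p) b D m n h) g) \<longlonglongrightarrow>
        chain_prob K (\<lambda>_. bm_trans CARD('p) b D h n) g"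
      unfolding chain_prob_def by (cases "g 0 = 0") (auto intro!: tendsto_prod)
    also have "chain_prob K (\<lambda>_. bm_trans CARD('p) b D h n) g =
        measure P {\<omega> \<in> path_space. \<forall>i\<le>K. grid_residue n h \<omega> i = g i}"
      by (rule brownian_grid_prob[OF assms(3,4) b D h g, symmetric])
    finally show ?thesis
    proof (rule Lim_transform_eventually)
      show "eventually (\<lambda>m. chain_prob K (walk_trans CARD('p) b D m n h) g =
          measure (Pm m) {\<omega> \<in> path_space. \<forall>i\<le>K. grid_residue n h \<omega> i = g i}) sequentially"
        using large eventually_ge_at_top[of n]
      proof eventually_elim
        case (elim m)
        interpret scaled_random_walk b D m n "M m" "S\<^sub>0 m" "X m" "S m" by (rule walk[OF elim])
        show ?case
          unfolding law_grid_prob[OF assms(6)[OF elim(1)] h] by (rule walk_grid_prob[OF h g, symmetric])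
      qed
    qed
  qed
  show "eventually (\<lambda>m. \<forall>J. measure (Pm m) (crowded_event n R \<delta> J) \<le> crowding_bound CARD('p) b D n R \<delta> m) sequentially"
    if "\<delta> > 0" for n R \<delta>
    using large eventually_ge_at_top[of n]
  proof eventually_elim
    case (elim m)
    interpret scaled_random_walk b D m n "M m" "S\<^sub>0 m" "X m" "S m" by (rule walk[OF elim])
    show ?case using law_crowded_prob[OF assms(6)[OF elim(1)] that] by blast
  qed
  show "crowding_bound CARD('p) b D n R \<delta> \<longlonglongrightarrow>
      \<delta> * (D / bm_beta CARD('p) b * ((real CARD('p) powr b) ^ n - 1)) +
      real R * (2 * \<delta> * (D / bm_beta CARD('p) b * ((real CARD('p) powr b) ^ n - 1)))\<^sup>2" for n R \<delta>
    by (rule crowding_bound_tendsto[OF p1 b D])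
qed

end
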